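(* Let $Y$ be a pointed stable double Segal space. Then $Y$ is isomorphic to the classifying diagram $N^\square\mathbb{D}$ of a reverse CGW category $\mathbb{D}$ if and only if $Y$ is isomorphic to the classifying diagram $N^\square\mathbb{D}$ of a double category $\mathbb{D}$ with shared isomorphisms in which all horizontal morphisms are monic and all vertical morphisms are epic.
   Context: A double category $\mathbb{D}$ has objects, horizontal morphisms (forming a category $\mathcal{H}(\mathbb{D})$), vertical morphisms (forming a category $\mathcal{V}(\mathbb{D})$ with the same objects), and squares; a square written (top $f$; left $h$; right $k$; bottom $g$) has boundary $f\colon A\to B$, $g\colon C\to D$ horizontal and $h\colon A\to C$, $k\colon B\to D$ vertical. Squares compose horizontally and vertically, with identities, subject to unit, associativity and interchange laws. A double functor preserves all of this structure. $[m]\boxtimes[n]$ is the double category freely generated by an $m\times n$ grid of squares ($m$ in the horizontal direction). "Monic"/"epic" refer to the categories $\mathcal{H}(\mathbb{D})$ and $\mathcal{V}(\mathbb{D})$ respectively. Shared isomorphism: a pair $(f,f')$ of a horizontal isomorphism $f\colon A\to B$ and a vertical isomorphism $f'\colon A\to B$ equipped with squares (top $f$; left $f'$; right $\mathrm{id}_B$; bottom $\mathrm{id}_B$), (top $\mathrm{id}_A$; left $\mathrm{id}_A$; right $f'$; bottom $f$), (top $f$; left $\mathrm{id}_A$; right $f'^{-1}$; bottom $\mathrm{id}_A$), (top $\mathrm{id}_A$; left $f'$; right $\mathrm{id}_A$; bottom $f^{-1}$). $\mathbb{D}$ has shared isomorphisms if there are bijections $\varphi$ from horizontal isomorphisms $A\to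 B$ to vertical isomorphisms $A\to B$, for all objects $A,B$, such that: (a) for horizontal $f\colon A\to A'$, $g\colon B\to B'$ and horizontal isomorphisms $h\colon A\to B$, $k\colon A'\to B'$, one has $kf=gh$ if and only if there is a square (top $f$; left $\varphi(h)$; right $\varphi(k)$; bottom $g$), and such a square is unique relative to its boundary; (b) for vertical $u\colon A\to B$, $u'\colon A'\to B'$ and horizontal isomorphisms $h\colon A\to A'$, $k\colon B\to B'$, one has $u'\varphi(h)=\varphi(k)u$ if and only if there is a square (top $h$; left $u$; right $u'$; bottom $k$), and such a square is unique relative to its boundary. In such a double category every horizontal or vertical isomorphism belongs to a unique shared isomorphism, and "isomorphism" means shared isomorphism. A natural (shared) isomorphism between double functors $F,G\colon\mathbb{C}\to\mathbb{D}$ is a family of shared isomorphisms $(\theta_A,\theta'_A)\colon FA\to GA$, one for each object $A$ of $\mathbb{C}$, such that the $\theta_A$ are the components of a natural horizontal transformation (natural for horizontal morphisms; with a square (top $\theta_A$; left $Fu$; right $Gu$; bottom $\theta_B$) for each vertical $u\colon A\to B$, compatible with vertical identities and composition, and with horizontal composition with the images $F\sigma,G\sigma$ of squares $\sigma$ of $\mathbb{C}$), and the $\theta'_A$ are, dually, the components of a natural vertical transformation. A zero object of $\mathbb{D}$ is an object initial in $\mathcal{H}(\mathbb{D})$ and terminal in $\mathcal{V}(\mathbb{D})$; $\mathbb{D}$ is pointed if it has a zero object. $\mathbb{D}$ is a reverse CGW category if: (I') it has shared isomorphisms; (M') all horizontal morphisms are monic and all vertical morphisms are epic; (Z') it is pointed;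 (K'') any pair consisting of a vertical $h\colon A\to C$ and a horizontal $f\colon A\to B$, and any pair consisting of a horizontal $g\colon C\to D$ and a vertical $k\colon B\to D$, extends to a square (top $f$; left $h$; right $k$; bottom $g$), uniquely up to a unique (natural shared) isomorphism of squares that is the identity on the three objects of the given pair. A bisimplicial space is a functor $Y\colon\Delta^{op}\times\Delta^{op}\to s\mathbf{Set}$; it is a double Segal space if the Segal maps $Y_{n,k}\to Y_{1,k}\times_{Y_{0,k}}\cdots\times_{Y_{0,k}}Y_{1,k}$ and $Y_{\ell,m}\to Y_{\ell,1}\times_{Y_{\ell,0}}\cdots\times_{Y_{\ell,0}}Y_{\ell,1}$ are weak equivalences of simplicial sets for $k,\ell\ge 0$, $m,n\ge 2$. It is stable if the restriction maps $Y_{1,1}\to Y_{0,1}\times_{Y_{0,0}}Y_{1,0}$ (the span formed by left and top edges) and $Y_{1,1}\to Y_{1,0}\times_{Y_{0,0}}Y_{0,1}$ (the cospan formed by bottom and right edges) are weak equivalences. A preaugmented bisimplicial space is a bisimplicial space $Y$ together with a simplicial set $Y_{-1}$ and a map $Y_{-1}\to Y_{0,0}$; isomorphisms are required to respect this data. It is pointed if $Y_{-1}$ is contractible and the composites $Y_{1,0}\times_{Y_{0,0}}Y_{-1}\to Y_{1,0}\to Y_{0,0}$ (fiber product over the horizontal source map, followed by horizontal target) and $Y_{0,1}\times_{Y_{0,0}}Y_{-1}\to Y_{0,1}\to Y_{0,0}$ (fiber product over the vertical target map, followed by vertical source) are weak equivalences. A pointed stable double Segal space is a pointed preaugmented bisimplicial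 space whose underlying bisimplicial space is a stable double Segal space. Classifying diagram: for $\mathbb{D}$ with shared isomorphisms, $(N^\square\mathbb{D})_{m,n}$ is the nerve of the groupoid of double functors $[m]\boxtimes[n]\to\mathbb{D}$ and natural shared isomorphisms; the preaugmentation $(N^\square\mathbb{D})_{-1}$ is the nerve of the full subgroupoid of zero objects of $\mathbb{D}$ (empty if there are none), with its inclusion into $(N^\square\mathbb{D})_{0,0}$. *)

theory Defs
  imports "HOL-Homology.Simplices" "HOL-Analysis.Sum_Topology" "HOL-Analysis.Homotopy"
begin

section \<open>Categories\<close>

record ('o, 'm) cat =
  Obj :: "'o set"
  Mor :: "'m set"
  Dom :: "'m \<Rightarrow> 'o"
  Cod :: "'m \<Rightarrow> 'o"
  Idn :: "'o \<Rightarrow> 'm"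
  Cmp :: "'m \<Rightarrow> 'm \<Rightarrow> 'm"  \<comment> \<open>\<open>Cmp C g f\<close> is \<open>g\<close> after \<open>f\<close>\<close>

definition is_category :: "('o, 'm) cat \<Rightarrow> bool" where
  "is_category C \<longleftrightarrow>
    Dom C \<in> Mor C \<rightarrow> Obj C \<and> Cod C \<in> Mor C \<rightarrow> Obj C \<and> Idn C \<in> Obj C \<rightarrow> Mor C \<and>
    (\<forall>A\<in>Obj C. Dom C (Idn C A) = A \<and> Cod C (Idn C A) = A) \<and>
    (\<forall>f\<in>Mor C. \<forall>g\<in>Mor C. Cod C f = Dom C g \<longrightarrow>
       Cmp C g f \<in> Mor C \<and> Dom C (Cmp C g f) = Dom C f \<and> Cod C (Cmp C g f) = Cod C g) \<and>
    (\<forall>f\<in>Mor C. Cmp C f (Idn C (Dom C f)) = f \<and> Cmp C (Idn C (Cod C f)) f = f) \<and>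
    (\<forall>f\<in>Mor C. \<forall>g\<in>Mor C. \<forall>h\<in>Mor C. Cod C f = Dom C g \<longrightarrow> Cod C g = Dom C h \<longrightarrow>
       Cmp C h (Cmp C g f) = Cmp C (Cmp C h g) f)"

definition is_functor ::
    "('o, 'm) cat \<Rightarrow> ('p, 'n) cat \<Rightarrow> ('o \<Rightarrow> 'p) \<Rightarrow> ('m \<Rightarrow> 'n) \<Rightarrow> bool" where
  "is_functor C D Fo Fm \<longleftrightarrow>
    Fo \<in> Obj C \<rightarrow> Obj D \<and> Fm \<in> Mor C \<rightarrow> Mor D \<and>
    (\<forall>f\<in>Mor C. Dom D (Fm f) = Fo (Dom C f) \<and> Cod D (Fm f) = Fo (Cod C f)) \<and>
    (\<forall>A\<in>Obj C. Fm (Idn C A) = Idn D (Fo A)) \<and>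
    (\<forall>f\<in>Mor C. \<forall>g\<in>Mor C. Cod C f = Dom C g \<longrightarrow> Fm (Cmp C g f) = Cmp D (Fm g) (Fm f))"

definition homs :: "('o, 'm) cat \<Rightarrow> 'o \<Rightarrow> 'o \<Rightarrow> 'm set" where
  "homs C A B = {f \<in> Mor C. Dom C f = A \<and> Cod C f = B}"

definition inverse_mors :: "('o, 'm) cat \<Rightarrow> 'm \<Rightarrow> 'm \<Rightarrow> bool" where
  "inverse_mors C f g \<longleftrightarrow>
    f \<in> Mor C \<and> g \<in> Mor C \<and> Dom C g = Cod C f \<and> Cod C g = Dom C f \<and>
    Cmp C g f = Idn C (Dom C f) \<and> Cmp C f g = Idn C (Cod C f)"

definition isos :: "('o, 'm) cat \<Rightarrow> 'o \<Rightarrow> 'o \<Rightarrow> 'm set" where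
  "isos C A B = {f \<in> homs C A B. \<exists>g. inverse_mors C f g}"

definition is_monic :: "('o, 'm) cat \<Rightarrow> 'm \<Rightarrow> bool" where
  "is_monic C f \<longleftrightarrow> (\<forall>g\<in>Mor C. \<forall>h\<in>Mor C.
     Dom C g = Dom C h \<longrightarrow> Cod C g = Dom C f \<longrightarrow> Cod C h = Dom C f \<longrightarrow>
     Cmp C f g = Cmp C f h \<longrightarrow> g = h)"

definition is_epic :: "('o, 'm) cat \<Rightarrow> 'm \<Rightarrow> bool" where
  "is_epic C f \<longleftrightarrow> (\<forall>g\<in>Mor C. \<forall>h\<in>Mor C.
     Cod C g = Cod C h \<longrightarrow> Dom C g = Cod C f \<longrightarrow> Dom C h = Cod C f \<longrightarrow>
     Cmp C g f = Cmp C h f \<longrightarrow> g = h)"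

definition is_initial :: "('o, 'm) cat \<Rightarrow> 'o \<Rightarrow> bool" where
  "is_initial C Z \<longleftrightarrow> Z \<in> Obj C \<and> (\<forall>A\<in>Obj C. \<exists>!f. f \<in> homs C Z A)"

definition is_terminal :: "('o, 'm) cat \<Rightarrow> 'o \<Rightarrow> bool" where
  "is_terminal C Z \<longleftrightarrow> Z \<in> Obj C \<and> (\<forall>A\<in>Obj C. \<exists>!f. f \<in> homs C A Z)"

definition full_subcat :: "('o, 'm) cat \<Rightarrow> 'o set \<Rightarrow> ('o, 'm) cat" where
  "full_subcat C S = C\<lparr>Obj := Obj C \<inter> S, Mor := {f \<in> Mor C. Dom C f \<in> S \<and> Cod C f \<in> S}\<rparr>"

text \<open>The poset \<open>[n] = {0 \<le> \<dots> \<le> n}\<close> as a category.\<close>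

definition ordcat :: "nat \<Rightarrow> (nat, nat \<times> nat) cat" where
  "ordcat n = \<lparr>Obj = {..n}, Mor = {(i, j). i \<le> j \<and> j \<le> n}, Dom = fst, Cod = snd,
     Idn = (\<lambda>i. (i, i)), Cmp = (\<lambda>g f. (fst f, snd g))\<rparr>"


section \<open>Double categories\<close>

text \<open>
  A double category is given by its horizontal category \<open>hcat\<close>, its vertical category \<open>vcat\<close>, and
  its squares, which form two categories: \<open>sqh\<close> has the vertical morphisms as objects and horizontal
  pasting as composition (so \<open>Dom\<close> and \<open>Cod\<close> are the left and right edges), and \<open>sqv\<close> has the
  horizontal morphisms as objects and vertical pasting as composition (so \<open>Dom\<close> and \<open>Cod\<close> are the
  top and bottom edges).
\<close>

record ('o, 'h, 'v, 's) dblcat =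
  hcat :: "('o, 'h) cat"
  vcat :: "('o, 'v) cat"
  sqh :: "('v, 's) cat"
  sqv :: "('h, 's) cat"

abbreviation "obs D \<equiv> Obj (hcat D)"
abbreviation "hors D \<equiv> Mor (hcat D)"
abbreviation "vers D \<equiv> Mor (vcat D)"
abbreviation "sqs D \<equiv> Mor (sqh D)"
abbreviation "sq_left D \<equiv> Dom (sqh D)"
abbreviation "sq_right D \<equiv> Cod (sqh D)"
abbreviation "sq_top D \<equiv> Dom (sqv D)"
abbreviation "sq_bot D \<equiv> Cod (sqv D)"

text \<open>
  The four functoriality conditions below say that the edges of a square fit together at the corners
  and that the edges of identity squares and of composite squares are the expected ones.
\<close>

definition double_category :: "('o, 'h, 'v, 's) dblcat \<Rightarrow> bool" where
  "double_category D \<longleftrightarrow>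
    is_category (hcat D) \<and> is_category (vcat D) \<and> is_category (sqh D) \<and> is_category (sqv D) \<and>
    Obj (vcat D) = obs D \<and> Obj (sqh D) = vers D \<and> Obj (sqv D) = hors D \<and> Mor (sqv D) = sqs D \<and>
    is_functor (sqh D) (hcat D) (Dom (vcat D)) (sq_top D) \<and>
    is_functor (sqh D) (hcat D) (Cod (vcat D)) (sq_bot D) \<and>
    is_functor (sqv D) (vcat D) (Dom (hcat D)) (sq_left D) \<and>
    is_functor (sqv D) (vcat D) (Cod (hcat D)) (sq_right D) \<and>
    (\<forall>A\<in>obs D. Idn (sqh D) (Idn (vcat D) A) = Idn (sqv D) (Idn (hcat D) A)) \<and>
    (\<forall>f\<in>hors D. \<forall>g\<in>hors D. Cod (hcat D) f = Dom (hcat D) g \<longrightarrow>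
       Idn (sqv D) (Cmp (hcat D) g f) = Cmp (sqh D) (Idn (sqv D) g) (Idn (sqv D) f)) \<and>
    (\<forall>u\<in>vers D. \<forall>w\<in>vers D. Cod (vcat D) u = Dom (vcat D) w \<longrightarrow>
       Idn (sqh D) (Cmp (vcat D) w u) = Cmp (sqv D) (Idn (sqh D) w) (Idn (sqh D) u)) \<and>
    (\<forall>a\<in>sqs D. \<forall>b\<in>sqs D. \<forall>c\<in>sqs D. \<forall>d\<in>sqs D.
       sq_right D a = sq_left D b \<longrightarrow> sq_right D c = sq_left D d \<longrightarrow>
       sq_bot D a = sq_top D c \<longrightarrow> sq_bot D b = sq_top D d \<longrightarrow>
       Cmp (sqv D) (Cmp (sqh D) d c) (Cmp (sqh D) b a) =
       Cmp (sqh D) (Cmp (sqv D) d b) (Cmp (sqv D) c a))"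

text \<open>\<open>is_square D f h k g s\<close>: \<open>s\<close> is a square (top \<open>f\<close>; left \<open>h\<close>; right \<open>k\<close>; bottom \<open>g\<close>).\<close>

definition is_square ::
    "('o, 'h, 'v, 's) dblcat \<Rightarrow> 'h \<Rightarrow> 'v \<Rightarrow> 'v \<Rightarrow> 'h \<Rightarrow> 's \<Rightarrow> bool" where
  "is_square D f h k g s \<longleftrightarrow>
    s \<in> sqs D \<and> sq_top D s = f \<and> sq_left D s = h \<and> sq_right D s = k \<and> sq_bot D s = g"

definition unique_square ::
    "('o, 'h, 'v, 's) dblcat \<Rightarrow> 'h \<Rightarrow> 'v \<Rightarrow> 'v \<Rightarrow> 'h \<Rightarrow> bool" where
  "unique_square D f h k g \<longleftrightarrow>
    (\<forall>s s'. is_square D f h k g s \<longrightarrow> is_square D f h k g s' \<longrightarrow> s = s')"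

text \<open>
  A shared isomorphism from \<open>A\<close> to \<open>B\<close>. The four squares are only required to exist: the notion is
  used in double categories with shared isomorphisms, where squares with such boundaries are unique.
\<close>

definition shared_iso ::
    "('o, 'h, 'v, 's) dblcat \<Rightarrow> 'o \<Rightarrow> 'o \<Rightarrow> 'h \<times> 'v \<Rightarrow> bool" where
  "shared_iso D A B p \<longleftrightarrow> (case p of (f, f') \<Rightarrow>
    f \<in> isos (hcat D) A B \<and> f' \<in> isos (vcat D) A B \<and>
    (\<exists>g g'. inverse_mors (hcat D) f g \<and> inverse_mors (vcat D) f' g' \<and>
      (\<exists>s. is_square D f f' (Idn (vcat D) B) (Idn (hcat D) B) s) \<and>
      (\<exists>s. is_square D (Idn (hcat D) A) (Idn (vcat D) A) f' f s) \<and>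
      (\<exists>s. is_square D f (Idn (vcat D) A) g' (Idn (hcat D) A) s) \<and>
      (\<exists>s. is_square D (Idn (hcat D) A) f' (Idn (vcat D) A) g s)))"

definition shared_id :: "('o, 'h, 'v, 's) dblcat \<Rightarrow> 'o \<Rightarrow> 'h \<times> 'v" where
  "shared_id D A = (Idn (hcat D) A, Idn (vcat D) A)"

definition shared_comp ::
    "('o, 'h, 'v, 's) dblcat \<Rightarrow> 'h \<times> 'v \<Rightarrow> 'h \<times> 'v \<Rightarrow> 'h \<times> 'v" where
  "shared_comp D q p = (Cmp (hcat D) (fst q) (fst p), Cmp (vcat D) (snd q) (snd p))"

definition has_shared_isos :: "('o, 'h, 'v, 's) dblcat \<Rightarrow> bool" where
  "has_shared_isos D \<longleftrightarrow> (\<exists>\<phi>.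
    (\<forall>A\<in>obs D. \<forall>B\<in>obs D. bij_betw \<phi> (isos (hcat D) A B) (isos (vcat D) A B)) \<and>
    (\<forall>A\<in>obs D. \<forall>A'\<in>obs D. \<forall>B\<in>obs D. \<forall>B'\<in>obs D.
      \<forall>f\<in>homs (hcat D) A A'. \<forall>g\<in>homs (hcat D) B B'.
      \<forall>h\<in>isos (hcat D) A B. \<forall>k\<in>isos (hcat D) A' B'.
        (Cmp (hcat D) k f = Cmp (hcat D) g h \<longleftrightarrow> (\<exists>s. is_square D f (\<phi> h) (\<phi> k) g s)) \<and>
        unique_square D f (\<phi> h) (\<phi> k) g) \<and>
    (\<forall>A\<in>obs D. \<forall>A'\<in>obs D. \<forall>B\<in>obs D. \<forall>B'\<in>obs D.
      \<forall>u\<in>homs (vcat D) A B. \<forall>u'\<in>homs (vcat D) A' B'.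
      \<forall>h\<in>isos (hcat D) A A'. \<forall>k\<in>isos (hcat D) B B'.
        (Cmp (vcat D) u' (\<phi> h) = Cmp (vcat D) (\<phi> k) u \<longleftrightarrow> (\<exists>s. is_square D h u u' k s)) \<and>
        unique_square D h u u' k))"

definition zero_object :: "('o, 'h, 'v, 's) dblcat \<Rightarrow> 'o \<Rightarrow> bool" where
  "zero_object D Z \<longleftrightarrow> is_initial (hcat D) Z \<and> is_terminal (vcat D) Z"


section \<open>Double functors and natural shared isomorphisms\<close>

record ('o1, 'h1, 'v1, 's1, 'o2, 'h2, 'v2, 's2) dfun =
  onob :: "'o1 \<Rightarrow> 'o2"
  onhor :: "'h1 \<Rightarrow> 'h2"
  onver :: "'v1 \<Rightarrow> 'v2"
  onsq :: "'s1 \<Rightarrow> 's2"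

text \<open>
  Double functors and natural isomorphisms are \<open>undefined\<close> off their domains, so that equality of
  these objects in HOL is equality of double functors and of natural isomorphisms.
\<close>

definition double_functor ::
    "('o1, 'h1, 'v1, 's1) dblcat \<Rightarrow> ('o2, 'h2, 'v2, 's2) dblcat \<Rightarrow>
     ('o1, 'h1, 'v1, 's1, 'o2, 'h2, 'v2, 's2) dfun \<Rightarrow> bool" where
  "double_functor C D F \<longleftrightarrow>
    onob F \<in> extensional (obs C) \<and> onhor F \<in> extensional (hors C) \<and>
    onver F \<in> extensional (vers C) \<and> onsq F \<in> extensional (sqs C) \<and>
    is_functor (hcat C) (hcat D) (onob F) (onhor F) \<and>
    is_functor (vcat C) (vcat D) (onob F) (onver F) \<and>
    is_functor (sqh C) (sqh D) (onver F) (onsq F) \<and>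
    is_functor (sqv C) (sqv D) (onhor F) (onsq F)"

definition dfun_comp ::
    "('o1, 'h1, 'v1, 's1) dblcat \<Rightarrow>
     ('o2, 'h2, 'v2, 's2, 'o3, 'h3, 'v3, 's3) dfun \<Rightarrow>
     ('o1, 'h1, 'v1, 's1, 'o2, 'h2, 'v2, 's2) dfun \<Rightarrow>
     ('o1, 'h1, 'v1, 's1, 'o3, 'h3, 'v3, 's3) dfun" where
  "dfun_comp C G F = \<lparr>
    onob = (\<lambda>A\<in>obs C. onob G (onob F A)),
    onhor = (\<lambda>f\<in>hors C. onhor G (onhor F f)),
    onver = (\<lambda>u\<in>vers C. onver G (onver F u)),
    onsq = (\<lambda>s\<in>sqs C. onsq G (onsq F s))\<rparr>"

text \<open>\<open>\<theta>\<close> is the family of components of a natural horizontal (resp. vertical) transformation.\<close>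

definition horizontal_natural ::
    "('o1, 'h1, 'v1, 's1) dblcat \<Rightarrow> ('o2, 'h2, 'v2, 's2) dblcat \<Rightarrow>
     ('o1, 'h1, 'v1, 's1, 'o2, 'h2, 'v2, 's2) dfun \<Rightarrow>
     ('o1, 'h1, 'v1, 's1, 'o2, 'h2, 'v2, 's2) dfun \<Rightarrow> ('o1 \<Rightarrow> 'h2) \<Rightarrow> bool" where
  "horizontal_natural C D F G \<theta> \<longleftrightarrow>
    (\<forall>A\<in>obs C. \<theta> A \<in> homs (hcat D) (onob F A) (onob G A)) \<and>
    (\<forall>f\<in>hors C. Cmp (hcat D) (onhor G f) (\<theta> (Dom (hcat C) f)) =
                 Cmp (hcat D) (\<theta> (Cod (hcat C) f)) (onhor F f)) \<and>
    (\<exists>\<tau>.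
      (\<forall>u\<in>vers C. is_square D (\<theta> (Dom (vcat C) u)) (onver F u) (onver G u)
                    (\<theta> (Cod (vcat C) u)) (\<tau> u)) \<and>
      (\<forall>A\<in>obs C. \<tau> (Idn (vcat C) A) = Idn (sqv D) (\<theta> A)) \<and>
      (\<forall>u\<in>vers C. \<forall>w\<in>vers C. Cod (vcat C) u = Dom (vcat C) w \<longrightarrow>
         \<tau> (Cmp (vcat C) w u) = Cmp (sqv D) (\<tau> w) (\<tau> u)) \<and>
      (\<forall>s\<in>sqs C. Cmp (sqh D) (\<tau> (sq_right C s)) (onsq F s) =
                  Cmp (sqh D) (onsq G s) (\<tau> (sq_left C s))))"

definition vertical_natural ::
    "('o1, 'h1, 'v1, 's1) dblcat \<Rightarrow> ('o2, 'h2, 'v2, 's2) dblcat \<Rightarrow>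
     ('o1, 'h1, 'v1, 's1, 'o2, 'h2, 'v2, 's2) dfun \<Rightarrow>
     ('o1, 'h1, 'v1, 's1, 'o2, 'h2, 'v2, 's2) dfun \<Rightarrow> ('o1 \<Rightarrow> 'v2) \<Rightarrow> bool" where
  "vertical_natural C D F G \<theta> \<longleftrightarrow>
    (\<forall>A\<in>obs C. \<theta> A \<in> homs (vcat D) (onob F A) (onob G A)) \<and>
    (\<forall>u\<in>vers C. Cmp (vcat D) (onver G u) (\<theta> (Dom (vcat C) u)) =
                 Cmp (vcat D) (\<theta> (Cod (vcat C) u)) (onver F u)) \<and>
    (\<exists>\<tau>.
      (\<forall>f\<in>hors C. is_square D (onhor F f) (\<theta> (Dom (hcat C) f)) (\<theta> (Cod (hcat C) f))
                    (onhor G f) (\<tau> f)) \<and>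
      (\<forall>A\<in>obs C. \<tau> (Idn (hcat C) A) = Idn (sqh D) (\<theta> A)) \<and>
      (\<forall>f\<in>hors C. \<forall>g\<in>hors C. Cod (hcat C) f = Dom (hcat C) g \<longrightarrow>
         \<tau> (Cmp (hcat C) g f) = Cmp (sqh D) (\<tau> g) (\<tau> f)) \<and>
      (\<forall>s\<in>sqs C. Cmp (sqv D) (\<tau> (sq_bot C s)) (onsq F s) =
                  Cmp (sqv D) (onsq G s) (\<tau> (sq_top C s))))"

definition natural_iso ::
    "('o1, 'h1, 'v1, 's1) dblcat \<Rightarrow> ('o2, 'h2, 'v2, 's2) dblcat \<Rightarrow>
     ('o1, 'h1, 'v1, 's1, 'o2, 'h2, 'v2, 's2) dfun \<Rightarrow>
     ('o1, 'h1, 'v1, 's1, 'o2, 'h2, 'v2, 's2) dfun \<Rightarrow> ('o1 \<Rightarrow> 'h2 \<times> 'v2) \<Rightarrow> bool" where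
  "natural_iso C D F G \<theta> \<longleftrightarrow>
    \<theta> \<in> extensional (obs C) \<and>
    (\<forall>A\<in>obs C. shared_iso D (onob F A) (onob G A) (\<theta> A)) \<and>
    horizontal_natural C D F G (\<lambda>A. fst (\<theta> A)) \<and>
    vertical_natural C D F G (\<lambda>A. snd (\<theta> A))"

text \<open>
  The groupoid of double functors \<open>C \<rightarrow> D\<close> and natural shared isomorphisms; a morphism
  \<open>(F, \<theta>, G)\<close> is a natural shared isomorphism \<open>\<theta>\<close> from \<open>F\<close> to \<open>G\<close>.
\<close>

definition dfun_groupoid ::
    "('o1, 'h1, 'v1, 's1) dblcat \<Rightarrow> ('o2, 'h2, 'v2, 's2) dblcat \<Rightarrow>
     (('o1, 'h1, 'v1, 's1, 'o2, 'h2, 'v2, 's2) dfun,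
      ('o1, 'h1, 'v1, 's1, 'o2, 'h2, 'v2, 's2) dfun \<times> ('o1 \<Rightarrow> 'h2 \<times> 'v2) \<times>
      ('o1, 'h1, 'v1, 's1, 'o2, 'h2, 'v2, 's2) dfun) cat" where
  "dfun_groupoid C D = \<lparr>
    Obj = {F. double_functor C D F},
    Mor = {(F, \<theta>, G). double_functor C D F \<and> double_functor C D G \<and> natural_iso C D F G \<theta>},
    Dom = (\<lambda>(F, \<theta>, G). F),
    Cod = (\<lambda>(F, \<theta>, G). G),
    Idn = (\<lambda>F. (F, (\<lambda>A\<in>obs C. shared_id D (onob F A)), F)),
    Cmp = (\<lambda>(_, \<eta>, H) (F, \<theta>, _). (F, (\<lambda>A\<in>obs C. shared_comp D (\<eta> A) (\<theta> A)), H))\<rparr>"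


section \<open>Grids\<close>

text \<open>
  The double category freely generated by an \<open>m \<times> n\<close> grid of squares, described explicitly: objects
  are the grid points \<open>(i, j)\<close> with \<open>i \<le> m\<close>, \<open>j \<le> n\<close>; there is one horizontal morphism
  \<open>((i, i'), j)\<close> from \<open>(i, j)\<close> to \<open>(i', j)\<close> for \<open>i \<le> i'\<close>, one vertical morphism \<open>(i, (j, j'))\<close>
  from \<open>(i, j)\<close> to \<open>(i, j')\<close> for \<open>j \<le> j'\<close>, and one square \<open>((i, i'), (j, j'))\<close> for each
  \<open>i \<le> i'\<close>, \<open>j \<le> j'\<close>.
\<close>

type_synonym grid_ob = "nat \<times> nat"
type_synonym grid_hor = "(nat \<times> nat) \<times> nat"
type_synonym grid_ver = "nat \<times> (nat \<times> nat)"
type_synonym grid_sq = "(nat \<times> nat) \<times> (nat \<times> nat)"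

definition grid :: "nat \<Rightarrow> nat \<Rightarrow> (grid_ob, grid_hor, grid_ver, grid_sq) dblcat" where
  "grid m n = \<lparr>
    hcat = \<lparr>Obj = {..m} \<times> {..n}, Mor = Mor (ordcat m) \<times> {..n},
      Dom = (\<lambda>(p, j). (fst p, j)), Cod = (\<lambda>(p, j). (snd p, j)),
      Idn = (\<lambda>(i, j). ((i, i), j)),
      Cmp = (\<lambda>(q, _) (p, j). (Cmp (ordcat m) q p, j))\<rparr>,
    vcat = \<lparr>Obj = {..m} \<times> {..n}, Mor = {..m} \<times> Mor (ordcat n),
      Dom = (\<lambda>(i, q). (i, fst q)), Cod = (\<lambda>(i, q). (i, snd q)),
      Idn = (\<lambda>(i, j). (i, (j, j))),
      Cmp = (\<lambda>(_, r) (i, q). (i, Cmp (ordcat n) r q))\<rparr>,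
    sqh = \<lparr>Obj = {..m} \<times> Mor (ordcat n), Mor = Mor (ordcat m) \<times> Mor (ordcat n),
      Dom = (\<lambda>(p, q). (fst p, q)), Cod = (\<lambda>(p, q). (snd p, q)),
      Idn = (\<lambda>(i, q). ((i, i), q)),
      Cmp = (\<lambda>(p', _) (p, q). (Cmp (ordcat m) p' p, q))\<rparr>,
    sqv = \<lparr>Obj = Mor (ordcat m) \<times> {..n}, Mor = Mor (ordcat m) \<times> Mor (ordcat n),
      Dom = (\<lambda>(p, q). (p, fst q)), Cod = (\<lambda>(p, q). (p, snd q)),
      Idn = (\<lambda>(p, j). (p, (j, j))),
      Cmp = (\<lambda>(_, q') (p, q). (p, Cmp (ordcat n) q' q))\<rparr>\<rparr>"

text \<open>The double functor \<open>grid m n \<rightarrow> grid m' n'\<close> induced by \<open>\<alpha> : [m] \<rightarrow> [m']\<close>, \<open>\<beta> : [n] \<rightarrow> [n']\<close>.\<close>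

definition grid_map :: "nat \<Rightarrow> nat \<Rightarrow> (nat \<Rightarrow> nat) \<Rightarrow> (nat \<Rightarrow> nat) \<Rightarrow>
    (grid_ob, grid_hor, grid_ver, grid_sq, grid_ob, grid_hor, grid_ver, grid_sq) dfun" where
  "grid_map m n \<alpha> \<beta> = \<lparr>
    onob = (\<lambda>(i, j)\<in>obs (grid m n). (\<alpha> i, \<beta> j)),
    onhor = (\<lambda>((i, i'), j)\<in>hors (grid m n). ((\<alpha> i, \<alpha> i'), \<beta> j)),
    onver = (\<lambda>(i, (j, j'))\<in>vers (grid m n). (\<alpha> i, (\<beta> j, \<beta> j'))),
    onsq = (\<lambda>((i, i'), (j, j'))\<in>sqs (grid m n). ((\<alpha> i, \<alpha> i'), (\<beta> j, \<beta> j')))\<rparr>"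

text \<open>The double functor \<open>grid 1 1 \<rightarrow> D\<close> determined by a square \<open>s\<close> of \<open>D\<close>.\<close>

definition square_dfun ::
    "('o, 'h, 'v, 's) dblcat \<Rightarrow> 's \<Rightarrow>
     (grid_ob, grid_hor, grid_ver, grid_sq, 'o, 'h, 'v, 's) dfun" where
  "square_dfun D s = (
    let hor = (\<lambda>j. if j = 0 then sq_top D s else sq_bot D s);
        ver = (\<lambda>i. if i = 0 then sq_left D s else sq_right D s);
        ob = (\<lambda>(i, j). if i = 0 then Dom (hcat D) (hor j) else Cod (hcat D) (hor j))
    in \<lparr>
      onob = (\<lambda>p\<in>obs (grid 1 1). ob p),
      onhor = (\<lambda>((i, i'), j)\<in>hors (grid 1 1). if i = i' then Idn (hcat D) (ob (i, j)) else hor j),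
      onver = (\<lambda>(i, (j, j'))\<in>vers (grid 1 1). if j = j' then Idn (vcat D) (ob (i, j)) else ver i),
      onsq = (\<lambda>((i, i'), (j, j'))\<in>sqs (grid 1 1).
        if i = i' \<and> j = j' then Idn (sqv D) (Idn (hcat D) (ob (i, j)))
        else if i = i' then Idn (sqh D) (ver i)
        else if j = j' then Idn (sqv D) (hor j)
        else s)\<rparr>)"

definition square_iso ::
    "('o, 'h, 'v, 's) dblcat \<Rightarrow> 's \<Rightarrow> 's \<Rightarrow> (grid_ob \<Rightarrow> 'h \<times> 'v) \<Rightarrow> bool" where
  "square_iso D s s' \<theta> \<longleftrightarrow> natural_iso (grid 1 1) D (square_dfun D s) (square_dfun D s') \<theta>"


section \<open>Reverse CGW categories\<close>

definition all_monic_epic :: "('o, 'h, 'v, 's) dblcat \<Rightarrow> bool" where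
  "all_monic_epic D \<longleftrightarrow>
    (\<forall>f\<in>hors D. is_monic (hcat D) f) \<and> (\<forall>u\<in>vers D. is_epic (vcat D) u)"

text \<open>
  In the first part the span is fixed on the corners \<open>(0, 0)\<close>, \<open>(1, 0)\<close>, \<open>(0, 1)\<close>; in the second
  part the cospan is fixed on the corners \<open>(0, 1)\<close>, \<open>(1, 1)\<close>, \<open>(1, 0)\<close>.
\<close>

definition unique_extensions :: "('o, 'h, 'v, 's) dblcat \<Rightarrow> bool" where
  "unique_extensions D \<longleftrightarrow>
    (\<forall>h\<in>vers D. \<forall>f\<in>hors D. Dom (vcat D) h = Dom (hcat D) f \<longrightarrow>
      (\<exists>s\<in>sqs D. sq_left D s = h \<and> sq_top D s = f) \<and>
      (\<forall>s\<in>sqs D. \<forall>s'\<in>sqs D.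
         sq_left D s = h \<and> sq_top D s = f \<and> sq_left D s' = h \<and> sq_top D s' = f \<longrightarrow>
         (\<exists>!\<theta>. square_iso D s s' \<theta> \<and>
            \<theta> (0, 0) = shared_id D (Dom (hcat D) f) \<and>
            \<theta> (1, 0) = shared_id D (Cod (hcat D) f) \<and>
            \<theta> (0, 1) = shared_id D (Cod (vcat D) h)))) \<and>
    (\<forall>g\<in>hors D. \<forall>k\<in>vers D. Cod (hcat D) g = Cod (vcat D) k \<longrightarrow>
      (\<exists>s\<in>sqs D. sq_bot D s = g \<and> sq_right D s = k) \<and>
      (\<forall>s\<in>sqs D. \<forall>s'\<in>sqs D.
         sq_bot D s = g \<and> sq_right D s = k \<and> sq_bot D s' = g \<and> sq_right D s' = k \<longrightarrow>
         (\<exists>!\<theta>. square_iso D s s' \<theta> \<and>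
            \<theta> (0, 1) = shared_id D (Dom (hcat D) g) \<and>
            \<theta> (1, 1) = shared_id D (Cod (hcat D) g) \<and>
            \<theta> (1, 0) = shared_id D (Dom (vcat D) k))))"

definition reverse_CGW_category :: "('o, 'h, 'v, 's) dblcat \<Rightarrow> bool" where
  "reverse_CGW_category D \<longleftrightarrow>
    double_category D \<and> has_shared_isos D \<and> all_monic_epic D \<and>
    (\<exists>Z. zero_object D Z) \<and> unique_extensions D"


section \<open>Simplicial sets and their weak equivalences\<close>

text \<open>\<open>\<Delta> k l\<close> is the set of morphisms \<open>[k] \<rightarrow> [l]\<close> of the simplex category.\<close>

definition Delta :: "nat \<Rightarrow> nat \<Rightarrow> (nat \<Rightarrow> nat) set" ("\<Delta>") where
  "\<Delta> k l = {\<alpha> \<in> {..k} \<rightarrow>\<^sub>E {..l}. mono_on {..k} \<alpha>}"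

definition Delta_id :: "nat \<Rightarrow> nat \<Rightarrow> nat" where
  "Delta_id k = (\<lambda>i\<in>{..k}. i)"

text \<open>\<open>sact X k l \<alpha> : X\<^sub>l \<rightarrow> X\<^sub>k\<close> is the action of \<open>\<alpha> : [k] \<rightarrow> [l]\<close>.\<close>

record 'a sset =
  simps :: "nat \<Rightarrow> 'a set"
  sact :: "nat \<Rightarrow> nat \<Rightarrow> (nat \<Rightarrow> nat) \<Rightarrow> 'a \<Rightarrow> 'a"

definition simplicial_set :: "'a sset \<Rightarrow> bool" where
  "simplicial_set X \<longleftrightarrow>
    (\<forall>k l. \<forall>\<alpha>\<in>\<Delta> k l. sact X k l \<alpha> \<in> simps X l \<rightarrow> simps X k) \<and>
    (\<forall>k. \<forall>x\<in>simps X k. sact X k k (Delta_id k) x = x) \<and>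
    (\<forall>k l p. \<forall>\<alpha>\<in>\<Delta> k l. \<forall>\<beta>\<in>\<Delta> l p. \<forall>x\<in>simps X p.
       sact X k p (compose {..k} \<beta> \<alpha>) x = sact X k l \<alpha> (sact X l p \<beta> x))"

definition simplicial_map :: "'a sset \<Rightarrow> 'b sset \<Rightarrow> (nat \<Rightarrow> 'a \<Rightarrow> 'b) \<Rightarrow> bool" where
  "simplicial_map X Y f \<longleftrightarrow>
    (\<forall>k. f k \<in> simps X k \<rightarrow> simps Y k) \<and>
    (\<forall>k l. \<forall>\<alpha>\<in>\<Delta> k l. \<forall>x\<in>simps X l. f k (sact X k l \<alpha> x) = sact Y k l \<alpha> (f l x))"

text \<open>
  Geometric realization: the quotient of the coproduct of the spaces \<open>X\<^sub>k \<times> \<Delta>\<^sup>k\<close> (with \<open>X\<^sub>k\<close>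
  discrete) by the equivalence relation generated by \<open>(\<alpha>\<^sup>* x, t) \<sim> (x, \<alpha>\<^sub>* t)\<close>.
\<close>

definition cells :: "'a sset \<Rightarrow> (nat \<times> 'a \<times> (nat \<Rightarrow> real)) topology" where
  "cells X = sum_topology
     (\<lambda>k. prod_topology (discrete_topology (simps X k))
            (subtopology (powertop_real UNIV) (standard_simplex k))) UNIV"

definition simplex_push :: "nat \<Rightarrow> (nat \<Rightarrow> nat) \<Rightarrow> (nat \<Rightarrow> real) \<Rightarrow> nat \<Rightarrow> real" where
  "simplex_push k \<alpha> t = (\<lambda>j. \<Sum>i | i \<le> k \<and> \<alpha> i = j. t i)"

definition glue ::
    "'a sset \<Rightarrow> ((nat \<times> 'a \<times> (nat \<Rightarrow> real)) \<times> (nat \<times> 'a \<times> (nat \<Rightarrow> real))) set" where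
  "glue X = {((k, sact X k l \<alpha> x, t), (l, x, simplex_push k \<alpha> t)) | k l \<alpha> x t.
     \<alpha> \<in> \<Delta> k l \<and> x \<in> simps X l \<and> t \<in> standard_simplex k}"

definition glue_eq ::
    "'a sset \<Rightarrow> ((nat \<times> 'a \<times> (nat \<Rightarrow> real)) \<times> (nat \<times> 'a \<times> (nat \<Rightarrow> real))) set" where
  "glue_eq X = Restr ((glue X \<union> (glue X)\<inverse>)\<^sup>*) (topspace (cells X))"

definition realization :: "'a sset \<Rightarrow> (nat \<times> 'a \<times> (nat \<Rightarrow> real)) set topology" where
  "realization X = topology (\<lambda>U. U \<subseteq> topspace (cells X) // glue_eq X \<and> openin (cells X) (\<Union>U))"

lemma equiv_glue_eq: "equiv (topspace (cells X)) (glue_eq X)"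
proof -
  have "sym ((glue X \<union> (glue X)\<inverse>)\<^sup>*)"
    by (rule sym_rtrancl) (auto simp: sym_def)
  then show ?thesis
    by (auto simp: equiv_def glue_eq_def refl_on_def sym_def trans_def intro: rtrancl_trans)
qed

lemma openin_realization:
  "openin (realization X) U \<longleftrightarrow>
    U \<subseteq> topspace (cells X) // glue_eq X \<and> openin (cells X) (\<Union>U)"
proof -
  have "istopology (\<lambda>U. U \<subseteq> topspace (cells X) // glue_eq X \<and> openin (cells X) (\<Union>U))"
    unfolding istopology_def
  proof (intro conjI allI impI)
    fix S T
    assume S: "S \<subseteq> topspace (cells X) // glue_eq X \<and> openin (cells X) (\<Union>S)"
      and T: "T \<subseteq> topspace (cells X) // glue_eq X \<and> openin (cells X) (\<Union>T)"
    have "\<Union>(S \<inter> T) = \<Union>S \<inter> \<Union>T"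
      using S T quotient_disj[OF equiv_glue_eq] by blast
    with S T show "openin (cells X) (\<Union>(S \<inter> T))"
      by auto
    show "S \<inter> T \<subseteq> topspace (cells X) // glue_eq X"
      using S by blast
  next
    fix K
    assume K: "\<forall>U\<in>K. U \<subseteq> topspace (cells X) // glue_eq X \<and> openin (cells X) (\<Union>U)"
    have "\<Union>(\<Union>K) = \<Union>(Union ` K)"
      by blast
    with K show "openin (cells X) (\<Union>(\<Union>K))"
      by (metis (no_types, lifting) imageE openin_Union)
    show "\<Union>K \<subseteq> topspace (cells X) // glue_eq X"
      using K by blast
  qed
  then show ?thesis
    by (simp add: realization_def)
qed

text \<open>The continuous map of realizations induced by a simplicial map \<open>f : X \<rightarrow> Y\<close>.\<close>

definition realization_map ::
    "'b sset \<Rightarrow> (nat \<Rightarrow> 'a \<Rightarrow> 'b) \<Rightarrow>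
     (nat \<times> 'a \<times> (nat \<Rightarrow> real)) set \<Rightarrow> (nat \<times> 'b \<times> (nat \<Rightarrow> real)) set" where
  "realization_map Y f c = glue_eq Y `` ((\<lambda>(k, x, t). (k, f k x, t)) ` c)"

text \<open>
  A weak equivalence of simplicial sets is a simplicial map whose geometric realization is a
  homotopy equivalence.
\<close>

definition weak_equivalence :: "'a sset \<Rightarrow> 'b sset \<Rightarrow> (nat \<Rightarrow> 'a \<Rightarrow> 'b) \<Rightarrow> bool" where
  "weak_equivalence X Y f \<longleftrightarrow>
    simplicial_map X Y f \<and>
    continuous_map (realization X) (realization Y) (realization_map Y f) \<and>
    (\<exists>g. continuous_map (realization Y) (realization X) g \<and>
      homotopic_with (\<lambda>_. True) (realization X) (realization X) (g \<circ> realization_map Y f) id \<and>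
      homotopic_with (\<lambda>_. True) (realization Y) (realization Y) (realization_map Y f \<circ> g) id)"

text \<open>The nonemptiness condition is needed: \<^const>\<open>contractible_space\<close> also holds for the empty space.\<close>

definition contractible_sset :: "'a sset \<Rightarrow> bool" where
  "contractible_sset X \<longleftrightarrow>
    topspace (realization X) \<noteq> {} \<and> contractible_space (realization X)"

definition fiber_product ::
    "'a sset \<Rightarrow> (nat \<Rightarrow> 'a \<Rightarrow> 'c) \<Rightarrow> 'b sset \<Rightarrow> (nat \<Rightarrow> 'b \<Rightarrow> 'c) \<Rightarrow> ('a \<times> 'b) sset" where
  "fiber_product X f Y g = \<lparr>
    simps = (\<lambda>k. {(x, y). x \<in> simps X k \<and> y \<in> simps Y k \<and> f k x = g k y}),
    sact = (\<lambda>k l \<alpha>. map_prod (sact X k l \<alpha>) (sact Y k l \<alpha>))\<rparr>"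

text \<open>
  The \<open>n\<close>-fold iterated fiber product \<open>X \<times>\<^sub>Z \<dots> \<times>\<^sub>Z X\<close> along \<open>t\<close> on the left factor and \<open>s\<close> on
  the right factor; a simplex is the list of its \<open>n\<close> components.
\<close>

definition iterated_fiber_product ::
    "nat \<Rightarrow> 'a sset \<Rightarrow> (nat \<Rightarrow> 'a \<Rightarrow> 'c) \<Rightarrow> (nat \<Rightarrow> 'a \<Rightarrow> 'c) \<Rightarrow> 'a list sset" where
  "iterated_fiber_product n X s t = \<lparr>
    simps = (\<lambda>k. {xs. length xs = n \<and> set xs \<subseteq> simps X k \<and>
                      (\<forall>i. Suc i < n \<longrightarrow> t k (xs ! i) = s k (xs ! Suc i))}),
    sact = (\<lambda>k l \<alpha>. map (sact X k l \<alpha>))\<rparr>"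


section \<open>Bisimplicial spaces\<close>

text \<open>
  \<open>bact Y m n m' n' \<alpha> \<beta> : Y\<^bsub>m',n'\<^esub> \<rightarrow> Y\<^bsub>m,n\<^esub>\<close> is the simplicial map induced by
  \<open>\<alpha> : [m] \<rightarrow> [m']\<close> and \<open>\<beta> : [n] \<rightarrow> [n']\<close>.
\<close>

record 'a bispace =
  spc :: "nat \<Rightarrow> nat \<Rightarrow> 'a sset"
  bact :: "nat \<Rightarrow> nat \<Rightarrow> nat \<Rightarrow> nat \<Rightarrow> (nat \<Rightarrow> nat) \<Rightarrow> (nat \<Rightarrow> nat) \<Rightarrow> nat \<Rightarrow> 'a \<Rightarrow> 'a"

definition bisimplicial_space :: "('a, 'z) bispace_scheme \<Rightarrow> bool" where
  "bisimplicial_space Y \<longleftrightarrow>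
    (\<forall>m n. simplicial_set (spc Y m n)) \<and>
    (\<forall>m n m' n'. \<forall>\<alpha>\<in>\<Delta> m m'. \<forall>\<beta>\<in>\<Delta> n n'.
       simplicial_map (spc Y m' n') (spc Y m n) (bact Y m n m' n' \<alpha> \<beta>)) \<and>
    (\<forall>m n k. \<forall>y\<in>simps (spc Y m n) k. bact Y m n m n (Delta_id m) (Delta_id n) k y = y) \<and>
    (\<forall>m n m' n' m'' n''. \<forall>\<alpha>\<in>\<Delta> m m'. \<forall>\<beta>\<in>\<Delta> n n'. \<forall>\<alpha>'\<in>\<Delta> m' m''. \<forall>\<beta>'\<in>\<Delta> n' n''.
       \<forall>k. \<forall>y\<in>simps (spc Y m'' n'') k.
         bact Y m n m'' n'' (compose {..m} \<alpha>' \<alpha>) (compose {..n} \<beta>' \<beta>) k y =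
         bact Y m n m' n' \<alpha> \<beta> k (bact Y m' n' m'' n'' \<alpha>' \<beta>' k y))"

text \<open>The map \<open>[0] \<rightarrow> [1]\<close> with value \<open>i\<close>, and the map \<open>[1] \<rightarrow> [n]\<close> with values \<open>i\<close>, \<open>i + 1\<close>.\<close>

definition Delta_vertex :: "nat \<Rightarrow> nat \<Rightarrow> nat" where
  "Delta_vertex i = (\<lambda>j\<in>{..0}. i)"

definition Delta_edge :: "nat \<Rightarrow> nat \<Rightarrow> nat" where
  "Delta_edge i = (\<lambda>j\<in>{..1}. i + j)"

text \<open>
  Horizontal source and target \<open>Y\<^bsub>1,n\<^esub> \<rightarrow> Y\<^bsub>0,n\<^esub>\<close> (on \<open>Y\<^bsub>1,1\<^esub>\<close>: left and right edge) and vertical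
  source and target \<open>Y\<^bsub>m,1\<^esub> \<rightarrow> Y\<^bsub>m,0\<^esub>\<close> (on \<open>Y\<^bsub>1,1\<^esub>\<close>: top and bottom edge).
\<close>

definition hsource :: "('a, 'z) bispace_scheme \<Rightarrow> nat \<Rightarrow> nat \<Rightarrow> 'a \<Rightarrow> 'a" where
  "hsource Y n = bact Y 0 n 1 n (Delta_vertex 0) (Delta_id n)"

definition htarget :: "('a, 'z) bispace_scheme \<Rightarrow> nat \<Rightarrow> nat \<Rightarrow> 'a \<Rightarrow> 'a" where
  "htarget Y n = bact Y 0 n 1 n (Delta_vertex 1) (Delta_id n)"

definition vsource :: "('a, 'z) bispace_scheme \<Rightarrow> nat \<Rightarrow> nat \<Rightarrow> 'a \<Rightarrow> 'a" where
  "vsource Y m = bact Y m 0 m 1 (Delta_id m) (Delta_vertex 0)"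

definition vtarget :: "('a, 'z) bispace_scheme \<Rightarrow> nat \<Rightarrow> nat \<Rightarrow> 'a \<Rightarrow> 'a" where
  "vtarget Y m = bact Y m 0 m 1 (Delta_id m) (Delta_vertex 1)"

definition double_Segal_space :: "('a, 'z) bispace_scheme \<Rightarrow> bool" where
  "double_Segal_space Y \<longleftrightarrow>
    bisimplicial_space Y \<and>
    (\<forall>n k. 2 \<le> n \<longrightarrow>
      weak_equivalence (spc Y n k)
        (iterated_fiber_product n (spc Y 1 k) (hsource Y k) (htarget Y k))
        (\<lambda>p y. map (\<lambda>i. bact Y 1 k n k (Delta_edge i) (Delta_id k) p y) [0..<n])) \<and>
    (\<forall>l m. 2 \<le> m \<longrightarrow>
      weak_equivalence (spc Y l m)
        (iterated_fiber_product m (spc Y l 1) (vsource Y l) (vtarget Y l))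
        (\<lambda>p y. map (\<lambda>i. bact Y l 1 l m (Delta_id l) (Delta_edge i) p y) [0..<m]))"

definition stable :: "('a, 'z) bispace_scheme \<Rightarrow> bool" where
  "stable Y \<longleftrightarrow>
    weak_equivalence (spc Y 1 1)
      (fiber_product (spc Y 0 1) (vsource Y 0) (spc Y 1 0) (hsource Y 0))
      (\<lambda>k y. (hsource Y 1 k y, vsource Y 1 k y)) \<and>
    weak_equivalence (spc Y 1 1)
      (fiber_product (spc Y 1 0) (htarget Y 0) (spc Y 0 1) (vtarget Y 0))
      (\<lambda>k y. (vtarget Y 1 k y, htarget Y 1 k y))"

text \<open>\<open>aug\<close> is \<open>Y\<^bsub>-1\<^esub>\<close> and \<open>augmap\<close> is the map \<open>Y\<^bsub>-1\<^esub> \<rightarrow> Y\<^bsub>0,0\<^esub>\<close>.\<close>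

record ('a, 'b) preaug_bispace = "'a bispace" +
  aug :: "'b sset"
  augmap :: "nat \<Rightarrow> 'b \<Rightarrow> 'a"

definition preaugmented_bisimplicial_space :: "('a, 'b) preaug_bispace \<Rightarrow> bool" where
  "preaugmented_bisimplicial_space Y \<longleftrightarrow>
    bisimplicial_space Y \<and> simplicial_set (aug Y) \<and> simplicial_map (aug Y) (spc Y 0 0) (augmap Y)"

definition pointed :: "('a, 'b) preaug_bispace \<Rightarrow> bool" where
  "pointed Y \<longleftrightarrow>
    contractible_sset (aug Y) \<and>
    weak_equivalence (fiber_product (spc Y 1 0) (hsource Y 0) (aug Y) (augmap Y)) (spc Y 0 0)
      (\<lambda>k (x, y). htarget Y 0 k x) \<and>
    weak_equivalence (fiber_product (spc Y 0 1) (vtarget Y 0) (aug Y) (augmap Y)) (spc Y 0 0)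
      (\<lambda>k (x, y). vsource Y 0 k x)"

definition pointed_stable_double_Segal_space :: "('a, 'b) preaug_bispace \<Rightarrow> bool" where
  "pointed_stable_double_Segal_space Y \<longleftrightarrow>
    preaugmented_bisimplicial_space Y \<and> pointed Y \<and> double_Segal_space Y \<and> stable Y"

definition isomorphic_preaug ::
    "('a, 'b) preaug_bispace \<Rightarrow> ('c, 'd) preaug_bispace \<Rightarrow> bool" (infix "\<cong>\<^sub>p" 50) where
  "Y \<cong>\<^sub>p Z \<longleftrightarrow> (\<exists>\<Phi> \<Psi>.
    (\<forall>m n. simplicial_map (spc Y m n) (spc Z m n) (\<Phi> m n)) \<and>
    (\<forall>m n k. bij_betw (\<Phi> m n k) (simps (spc Y m n) k) (simps (spc Z m n) k)) \<and>
    (\<forall>m n m' n'. \<forall>\<alpha>\<in>\<Delta> m m'. \<forall>\<beta>\<in>\<Delta> n n'. \<forall>k. \<forall>y\<in>simps (spc Y m' n') k.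
       \<Phi> m n k (bact Y m n m' n' \<alpha> \<beta> k y) = bact Z m n m' n' \<alpha> \<beta> k (\<Phi> m' n' k y)) \<and>
    simplicial_map (aug Y) (aug Z) \<Psi> \<and>
    (\<forall>k. bij_betw (\<Psi> k) (simps (aug Y) k) (simps (aug Z) k)) \<and>
    (\<forall>k. \<forall>y\<in>simps (aug Y) k. \<Phi> 0 0 k (augmap Y k y) = augmap Z k (\<Psi> k y)))"


section \<open>The classifying diagram\<close>

text \<open>The nerve of a category: a \<open>k\<close>-simplex is a functor \<open>[k] \<rightarrow> C\<close>.\<close>

definition nerve :: "('o, 'm) cat \<Rightarrow> ((nat \<Rightarrow> 'o) \<times> (nat \<times> nat \<Rightarrow> 'm)) sset" where
  "nerve C = \<lparr>
    simps = (\<lambda>k. {(x, a). x \<in> extensional (Obj (ordcat k)) \<and> a \<in> extensional (Mor (ordcat k)) \<and>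
                          is_functor (ordcat k) C x a}),
    sact = (\<lambda>k l \<alpha> (x, a). (\<lambda>i\<in>Obj (ordcat k). x (\<alpha> i),
                             \<lambda>(i, j)\<in>Mor (ordcat k). a (\<alpha> i, \<alpha> j)))\<rparr>"

definition nerve_map :: "('o \<Rightarrow> 'p) \<Rightarrow> ('m \<Rightarrow> 'n) \<Rightarrow> nat \<Rightarrow>
    (nat \<Rightarrow> 'o) \<times> (nat \<times> nat \<Rightarrow> 'm) \<Rightarrow> (nat \<Rightarrow> 'p) \<times> (nat \<times> nat \<Rightarrow> 'n)" where
  "nerve_map Fo Fm k = (\<lambda>(x, a). (\<lambda>i\<in>Obj (ordcat k). Fo (x i), \<lambda>u\<in>Mor (ordcat k). Fm (a u)))"

text \<open>Precomposition with \<open>P : B \<rightarrow> C\<close> on morphisms of \<open>dfun_groupoid C D\<close>.\<close>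

definition whisker ::
    "('o1, 'h1, 'v1, 's1) dblcat \<Rightarrow> ('o1, 'h1, 'v1, 's1, 'o2, 'h2, 'v2, 's2) dfun \<Rightarrow>
     ('o2, 'h2, 'v2, 's2, 'o3, 'h3, 'v3, 's3) dfun \<times> ('o2 \<Rightarrow> 'h3 \<times> 'v3) \<times>
     ('o2, 'h2, 'v2, 's2, 'o3, 'h3, 'v3, 's3) dfun \<Rightarrow>
     ('o1, 'h1, 'v1, 's1, 'o3, 'h3, 'v3, 's3) dfun \<times> ('o1 \<Rightarrow> 'h3 \<times> 'v3) \<times>
     ('o1, 'h1, 'v1, 's1, 'o3, 'h3, 'v3, 's3) dfun" where
  "whisker B P = (\<lambda>(F, \<theta>, G). (dfun_comp B F P, \<lambda>A\<in>obs B. \<theta> (onob P A), dfun_comp B G P))"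

type_synonym ('o, 'h, 'v, 's) grid_dfun =
  "(grid_ob, grid_hor, grid_ver, grid_sq, 'o, 'h, 'v, 's) dfun"

type_synonym ('o, 'h, 'v, 's) grid_simplex =
  "(nat \<Rightarrow> ('o, 'h, 'v, 's) grid_dfun) \<times>
   (nat \<times> nat \<Rightarrow>
     ('o, 'h, 'v, 's) grid_dfun \<times> (grid_ob \<Rightarrow> 'h \<times> 'v) \<times> ('o, 'h, 'v, 's) grid_dfun)"

text \<open>
  A double functor \<open>grid 0 0 \<rightarrow> D\<close> is an object of \<open>D\<close>, and a natural shared isomorphism between
  two such is a shared isomorphism of objects, so the groupoid of zero objects is taken to be a full
  subgroupoid of \<open>dfun_groupoid (grid 0 0) D\<close>.
\<close>

definition classifying_diagram ::
    "('o, 'h, 'v, 's) dblcat \<Rightarrow>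
     (('o, 'h, 'v, 's) grid_simplex, ('o, 'h, 'v, 's) grid_simplex) preaug_bispace" where
  "classifying_diagram D = \<lparr>
    spc = (\<lambda>m n. nerve (dfun_groupoid (grid m n) D)),
    bact = (\<lambda>m n m' n' \<alpha> \<beta>. nerve_map
      (\<lambda>F. dfun_comp (grid m n) F (grid_map m n \<alpha> \<beta>))
      (whisker (grid m n) (grid_map m n \<alpha> \<beta>))),
    aug = nerve (full_subcat (dfun_groupoid (grid 0 0) D) {F. zero_object D (onob F (0, 0))}),
    augmap = (\<lambda>k x. x)\<rparr>"

end

theory Submission
  imports Defs "HOL-Analysis.Lebesgue_Measure"
begin

text \<open>
  The double category \<open>D\<close> itself turns out to be a reverse CGW category. A zero object exists because
  the contractible space \<open>Y\<^sub>-\<^sub>1\<close> is nonempty. Extensions of spans and cospans come from the two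
  weak equivalences in the definition of stability, once it is known that a functor of groupoids whose
  nerve is a weak equivalence is essentially surjective (whence a square, after transport along shared
  isomorphisms) and full (whence an isomorphism between two extensions that is the identity on the given
  corners). Uniqueness of the latter is cancellation of an epic or monic edge.

  For fullness, a point \<open>(k, x, t)\<close> of the realization of a nerve is read as the step function on
  \<open>[0, 1)\<close> with steps of lengths \<open>t\<^sub>0, \<dots>, t\<^sub>k\<close> and values the morphisms \<open>x\<^sub>0 \<rightarrow> x\<^sub>i\<close>; this is
  insensitive to faces and degeneracies up to a change of base. Two nearby points have step functions that
  agree, after a change of base, on a set of measure greater than \<open>2/3\<close>, and since any two such sets meet
  the change of base is unique. Hence paths have a holonomy in the groupoid, which is invariant under
  homotopy and recovers the morphism given by an edge.
\<close>

section \<open>Groupoids\<close>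

text \<open>The obstacle is fullness. A homotopy inverse and its homotopies are merely continuous
  maps of quotient spaces; they need not come from simplicial maps, so morphisms have to be read off
  from paths. A point of the realization has no preferred cell, and the base object
  \<open>x_0\<close> of a cell changes under faces. A path is therefore represented by an arbitrary
  choice of cells, and continuity survives only as the statement that neighbouring cells admit a
  change of base with large agreement. Agreement is measured by length because the step function
  depends continuously on \<open>t\<close> in measure but not pointwise. For uniqueness alone the
  bound \<open>1/2\<close> would do; \<open>2/3 = 5/6 + 5/6 - 1\<close> is what remains after
  composing two changes of base of quality \<open>5/6\<close>, and this gives local lifts. They are
  glued over a square as in a covering space.

  The spaces of \<open>Y\<close> and their fiber products are not nerves themselves, so all this is
  done for simplicial sets with a simplicial map to a nerve. A second obstacle is that the bijection
  witnessing shared isomorphisms need not respect composition; it is normalised before natural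
  isomorphisms are composed.\<close>

definition groupoid :: "('o, 'm) cat \<Rightarrow> bool" where
  "groupoid C \<longleftrightarrow> is_category C \<and> (\<forall>f\<in>Mor C. \<exists>g. inverse_mors C f g)"

definition inv_mor :: "('o, 'm) cat \<Rightarrow> 'm \<Rightarrow> 'm" where
  "inv_mor C f = (SOME g. inverse_mors C f g)"

lemma groupoid_is_category: "groupoid C \<Longrightarrow> is_category C"
  by (simp add: groupoid_def)

lemma mor_in_homs: "f \<in> Mor C \<Longrightarrow> f \<in> homs C (Dom C f) (Cod C f)"
  by (simp add: homs_def)

lemma homs_obj:
  assumes "is_category C" "f \<in> homs C A B"
  shows "A \<in> Obj C" "B \<in> Obj C"
  using assms by (auto simp: is_category_def homs_def)

lemma id_in_homs:
  assumes "is_category C" "A \<in> Obj C"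
  shows "Idn C A \<in> homs C A A"
  using assms by (auto simp: is_category_def homs_def)

lemma comp_in_homs:
  assumes "is_category C" "f \<in> homs C A B" "g \<in> homs C B E"
  shows "Cmp C g f \<in> homs C A E"
  using assms unfolding is_category_def homs_def by auto

lemma comp_assoc:
  assumes "is_category C" "f \<in> homs C A B" "g \<in> homs C B E" "h \<in> homs C E K"
  shows "Cmp C h (Cmp C g f) = Cmp C (Cmp C h g) f"
  using assms unfolding is_category_def homs_def by auto

lemma comp_id:
  assumes "is_category C" "f \<in> homs C A B"
  shows "Cmp C f (Idn C A) = f" "Cmp C (Idn C B) f = f"
  using assms unfolding is_category_def homs_def by auto

lemma inverse_mors_sym: "inverse_mors C f g \<Longrightarrow> inverse_mors C g f"
  by (auto simp: inverse_mors_def)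

lemma inverse_mors_homs:
  assumes "inverse_mors C f g" "f \<in> homs C A B"
  shows "g \<in> homs C B A" "Cmp C g f = Idn C A" "Cmp C f g = Idn C B"
  using assms by (auto simp: inverse_mors_def homs_def)

lemma inverse_morsI:
  assumes "f \<in> homs C A B" "g \<in> homs C B A" "Cmp C g f = Idn C A" "Cmp C f g = Idn C B"
  shows "inverse_mors C f g"
  using assms by (auto simp: inverse_mors_def homs_def)

lemma inverse_mors_unique:
  assumes C: "is_category C" and 1: "inverse_mors C f g" and 2: "inverse_mors C f g'"
  shows "g = g'"
proof -
  have f: "f \<in> homs C (Dom C f) (Cod C f)"
    using 1 by (simp add: inverse_mors_def homs_def)
  note g = inverse_mors_homs[OF 1 f] and g' = inverse_mors_homs[OF 2 f]
  have "g = Cmp C g (Cmp C f g')"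
    using comp_id[OF C g(1)] g' by simp
  also have "\<dots> = Cmp C (Cmp C g f) g'"
    by (rule comp_assoc[OF C g'(1) f g(1)])
  finally show ?thesis
    using comp_id[OF C g'(1)] g by simp
qed

lemma inv_mor:
  assumes "groupoid C" "f \<in> homs C A B"
  shows "inv_mor C f \<in> homs C B A" "Cmp C (inv_mor C f) f = Idn C A"
    "Cmp C f (inv_mor C f) = Idn C B"
proof -
  have "f \<in> Mor C"
    using assms by (simp add: homs_def)
  then have "inverse_mors C f (inv_mor C f)"
    using assms(1) unfolding groupoid_def inv_mor_def by (metis someI_ex)
  from inverse_mors_homs[OF this assms(2)]
  show "inv_mor C f \<in> homs C B A" "Cmp C (inv_mor C f) f = Idn C A"
    "Cmp C f (inv_mor C f) = Idn C B" .
qed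

lemma comp_inv_cancel:
  assumes G: "groupoid C" and f: "f \<in> homs C A B"
  shows "g \<in> homs C B E \<Longrightarrow> Cmp C (Cmp C g f) (inv_mor C f) = g"
    and "g \<in> homs C A E \<Longrightarrow> Cmp C (Cmp C g (inv_mor C f)) f = g"
    and "g \<in> homs C E A \<Longrightarrow> Cmp C (inv_mor C f) (Cmp C f g) = g"
    and "g \<in> homs C E B \<Longrightarrow> Cmp C f (Cmp C (inv_mor C f) g) = g"
proof -
  note C = groupoid_is_category[OF G] and i = inv_mor[OF G f]
  show "g \<in> homs C B E \<Longrightarrow> Cmp C (Cmp C g f) (inv_mor C f) = g"
    using comp_assoc[OF C i(1) f] comp_id[OF C] i by metis
  show "g \<in> homs C A E \<Longrightarrow> Cmp C (Cmp C g (inv_mor C f)) f = g"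
    using comp_assoc[OF C f i(1)] comp_id[OF C] i by metis
  show "g \<in> homs C E A \<Longrightarrow> Cmp C (inv_mor C f) (Cmp C f g) = g"
    using comp_assoc[OF C _ f i(1)] comp_id[OF C] i by metis
  show "g \<in> homs C E B \<Longrightarrow> Cmp C f (Cmp C (inv_mor C f) g) = g"
    using comp_assoc[OF C _ i(1) f] comp_id[OF C] i by metis
qed

lemma comp_cancel_right:
  assumes "groupoid C" "f \<in> homs C A B" "g \<in> homs C B E" "h \<in> homs C B E"
    "Cmp C g f = Cmp C h f"
  shows "g = h"
  using comp_inv_cancel(1)[OF assms(1,2)] assms(3-5) by metis

lemma comp_cancel_left:
  assumes "groupoid C" "f \<in> homs C A B" "g \<in> homs C E A" "h \<in> homs C E A"
    "Cmp C f g = Cmp C f h"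
  shows "g = h"
  using comp_inv_cancel(3)[OF assms(1,2)] assms(3-5) by metis

lemma functor_homs:
  assumes "is_functor C D Fo Fm" "f \<in> homs C A B"
  shows "Fm f \<in> homs D (Fo A) (Fo B)"
  using assms by (auto simp: is_functor_def homs_def)

lemma functor_comp:
  assumes "is_functor C D Fo Fm" "f \<in> homs C A B" "g \<in> homs C B E"
  shows "Fm (Cmp C g f) = Cmp D (Fm g) (Fm f)"
  using assms by (auto simp: is_functor_def homs_def)

lemma functor_id:
  assumes "is_functor C D Fo Fm" "A \<in> Obj C"
  shows "Fm (Idn C A) = Idn D (Fo A)"
  using assms by (auto simp: is_functor_def)

section \<open>Holonomy of locally framed families\<close>

definition agreement ::
    "('o, 'm) cat \<Rightarrow> ('c \<Rightarrow> real \<Rightarrow> 'm) \<Rightarrow> 'c \<Rightarrow> 'm \<Rightarrow> 'c \<Rightarrow> real set" where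
  "agreement C fr c m c' = {s \<in> {0..<1}. Cmp C (fr c' s) m = fr c s}"

text \<open>The inequality is strict so that a given change of base always has some slack above
  \<open>r\<close>. The slack absorbs a change of representing cell and makes nearness an open
  condition.\<close>

definition near ::
    "('o, 'm) cat \<Rightarrow> ('c \<Rightarrow> 'o) \<Rightarrow> ('c \<Rightarrow> real \<Rightarrow> 'm) \<Rightarrow> real \<Rightarrow> 'c \<Rightarrow> 'm \<Rightarrow> 'c \<Rightarrow> bool" where
  "near C ob fr r c m c' \<longleftrightarrow>
    m \<in> homs C (ob c) (ob c') \<and> r < measure lborel (agreement C fr c m c')"

text \<open>Inclusion-exclusion, with the union bounded by the total length 1. It is the source of
  the loss \<open>r + r' - 1\<close> when two changes of base are composed.\<close>

lemma measure_Int_unit_interval: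
  fixes A B :: "real set"
  assumes "A \<in> sets lborel" "B \<in> sets lborel" "A \<subseteq> {0..<1}" "B \<subseteq> {0..<1}"
  shows "measure lborel (A \<inter> B) \<ge> measure lborel A + measure lborel B - 1"
proof -
  have fin: "E \<in> fmeasurable lborel" if "E \<in> sets lborel" "E \<subseteq> {0..<1}" for E :: "real set"
  proof (rule fmeasurableI2)
    show "{0..<1::real} \<in> fmeasurable lborel"
      by (simp add: fmeasurable_def)
  qed (use that in auto)
  have "measure lborel (A \<union> B) \<le> measure lborel {0..<1::real}"
    by (rule measure_mono_fmeasurable) (use assms in \<open>auto simp: fmeasurable_def\<close>)
  moreover have "measure lborel (A \<union> B) = measure lborel A + measure lborel B - measure lborel (A \<inter> B)"
    by (rule measure_Un3) (use fin assms in auto)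
  ultimately show ?thesis
    by simp
qed

text \<open>Each point \<open>c\<close> carries a step function \<open>fr c\<close> on
  \<open>[0, 1)\<close> whose values are morphisms out of the base \<open>ob c\<close>. Finite range
  and measurable level sets replace a measurable structure on the type of morphisms: they make an
  agreement set a finite union of measurable sets.\<close>

locale framing =
  fixes C :: "('o, 'm) cat" and P :: "'c set" and ob :: "'c \<Rightarrow> 'o" and fr :: "'c \<Rightarrow> real \<Rightarrow> 'm"
  assumes gpd: "groupoid C"
    and frame: "\<And>c s. c \<in> P \<Longrightarrow> s \<in> {0..<1} \<Longrightarrow> fr c s \<in> Mor C \<and> Dom C (fr c s) = ob c"
    and finite_frame: "\<And>c. c \<in> P \<Longrightarrow> finite (fr c ` {0..<1})"
    and measurable_frame: "\<And>c z. c \<in> P \<Longrightarrow> {s \<in> {0..<1}. fr c s = z} \<in> sets lborel"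
begin

lemmas cat = groupoid_is_category[OF gpd]

lemma ob_Obj:
  assumes "c \<in> P" shows "ob c \<in> Obj C"
  using homs_obj(1)[OF cat mor_in_homs] frame[OF assms, of 0] by force

lemma frame_homs:
  assumes "c \<in> P" "s \<in> {0..<1}"
  shows "fr c s \<in> homs C (ob c) (Cod C (fr c s))"
  using frame[OF assms] by (simp add: homs_def)

lemma agreement_measurable:
  assumes "c \<in> P" "c' \<in> P"
  shows "agreement C fr c m c' \<in> sets lborel"
proof -
  have "agreement C fr c m c' =
    (\<Union>z\<in>fr c' ` {0..<1}. {s\<in>{0..<1}. fr c' s = z} \<inter> {s\<in>{0..<1}. fr c s = Cmp C z m})"
    by (auto simp: agreement_def)
  then show ?thesis
    by (simp only:) (intro sets.finite_UN sets.Int finite_frame measurable_frame assms)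
qed

lemma agreement_subset: "agreement C fr c m c' \<subseteq> {0..<1}"
  by (auto simp: agreement_def)

abbreviation "nearby \<equiv> near C ob fr"

lemma near_homs: "nearby r c m c' \<Longrightarrow> m \<in> homs C (ob c) (ob c')"
  by (simp add: near_def)

lemma near_total:
  assumes "m \<in> homs C (ob c) (ob c')" "r < 1"
    "\<And>s. s \<in> {0..<1} \<Longrightarrow> Cmp C (fr c' s) m = fr c s"
  shows "nearby r c m c'"
proof -
  have "agreement C fr c m c' = {0..<1}"
    using assms(3) by (auto simp: agreement_def)
  then show ?thesis
    using assms by (simp add: near_def)
qed

lemma near_refl:
  assumes "c \<in> P" "r < 1"
  shows "nearby r c (Idn C (ob c)) c"
  using assms id_in_homs[OF cat ob_Obj] comp_id[OF cat frame_homs] by (intro near_total) auto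

lemma near_sym:
  assumes "c \<in> P" "c' \<in> P" "nearby r c m c'"
  shows "nearby r c' (inv_mor C m) c"
proof -
  have m: "m \<in> homs C (ob c) (ob c')"
    using assms by (simp add: near_def)
  have "Cmp C (fr c s) (inv_mor C m) = fr c' s \<longleftrightarrow> Cmp C (fr c' s) m = fr c s"
    if s: "s \<in> {0..<1}" for s
    using comp_inv_cancel(1)[OF gpd m frame_homs[OF assms(2) s]]
      comp_inv_cancel(2)[OF gpd m frame_homs[OF assms(1) s]] by metis
  then have "agreement C fr c' (inv_mor C m) c = agreement C fr c m c'"
    by (auto simp: agreement_def)
  then show ?thesis
    using assms inv_mor[OF gpd m] by (simp add: near_def)
qed

lemma near_trans:
  assumes c: "c \<in> P" "c' \<in> P" "c'' \<in> P"
    and n: "nearby r c m c'" "nearby r' c' m' c''"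
  shows "nearby (r + r' - 1) c (Cmp C m' m) c''"
proof -
  have m: "m \<in> homs C (ob c) (ob c')" "m' \<in> homs C (ob c') (ob c'')"
    using n by (simp_all add: near_def)
  have sub: "agreement C fr c m c' \<inter> agreement C fr c' m' c'' \<subseteq> agreement C fr c (Cmp C m' m) c''"
    using comp_assoc[OF cat m frame_homs] c by (auto simp: agreement_def)
  have "measure lborel (agreement C fr c m c' \<inter> agreement C fr c' m' c'') \<le>
      measure lborel (agreement C fr c (Cmp C m' m) c'')"
  proof (rule measure_mono_fmeasurable[OF sub])
    show "agreement C fr c (Cmp C m' m) c'' \<in> fmeasurable lborel"
      by (rule fmeasurableI2[of "{0..<1}"])
        (use agreement_measurable agreement_subset c in \<open>auto simp: fmeasurable_def\<close>)
  qed (use agreement_measurable c in auto)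
  moreover have "measure lborel (agreement C fr c m c') + measure lborel (agreement C fr c' m' c'') - 1
      \<le> measure lborel (agreement C fr c m c' \<inter> agreement C fr c' m' c'')"
    by (intro measure_Int_unit_interval agreement_measurable agreement_subset c)
  ultimately show ?thesis
    using n comp_in_homs[OF cat m] by (auto simp: near_def)
qed

text \<open>A nonnegative threshold makes the agreement set nonempty, and a single parameter
  suffices: there the frame value, being invertible, cancels.\<close>

lemma near_self:
  assumes "c \<in> P" "nearby r c m c" "0 \<le> r"
  shows "m = Idn C (ob c)"
proof -
  have "agreement C fr c m c \<noteq> {}"
    using assms by (auto simp: near_def)
  then obtain s where s: "s \<in> {0..<1}" "Cmp C (fr c s) m = fr c s"
    by (auto simp: agreement_def)
  then have "Cmp C (fr c s) m = Cmp C (fr c s) (Idn C (ob c))"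
    using comp_id[OF cat frame_homs[OF assms(1)]] by simp
  then show ?thesis
    by (rule comp_cancel_left[OF gpd frame_homs[OF assms(1) s(1)] near_homs[OF assms(2)]
          id_in_homs[OF cat ob_Obj[OF assms(1)]]])
qed

text \<open>The composite of \<open>m\<close> with the inverse of \<open>m'\<close> is a change of
  base from \<open>c\<close> to itself with agreement above \<open>r + r' - 1\<close>, hence the
  identity by \<open>near_self\<close>.\<close>

lemma near_unique:
  assumes c: "c \<in> P" "c' \<in> P" and n: "nearby r c m c'" "nearby r' c m' c'" and r: "1 \<le> r + r'"
  shows "m = m'"
proof -
  note m = near_homs[OF n(1)] and m' = near_homs[OF n(2)]
  have "Cmp C (inv_mor C m') m = Idn C (ob c)"
    using near_self[OF c(1) near_trans[OF c c(1) n(1) near_sym[OF c n(2)]]] r by simp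
  then show ?thesis
    using comp_inv_cancel(4)[OF gpd m' m] comp_id[OF cat m'] by simp
qed

text \<open>What remains of continuity for a family of cells chosen without any continuity:
  neighbours are related by some change of base, with agreement as close to 1 as desired.\<close>

definition coherent :: "'u::metric_space set \<Rightarrow> ('u \<Rightarrow> 'c) \<Rightarrow> bool" where
  "coherent S \<Gamma> \<longleftrightarrow> \<Gamma> ` S \<subseteq> P \<and>
    (\<forall>u\<in>S. \<forall>r<1. \<exists>\<delta>>0. \<forall>v\<in>S. dist u v < \<delta> \<longrightarrow> (\<exists>m. nearby r (\<Gamma> u) m (\<Gamma> v)))"

lemma coherentD:
  assumes "coherent S \<Gamma>" "u \<in> S" "r < 1"
  obtains \<delta> where "\<delta> > 0" "\<And>v. v \<in> S \<Longrightarrow> dist u v < \<delta> \<Longrightarrow> \<exists>m. nearby r (\<Gamma> u) m (\<Gamma> v)"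
proof -
  have "\<exists>\<delta>>0. \<forall>v\<in>S. dist u v < \<delta> \<longrightarrow> (\<exists>m. nearby r (\<Gamma> u) m (\<Gamma> v))"
    using assms unfolding coherent_def by simp
  then show thesis
    using that by (elim exE conjE) simp
qed

end

text \<open>The analogue of a lift to a covering space: morphisms out of a fixed object
  \<open>A\<close>, carried along by the local changes of base. No continuity of \<open>e\<close> is
  meant. At threshold \<open>2/3\<close> the change of base is unique, so \<open>e u\<close>
  determines \<open>e\<close> near \<open>u\<close>.\<close>

definition lift_of ::
    "('o, 'm) cat \<Rightarrow> ('c \<Rightarrow> 'o) \<Rightarrow> ('c \<Rightarrow> real \<Rightarrow> 'm) \<Rightarrow> 'u::metric_space set \<Rightarrow> ('u \<Rightarrow> 'c) \<Rightarrow>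
      'o \<Rightarrow> ('u \<Rightarrow> 'm) \<Rightarrow> bool" where
  "lift_of C ob fr S \<Gamma> A e \<longleftrightarrow>
    (\<forall>u\<in>S. e u \<in> homs C A (ob (\<Gamma> u))) \<and>
    (\<forall>u\<in>S. \<exists>\<delta>>0. \<forall>v\<in>S. dist u v < \<delta> \<longrightarrow>
      (\<exists>m. near C ob fr (2/3) (\<Gamma> u) m (\<Gamma> v) \<and> e v = Cmp C m (e u)))"

context framing
begin

abbreviation "lift \<equiv> lift_of C ob fr"

lemma liftD:
  assumes "lift S \<Gamma> A e" "u \<in> S"
  obtains \<delta> where "\<delta> > 0" "\<And>v. v \<in> S \<Longrightarrow> dist u v < \<delta> \<Longrightarrow>
    \<exists>m. nearby (2/3) (\<Gamma> u) m (\<Gamma> v) \<and> e v = Cmp C m (e u)"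
proof -
  have "\<exists>\<delta>>0. \<forall>v\<in>S. dist u v < \<delta> \<longrightarrow> (\<exists>m. nearby (2/3) (\<Gamma> u) m (\<Gamma> v) \<and> e v = Cmp C m (e u))"
    using assms unfolding lift_of_def by simp
  then show thesis
    using that by (elim exE conjE) simp
qed

lemma lift_homs: "lift S \<Gamma> A e \<Longrightarrow> u \<in> S \<Longrightarrow> e u \<in> homs C A (ob (\<Gamma> u))"
  by (simp add: lift_of_def)

lemma coherent_compose:
  assumes \<Gamma>: "coherent S \<Gamma>" and f: "continuous_on T f" "f ` T \<subseteq> S"
  shows "coherent T (\<lambda>u. \<Gamma> (f u))"
  unfolding coherent_def
proof (intro conjI ballI allI impI)
  show "(\<lambda>u. \<Gamma> (f u)) ` T \<subseteq> P"
    using \<Gamma> f(2) by (auto simp: coherent_def)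
  fix u r assume u: "u \<in> T" and r: "r < (1::real)"
  obtain \<delta> where \<delta>: "\<delta> > 0" "\<And>v. v \<in> S \<Longrightarrow> dist (f u) v < \<delta> \<Longrightarrow> \<exists>m. nearby r (\<Gamma> (f u)) m (\<Gamma> v)"
    using coherentD[OF \<Gamma> _ r, of "f u"] u f(2) by (metis image_subset_iff)
  obtain d where "d > 0" "\<And>v. v \<in> T \<Longrightarrow> dist v u < d \<Longrightarrow> dist (f v) (f u) < \<delta>"
    using f(1) u \<delta>(1) unfolding continuous_on_iff by blast
  then show "\<exists>d>0. \<forall>v\<in>T. dist u v < d \<longrightarrow> (\<exists>m. nearby r (\<Gamma> (f u)) m (\<Gamma> (f v)))"
    using \<delta>(2) f(2) by (metis dist_commute image_subset_iff)
qed

lemma lift_compose: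
  assumes e: "lift S \<Gamma> A e" and f: "continuous_on T f" "f ` T \<subseteq> S"
  shows "lift T (\<lambda>u. \<Gamma> (f u)) A (\<lambda>u. e (f u))"
  unfolding lift_of_def
proof (intro conjI ballI)
  fix u assume u: "u \<in> T"
  show "e (f u) \<in> homs C A (ob (\<Gamma> (f u)))"
    using e u f(2) by (auto simp: lift_of_def)
  obtain \<delta> where \<delta>: "\<delta> > 0" "\<And>v. v \<in> S \<Longrightarrow> dist (f u) v < \<delta> \<Longrightarrow>
      \<exists>m. nearby (2/3) (\<Gamma> (f u)) m (\<Gamma> v) \<and> e v = Cmp C m (e (f u))"
    using liftD[OF e, of "f u"] u f(2) by (metis image_subset_iff)
  obtain d where "d > 0" "\<And>v. v \<in> T \<Longrightarrow> dist v u < d \<Longrightarrow> dist (f v) (f u) < \<delta>"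
    using f(1) u \<delta>(1) unfolding continuous_on_iff by blast
  then show "\<exists>d>0. \<forall>v\<in>T. dist u v < d \<longrightarrow>
      (\<exists>m. nearby (2/3) (\<Gamma> (f u)) m (\<Gamma> (f v)) \<and> e (f v) = Cmp C m (e (f u)))"
    using \<delta>(2) f(2) by (metis dist_commute image_subset_iff)
qed

lemma lift_subset:
  assumes "lift S \<Gamma> A e" "T \<subseteq> S"
  shows "lift T \<Gamma> A e"
  using lift_compose[OF assms(1), of T "\<lambda>u. u"] assms(2) by (simp add: continuous_on_id)

lemma lift_rebase:
  assumes e: "lift S \<Gamma> A e" and n: "n \<in> homs C B A"
  shows "lift S \<Gamma> B (\<lambda>u. Cmp C (e u) n)"
  unfolding lift_of_def
proof (intro conjI ballI)
  fix u assume u: "u \<in> S"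
  have eu: "e u \<in> homs C A (ob (\<Gamma> u))"
    using e u by (simp add: lift_of_def)
  then show "Cmp C (e u) n \<in> homs C B (ob (\<Gamma> u))"
    using comp_in_homs[OF cat n] by simp
  obtain \<delta> where "\<delta> > 0" "\<And>v. v \<in> S \<Longrightarrow> dist u v < \<delta> \<Longrightarrow>
      \<exists>m. nearby (2/3) (\<Gamma> u) m (\<Gamma> v) \<and> e v = Cmp C m (e u)"
    using liftD[OF e u] by metis
  then show "\<exists>\<delta>>0. \<forall>v\<in>S. dist u v < \<delta> \<longrightarrow>
      (\<exists>m. nearby (2/3) (\<Gamma> u) m (\<Gamma> v) \<and> Cmp C (e v) n = Cmp C m (Cmp C (e u) n))"
    using comp_assoc[OF cat n eu near_homs] by metis
qed

text \<open>Near any point both lifts are moved by the same change of base, which is left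
  cancellable. So the truth value of \<open>e u = e' u\<close> is locally constant, hence constant
  on a connected set.\<close>

lemma lift_unique:
  assumes S: "connected S" and P: "\<Gamma> ` S \<subseteq> P" and e: "lift S \<Gamma> A e" "lift S \<Gamma> A e'"
    and w: "w \<in> S" "e w = e' w" and u: "u \<in> S"
  shows "e u = e' u"
proof -
  have "(\<lambda>u. e u = e' u) constant_on S"
  proof (rule locally_constant_imp_constant[OF S])
    fix a assume a: "a \<in> S"
    obtain d where d: "d > 0" "\<And>v. v \<in> S \<Longrightarrow> dist a v < d \<Longrightarrow>
        \<exists>m. nearby (2/3) (\<Gamma> a) m (\<Gamma> v) \<and> e v = Cmp C m (e a)"
      using liftD[OF e(1) a] by metis
    obtain d' where d': "d' > 0" "\<And>v. v \<in> S \<Longrightarrow> dist a v < d' \<Longrightarrow>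
        \<exists>m. nearby (2/3) (\<Gamma> a) m (\<Gamma> v) \<and> e' v = Cmp C m (e' a)"
      using liftD[OF e(2) a] by metis
    have "(e v = e' v) = (e a = e' a)" if v: "v \<in> S \<inter> ball a (min d d')" for v
    proof -
      obtain m m' where m: "nearby (2/3) (\<Gamma> a) m (\<Gamma> v)" "e v = Cmp C m (e a)"
        and m': "nearby (2/3) (\<Gamma> a) m' (\<Gamma> v)" "e' v = Cmp C m' (e' a)"
        using d(2) d'(2) v by fastforce
      have "m = m'"
        using near_unique[OF _ _ m(1) m'(1)] P a v by auto
      then show ?thesis
        using comp_cancel_left[OF gpd near_homs[OF m(1)] lift_homs[OF e(1) a] lift_homs[OF e(2) a]]
          m(2) m'(2) by metis
    qed
    then have "\<forall>x\<in>S \<inter> ball a (min d d'). (e x = e' x) = (e a = e' a)"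
      by blast
    moreover have "openin (top_of_set S) (S \<inter> ball a (min d d'))" "a \<in> S \<inter> ball a (min d d')"
      using d(1) d'(1) a by (simp_all add: openin_open_Int)
    ultimately show "\<exists>T. openin (top_of_set S) T \<and> a \<in> T \<and> (\<forall>x\<in>T. (e x = e' x) = (e a = e' a))"
      by blast
  qed
  then show ?thesis
    using w u unfolding constant_on_def by metis
qed

text \<open>The two lifts may have different base objects, so the second is first precomposed with
  the morphism that makes it equal to the first at one common point. Uniqueness on the connected
  intersection then makes them equal on all of it.\<close>

lemma lift_union:
  assumes S: "closed S1" "closed S2" "connected (S1 \<inter> S2)" "S1 \<inter> S2 \<noteq> {}"
    and P: "\<Gamma> ` (S1 \<union> S2) \<subseteq> P"
    and e1: "lift S1 \<Gamma> A1 e1" and e2: "lift S2 \<Gamma> A2 e2"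
  shows "\<exists>e. lift (S1 \<union> S2) \<Gamma> A1 e"
proof -
  obtain p where p: "p \<in> S1" "p \<in> S2"
    using S by auto
  have p1: "e1 p \<in> homs C A1 (ob (\<Gamma> p))" and p2: "e2 p \<in> homs C A2 (ob (\<Gamma> p))"
    using e1 e2 p by (auto simp: lift_of_def)
  define n where "n = Cmp C (inv_mor C (e2 p)) (e1 p)"
  have n: "n \<in> homs C A1 A2"
    using comp_in_homs[OF cat p1 inv_mor(1)[OF gpd p2]] by (simp add: n_def)
  define e2' where "e2' u = Cmp C (e2 u) n" for u
  have e2': "lift S2 \<Gamma> A1 e2'"
    unfolding e2'_def by (rule lift_rebase[OF e2 n])
  have p': "e1 p = e2' p"
    using comp_inv_cancel(4)[OF gpd p2 p1] by (simp add: e2'_def n_def)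
  have eq: "e1 u = e2' u" if "u \<in> S1" "u \<in> S2" for u
    by (rule lift_unique[OF S(3) _ lift_subset[OF e1] lift_subset[OF e2'] _ p']) (use p that P in auto)
  define e where "e u = (if u \<in> S1 then e1 u else e2' u)" for u
  have es: "e u = e1 u" if "u \<in> S1" for u
    using that by (simp add: e_def)
  have es2: "e u = e2' u" if "u \<in> S2" for u
    using that eq by (simp add: e_def)
  have "lift (S1 \<union> S2) \<Gamma> A1 e"
    unfolding lift_of_def
  proof (intro conjI ballI)
    fix u assume u: "u \<in> S1 \<union> S2"
    then show "e u \<in> homs C A1 (ob (\<Gamma> u))"
      using e1 e2' es es2 by (auto simp: lift_of_def)
    have "\<exists>\<delta>>0. \<forall>v\<in>S1. dist u v < \<delta> \<longrightarrow> (\<exists>m. nearby (2/3) (\<Gamma> u) m (\<Gamma> v) \<and> e v = Cmp C m (e u))"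
    proof (cases "u \<in> S1")
      case True
      then show ?thesis
        using e1 es by (simp add: lift_of_def)
    next
      case False
      \<comment> \<open>\<open>S1\<close> is closed, so a point outside it has a ball missing
        \<open>S1\<close>, and the condition on \<open>S1\<close> is vacuous there.\<close>
      then obtain \<delta> where "\<delta> > 0" "ball u \<delta> \<inter> S1 = {}"
        using S(1) by (metis ComplI open_Compl openE disjoint_eq_subset_Compl)
      then show ?thesis
        by (metis IntI emptyE mem_ball)
    qed
    then obtain d where d: "d > 0" "\<And>v. v \<in> S1 \<Longrightarrow> dist u v < d \<Longrightarrow>
        \<exists>m. nearby (2/3) (\<Gamma> u) m (\<Gamma> v) \<and> e v = Cmp C m (e u)"
      by meson
    have "\<exists>\<delta>>0. \<forall>v\<in>S2. dist u v < \<delta> \<longrightarrow> (\<exists>m. nearby (2/3) (\<Gamma> u) m (\<Gamma> v) \<and> e v = Cmp C m (e u))"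
    proof (cases "u \<in> S2")
      case True
      then show ?thesis
        using e2' es2 by (simp add: lift_of_def)
    next
      case False
      then obtain \<delta> where "\<delta> > 0" "ball u \<delta> \<inter> S2 = {}"
        using S(2) by (metis ComplI open_Compl openE disjoint_eq_subset_Compl)
      then show ?thesis
        by (metis IntI emptyE mem_ball)
    qed
    then obtain d' where d': "d' > 0" "\<And>v. v \<in> S2 \<Longrightarrow> dist u v < d' \<Longrightarrow>
        \<exists>m. nearby (2/3) (\<Gamma> u) m (\<Gamma> v) \<and> e v = Cmp C m (e u)"
      by meson
    show "\<exists>\<delta>>0. \<forall>v\<in>S1 \<union> S2. dist u v < \<delta> \<longrightarrow>
        (\<exists>m. nearby (2/3) (\<Gamma> u) m (\<Gamma> v) \<and> e v = Cmp C m (e u))"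
      using d d' by (intro exI[of _ "min d d'"]) auto
  qed
  then show ?thesis
    by blast
qed

text \<open>Changes of base out of the single cell \<open>\<Gamma> u\<close> form the lift. They are
  taken with agreement above \<open>5/6\<close>, so that going back from \<open>v\<close> to
  \<open>u\<close> and on to \<open>w\<close> still agrees on more than
  \<open>5/6 + 5/6 - 1 = 2/3\<close>.\<close>

lemma lift_local:
  assumes \<Gamma>: "coherent S \<Gamma>" and u: "u \<in> S"
  shows "\<exists>\<delta>>0. \<exists>A e. lift (S \<inter> ball u \<delta>) \<Gamma> A e"
proof -
  have P: "\<Gamma> v \<in> P" if "v \<in> S" for v
    using \<Gamma> that by (auto simp: coherent_def)
  obtain \<delta> where \<delta>: "\<delta> > 0" "\<And>v. v \<in> S \<Longrightarrow> dist u v < \<delta> \<Longrightarrow> \<exists>m. nearby (5/6) (\<Gamma> u) m (\<Gamma> v)"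
    by (rule coherentD[OF \<Gamma> u, of "5/6"]) auto
  define e where "e v = (SOME m. nearby (5/6) (\<Gamma> u) m (\<Gamma> v))" for v
  have e: "nearby (5/6) (\<Gamma> u) (e v) (\<Gamma> v)" if "v \<in> S \<inter> ball u \<delta>" for v
    unfolding e_def by (rule someI_ex) (use \<delta>(2) that in auto)
  have "lift (S \<inter> ball u \<delta>) \<Gamma> (ob (\<Gamma> u)) e"
    unfolding lift_of_def
  proof (intro conjI ballI)
    fix v assume v: "v \<in> S \<inter> ball u \<delta>"
    note ev = near_homs[OF e[OF v]]
    show "e v \<in> homs C (ob (\<Gamma> u)) (ob (\<Gamma> v))"
      by (rule ev)
    have "\<exists>m. nearby (2/3) (\<Gamma> v) m (\<Gamma> w) \<and> e w = Cmp C m (e v)" if w: "w \<in> S \<inter> ball u \<delta>" for w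
    proof (intro exI conjI)
      have "nearby (5/6 + 5/6 - 1) (\<Gamma> v) (Cmp C (e w) (inv_mor C (e v))) (\<Gamma> w)"
        by (rule near_trans[OF _ _ _ near_sym[OF _ _ e[OF v]] e[OF w]]) (use P u v w in auto)
      then show "nearby (2/3) (\<Gamma> v) (Cmp C (e w) (inv_mor C (e v))) (\<Gamma> w)"
        by simp
      show "e w = Cmp C (Cmp C (e w) (inv_mor C (e v))) (e v)"
        using comp_inv_cancel(2)[OF gpd ev near_homs[OF e[OF w]]] by simp
    qed
    then show "\<exists>d>0. \<forall>w\<in>S \<inter> ball u \<delta>. dist v w < d \<longrightarrow>
        (\<exists>m. nearby (2/3) (\<Gamma> v) m (\<Gamma> w) \<and> e w = Cmp C m (e v))"
      using zero_less_one by blast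
  qed
  then show ?thesis
    using \<delta>(1) by blast
qed

text \<open>Compactness of the square in the form of interval bisection, used twice: along a
  vertical line, small rectangles are glued to a strip of positive width, and then strips are glued
  to the square. Every intersection that occurs is convex, which provides the connectedness demanded
  by \<open>lift_union\<close>.\<close>

lemma lift_square:
  assumes \<Gamma>: "coherent ({0..1} \<times> {0..1}) \<Gamma>"
  shows "\<exists>A e. lift ({0..1::real} \<times> {0..1::real}) \<Gamma> A e"
proof -
  define I :: "real set" where "I = {0..1}"
  have P: "\<Gamma> ` S \<subseteq> P" if "S \<subseteq> I \<times> I" for S
    using \<Gamma> that unfolding coherent_def I_def by blast
  have strip: "\<exists>\<epsilon>>0. \<exists>A e. lift (({x-\<epsilon>..x+\<epsilon>} \<inter> I) \<times> I) \<Gamma> A e" if x: "x \<in> I" for x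
  proof -
    \<comment> \<open>The bounds stand inside the predicate because \<open>Bolzano\<close> tests it
      on all short intervals around a point, also on those that leave \<open>[0, 1]\<close>.\<close>
    have "0 \<le> (0::real) \<longrightarrow> 1 \<le> (1::real) \<longrightarrow>
        (\<exists>\<epsilon>>0. \<exists>A e. lift (({x-\<epsilon>..x+\<epsilon>} \<inter> I) \<times> {0..1}) \<Gamma> A e)"
    proof (rule Bolzano[of 0 1 "\<lambda>c d. 0 \<le> c \<longrightarrow> d \<le> 1 \<longrightarrow>
        (\<exists>\<epsilon>>0. \<exists>A e. lift (({x-\<epsilon>..x+\<epsilon>} \<inter> I) \<times> {c..d}) \<Gamma> A e)"])
      show "0 \<le> (1::real)"
        by simp
    next
      fix a b c :: real
      assume 1: "0 \<le> a \<longrightarrow> b \<le> 1 \<longrightarrow> (\<exists>\<epsilon>>0. \<exists>A e. lift (({x-\<epsilon>..x+\<epsilon>} \<inter> I) \<times> {a..b}) \<Gamma> A e)"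
        and 2: "0 \<le> b \<longrightarrow> c \<le> 1 \<longrightarrow> (\<exists>\<epsilon>>0. \<exists>A e. lift (({x-\<epsilon>..x+\<epsilon>} \<inter> I) \<times> {b..c}) \<Gamma> A e)"
        and abc: "a \<le> b" "b \<le> c"
      show "0 \<le> a \<longrightarrow> c \<le> 1 \<longrightarrow> (\<exists>\<epsilon>>0. \<exists>A e. lift (({x-\<epsilon>..x+\<epsilon>} \<inter> I) \<times> {a..c}) \<Gamma> A e)"
      proof (intro impI)
        assume ac: "0 \<le> a" "c \<le> 1"
        obtain \<epsilon>1 A1 e1 where e1: "\<epsilon>1 > 0" "lift (({x-\<epsilon>1..x+\<epsilon>1} \<inter> I) \<times> {a..b}) \<Gamma> A1 e1"
          using 1 ac abc by auto
        obtain \<epsilon>2 A2 e2 where e2: "\<epsilon>2 > 0" "lift (({x-\<epsilon>2..x+\<epsilon>2} \<inter> I) \<times> {b..c}) \<Gamma> A2 e2"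
          using 2 ac abc by auto
        \<comment> \<open>A common width for both rectangles. The predicate asserts only some
          positive width, so it may shrink at each gluing.\<close>
        define \<epsilon> where "\<epsilon> = min \<epsilon>1 \<epsilon>2"
        have \<epsilon>: "\<epsilon> > 0" "\<epsilon> \<le> \<epsilon>1" "\<epsilon> \<le> \<epsilon>2"
          using e1 e2 by (auto simp: \<epsilon>_def)
        define J where "J = {x-\<epsilon>..x+\<epsilon>} \<inter> I"
        have xJ: "x \<in> J"
          using x \<epsilon> by (auto simp: J_def)
        have int: "(J \<times> {a..b}) \<inter> (J \<times> {b..c}) = J \<times> {b}" "(J \<times> {a..b}) \<union> (J \<times> {b..c}) = J \<times> {a..c}"
          using abc by auto
        have "\<exists>e. lift ((J \<times> {a..b}) \<union> (J \<times> {b..c})) \<Gamma> A1 e"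
        proof (rule lift_union)
          show "closed (J \<times> {a..b})" "closed (J \<times> {b..c})"
            by (auto simp: J_def I_def intro!: closed_Times)
          show "connected ((J \<times> {a..b}) \<inter> (J \<times> {b..c}))"
            unfolding int by (auto simp: J_def I_def intro!: convex_connected convex_Times convex_Int)
          show "(J \<times> {a..b}) \<inter> (J \<times> {b..c}) \<noteq> {}"
            unfolding int using xJ by blast
          show "\<Gamma> ` ((J \<times> {a..b}) \<union> (J \<times> {b..c})) \<subseteq> P"
            by (rule P) (use ac abc in \<open>auto simp: J_def I_def\<close>)
          show "lift (J \<times> {a..b}) \<Gamma> A1 e1"
            by (rule lift_subset[OF e1(2)]) (use \<epsilon> in \<open>auto simp: J_def\<close>)
          show "lift (J \<times> {b..c}) \<Gamma> A2 e2"
            by (rule lift_subset[OF e2(2)]) (use \<epsilon> in \<open>auto simp: J_def\<close>)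
        qed
        then show "\<exists>\<epsilon>>0. \<exists>A e. lift (({x-\<epsilon>..x+\<epsilon>} \<inter> I) \<times> {a..c}) \<Gamma> A e"
          unfolding int using \<epsilon>(1) unfolding J_def by blast
      qed
    next
      fix y :: real assume "0 \<le> y" "y \<le> 1"
      then have "(x, y) \<in> I \<times> I"
        using x by (auto simp: I_def)
      then obtain \<delta> A e where \<delta>: "\<delta> > 0" "lift (I \<times> I \<inter> ball (x, y) \<delta>) \<Gamma> A e"
        using lift_local \<Gamma> unfolding I_def by meson
      show "\<exists>d>0. \<forall>a b. a \<le> y \<and> y \<le> b \<and> b - a < d \<longrightarrow> 0 \<le> a \<longrightarrow> b \<le> 1 \<longrightarrow>
          (\<exists>\<epsilon>>0. \<exists>A e. lift (({x-\<epsilon>..x+\<epsilon>} \<inter> I) \<times> {a..b}) \<Gamma> A e)"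
      \<comment> \<open>Half of \<open>\<delta>\<close> for each direction, since the distance in
        the plane is at most the sum of the coordinate distances.\<close>
      proof (intro exI[of _ "\<delta>/2"] conjI allI impI)
        fix a b assume ab: "a \<le> y \<and> y \<le> b \<and> b - a < \<delta>/2" "0 \<le> a" "b \<le> 1"
        have "lift (({x-\<delta>/2..x+\<delta>/2} \<inter> I) \<times> {a..b}) \<Gamma> A e"
        proof (rule lift_subset[OF \<delta>(2)], safe)
          fix x' y' assume x': "x' \<in> {x-\<delta>/2..x+\<delta>/2}" and y': "y' \<in> {a..b}"
          show "y' \<in> I"
            using y' ab by (simp add: I_def)
          have "dist (x, y) (x', y') \<le> \<bar>dist x x'\<bar> + \<bar>dist y y'\<bar>"
            unfolding dist_Pair_Pair by (rule sqrt_sum_squares_le_sum_abs)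
          also have "\<dots> < \<delta>"
            using x' y' ab by (auto simp: dist_real_def)
          finally show "(x', y') \<in> ball (x, y) \<delta>"
            by simp
        qed
        then show "\<exists>A e. lift (({x-\<delta>/2..x+\<delta>/2} \<inter> I) \<times> {a..b}) \<Gamma> A e"
          by blast
      qed (use \<delta> in auto)
    qed
    then show ?thesis
      by (simp add: I_def)
  qed
  have "0 \<le> (0::real) \<longrightarrow> 1 \<le> (1::real) \<longrightarrow> (\<exists>A e. lift ({0..1} \<times> I) \<Gamma> A e)"
  proof (rule Bolzano[of 0 1 "\<lambda>a b. 0 \<le> a \<longrightarrow> b \<le> 1 \<longrightarrow> (\<exists>A e. lift ({a..b} \<times> I) \<Gamma> A e)"])
    fix a b c :: real
    assume 1: "0 \<le> a \<longrightarrow> b \<le> 1 \<longrightarrow> (\<exists>A e. lift ({a..b} \<times> I) \<Gamma> A e)"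
      and 2: "0 \<le> b \<longrightarrow> c \<le> 1 \<longrightarrow> (\<exists>A e. lift ({b..c} \<times> I) \<Gamma> A e)" and abc: "a \<le> b" "b \<le> c"
    show "0 \<le> a \<longrightarrow> c \<le> 1 \<longrightarrow> (\<exists>A e. lift ({a..c} \<times> I) \<Gamma> A e)"
    proof (intro impI)
      assume ac: "0 \<le> a" "c \<le> 1"
      obtain A1 e1 A2 e2 where e: "lift ({a..b} \<times> I) \<Gamma> A1 e1" "lift ({b..c} \<times> I) \<Gamma> A2 e2"
        using 1 2 ac abc by auto
      have int: "({a..b} \<times> I) \<inter> ({b..c} \<times> I) = {b} \<times> I" "({a..b} \<times> I) \<union> ({b..c} \<times> I) = {a..c} \<times> I"
        using abc by auto
      have "\<exists>e. lift (({a..b} \<times> I) \<union> ({b..c} \<times> I)) \<Gamma> A1 e"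
        by (rule lift_union[OF _ _ _ _ P e], unfold int)
          (use ac abc in \<open>auto simp: I_def intro!: closed_Times convex_connected convex_Times\<close>)
      then show "\<exists>A e. lift ({a..c} \<times> I) \<Gamma> A e"
        unfolding int by blast
    qed
  next
    fix x :: real assume "0 \<le> x" "x \<le> 1"
    then obtain \<epsilon> A e where \<epsilon>: "\<epsilon> > 0" "lift (({x-\<epsilon>..x+\<epsilon>} \<inter> I) \<times> I) \<Gamma> A e"
      using strip[of x] by (auto simp: I_def)
    show "\<exists>d>0. \<forall>a b. a \<le> x \<and> x \<le> b \<and> b - a < d \<longrightarrow> 0 \<le> a \<longrightarrow> b \<le> 1 \<longrightarrow>
        (\<exists>A e. lift ({a..b} \<times> I) \<Gamma> A e)"
    proof (intro exI[of _ \<epsilon>] conjI allI impI)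
      fix a b assume "a \<le> x \<and> x \<le> b \<and> b - a < \<epsilon>" "0 \<le> a" "b \<le> 1"
      then have "lift ({a..b} \<times> I) \<Gamma> A e"
        by (intro lift_subset[OF \<epsilon>(2)]) (auto simp: I_def)
      then show "\<exists>A e. lift ({a..b} \<times> I) \<Gamma> A e"
        by blast
    qed (use \<epsilon> in auto)
  qed simp
  then show ?thesis
    by (simp add: I_def)
qed

end

text \<open>Parallel transport along a path, read off at the end of the lift that starts at the
  identity. It is a relation and not a function, since an arbitrary \<open>\<Gamma>\<close> need not
  have a lift.\<close>

definition holonomy ::
    "('o, 'm) cat \<Rightarrow> ('c \<Rightarrow> 'o) \<Rightarrow> ('c \<Rightarrow> real \<Rightarrow> 'm) \<Rightarrow> (real \<Rightarrow> 'c) \<Rightarrow> 'm \<Rightarrow> bool" where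
  "holonomy C ob fr \<Gamma> m \<longleftrightarrow>
    (\<exists>e. lift_of C ob fr {0..1} \<Gamma> (ob (\<Gamma> 0)) e \<and> e 0 = Idn C (ob (\<Gamma> 0)) \<and> e 1 = m)"

context framing
begin

abbreviation "hol \<equiv> holonomy C ob fr"

lemma hol_homs: "hol \<Gamma> m \<Longrightarrow> m \<in> homs C (ob (\<Gamma> 0)) (ob (\<Gamma> 1))"
  using lift_homs[of "{0..1}" \<Gamma> "ob (\<Gamma> 0)" _ 1] by (auto simp: holonomy_def)

lemma hol_of_lift:
  assumes e: "lift {0..1} \<Gamma> A e"
  shows "hol \<Gamma> (Cmp C (e 1) (inv_mor C (e 0)))"
proof -
  have e0: "e 0 \<in> homs C A (ob (\<Gamma> 0))"
    using lift_homs[OF e] by simp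
  show ?thesis
    unfolding holonomy_def
    using lift_rebase[OF e inv_mor(1)[OF gpd e0]] inv_mor(3)[OF gpd e0]
    by (intro exI[of _ "\<lambda>u. Cmp C (e u) (inv_mor C (e 0))"]) simp
qed

text \<open>By uniqueness, any lift is the normalised one precomposed with its own initial value;
  hence \<open>m\<close> transports every lift, whatever its base object.\<close>

lemma hol_lift:
  assumes P: "\<Gamma> ` {0..1} \<subseteq> P" and h: "hol \<Gamma> m" and e: "lift {0..1} \<Gamma> A e"
  shows "Cmp C m (e 0) = e 1"
proof -
  obtain e' where e': "lift {0..1} \<Gamma> (ob (\<Gamma> 0)) e'" "e' 0 = Idn C (ob (\<Gamma> 0))" "e' 1 = m"
    using h by (auto simp: holonomy_def)
  have e0: "e 0 \<in> homs C A (ob (\<Gamma> 0))"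
    using lift_homs[OF e] by simp
  have "Cmp C (e' 1) (e 0) = e 1"
    by (rule lift_unique[OF _ P lift_rebase[OF e'(1) e0] e, of 0])
      (use e'(2) comp_id[OF cat e0] in auto)
  then show ?thesis
    using e' by simp
qed

text \<open>The path is pulled back to the square, constant in the second coordinate, so that
  \<open>lift_square\<close> serves for paths as well.\<close>

lemma hol_exists:
  assumes \<Gamma>: "coherent {0..1} \<Gamma>"
  shows "\<exists>m. hol \<Gamma> m"
proof -
  have "coherent ({0..1} \<times> {0..1}) (\<lambda>p::real \<times> real. \<Gamma> (fst p))"
    by (rule coherent_compose[OF \<Gamma>]) (auto intro!: continuous_intros)
  then obtain A e where e: "lift ({0..1} \<times> {0..1}) (\<lambda>p::real \<times> real. \<Gamma> (fst p)) A e"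
    using lift_square by blast
  have "lift {0..1} (\<lambda>t::real. \<Gamma> (fst (t, 0::real))) A (\<lambda>t. e (t, 0))"
    by (rule lift_compose[OF e]) (auto intro!: continuous_intros)
  then show ?thesis
    using hol_of_lift by auto
qed

text \<open>One lift over the whole square restricts to lifts along the four sides, so both
  composites carry its value at \<open>(0, 0)\<close> to its value at \<open>(1, 1)\<close>. This is
  homotopy invariance of holonomy, with endpoints allowed to move.\<close>

lemma hol_square:
  assumes \<Gamma>: "coherent ({0..1} \<times> {0..1}) \<Gamma>"
    and m: "hol (\<lambda>t. \<Gamma> (0, t)) m0" "hol (\<lambda>t. \<Gamma> (1, t)) m1"
    and n: "hol (\<lambda>t. \<Gamma> (t, 0)) n0" "hol (\<lambda>t. \<Gamma> (t, 1)) n1"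
  shows "Cmp C m1 n0 = Cmp C n1 m0"
proof -
  obtain A e where e: "lift ({0..1} \<times> {0..1}) \<Gamma> A e"
    using lift_square[OF \<Gamma>] by blast
  have P: "\<Gamma> p \<in> P" if "p \<in> {0..1} \<times> {0..1}" for p
    using \<Gamma> that by (auto simp: coherent_def)
  have e1: "lift {0..1} (\<lambda>t. \<Gamma> (x, t)) A (\<lambda>t. e (x, t))" if "x \<in> {0..1}" for x
    by (rule lift_compose[OF e]) (use that in \<open>auto intro!: continuous_intros\<close>)
  have e2: "lift {0..1} (\<lambda>t. \<Gamma> (t, x)) A (\<lambda>t. e (t, x))" if "x \<in> {0..1}" for x
    by (rule lift_compose[OF e]) (use that in \<open>auto intro!: continuous_intros\<close>)
  have eq: "Cmp C m0 (e (0, 0)) = e (0, 1)" "Cmp C m1 (e (1, 0)) = e (1, 1)"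
    "Cmp C n0 (e (0, 0)) = e (1, 0)" "Cmp C n1 (e (0, 1)) = e (1, 1)"
    using hol_lift[OF _ m(1) e1] hol_lift[OF _ m(2) e1] hol_lift[OF _ n(1) e2] hol_lift[OF _ n(2) e2]
      P by (auto simp: image_subset_iff)
  have e00: "e (0, 0) \<in> homs C A (ob (\<Gamma> (0, 0)))"
    using lift_homs[OF e] by simp
  note h = hol_homs[OF m(1)] hol_homs[OF m(2)] hol_homs[OF n(1)] hol_homs[OF n(2)]
  have "Cmp C (Cmp C m1 n0) (e (0, 0)) = Cmp C (Cmp C n1 m0) (e (0, 0))"
    using comp_assoc[OF cat e00 h(3) h(2)] comp_assoc[OF cat e00 h(1) h(4)] eq by simp
  then show ?thesis
    by (rule comp_cancel_right[OF gpd e00 comp_in_homs[OF cat h(3,2)] comp_in_homs[OF cat h(1,4)]])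
qed

end

text \<open>A functor can only enlarge an agreement set, since it preserves the defining
  equation.\<close>

lemma near_map:
  assumes C: "framing C P ob fr" and D: "framing D Q ob' fr'" and F: "is_functor C D Fo Fm"
    and f: "f ` P \<subseteq> Q" "\<And>c. c \<in> P \<Longrightarrow> ob' (f c) = Fo (ob c)"
      "\<And>c s. c \<in> P \<Longrightarrow> s \<in> {0..<1} \<Longrightarrow> fr' (f c) s = Fm (fr c s)"
    and c: "c \<in> P" "c' \<in> P" and n: "near C ob fr r c m c'"
  shows "near D ob' fr' r (f c) (Fm m) (f c')"
proof -
  note m = framing.near_homs[OF C n]
  have sub: "agreement C fr c m c' \<subseteq> agreement D fr' (f c) (Fm m) (f c')"
  proof
    fix s assume s: "s \<in> agreement C fr c m c'"
    then have s1: "s \<in> {0..<1}"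
      by (simp add: agreement_def)
    have "Cmp D (fr' (f c') s) (Fm m) = Fm (Cmp C (fr c' s) m)"
      unfolding f(3)[OF c(2) s1] functor_comp[OF F m framing.frame_homs[OF C c(2) s1]] ..
    then show "s \<in> agreement D fr' (f c) (Fm m) (f c')"
      using s f(3)[OF c(1)] by (simp add: agreement_def)
  qed
  have "measure lborel (agreement C fr c m c') \<le> measure lborel (agreement D fr' (f c) (Fm m) (f c'))"
  proof (rule measure_mono_fmeasurable[OF sub])
    show "agreement D fr' (f c) (Fm m) (f c') \<in> fmeasurable lborel"
      by (rule fmeasurableI2[of "{0..<1}", OF _ framing.agreement_subset[OF D]
            framing.agreement_measurable[OF D]])
        (use f c in \<open>auto simp: fmeasurable_def\<close>)
  qed (rule framing.agreement_measurable[OF C c])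
  then show ?thesis
    using n functor_homs[OF F m] f(2) c by (auto simp: near_def)
qed

lemma holonomy_map:
  assumes C: "framing C P ob fr" and D: "framing D Q ob' fr'" and F: "is_functor C D Fo Fm"
    and f: "f ` P \<subseteq> Q" "\<And>c. c \<in> P \<Longrightarrow> ob' (f c) = Fo (ob c)"
      "\<And>c s. c \<in> P \<Longrightarrow> s \<in> {0..<1} \<Longrightarrow> fr' (f c) s = Fm (fr c s)"
    and P: "\<Gamma> ` {0..1} \<subseteq> P" and h: "holonomy C ob fr \<Gamma> m"
  shows "holonomy D ob' fr' (\<lambda>t. f (\<Gamma> t)) (Fm m)"
proof -
  obtain e where e: "lift_of C ob fr {0..1} \<Gamma> (ob (\<Gamma> 0)) e" "e 0 = Idn C (ob (\<Gamma> 0))" "e 1 = m"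
    using h by (auto simp: holonomy_def)
  have P': "\<Gamma> t \<in> P" if "t \<in> {0..1}" for t
    using P that by auto
  note eh = framing.lift_homs[OF C e(1)]
  have "lift_of D ob' fr' {0..1} (\<lambda>t. f (\<Gamma> t)) (Fo (ob (\<Gamma> 0))) (\<lambda>t. Fm (e t))"
    unfolding lift_of_def
  proof (intro conjI ballI)
    fix u :: real assume u: "u \<in> {0..1}"
    show "Fm (e u) \<in> homs D (Fo (ob (\<Gamma> 0))) (ob' (f (\<Gamma> u)))"
      using functor_homs[OF F eh[OF u]] f(2)[OF P'[OF u]] by simp
    obtain \<delta> where \<delta>: "\<delta> > 0" "\<And>v. v \<in> {0..1} \<Longrightarrow> dist u v < \<delta> \<Longrightarrow>
        \<exists>m. near C ob fr (2/3) (\<Gamma> u) m (\<Gamma> v) \<and> e v = Cmp C m (e u)"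
      using framing.liftD[OF C e(1) u] by metis
    have "\<exists>m. near D ob' fr' (2/3) (f (\<Gamma> u)) m (f (\<Gamma> v)) \<and> Fm (e v) = Cmp D m (Fm (e u))"
      if v: "v \<in> {0..1}" "dist u v < \<delta>" for v
    proof -
      obtain m where m: "near C ob fr (2/3) (\<Gamma> u) m (\<Gamma> v)" "e v = Cmp C m (e u)"
        using \<delta>(2)[OF v] by blast
      then show ?thesis
        using near_map[OF C D F f P'[OF u] P'[OF v(1)] m(1)]
          functor_comp[OF F eh[OF u] framing.near_homs[OF C m(1)]] by auto
    qed
    then show "\<exists>\<delta>>0. \<forall>v\<in>{0..1}. dist u v < \<delta> \<longrightarrow>
        (\<exists>m. near D ob' fr' (2/3) (f (\<Gamma> u)) m (f (\<Gamma> v)) \<and> Fm (e v) = Cmp D m (Fm (e u)))"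
      using \<delta>(1) by blast
  qed
  moreover have "Fm (e 0) = Idn D (Fo (ob (\<Gamma> 0)))"
    using functor_id[OF F framing.ob_Obj[OF C]] P' e(2) by simp
  ultimately show ?thesis
    using f(2)[OF P'] e(3) unfolding holonomy_def by (intro exI[of _ "\<lambda>t. Fm (e t)"]) simp
qed

section \<open>Realizations of simplicial sets labelled in a groupoid\<close>

definition step_index :: "(nat \<Rightarrow> real) \<Rightarrow> real \<Rightarrow> nat" where
  "step_index t s = (LEAST i. s < (\<Sum>j\<le>i. t j))"

text \<open>The intervals are half open, so an index with \<open>t i = 0\<close> owns an empty
  interval: vanishing coordinates leave no trace in the step function.\<close>

lemma step_index_eq:
  assumes t: "\<And>i. 0 \<le> t i" and i: "(\<Sum>j<i. t j) \<le> s" "s < (\<Sum>j\<le>i. t j)"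
  shows "step_index t s = i"
  unfolding step_index_def
proof (rule Least_equality)
  show "s < (\<Sum>j\<le>i. t j)"
    by fact
  fix i' assume i': "s < (\<Sum>j\<le>i'. t j)"
  show "i \<le> i'"
  proof (rule ccontr)
    assume "\<not> i \<le> i'"
    then have "(\<Sum>j\<le>i'. t j) \<le> (\<Sum>j<i. t j)"
      by (intro sum_mono2) (use t in auto)
    with i i' show False
      by simp
  qed
qed

lemma step_index:
  assumes t: "t \<in> standard_simplex k" and s: "s \<in> {0..<1}"
  shows "step_index t s \<le> k" "(\<Sum>j<step_index t s. t j) \<le> s" "s < (\<Sum>j\<le>step_index t s. t j)"
proof -
  have k: "s < (\<Sum>j\<le>k. t j)"
    using t s by (auto simp: standard_simplex_def)
  show "step_index t s \<le> k"
    unfolding step_index_def using k by (rule Least_le)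
  show "s < (\<Sum>j\<le>step_index t s. t j)"
    unfolding step_index_def using k by (rule LeastI)
  show "(\<Sum>j<step_index t s. t j) \<le> s"
  proof (cases "step_index t s")
    case (Suc i)
    then have "\<not> s < (\<Sum>j\<le>i. t j)"
      unfolding step_index_def using not_less_Least by (metis lessI)
    then show ?thesis
      by (simp add: Suc lessThan_Suc_atMost)
  qed (use s in simp)
qed

lemma simplex_push_in_simplex:
  assumes \<alpha>: "\<alpha> \<in> \<Delta> k l" and t: "t \<in> standard_simplex k"
  shows "simplex_push k \<alpha> t \<in> standard_simplex l"
proof -
  have t0: "\<And>i. 0 \<le> t i" and t1: "(\<Sum>i\<le>k. t i) = 1"
    using t by (auto simp: standard_simplex_def)
  have a: "\<alpha> i \<le> l" if "i \<le> k" for i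
    using \<alpha> that by (auto simp: Delta_def)
  have "(\<Sum>j\<le>l. simplex_push k \<alpha> t j) = (\<Sum>j\<le>l. \<Sum>i | i \<in> {..k} \<and> \<alpha> i = j. t i)"
    by (simp add: simplex_push_def)
  also have "\<dots> = (\<Sum>i\<le>k. t i)"
    by (rule sum.group) (use a in auto)
  finally have 1: "(\<Sum>j\<le>l. simplex_push k \<alpha> t j) = 1"
    using t1 by simp
  have 0: "0 \<le> simplex_push k \<alpha> t j" for j
    by (auto simp: simplex_push_def intro!: sum_nonneg t0)
  have z: "simplex_push k \<alpha> t j = 0" if "j > l" for j
    unfolding simplex_push_def using a that by (intro sum.neutral) fastforce
  have "simplex_push k \<alpha> t j \<le> 1" for j
  proof (cases "j \<le> l")
    case True
    then show ?thesis
      using member_le_sum[of j "{..l}" "simplex_push k \<alpha> t"] 0 1 by simp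
  qed (use z in simp)
  then show ?thesis
    using 0 1 z by (simp add: standard_simplex_def)
qed

text \<open>As \<open>\<alpha>\<close> is monotone, the interval of \<open>j\<close> for the pushed
  point is the concatenation of the intervals of the indices in the fibre over \<open>j\<close>; so
  the interval of \<open>i\<close> lies in that of \<open>\<alpha> i\<close>.\<close>

lemma step_index_push:
  assumes \<alpha>: "\<alpha> \<in> \<Delta> k l" and t: "t \<in> standard_simplex k" and s: "s \<in> {0..<1}"
  shows "step_index (simplex_push k \<alpha> t) s = \<alpha> (step_index t s)"
proof -
  define i where "i = step_index t s"
  note i = step_index[OF t s, folded i_def]
  have t0: "\<And>i. 0 \<le> t i"
    using t by (auto simp: standard_simplex_def)
  have mono: "\<alpha> p \<le> \<alpha> q" if "p \<le> q" "q \<le> k" for p q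
    using \<alpha> that by (auto simp: Delta_def mono_on_def)
  have sum: "(\<Sum>j\<in>J. simplex_push k \<alpha> t j) = (\<Sum>i | i \<in> {..k} \<and> \<alpha> i \<in> J. t i)" if "finite J" for J
  proof -
    have "(\<Sum>j\<in>J. simplex_push k \<alpha> t j) = (\<Sum>j\<in>J. sum t {i \<in> {i. i \<in> {..k} \<and> \<alpha> i \<in> J}. \<alpha> i = j})"
      unfolding simplex_push_def by (intro sum.cong refl) auto
    also have "\<dots> = (\<Sum>i | i \<in> {..k} \<and> \<alpha> i \<in> J. t i)"
      by (rule sum.group) (use that in auto)
    finally show ?thesis .
  qed
  show ?thesis
    unfolding i_def[symmetric]
  proof (rule step_index_eq)
    show "0 \<le> simplex_push k \<alpha> t j" for j
      by (auto simp: simplex_push_def intro!: sum_nonneg t0)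
    have "(\<Sum>j<\<alpha> i. simplex_push k \<alpha> t j) \<le> (\<Sum>j<i. t j)"
      unfolding sum[OF finite_lessThan]
    proof (rule sum_mono2)
      show "{j. j \<in> {..k} \<and> \<alpha> j \<in> {..<\<alpha> i}} \<subseteq> {..<i}"
        using mono[of i] by (auto simp: not_less[symmetric])
    qed (use t0 in auto)
    then show "(\<Sum>j<\<alpha> i. simplex_push k \<alpha> t j) \<le> s"
      using i by simp
    have "(\<Sum>j\<le>i. t j) \<le> (\<Sum>j\<le>\<alpha> i. simplex_push k \<alpha> t j)"
      unfolding sum[OF finite_atMost]
      by (rule sum_mono2) (use t0 mono i in auto)
    then show "s < (\<Sum>j\<le>\<alpha> i. simplex_push k \<alpha> t j)"
      using i by simp
  qed
qed

section \<open>Cells and their classes in the realization\<close>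

lemma topspace_cells:
  "topspace (cells X) = {(k, x, t). x \<in> simps X k \<and> t \<in> standard_simplex k}"
  by (auto simp: cells_def topspace_sum_topology topspace_prod_topology)

lemma topspace_realization: "topspace (realization X) = topspace (cells X) // glue_eq X"
proof -
  have "\<Union>(topspace (cells X) // glue_eq X) = topspace (cells X)"
    by (rule Union_quotient[OF equiv_glue_eq])
  then have "openin (realization X) (topspace (cells X) // glue_eq X)"
    by (simp add: openin_realization)
  then show ?thesis
    by (meson openin_realization openin_subset openin_topspace subset_antisym)
qed

definition cell_class :: "'a sset \<Rightarrow> nat \<times> 'a \<times> (nat \<Rightarrow> real) \<Rightarrow> (nat \<times> 'a \<times> (nat \<Rightarrow> real)) set" where
  "cell_class X c = glue_eq X `` {c}"

lemma cell_class_refl: "c \<in> topspace (cells X) \<Longrightarrow> c \<in> cell_class X c"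
  using equiv_glue_eq[of X] by (auto simp: cell_class_def equiv_def refl_on_def)

lemma cell_class_eq: "(c, c') \<in> glue_eq X \<Longrightarrow> cell_class X c = cell_class X c'"
  unfolding cell_class_def by (rule equiv_class_eq[OF equiv_glue_eq])

lemma cell_class_cases:
  assumes "p \<in> topspace (realization X)"
  obtains c where "c \<in> topspace (cells X)" "cell_class X c = p"
  using assms unfolding topspace_realization cell_class_def by (auto elim: quotientE)

lemma continuous_map_cell_class: "continuous_map (cells X) (realization X) (cell_class X)"
  unfolding continuous_map_def
proof (intro conjI allI impI)
  show "cell_class X \<in> topspace (cells X) \<rightarrow> topspace (realization X)"
    by (auto simp: topspace_realization cell_class_def intro: quotientI)
  fix U assume U: "openin (realization X) U"
  then have sub: "U \<subseteq> topspace (cells X) // glue_eq X" and op: "openin (cells X) (\<Union>U)"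
    by (simp_all add: openin_realization)
  have "{c \<in> topspace (cells X). cell_class X c \<in> U} = \<Union>U"
  proof (intro equalityI subsetI)
    fix c assume "c \<in> {c \<in> topspace (cells X). cell_class X c \<in> U}"
    then show "c \<in> \<Union>U"
      using cell_class_refl by blast
  next
    fix c assume "c \<in> \<Union>U"
    then obtain p where p: "p \<in> U" "c \<in> p"
      by blast
    then obtain c' where c': "c' \<in> topspace (cells X)" "p = glue_eq X `` {c'}"
      using sub by (blast elim: quotientE)
    have "(c', c) \<in> glue_eq X"
      using c' p by simp
    then have "c \<in> topspace (cells X)" "cell_class X c = p"
      using cell_class_eq[of c' c X] c'(2) by (auto simp: glue_eq_def cell_class_def)
    then show "c \<in> {c \<in> topspace (cells X). cell_class X c \<in> U}"
      using p by simp
  qed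
  then show "openin (cells X) {c \<in> topspace (cells X). cell_class X c \<in> U}"
    using op by simp
qed

text \<open>The cut measure is 1-Lipschitz in the cut point, since the part of \<open>B\<close>
  between two cuts has measure at most their distance.\<close>

lemma continuous_measure_cut:
  fixes B :: "real set"
  assumes B: "B \<in> sets lborel" "B \<subseteq> {0..<1}"
  shows "continuous_on UNIV (\<lambda>y. measure lborel (B \<inter> {..<y}))"
    and "p \<le> q \<Longrightarrow> measure lborel (B \<inter> {p..<q}) = measure lborel (B \<inter> {..<q}) - measure lborel (B \<inter> {..<p})"
proof -
  have fin: "E \<in> fmeasurable lborel" if "E \<in> sets lborel" "E \<subseteq> {0..<1}" for E :: "real set"
  proof (rule fmeasurableI2)
    show "{0..<1::real} \<in> fmeasurable lborel"
      by (simp add: fmeasurable_def)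
  qed (use that in auto)
  have diff: "measure lborel (B \<inter> {p..<q}) = measure lborel (B \<inter> {..<q}) - measure lborel (B \<inter> {..<p})"
    if "p \<le> q" for p q
  proof -
    have "B \<inter> {p..<q} = (B \<inter> {..<q}) - (B \<inter> {..<p})"
      using that by auto
    then show ?thesis
      using that by (simp only:) (intro measurable_measure_Diff fin, use B in auto)
  qed
  then show "p \<le> q \<Longrightarrow> measure lborel (B \<inter> {p..<q}) = measure lborel (B \<inter> {..<q}) - measure lborel (B \<inter> {..<p})" .
  have le: "measure lborel (B \<inter> {p..<q}) \<le> q - p" if "p \<le> q" for p q
  proof -
    have "measure lborel (B \<inter> {p..<q}) \<le> measure lborel {p..<q}"
      by (rule measure_mono_fmeasurable) (use B that in \<open>auto simp: fmeasurable_def\<close>)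
    then show ?thesis
      using that by simp
  qed
  have nn: "0 \<le> measure lborel (B \<inter> {p..<q})" for p q
    by simp
  have lip: "\<bar>measure lborel (B \<inter> {..<q}) - measure lborel (B \<inter> {..<p})\<bar> \<le> \<bar>q - p\<bar>" for p q
    using diff[of p q] diff[of q p] le[of p q] le[of q p] nn[of p q] nn[of q p] by linarith
  show "continuous_on UNIV (\<lambda>y. measure lborel (B \<inter> {..<y}))"
    unfolding continuous_on_iff dist_real_def using lip by (meson order_le_less_trans)
qed

section \<open>The framing of cells by labels in a groupoid\<close>

definition cell_ob :: "(nat \<Rightarrow> 'a \<Rightarrow> (nat \<Rightarrow> 'o) \<times> (nat \<times> nat \<Rightarrow> 'm)) \<Rightarrow> nat \<times> 'a \<times> (nat \<Rightarrow> real) \<Rightarrow> 'o" where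
  "cell_ob L = (\<lambda>(k, x, t). fst (L k x) 0)"

text \<open>All values start at the label of vertex 0, even if \<open>t 0 = 0\<close>. This
  dependence on the representing cell is the reason why cells are compared only up to a change of
  base.\<close>

definition cell_frame ::
    "(nat \<Rightarrow> 'a \<Rightarrow> (nat \<Rightarrow> 'o) \<times> (nat \<times> nat \<Rightarrow> 'm)) \<Rightarrow> nat \<times> 'a \<times> (nat \<Rightarrow> real) \<Rightarrow> real \<Rightarrow> 'm" where
  "cell_frame L = (\<lambda>(k, x, t) s. snd (L k x) (0, step_index t s))"

text \<open>A simplicial map to the nerve is enough, it need not be an isomorphism. This covers the
  fiber products in the stability condition, whose simplices are pairs of simplices and not
  functors.\<close>

locale labelled_sset =
  fixes X :: "'a sset" and G :: "('o, 'm) cat"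
    and L :: "nat \<Rightarrow> 'a \<Rightarrow> (nat \<Rightarrow> 'o) \<times> (nat \<times> nat \<Rightarrow> 'm)"
  assumes sset: "simplicial_set X" and grp: "groupoid G" and label: "simplicial_map X (nerve G) L"
begin

abbreviation "ob \<equiv> cell_ob L"
abbreviation "fr \<equiv> cell_frame L"

lemma label_functor:
  assumes "x \<in> simps X k"
  shows "is_functor (ordcat k) G (fst (L k x)) (snd (L k x))"
proof -
  have "L k x \<in> simps (nerve G) k"
    using assms label by (auto simp: simplicial_map_def)
  then show ?thesis
    by (auto simp: nerve_def)
qed

lemma label_homs:
  assumes "x \<in> simps X k" "i \<le> j" "j \<le> k"
  shows "snd (L k x) (i, j) \<in> homs G (fst (L k x) i) (fst (L k x) j)"
  using functor_homs[OF label_functor[OF assms(1)], of "(i, j)" i j] assms(2,3)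
  by (simp add: homs_def ordcat_def)

lemma label_id:
  assumes "x \<in> simps X k" "i \<le> k"
  shows "snd (L k x) (i, i) = Idn G (fst (L k x) i)"
  using functor_id[OF label_functor[OF assms(1)], of i] assms(2) by (simp add: ordcat_def)

lemma label_comp:
  assumes "x \<in> simps X k" "h \<le> i" "i \<le> j" "j \<le> k"
  shows "Cmp G (snd (L k x) (i, j)) (snd (L k x) (h, i)) = snd (L k x) (h, j)"
  using functor_comp[OF label_functor[OF assms(1)], of "(h, i)" h i "(i, j)" j] assms(2-)
  by (simp add: homs_def ordcat_def)

lemma label_act:
  assumes "x \<in> simps X l" "\<alpha> \<in> \<Delta> k l"
  shows "i \<le> k \<Longrightarrow> fst (L k (sact X k l \<alpha> x)) i = fst (L l x) (\<alpha> i)"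
    and "i \<le> j \<Longrightarrow> j \<le> k \<Longrightarrow> snd (L k (sact X k l \<alpha> x)) (i, j) = snd (L l x) (\<alpha> i, \<alpha> j)"
proof -
  have "L k (sact X k l \<alpha> x) = sact (nerve G) k l \<alpha> (L l x)"
    using label assms by (simp add: simplicial_map_def)
  then show "i \<le> k \<Longrightarrow> fst (L k (sact X k l \<alpha> x)) i = fst (L l x) (\<alpha> i)"
    and "i \<le> j \<Longrightarrow> j \<le> k \<Longrightarrow> snd (L k (sact X k l \<alpha> x)) (i, j) = snd (L l x) (\<alpha> i, \<alpha> j)"
    by (simp_all add: nerve_def ordcat_def split_beta)
qed

lemma framing: "framing G (topspace (cells X)) ob fr"
proof (unfold_locales, rule grp)
  fix c :: "nat \<times> 'a \<times> (nat \<Rightarrow> real)"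
  assume "c \<in> topspace (cells X)"
  then obtain k x t where c: "c = (k, x, t)" and x: "x \<in> simps X k" and t: "t \<in> standard_simplex k"
    by (auto simp: topspace_cells)
  show "fr c s \<in> Mor G \<and> Dom G (fr c s) = ob c" if s: "s \<in> {0..<1}" for s
    using label_homs[OF x le0 step_index(1)[OF t s]] by (simp add: c cell_ob_def cell_frame_def homs_def)
  have "fr c ` {0..<1} \<subseteq> (\<lambda>i. snd (L k x) (0, i)) ` {..k}"
    using step_index(1)[OF t] by (auto simp: c cell_frame_def)
  then show "finite (fr c ` {0..<1})"
    by (rule finite_subset) simp
  have idx: "step_index t s = i \<longleftrightarrow> s \<in> {(\<Sum>j<i. t j)..<(\<Sum>j\<le>i. t j)}" if "s \<in> {0..<1}" for s i
    using step_index(2,3)[OF t that] step_index_eq[of t i s] t by (auto simp: standard_simplex_def)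
  show "{s \<in> {0..<1}. fr c s = z} \<in> sets lborel" for z
  proof -
    have "{s \<in> {0..<1}. fr c s = z} =
      (\<Union>i\<in>{i. i \<le> k \<and> snd (L k x) (0, i) = z}. {0..<1} \<inter> {(\<Sum>j<i. t j)..<(\<Sum>j\<le>i. t j)})"
    proof (intro equalityI subsetI)
      fix s assume s: "s \<in> {s \<in> {0..<1}. fr c s = z}"
      then show "s \<in> (\<Union>i\<in>{i. i \<le> k \<and> snd (L k x) (0, i) = z}. {0..<1} \<inter> {(\<Sum>j<i. t j)..<(\<Sum>j\<le>i. t j)})"
        using step_index[OF t, of s] by (auto simp: c cell_frame_def intro!: exI[of _ "step_index t s"])
    next
      fix s assume "s \<in> (\<Union>i\<in>{i. i \<le> k \<and> snd (L k x) (0, i) = z}. {0..<1} \<inter> {(\<Sum>j<i. t j)..<(\<Sum>j\<le>i. t j)})"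
      then obtain i where i: "s \<in> {0..<1}" "snd (L k x) (0, i) = z" "s \<in> {(\<Sum>j<i. t j)..<(\<Sum>j\<le>i. t j)}"
        by blast
      then have "step_index t s = i"
        using idx by blast
      then show "s \<in> {s \<in> {0..<1}. fr c s = z}"
        using i by (simp add: c cell_frame_def)
    qed
    then show ?thesis
      by simp
  qed
qed

sublocale fram: framing G "topspace (cells X)" ob fr
  by (rule framing)

text \<open>One change of base whose agreement set has full measure. The form with all
  \<open>r < 1\<close> lets it be composed with \<open>near\<close> directly.\<close>

definition same_frame :: "nat \<times> 'a \<times> (nat \<Rightarrow> real) \<Rightarrow> nat \<times> 'a \<times> (nat \<Rightarrow> real) \<Rightarrow> bool" where
  "same_frame c c' \<longleftrightarrow> c \<in> topspace (cells X) \<and> c' \<in> topspace (cells X) \<and>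
    (\<exists>m. \<forall>r<1. near G ob fr r c m c')"

lemma same_frame_sym: "same_frame c c' \<Longrightarrow> same_frame c' c"
  unfolding same_frame_def using fram.near_sym by blast

lemma near_same_frame:
  assumes c: "c \<in> topspace (cells X)" and n: "near G ob fr r c m c'" and s: "same_frame c' c''"
  shows "\<exists>m'. near G ob fr r c m' c''"
proof -
  define w where "w = measure lborel (agreement G fr c m c')"
  have w: "r < w" "near G ob fr ((r + w) / 2) c m c'"
    using n by (auto simp: near_def w_def)
  obtain m' where "\<forall>r<1. near G ob fr r c' m' c''"
    using s by (auto simp: same_frame_def)
  \<comment> \<open>The slack \<open>w - r\<close> is shared between the two factors, so that the
    thresholds add up to exactly \<open>r + 1\<close>.\<close>
  then have "near G ob fr (1 - (w - r) / 2) c' m' c''"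
    using w(1) by simp
  from fram.near_trans[OF c _ _ w(2) this] s
  have "near G ob fr ((r + w) / 2 + (1 - (w - r) / 2) - 1) c (Cmp G m' m) c''"
    by (simp add: same_frame_def)
  moreover have "(r + w) / 2 + (1 - (w - r) / 2) - 1 = r"
    by (simp add: field_simps)
  ultimately show ?thesis
    by auto
qed

lemma same_frame_trans:
  assumes "same_frame c c'" "same_frame c' c''"
  shows "same_frame c c''"
proof -
  note c = assms[unfolded same_frame_def]
  obtain m m' where m: "\<forall>r<1. near G ob fr r c m c'" "\<forall>r<1. near G ob fr r c' m' c''"
    using c by blast
  have "near G ob fr r c (Cmp G m' m) c''" if "r < 1" for r
    using fram.near_trans[of c c' c'' "(1 + r)/2" m "(1 + r)/2" m'] m c that by simp
  then show ?thesis
    using c by (auto simp: same_frame_def)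
qed

text \<open>The label morphism from vertex \<open>0\<close> to vertex \<open>\<alpha> 0\<close> of
  \<open>x\<close> changes the base: \<open>step_index_push\<close> matches the steps, and
  functoriality of the label makes the frames agree everywhere. It leads from \<open>c'\<close> to
  \<open>c\<close>; invertibility in \<open>G\<close> gives the other direction.\<close>

lemma glue_same_frame:
  assumes "(c, c') \<in> glue X"
  shows "same_frame c c'"
proof -
  obtain k l \<alpha> x t where cc: "c = (k, sact X k l \<alpha> x, t)" "c' = (l, x, simplex_push k \<alpha> t)"
    and \<alpha>: "\<alpha> \<in> \<Delta> k l" and x: "x \<in> simps X l" and t: "t \<in> standard_simplex k"
    using assms by (auto simp: glue_def)
  have P: "c \<in> topspace (cells X)" "c' \<in> topspace (cells X)"
    using sset \<alpha> x t simplex_push_in_simplex[OF \<alpha> t]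
    by (auto simp: cc topspace_cells simplicial_set_def)
  have a: "\<alpha> i \<le> \<alpha> j" "\<alpha> j \<le> l" if "i \<le> j" "j \<le> k" for i j
    using \<alpha> that by (auto simp: Delta_def mono_on_def)
  have "near G ob fr r c' (snd (L l x) (0, \<alpha> 0)) c" if r: "r < 1" for r
  proof (rule fram.near_total[OF _ r])
    show "snd (L l x) (0, \<alpha> 0) \<in> homs G (ob c') (ob c)"
      using label_homs[OF x le0 a(2)[of 0 0]] label_act(1)[OF x \<alpha>, of 0] by (simp add: cc cell_ob_def)
    fix s :: real assume s: "s \<in> {0..<1}"
    note i = step_index[OF t s]
    show "Cmp G (fr c s) (snd (L l x) (0, \<alpha> 0)) = fr c' s"
      using label_act(2)[OF x \<alpha> le0 i(1)] label_comp[OF x le0 a[OF le0 i(1)]]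
      by (simp add: cc cell_frame_def step_index_push[OF \<alpha> t s])
  qed
  then have "same_frame c' c"
    using P by (auto simp: same_frame_def)
  then show ?thesis
    by (rule same_frame_sym)
qed

lemma glue_eq_same_frame:
  assumes "(c, c') \<in> glue_eq X"
  shows "same_frame c c'"
proof -
  have c: "c \<in> topspace (cells X)" and r: "(c, c') \<in> (glue X \<union> (glue X)\<inverse>)\<^sup>*"
    using assms by (auto simp: glue_eq_def)
  from r show ?thesis
  proof (induction rule: rtrancl_induct)
    case base
    show ?case
      using c fram.near_refl[OF c] by (auto simp: same_frame_def)
  next
    case (step y z)
    then show ?case
      using glue_same_frame same_frame_sym same_frame_trans by blast
  qed
qed

lemma continuous_map_partial_sum:
  "continuous_map (subtopology (powertop_real UNIV) S) euclideanreal (\<lambda>t. \<Sum>i\<in>I. t i)"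
  if "finite I" for I :: "nat set"
  by (intro continuous_map_from_subtopology continuous_map_sum that continuous_map_product_projection) auto

text \<open>With \<open>x\<close> and \<open>m\<close> fixed, the agreement measure is a finite sum
  of differences of cut measures at the partial sums of \<open>t\<close>, hence continuous in
  \<open>t\<close>, and a strict lower bound is an open condition. \<open>m\<close> can stay fixed
  because the base of \<open>(k, x, t)\<close> does not depend on \<open>t\<close>.\<close>

lemma openin_near_cells:
  assumes c: "c \<in> topspace (cells X)"
  shows "openin (cells X) {c' \<in> topspace (cells X). \<exists>m. near G ob fr r c m c'}" (is "openin _ ?V")
proof -
  have "openin (prod_topology (discrete_topology (simps X k))
          (subtopology (powertop_real UNIV) (standard_simplex k))) {p. (k, p) \<in> ?V}" for k
    unfolding openin_prod_topology_alt
  proof (intro allI impI)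
    fix x t assume "(x, t) \<in> {p. (k, p) \<in> ?V}"
    then obtain m where x: "x \<in> simps X k" and t: "t \<in> standard_simplex k"
      and m: "near G ob fr r c m (k, x, t)"
      by (auto simp: topspace_cells)
    define T where "T = subtopology (powertop_real UNIV) (standard_simplex k)"
    have topT: "topspace T = standard_simplex k"
      by (simp add: T_def)
    \<comment> \<open>The parameters at which vertex \<open>j\<close>, rebased by \<open>m\<close>,
      gives the right value. These sets do not depend on \<open>t\<close>, which enters only through
      the interval on which vertex \<open>j\<close> is attained.\<close>
    define B where "B j = {s \<in> {0..<1}. Cmp G (snd (L k x) (0, j)) m = fr c s}" for j
    have B: "B j \<in> sets lborel" "B j \<subseteq> {0..<1}" for j
      using fram.measurable_frame[OF c, of "Cmp G (snd (L k x) (0, j)) m"]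
      by (auto simp: B_def eq_commute)
    define F where "F j y = measure lborel (B j \<inter> {..<y})" for j y
    have meas: "measure lborel (agreement G fr c m (k, x, t')) =
        (\<Sum>j\<le>k. F j (\<Sum>i\<le>j. t' i) - F j (\<Sum>i<j. t' i))" if t': "t' \<in> standard_simplex k" for t'
    proof -
      have t0: "\<And>i. 0 \<le> t' i"
        using t' by (auto simp: standard_simplex_def)
      have ag: "agreement G fr c m (k, x, t') = (\<Union>j\<in>{..k}. B j \<inter> {(\<Sum>i<j. t' i)..<(\<Sum>i\<le>j. t' i)})"
      proof (intro equalityI subsetI)
        fix s assume "s \<in> agreement G fr c m (k, x, t')"
        then show "s \<in> (\<Union>j\<in>{..k}. B j \<inter> {(\<Sum>i<j. t' i)..<(\<Sum>i\<le>j. t' i)})"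
          using step_index[OF t', of s]
          by (auto simp: agreement_def B_def cell_frame_def intro!: bexI[of _ "step_index t' s"])
      next
        fix s assume "s \<in> (\<Union>j\<in>{..k}. B j \<inter> {(\<Sum>i<j. t' i)..<(\<Sum>i\<le>j. t' i)})"
        then obtain j where "s \<in> B j" "(\<Sum>i<j. t' i) \<le> s" "s < (\<Sum>i\<le>j. t' i)"
          by auto
        then show "s \<in> agreement G fr c m (k, x, t')"
          using step_index_eq[OF t0, where i=j and s=s] by (simp add: agreement_def B_def cell_frame_def)
      qed
      have disj: "disjoint_family_on (\<lambda>j. B j \<inter> {(\<Sum>i<j. t' i)..<(\<Sum>i\<le>j. t' i)}) {..k}"
        unfolding disjoint_family_on_def
      proof (intro ballI impI, rule ccontr)
        fix p q assume "p \<noteq> q"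
          and "(B p \<inter> {(\<Sum>i<p. t' i)..<(\<Sum>i\<le>p. t' i)}) \<inter> (B q \<inter> {(\<Sum>i<q. t' i)..<(\<Sum>i\<le>q. t' i)}) \<noteq> {}"
        then obtain s where "(\<Sum>i<p. t' i) \<le> s" "s < (\<Sum>i\<le>p. t' i)" "(\<Sum>i<q. t' i) \<le> s" "s < (\<Sum>i\<le>q. t' i)"
          by auto
        then have "step_index t' s = p" "step_index t' s = q"
          by (auto intro: step_index_eq[OF t0])
        with \<open>p \<noteq> q\<close> show False
          by simp
      qed
      have fin: "emeasure lborel (B j \<inter> {(\<Sum>i<j. t' i)..<(\<Sum>i\<le>j. t' i)}) \<noteq> \<infinity>" for j
      proof -
        have "emeasure lborel (B j \<inter> {(\<Sum>i<j. t' i)..<(\<Sum>i\<le>j. t' i)}) \<le> emeasure lborel {0..<1::real}"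
          by (rule emeasure_mono) (use B(2) in auto)
        then show ?thesis
          by (auto simp: top_unique)
      qed
      have "measure lborel (agreement G fr c m (k, x, t')) =
          (\<Sum>j\<le>k. measure lborel (B j \<inter> {(\<Sum>i<j. t' i)..<(\<Sum>i\<le>j. t' i)}))"
        unfolding ag
        by (rule measure_finite_Union) (use disj fin B in auto)
      also have "\<dots> = (\<Sum>j\<le>k. F j (\<Sum>i\<le>j. t' i) - F j (\<Sum>i<j. t' i))"
        unfolding F_def
        by (intro sum.cong refl continuous_measure_cut(2) B)
          (use t0 in \<open>auto intro!: sum_mono2\<close>)
      finally show ?thesis .
    qed
    have Fc: "continuous_map euclideanreal euclideanreal (F j)" for j
      unfolding F_def using continuous_measure_cut(1)[OF B] by (simp add: continuous_map_iff_continuous2)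
    have "continuous_map T euclideanreal (\<lambda>t'. \<Sum>j\<le>k. F j (\<Sum>i\<le>j. t' i) - F j (\<Sum>i<j. t' i))"
      unfolding T_def
      by (intro continuous_map_sum continuous_map_diff
          continuous_map_compose[OF continuous_map_partial_sum Fc, unfolded o_def]) auto
    then have cont: "continuous_map T euclideanreal (\<lambda>t'. measure lborel (agreement G fr c m (k, x, t')))"
      by (rule continuous_map_eq) (simp add: topT meas)
    define W where "W = {t' \<in> topspace T. measure lborel (agreement G fr c m (k, x, t')) \<in> {r<..}}"
    have "openin T W"
      unfolding W_def by (rule openin_continuous_map_preimage[OF cont]) simp
    moreover have "t \<in> W"
      using m t by (simp add: W_def topT near_def)
    moreover have "{x} \<times> W \<subseteq> {p. (k, p) \<in> ?V}"
      using m x by (auto simp: W_def topT topspace_cells near_def cell_ob_def)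
    ultimately show "\<exists>U V. openin (discrete_topology (simps X k)) U \<and>
        openin (subtopology (powertop_real UNIV) (standard_simplex k)) V \<and>
        x \<in> U \<and> t \<in> V \<and> U \<times> V \<subseteq> {p. (k, p) \<in> ?V}"
      using x unfolding T_def[symmetric] by (intro exI[of _ "{x}"] exI[of _ W]) auto
  qed
  moreover have "?V \<subseteq> (SIGMA k:UNIV. topspace (prod_topology (discrete_topology (simps X k))
          (subtopology (powertop_real UNIV) (standard_simplex k))))"
    by (auto simp: topspace_cells)
  ultimately show ?thesis
    unfolding cells_def openin_sum_topology by (simp add: cells_def o_def)
qed

text \<open>By \<open>near_same_frame\<close> the set of near cells is saturated for the gluing
  relation, so its openness descends to the quotient.\<close>

lemma openin_near:
  fixes r :: real
  assumes c: "c \<in> topspace (cells X)"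
  defines "V \<equiv> {c' \<in> topspace (cells X). \<exists>m. near G ob fr r c m c'}"
  shows "openin (realization X) (cell_class X ` V)" "\<Union>(cell_class X ` V) = V"
proof -
  show U: "\<Union>(cell_class X ` V) = V"
  proof (intro equalityI subsetI)
    fix c'' assume "c'' \<in> \<Union>(cell_class X ` V)"
    then obtain c' where c': "c' \<in> V" "(c', c'') \<in> glue_eq X"
      by (auto simp: cell_class_def)
    then show "c'' \<in> V"
      using near_same_frame[OF c _ glue_eq_same_frame[OF c'(2)]] by (auto simp: V_def glue_eq_def)
  next
    fix c' assume "c' \<in> V"
    moreover from this have "c' \<in> cell_class X c'"
      by (intro cell_class_refl) (simp add: V_def)
    ultimately show "c' \<in> \<Union>(cell_class X ` V)"
      by blast
  qed
  show "openin (realization X) (cell_class X ` V)"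
    unfolding openin_realization U
    using openin_near_cells[OF c] by (auto simp: V_def cell_class_def intro: quotientI)
qed

text \<open>The bridge from topology to lifts: over a continuous map the cells may be chosen at
  will, because nearness to a fixed cell is an open condition on points of the realization.\<close>

lemma coherent_lift_choice:
  assumes p: "continuous_map (top_of_set S) (realization X) p"
    and \<Gamma>: "\<And>u. u \<in> S \<Longrightarrow> \<Gamma> u \<in> topspace (cells X) \<and> cell_class X (\<Gamma> u) = p u"
  shows "fram.coherent S \<Gamma>"
  unfolding fram.coherent_def
proof (intro conjI ballI allI impI)
  show "\<Gamma> ` S \<subseteq> topspace (cells X)"
    using \<Gamma> by blast
  fix u and r :: real assume u: "u \<in> S" and r: "r < 1"
  define V where "V = {c' \<in> topspace (cells X). \<exists>m. near G ob fr r (\<Gamma> u) m c'}"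
  have gu: "\<Gamma> u \<in> topspace (cells X)"
    using \<Gamma> u by blast
  note V = openin_near[OF gu, of r, folded V_def]
  have "\<Gamma> u \<in> V"
    using gu fram.near_refl[OF gu r] by (auto simp: V_def)
  then have "p u \<in> cell_class X ` V"
    using \<Gamma>[OF u] by blast
  moreover have "openin (top_of_set S) {v \<in> S. p v \<in> cell_class X ` V}"
    using openin_continuous_map_preimage[OF p V(1)] by simp
  ultimately obtain \<delta> where \<delta>: "\<delta> > 0" "ball u \<delta> \<inter> S \<subseteq> {v \<in> S. p v \<in> cell_class X ` V}"
    using u unfolding openin_contains_ball by blast
  have "\<exists>m. near G ob fr r (\<Gamma> u) m (\<Gamma> v)" if v: "v \<in> S" "dist u v < \<delta>" for v
  proof -
    have "p v \<in> cell_class X ` V"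
      using \<delta>(2) v by auto
    moreover have "\<Gamma> v \<in> p v"
      using \<Gamma>[OF v(1)] cell_class_refl by blast
    ultimately have "\<Gamma> v \<in> V"
      using V(2) by blast
    then show ?thesis
      by (simp add: V_def)
  qed
  then show "\<exists>\<delta>>0. \<forall>v\<in>S. dist u v < \<delta> \<longrightarrow> (\<exists>m. near G ob fr r (\<Gamma> u) m (\<Gamma> v))"
    using \<delta>(1) by blast
qed

end

section \<open>Vertices and edges as points and paths of the realization\<close>

definition vertex_cell :: "'a \<Rightarrow> nat \<times> 'a \<times> (nat \<Rightarrow> real)" where
  "vertex_cell x = (0, x, \<lambda>j. if j = 0 then 1 else 0)"

definition edge_cell :: "'a \<Rightarrow> real \<Rightarrow> nat \<times> 'a \<times> (nat \<Rightarrow> real)" where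
  "edge_cell a u = (1, a, \<lambda>j. if j = 0 then 1 - u else if j = 1 then u else 0)"

definition edge_vertex :: "'a sset \<Rightarrow> nat \<Rightarrow> 'a \<Rightarrow> 'a" where
  "edge_vertex X i = sact X 0 1 (Delta_vertex i)"

lemma Delta_vertex_in: "i \<le> k \<Longrightarrow> Delta_vertex i \<in> \<Delta> 0 k"
  by (auto simp: Delta_def Delta_vertex_def mono_on_def)

lemma edge_vertex_in: "simplicial_set X \<Longrightarrow> a \<in> simps X 1 \<Longrightarrow> i \<le> 1 \<Longrightarrow> edge_vertex X i a \<in> simps X 0"
  unfolding edge_vertex_def using Delta_vertex_in[of i 1] by (auto simp: simplicial_set_def)

lemma vertex_cell_in: "x \<in> simps X 0 \<Longrightarrow> vertex_cell x \<in> topspace (cells X)"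
  by (simp add: topspace_cells vertex_cell_def basis_in_standard_simplex)

lemma edge_simplex:
  assumes "u \<in> {0..1}"
  shows "(\<lambda>j. if j = 0 then 1 - u else if j = 1 then u else 0) \<in> standard_simplex 1"
  using assms by (auto simp: standard_simplex_def)

lemma edge_cell_in: "a \<in> simps X 1 \<Longrightarrow> u \<in> {0..1} \<Longrightarrow> edge_cell a u \<in> topspace (cells X)"
  using edge_simplex[of u] by (simp add: topspace_cells edge_cell_def)

lemma edge_cell_endpoint:
  assumes X: "simplicial_set X" and a: "a \<in> simps X 1" and i: "i \<le> 1"
  shows "cell_class X (vertex_cell (edge_vertex X i a)) = cell_class X (edge_cell a (real i))"
proof (rule cell_class_eq)
  have push: "simplex_push 0 (Delta_vertex i) (\<lambda>j. if j = 0 then 1 else 0) =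
      (\<lambda>j. if j = 0 then 1 - real i else if j = 1 then real i else 0)"
  proof
    fix j :: nat
    have "{i'. i' \<le> (0::nat) \<and> Delta_vertex i i' = j} = (if i = j then {0} else {})"
      by (auto simp: Delta_vertex_def)
    then show "simplex_push 0 (Delta_vertex i) (\<lambda>j. if j = 0 then 1 else 0) j =
        (if j = 0 then 1 - real i else if j = 1 then real i else 0)"
      using i by (cases "i = 0") (auto simp: simplex_push_def le_Suc_eq)
  qed
  have "(vertex_cell (edge_vertex X i a), edge_cell a (real i)) \<in> glue X"
    unfolding glue_def vertex_cell_def edge_cell_def edge_vertex_def push[symmetric]
    using Delta_vertex_in[OF i] a basis_in_standard_simplex[of 0 0] by auto
  moreover have "vertex_cell (edge_vertex X i a) \<in> topspace (cells X)"
    by (rule vertex_cell_in[OF edge_vertex_in[OF X a i]])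
  moreover have "edge_cell a (real i) \<in> topspace (cells X)"
    using i by (intro edge_cell_in[OF a]) auto
  ultimately show "(vertex_cell (edge_vertex X i a), edge_cell a (real i)) \<in> glue_eq X"
    by (auto simp: glue_eq_def)
qed

lemma continuous_map_edge:
  assumes a: "a \<in> simps X 1"
  shows "continuous_map (top_of_set {0..1}) (realization X) (\<lambda>u. cell_class X (edge_cell a u))"
proof -
  let ?t = "\<lambda>(u::real) (j::nat). if j = 0 then 1 - u else if j = 1 then u else 0"
  let ?Y = "\<lambda>k. prod_topology (discrete_topology (simps X k))
            (subtopology (powertop_real UNIV) (standard_simplex k))"
  have "continuous_map (top_of_set {0..1}) (powertop_real UNIV) ?t"
    unfolding continuous_map_componentwise_UNIV
  proof
    fix j :: nat
    show "continuous_map (top_of_set {0..1}) euclideanreal (\<lambda>u::real. ?t u j)"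
      by (cases "j = 0"; cases "j = 1") (auto intro!: continuous_intros)
  qed
  then have "continuous_map (top_of_set {0..1}) (subtopology (powertop_real UNIV) (standard_simplex 1)) ?t"
    using edge_simplex by (auto simp: continuous_map_in_subtopology)
  then have "continuous_map (top_of_set {0..1}) (?Y 1) (\<lambda>u. (a, ?t u))"
    using a by (intro continuous_map_pairedI) auto
  moreover have "continuous_map (?Y 1) (cells X) (\<lambda>p. (1, p))"
    unfolding cells_def by (rule continuous_map_component_injection) simp
  ultimately have "continuous_map (top_of_set {0..1}) (cells X) (edge_cell a)"
    using continuous_map_compose unfolding edge_cell_def o_def by fastforce
  from continuous_map_compose[OF this continuous_map_cell_class] show ?thesis
    by (simp add: o_def)
qed

section \<open>Maps of realizations computed on cells\<close>

definition map_cell :: "(nat \<Rightarrow> 'a \<Rightarrow> 'b) \<Rightarrow> nat \<times> 'a \<times> (nat \<Rightarrow> real) \<Rightarrow> nat \<times> 'b \<times> (nat \<Rightarrow> real)" where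
  "map_cell f = (\<lambda>(k, x, t). (k, f k x, t))"

lemma map_cell_in:
  "simplicial_map X Y f \<Longrightarrow> c \<in> topspace (cells X) \<Longrightarrow> map_cell f c \<in> topspace (cells Y)"
  by (auto simp: topspace_cells map_cell_def simplicial_map_def)

lemma map_cell_glue_eq:
  assumes f: "simplicial_map X Y f" and c: "(c, c') \<in> glue_eq X"
  shows "(map_cell f c, map_cell f c') \<in> glue_eq Y"
proof -
  have glue: "(map_cell f c, map_cell f c') \<in> glue Y" if "(c, c') \<in> glue X" for c c'
    using that f by (fastforce simp: glue_def map_cell_def simplicial_map_def)
  have "(c, c') \<in> (glue X \<union> (glue X)\<inverse>)\<^sup>*"
    using c by (simp add: glue_eq_def)
  then have "(map_cell f c, map_cell f c') \<in> (glue Y \<union> (glue Y)\<inverse>)\<^sup>*"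
  proof (induction rule: rtrancl_induct)
    case (step y z)
    then have "(map_cell f y, map_cell f z) \<in> glue Y \<union> (glue Y)\<inverse>"
      using glue by blast
    with step.IH show ?case
      by (rule rtrancl_into_rtrancl)
  qed simp
  then show ?thesis
    using c map_cell_in[OF f] by (auto simp: glue_eq_def)
qed

text \<open>The map saturates the image of a whole class; since gluing is preserved, each member
  contributes the same class.\<close>

lemma realization_map_cell:
  assumes f: "simplicial_map X Y f" and c: "c \<in> topspace (cells X)"
  shows "realization_map Y f (cell_class X c) = cell_class Y (map_cell f c)"
proof -
  have "realization_map Y f (cell_class X c) = (\<Union>c'\<in>cell_class X c. cell_class Y (map_cell f c'))"
    unfolding realization_map_def cell_class_def map_cell_def by blast
  also have "\<dots> = (\<Union>c'\<in>cell_class X c. cell_class Y (map_cell f c))"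
    using cell_class_eq[OF map_cell_glue_eq[OF f]] by (auto simp: cell_class_def)
  also have "\<dots> = cell_class Y (map_cell f c)"
    using cell_class_refl[OF c] by blast
  finally show ?thesis .
qed

context labelled_sset
begin

lemma vertex_frame:
  assumes x: "x \<in> simps X 0" and s: "s \<in> {0..<1}"
  shows "fr (vertex_cell x) s = Idn G (fst (L 0 x) 0)"
proof -
  have "step_index (\<lambda>j. if j = 0 then 1 else 0) s = 0"
    using s by (intro step_index_eq) auto
  then show ?thesis
    using label_id[OF x, of 0] by (simp add: cell_frame_def vertex_cell_def)
qed

lemma edge_frame:
  assumes a: "a \<in> simps X 1" and s: "s \<in> {0..<1}" and u: "u \<in> {0..1}"
  shows "fr (edge_cell a u) s = (if s < 1 - u then Idn G (fst (L 1 a) 0) else snd (L 1 a) (0, 1))"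
proof -
  have "step_index (\<lambda>j. if j = 0 then 1 - u else if j = 1 then u else 0) s = (if s < 1 - u then 0 else 1)"
    using s u by (intro step_index_eq) auto
  then show ?thesis
    using label_id[OF a, of 0] by (simp add: cell_frame_def edge_cell_def)
qed

lemma edge_vertex_label:
  assumes a: "a \<in> simps X 1" and i: "i \<le> 1"
  shows "fst (L 0 (edge_vertex X i a)) 0 = fst (L 1 a) i"
  using label_act(1)[OF a Delta_vertex_in[OF i], of 0] by (simp add: edge_vertex_def Delta_vertex_def)

text \<open>At the ends, the vertex cells replace the equivalent boundary cells of the edge. Paths
  of edges with a common vertex then meet in the same cell, and their holonomies fit together with
  those of the tracks of the vertices.\<close>

definition edge_path :: "'a \<Rightarrow> real \<Rightarrow> nat \<times> 'a \<times> (nat \<Rightarrow> real)" where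
  "edge_path a u = (if u = 0 then vertex_cell (edge_vertex X 0 a)
    else if u = 1 then vertex_cell (edge_vertex X 1 a) else edge_cell a u)"

lemma edge_path_class:
  assumes a: "a \<in> simps X 1" and u: "u \<in> {0..1}"
  shows "edge_path a u \<in> topspace (cells X)"
    "cell_class X (edge_path a u) = cell_class X (edge_cell a u)"
  using vertex_cell_in[OF edge_vertex_in[OF sset a]] edge_cell_in[OF a u]
    edge_cell_endpoint[OF sset a, of 0] edge_cell_endpoint[OF sset a, of 1]
  by (auto simp: edge_path_def)

text \<open>The base is vertex \<open>0\<close> for \<open>u < 1\<close> and jumps to vertex
  \<open>1\<close> at \<open>u = 1\<close>; the explicit lift \<open>e\<close> makes the same jump.
  Rebased by \<open>e\<close>, the frame is the identity before \<open>1 - u\<close> and the label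
  of the edge after it, so only the position of the break varies.\<close>

lemma hol_edge_path:
  assumes a: "a \<in> simps X 1"
  shows "fram.hol (edge_path a) (snd (L 1 a) (0, 1))"
proof -
  let ?A = "fst (L 1 a) 0" and ?b = "snd (L 1 a) (0, 1)"
  define e where "e u = (if u = 1 then ?b else Idn G ?A)" for u :: real
  have b: "?b \<in> homs G ?A (fst (L 1 a) 1)"
    using label_homs[OF a, of 0 1] by simp
  have idA: "Idn G ?A \<in> homs G ?A ?A"
    using id_in_homs[OF fram.cat homs_obj(1)[OF fram.cat b]] .
  have obs: "ob (edge_path a u) = (if u = 1 then fst (L 1 a) 1 else ?A)" for u
    using edge_vertex_label[OF a, of 0] edge_vertex_label[OF a, of 1]
    by (simp add: edge_path_def cell_ob_def vertex_cell_def edge_cell_def)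
  have eh: "e u \<in> homs G ?A (ob (edge_path a u))" for u
    using b idA by (simp add: e_def obs)
  have fre: "Cmp G (fr (edge_path a u) s) (e u) = (if s < 1 - u then Idn G ?A else ?b)"
    if u: "u \<in> {0..1}" and s: "s \<in> {0..<1}" for u s
  proof -
    consider "u = 0" | "u = 1" | "u \<noteq> 0" "u \<noteq> 1"
      by blast
    then show ?thesis
    proof cases
      case 1
      then show ?thesis
        using vertex_frame[OF edge_vertex_in[OF sset a] s, of 0] edge_vertex_label[OF a, of 0] s
          comp_id[OF fram.cat idA] by (simp add: edge_path_def e_def)
    next
      case 2
      then show ?thesis
        using vertex_frame[OF edge_vertex_in[OF sset a] s, of 1] edge_vertex_label[OF a, of 1] s
          comp_id[OF fram.cat b] by (simp add: edge_path_def e_def)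
    next
      case 3
      then show ?thesis
        using edge_frame[OF a s u] comp_id[OF fram.cat b] comp_id[OF fram.cat idA]
        by (simp add: edge_path_def e_def)
    qed
  qed
  have nr: "near G ob fr (2/3) (edge_path a u) (Cmp G (e v) (inv_mor G (e u))) (edge_path a v)"
    if u: "u \<in> {0..1}" and v: "v \<in> {0..1}" and uv: "dist u v < 1/3" for u v
  proof -
    let ?m = "Cmp G (e v) (inv_mor G (e u))"
    \<comment> \<open>The rebased frames at \<open>u\<close> and \<open>v\<close> differ only
      between their breaks, on an interval shorter than \<open>1/3\<close>; this leaves agreement
      above \<open>2/3\<close>.\<close>
    define lo hi where "lo = 1 - max u v" and "hi = 1 - min u v"
    have lohi: "0 \<le> lo" "lo \<le> hi" "hi \<le> 1" "hi - lo < 1/3"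
      using u v uv by (auto simp: lo_def hi_def dist_real_def max_def min_def)
    have sub: "{0..<1} - {lo..<hi} \<subseteq> agreement G fr (edge_path a u) ?m (edge_path a v)"
    proof
      fix s assume s: "s \<in> {0..<1} - {lo..<hi}"
      then have s1: "s \<in> {0..<1}" and iff: "s < 1 - u \<longleftrightarrow> s < 1 - v"
        by (auto simp: lo_def hi_def max_def min_def split: if_splits)
      note fu = fram.frame_homs[OF edge_path_class(1)[OF a u] s1]
      note fv = fram.frame_homs[OF edge_path_class(1)[OF a v] s1]
      note ei = inv_mor(1)[OF grp eh[of u]]
      have "Cmp G (fr (edge_path a v) s) ?m = Cmp G (Cmp G (fr (edge_path a v) s) (e v)) (inv_mor G (e u))"
        by (rule comp_assoc[OF fram.cat ei eh fv])
      also have "\<dots> = Cmp G (Cmp G (fr (edge_path a u) s) (e u)) (inv_mor G (e u))"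
        using fre[OF u s1] fre[OF v s1] iff by simp
      also have "\<dots> = fr (edge_path a u) s"
        by (rule comp_inv_cancel(1)[OF grp eh fu])
      finally show "s \<in> agreement G fr (edge_path a u) ?m (edge_path a v)"
        using s1 by (simp add: agreement_def)
    qed
    have "measure lborel ({0..<1} - {lo..<hi}) = measure lborel {0..<1::real} - measure lborel {lo..<hi}"
      by (rule measurable_measure_Diff) (use lohi in \<open>auto simp: fmeasurable_def\<close>)
    then have "2/3 < measure lborel ({0..<1} - {lo..<hi})"
      using lohi by simp
    also have "\<dots> \<le> measure lborel (agreement G fr (edge_path a u) ?m (edge_path a v))"
    proof (rule measure_mono_fmeasurable[OF sub])
      show "agreement G fr (edge_path a u) ?m (edge_path a v) \<in> fmeasurable lborel"
        by (rule fmeasurableI2[of "{0..<1}", OF _ fram.agreement_subset fram.agreement_measurable])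
          (use edge_path_class(1)[OF a] u v in \<open>auto simp: fmeasurable_def\<close>)
    qed simp
    finally show ?thesis
      using comp_in_homs[OF fram.cat inv_mor(1)[OF grp eh] eh] by (simp add: near_def)
  qed
  have "fram.lift {0..1} (edge_path a) ?A e"
    unfolding lift_of_def
  proof (intro conjI ballI)
    fix u :: real assume u: "u \<in> {0..1}"
    show "e u \<in> homs G ?A (ob (edge_path a u))"
      by (rule eh)
    show "\<exists>\<delta>>0. \<forall>v\<in>{0..1}. dist u v < \<delta> \<longrightarrow>
        (\<exists>m. near G ob fr (2/3) (edge_path a u) m (edge_path a v) \<and> e v = Cmp G m (e u))"
      using nr[OF u] comp_inv_cancel(2)[OF grp eh eh]
      by (intro exI[of _ "1/3"] conjI ballI impI) (simp, metis)
  qed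
  then show ?thesis
    unfolding holonomy_def by (intro exI[of _ e]) (simp add: obs e_def)
qed

end

text \<open>
  A homotopy inverse \<open>g\<close> of the realization of \<open>f\<close> sends the loop (or path) of an edge of \<open>Z\<close> to a
  path in the realization of \<open>X\<close>, whose holonomy is a morphism of \<open>G\<close>. Comparing holonomies along the
  homotopies shows that the image of this morphism is the label of the edge, up to automorphisms
  that do not depend on the edge.
\<close>

locale labelled_weak_equivalence =
  X: labelled_sset X G L + Z: labelled_sset Z H L'
  for X :: "'a sset" and G :: "('o, 'm) cat" and L and Z :: "'b sset" and H :: "('p, 'n) cat" and L' +
  fixes f :: "nat \<Rightarrow> 'a \<Rightarrow> 'b" and Fo :: "'o \<Rightarrow> 'p" and Fm :: "'m \<Rightarrow> 'n"
  assumes weq: "weak_equivalence X Z f" and F: "is_functor G H Fo Fm"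
    and label_ob: "\<And>k x i. x \<in> simps X k \<Longrightarrow> i \<le> k \<Longrightarrow> fst (L' k (f k x)) i = Fo (fst (L k x) i)"
    and label_mor: "\<And>k x i j. x \<in> simps X k \<Longrightarrow> i \<le> j \<Longrightarrow> j \<le> k \<Longrightarrow>
      snd (L' k (f k x)) (i, j) = Fm (snd (L k x) (i, j))"
begin

lemma smap: "simplicial_map X Z f"
  using weq by (simp add: weak_equivalence_def)

lemma map_frame:
  assumes "c \<in> topspace (cells X)"
  shows "Z.ob (map_cell f c) = Fo (X.ob c)"
    and "s \<in> {0..<1} \<Longrightarrow> Z.fr (map_cell f c) s = Fm (X.fr c s)"
  using assms label_ob label_mor step_index(1)
  by (auto simp: topspace_cells cell_ob_def cell_frame_def map_cell_def)

lemma map_hol: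
  assumes "\<Gamma> ` {0..1} \<subseteq> topspace (cells X)" "X.fram.hol \<Gamma> m"
  shows "Z.fram.hol (\<lambda>t. map_cell f (\<Gamma> t)) (Fm m)"
  by (rule holonomy_map[OF X.framing Z.framing F _ map_frame assms]) (use map_cell_in[OF smap] in auto)

end

definition pick_cell :: "'a sset \<Rightarrow> (nat \<times> 'a \<times> (nat \<Rightarrow> real)) set \<Rightarrow> nat \<times> 'a \<times> (nat \<Rightarrow> real)" where
  "pick_cell X p = (SOME c. c \<in> topspace (cells X) \<and> cell_class X c = p)"

lemma pick_cell:
  assumes "p \<in> topspace (realization X)"
  shows "pick_cell X p \<in> topspace (cells X)" "cell_class X (pick_cell X p) = p"
proof -
  have "\<exists>c. c \<in> topspace (cells X) \<and> cell_class X c = p"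
    using cell_class_cases[OF assms] by metis
  from someI_ex[OF this] show "pick_cell X p \<in> topspace (cells X)" "cell_class X (pick_cell X p) = p"
    unfolding pick_cell_def by auto
qed

definition vertex_point :: "'a sset \<Rightarrow> 'a \<Rightarrow> (nat \<times> 'a \<times> (nat \<Rightarrow> real)) set" where
  "vertex_point X x = cell_class X (vertex_cell x)"

lemma cell_class_in: "c \<in> topspace (cells X) \<Longrightarrow> cell_class X c \<in> topspace (realization X)"
  by (auto simp: topspace_realization cell_class_def intro: quotientI)

lemma vertex_point_in: "x \<in> simps X 0 \<Longrightarrow> vertex_point X x \<in> topspace (realization X)"
  unfolding vertex_point_def by (intro cell_class_in vertex_cell_in)

lemma continuous_map_homotopy_point:
  assumes h: "continuous_map (prod_topology (top_of_set {0..1::real}) T) T' h" and p: "p \<in> topspace T"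
  shows "continuous_map (top_of_set {0..1}) T' (\<lambda>\<tau>. h (\<tau>, p))"
proof -
  have "continuous_map (top_of_set {0..1}) (prod_topology (top_of_set {0..1::real}) T) (\<lambda>\<tau>. (\<tau>, p))"
    using p by (intro continuous_map_pairedI) (auto simp: continuous_map_id[unfolded id_def])
  from continuous_map_compose[OF this h] show ?thesis
    by (simp add: o_def)
qed

context labelled_weak_equivalence
begin

section \<open>Holonomy along the homotopies to the identities\<close>

context
  fixes g :: "(nat \<times> 'b \<times> (nat \<Rightarrow> real)) set \<Rightarrow> (nat \<times> 'a \<times> (nat \<Rightarrow> real)) set"
    and hX :: "real \<times> (nat \<times> 'a \<times> (nat \<Rightarrow> real)) set \<Rightarrow> (nat \<times> 'a \<times> (nat \<Rightarrow> real)) set"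
    and hZ :: "real \<times> (nat \<times> 'b \<times> (nat \<Rightarrow> real)) set \<Rightarrow> (nat \<times> 'b \<times> (nat \<Rightarrow> real)) set"
  assumes g: "continuous_map (realization Z) (realization X) g"
    and hX: "continuous_map (prod_topology (top_of_set {0..1}) (realization X)) (realization X) hX"
      "\<And>p. hX (0, p) = g (realization_map Z f p)" "\<And>p. hX (1, p) = p"
    and hZ: "continuous_map (prod_topology (top_of_set {0..1}) (realization Z)) (realization Z) hZ"
      "\<And>p. hZ (0, p) = realization_map Z f (g p)" "\<And>p. hZ (1, p) = p"
begin

lemma g_in: "p \<in> topspace (realization Z) \<Longrightarrow> g p \<in> topspace (realization X)"
  using g by (auto simp: continuous_map_def)

lemma homotopy_in:
  assumes "\<tau> \<in> {0..1}"
  shows "p \<in> topspace (realization X) \<Longrightarrow> hX (\<tau>, p) \<in> topspace (realization X)"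
    and "q \<in> topspace (realization Z) \<Longrightarrow> hZ (\<tau>, q) \<in> topspace (realization Z)"
  using assms continuous_map_image_subset_topspace[OF hX(1)]
    continuous_map_image_subset_topspace[OF hZ(1)] by auto

lemma base_in:
  assumes "z \<in> simps Z 0"
  shows "pick_cell X (g (vertex_point Z z)) \<in> topspace (cells X)"
  by (intro pick_cell g_in vertex_point_in assms)

lemma map_vertex:
  assumes s: "s \<in> simps X 0"
  shows "f 0 s \<in> simps Z 0" "realization_map Z f (vertex_point X s) = vertex_point Z (f 0 s)"
  using smap s realization_map_cell[OF smap vertex_cell_in[OF s]]
  by (auto simp: simplicial_map_def vertex_point_def map_cell_def vertex_cell_def)

text \<open>Holonomy of the track of the vertex under the homotopy \<open>hX\<close>. The cell at
  time 1 is prescribed as \<open>vertex_cell s\<close>, so that the target is the label of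
  \<open>s\<close> itself.\<close>

lemma ex_to_vertex:
  assumes s: "s \<in> simps X 0"
  shows "\<exists>\<epsilon>. \<epsilon> \<in> homs G (X.ob (pick_cell X (g (vertex_point Z (f 0 s))))) (fst (L 0 s) 0)"
proof -
  define \<Lambda> where "\<Lambda> \<tau> = (if \<tau> = 1 then vertex_cell s else pick_cell X (hX (\<tau>, vertex_point X s)))" for \<tau>
  have "X.fram.coherent {0..1} \<Lambda>"
  proof (rule X.coherent_lift_choice[OF continuous_map_homotopy_point[OF hX(1) vertex_point_in[OF s]]])
    fix \<tau> :: real assume "\<tau> \<in> {0..1}"
    then show "\<Lambda> \<tau> \<in> topspace (cells X) \<and> cell_class X (\<Lambda> \<tau>) = hX (\<tau>, vertex_point X s)"
      using pick_cell[OF homotopy_in(1)[OF _ vertex_point_in[OF s]]] vertex_cell_in[OF s] hX(3)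
      by (auto simp: \<Lambda>_def vertex_point_def)
  qed
  then obtain m where "X.fram.hol \<Lambda> m"
    using X.fram.hol_exists by blast
  then have "m \<in> homs G (X.ob (\<Lambda> 0)) (X.ob (\<Lambda> 1))"
    by (rule X.fram.hol_homs)
  moreover have "\<Lambda> 0 = pick_cell X (g (vertex_point Z (f 0 s)))"
    using hX(2) map_vertex(2)[OF s] by (simp add: \<Lambda>_def)
  ultimately show ?thesis
    by (auto simp: \<Lambda>_def cell_ob_def vertex_cell_def)
qed

text \<open>The cells at both ends are prescribed: at time 0 the image of the cell picked in
  \<open>X\<close>, which puts the base into the image of \<open>Fo\<close>, and at time 1 the
  vertex. The track depends on the vertex alone, so one holonomy serves all edges at
  \<open>z\<close>.\<close>

definition vertex_track where
  "vertex_track z \<tau> = (if \<tau> = 0 then map_cell f (pick_cell X (g (vertex_point Z z)))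
    else if \<tau> = 1 then vertex_cell z else pick_cell Z (hZ (\<tau>, vertex_point Z z)))"

lemma ex_hol_vertex_track:
  assumes z: "z \<in> simps Z 0"
  shows "\<exists>\<kappa>. Z.fram.hol (vertex_track z) \<kappa>"
proof (rule Z.fram.hol_exists,
    rule Z.coherent_lift_choice[OF continuous_map_homotopy_point[OF hZ(1) vertex_point_in[OF z]]])
  fix \<tau> :: real assume "\<tau> \<in> {0..1}"
  then show "vertex_track z \<tau> \<in> topspace (cells Z) \<and>
      cell_class Z (vertex_track z \<tau>) = hZ (\<tau>, vertex_point Z z)"
    using pick_cell[OF homotopy_in(2)[OF _ vertex_point_in[OF z]]] vertex_cell_in[OF z] hZ(2,3)
      map_cell_in[OF smap base_in[OF z]] realization_map_cell[OF smap base_in[OF z]]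
      pick_cell(2)[OF g_in[OF vertex_point_in[OF z]]]
    by (auto simp: vertex_track_def vertex_point_def)
qed

lemma hol_vertex_track_homs:
  assumes z: "z \<in> simps Z 0" and \<kappa>: "Z.fram.hol (vertex_track z) \<kappa>"
  shows "\<kappa> \<in> homs H (Fo (X.ob (pick_cell X (g (vertex_point Z z))))) (fst (L' 0 z) 0)"
  using Z.fram.hol_homs[OF \<kappa>] map_frame(1)[OF base_in[OF z]]
  by (simp add: vertex_track_def cell_ob_def vertex_cell_def)

text \<open>Holonomy around the square that the edge sweeps out under the homotopy
  \<open>hZ\<close>. Its side at time 0 is the image of a path in the realization of
  \<open>X\<close>, and \<open>m\<close> is the holonomy of that path; at time 1 it is the edge
  itself.\<close>

lemma ex_edge_preimage:
  assumes a: "a \<in> simps Z 1"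
    and \<kappa>: "Z.fram.hol (vertex_track (edge_vertex Z 0 a)) \<kappa>0" "Z.fram.hol (vertex_track (edge_vertex Z 1 a)) \<kappa>1"
  shows "\<exists>m \<in> homs G (X.ob (pick_cell X (g (vertex_point Z (edge_vertex Z 0 a)))))
                       (X.ob (pick_cell X (g (vertex_point Z (edge_vertex Z 1 a))))).
    Cmp H (snd (L' 1 a) (0, 1)) \<kappa>0 = Cmp H \<kappa>1 (Fm m)"
proof -
  define e where "e u = cell_class Z (edge_cell a u)" for u
  have ec: "continuous_map (top_of_set {0..1}) (realization Z) e"
    unfolding e_def by (rule continuous_map_edge[OF a])
  have ein: "e u \<in> topspace (realization Z)" if "u \<in> {0..1}" for u
    unfolding e_def by (intro cell_class_in edge_cell_in a that)
  have e01: "e 0 = vertex_point Z (edge_vertex Z 0 a)" "e 1 = vertex_point Z (edge_vertex Z 1 a)"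
    using edge_cell_endpoint[OF Z.sset a, of 0] edge_cell_endpoint[OF Z.sset a, of 1]
    by (simp_all add: e_def vertex_point_def)
  define \<beta> where "\<beta> u = pick_cell X (g (e u))" for u
  have \<beta>: "\<beta> u \<in> topspace (cells X)" "cell_class X (\<beta> u) = g (e u)" if "u \<in> {0..1}" for u
    using pick_cell[OF g_in[OF ein[OF that]]] by (simp_all add: \<beta>_def)
  have "X.fram.coherent {0..1} \<beta>"
    by (rule X.coherent_lift_choice[OF continuous_map_compose[OF ec g]]) (use \<beta> in auto)
  then obtain m where m: "X.fram.hol \<beta> m"
    using X.fram.hol_exists by blast
  \<comment> \<open>Cells are prescribed at times 0 and 1, where the holonomy has to be recognised.
    On the sides \<open>u = 0\<close> and \<open>u = 1\<close> the family then coincides with the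
    vertex tracks.\<close>
  define \<Gamma> where "\<Gamma> = (\<lambda>(\<tau>, u). if \<tau> = 0 then map_cell f (\<beta> u) else if \<tau> = 1 then Z.edge_path a u
    else pick_cell Z (hZ (\<tau>, e u)))"
  have "continuous_map (top_of_set ({0..1} \<times> {0..1})) (prod_topology (top_of_set {0..1::real}) (realization Z))
      (\<lambda>p. (fst p, e (snd p)))"
  proof (rule continuous_map_pairedI)
    show "continuous_map (top_of_set ({0..1} \<times> {0..1})) (top_of_set {0..1::real}) fst"
      by (auto simp: continuous_map_in_subtopology intro!: continuous_intros)
    have "continuous_map (top_of_set ({0..1} \<times> {0..1})) (top_of_set {0..1::real}) snd"
      by (auto simp: continuous_map_in_subtopology intro!: continuous_intros)
    from continuous_map_compose[OF this ec]
    show "continuous_map (top_of_set ({0..1} \<times> {0..1})) (realization Z) (\<lambda>p. e (snd p))"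
      by (simp add: o_def)
  qed
  from continuous_map_compose[OF this hZ(1)]
  have hc: "continuous_map (top_of_set ({0..1} \<times> {0..1})) (realization Z) (\<lambda>p. hZ (fst p, e (snd p)))"
    by (simp add: o_def)
  have "Z.fram.coherent ({0..1} \<times> {0..1}) \<Gamma>"
  proof (rule Z.coherent_lift_choice[OF hc])
    fix p :: "real \<times> real" assume p: "p \<in> {0..1} \<times> {0..1}"
    obtain \<tau> u where p_eq: "p = (\<tau>, u)" and \<tau>: "\<tau> \<in> {0..1}" and u: "u \<in> {0..1}"
      using p by auto
    show "\<Gamma> p \<in> topspace (cells Z) \<and> cell_class Z (\<Gamma> p) = hZ (fst p, e (snd p))"
      using map_cell_in[OF smap \<beta>(1)[OF u]] realization_map_cell[OF smap \<beta>(1)[OF u]] \<beta>(2)[OF u]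
        hZ(2,3) Z.edge_path_class[OF a u] pick_cell[OF homotopy_in(2)[OF \<tau> ein[OF u]]]
      by (auto simp: \<Gamma>_def p_eq e_def)
  qed
  moreover have "Z.fram.hol (\<lambda>t. \<Gamma> (0, t)) (Fm m)"
  proof -
    have "\<beta> ` {0..1} \<subseteq> topspace (cells X)"
      using \<beta>(1) by blast
    from map_hol[OF this m] show ?thesis
      by (simp add: \<Gamma>_def)
  qed
  moreover have "Z.fram.hol (\<lambda>t. \<Gamma> (1, t)) (snd (L' 1 a) (0, 1))"
    using Z.hol_edge_path[OF a] by (simp add: \<Gamma>_def)
  moreover have "Z.fram.hol (\<lambda>t. \<Gamma> (t, 0)) \<kappa>0"
  proof -
    have "(\<lambda>t. \<Gamma> (t, 0)) = vertex_track (edge_vertex Z 0 a)"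
      by (auto simp: fun_eq_iff \<Gamma>_def vertex_track_def \<beta>_def e01 Z.edge_path_def)
    then show ?thesis
      using \<kappa>(1) by simp
  qed
  moreover have "Z.fram.hol (\<lambda>t. \<Gamma> (t, 1)) \<kappa>1"
  proof -
    have "(\<lambda>t. \<Gamma> (t, 1)) = vertex_track (edge_vertex Z 1 a)"
      by (auto simp: fun_eq_iff \<Gamma>_def vertex_track_def \<beta>_def e01 Z.edge_path_def)
    then show ?thesis
      using \<kappa>(2) by simp
  qed
  ultimately have "Cmp H (snd (L' 1 a) (0, 1)) \<kappa>0 = Cmp H \<kappa>1 (Fm m)"
    by (rule Z.fram.hol_square)
  moreover have "m \<in> homs G (X.ob (\<beta> 0)) (X.ob (\<beta> 1))"
    by (rule X.fram.hol_homs[OF m])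
  ultimately show ?thesis
    by (auto simp: \<beta>_def e01)
qed

lemma essentially_surjective_aux:
  assumes z: "z \<in> simps Z 0"
  shows "\<exists>A\<in>Obj G. \<exists>m. m \<in> homs H (Fo A) (fst (L' 0 z) 0)"
  using hol_vertex_track_homs[OF z] ex_hol_vertex_track[OF z] X.fram.ob_Obj[OF base_in[OF z]] by blast

text \<open>The comparison \<open>\<kappa>\<close> from the homotopy on \<open>Z\<close> and the
  image \<open>Fm \<epsilon>\<close> of the comparison from the homotopy on \<open>X\<close> have
  the same source and target but need not be equal. So the edge to be pulled back is labelled not by
  \<open>b\<close> but by \<open>b\<close> corrected by this discrepancy at both ends.\<close>

lemma full_aux:
  assumes s: "s \<in> simps X 0" "s' \<in> simps X 0"
    and edges: "\<And>b. b \<in> homs H (fst (L' 0 (f 0 s)) 0) (fst (L' 0 (f 0 s')) 0) \<Longrightarrow>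
      \<exists>a\<in>simps Z 1. edge_vertex Z 0 a = f 0 s \<and> edge_vertex Z 1 a = f 0 s' \<and> snd (L' 1 a) (0, 1) = b"
    and b: "b \<in> homs H (fst (L' 0 (f 0 s)) 0) (fst (L' 0 (f 0 s')) 0)"
  shows "\<exists>m \<in> homs G (fst (L 0 s) 0) (fst (L 0 s') 0). Fm m = b"
proof -
  note cG = groupoid_is_category[OF X.grp] and cH = groupoid_is_category[OF Z.grp]
  define base where "base s = X.ob (pick_cell X (g (vertex_point Z (f 0 s))))" for s
  obtain \<epsilon> \<epsilon>' where \<epsilon>: "\<epsilon> \<in> homs G (base s) (fst (L 0 s) 0)" and \<epsilon>': "\<epsilon>' \<in> homs G (base s') (fst (L 0 s') 0)"
    using ex_to_vertex[OF s(1)] ex_to_vertex[OF s(2)] unfolding base_def by (elim exE)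
  obtain \<kappa> \<kappa>' where \<kappa>h: "Z.fram.hol (vertex_track (f 0 s)) \<kappa>" "Z.fram.hol (vertex_track (f 0 s')) \<kappa>'"
    using ex_hol_vertex_track[OF map_vertex(1)[OF s(1)]] ex_hol_vertex_track[OF map_vertex(1)[OF s(2)]]
    by (elim exE)
  have \<kappa>: "\<kappa> \<in> homs H (Fo (base s)) (fst (L' 0 (f 0 s)) 0)"
    and \<kappa>': "\<kappa>' \<in> homs H (Fo (base s')) (fst (L' 0 (f 0 s')) 0)"
    using hol_vertex_track_homs[OF map_vertex(1)] s \<kappa>h by (auto simp: base_def)
  have F\<epsilon>: "Fm \<epsilon> \<in> homs H (Fo (base s)) (fst (L' 0 (f 0 s)) 0)"
    and F\<epsilon>': "Fm \<epsilon>' \<in> homs H (Fo (base s')) (fst (L' 0 (f 0 s')) 0)"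
    using functor_homs[OF F \<epsilon>] functor_homs[OF F \<epsilon>'] label_ob s by auto
  \<comment> \<open>The value that \<open>Fm m\<close> must take so that conjugating
    \<open>m\<close> by \<open>\<epsilon>\<close> and \<open>\<epsilon>'\<close> gives a morphism
    sent to \<open>b\<close>.\<close>
  define y where "y = Cmp H (inv_mor H (Fm \<epsilon>')) (Cmp H b (Fm \<epsilon>))"
  have bF: "Cmp H b (Fm \<epsilon>) \<in> homs H (Fo (base s)) (fst (L' 0 (f 0 s')) 0)"
    by (rule comp_in_homs[OF cH F\<epsilon> b])
  have y: "y \<in> homs H (Fo (base s)) (Fo (base s'))"
    unfolding y_def by (rule comp_in_homs[OF cH bF inv_mor(1)[OF Z.grp F\<epsilon>']])
  have Fy: "Cmp H (Fm \<epsilon>') y = Cmp H b (Fm \<epsilon>)"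
    unfolding y_def by (rule comp_inv_cancel(4)[OF Z.grp F\<epsilon>' bF])
  \<comment> \<open>Solved from the equation of \<open>ex_edge_preimage\<close>: an edge with this
    label pulls back to a morphism whose image is \<open>y\<close>.\<close>
  define ba where "ba = Cmp H (Cmp H \<kappa>' y) (inv_mor H \<kappa>)"
  have \<kappa>y: "Cmp H \<kappa>' y \<in> homs H (Fo (base s)) (fst (L' 0 (f 0 s')) 0)"
    by (rule comp_in_homs[OF cH y \<kappa>'])
  have "ba \<in> homs H (fst (L' 0 (f 0 s)) 0) (fst (L' 0 (f 0 s')) 0)"
    unfolding ba_def by (rule comp_in_homs[OF cH inv_mor(1)[OF Z.grp \<kappa>] \<kappa>y])
  then obtain a where a: "a \<in> simps Z 1" "edge_vertex Z 0 a = f 0 s" "edge_vertex Z 1 a = f 0 s'"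
    "snd (L' 1 a) (0, 1) = ba"
    using edges by blast
  obtain m where m: "m \<in> homs G (base s) (base s')" "Cmp H ba \<kappa> = Cmp H \<kappa>' (Fm m)"
    using ex_edge_preimage[OF a(1)] \<kappa>h a by (auto simp: base_def)
  have "Cmp H \<kappa>' (Fm m) = Cmp H \<kappa>' y"
    using m(2) comp_inv_cancel(2)[OF Z.grp \<kappa> \<kappa>y] by (simp add: ba_def)
  then have Fmm: "Fm m = y"
    by (rule comp_cancel_left[OF Z.grp \<kappa>' functor_homs[OF F m(1)] y])
  define m' where "m' = Cmp G (Cmp G \<epsilon>' m) (inv_mor G \<epsilon>)"
  have \<epsilon>m: "Cmp G \<epsilon>' m \<in> homs G (base s) (fst (L 0 s') 0)"
    by (rule comp_in_homs[OF cG m(1) \<epsilon>'])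
  have m': "m' \<in> homs G (fst (L 0 s) 0) (fst (L 0 s') 0)"
    unfolding m'_def by (rule comp_in_homs[OF cG inv_mor(1)[OF X.grp \<epsilon>] \<epsilon>m])
  have "Cmp H (Fm m') (Fm \<epsilon>) = Fm (Cmp G m' \<epsilon>)"
    by (rule functor_comp[OF F \<epsilon> m', symmetric])
  also have "\<dots> = Fm (Cmp G \<epsilon>' m)"
    using comp_inv_cancel(2)[OF X.grp \<epsilon> \<epsilon>m] by (simp add: m'_def)
  also have "\<dots> = Cmp H b (Fm \<epsilon>)"
    using functor_comp[OF F m(1) \<epsilon>'] Fmm Fy by simp
  finally have "Fm m' = b"
    using comp_cancel_right[OF Z.grp F\<epsilon> _ b] functor_homs[OF F m'] label_ob s by simp
  then show ?thesis
    using m' by blast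
qed

end

lemma ex_homotopy_inverse:
  obtains g hX hZ where
    "continuous_map (realization Z) (realization X) g"
    "continuous_map (prod_topology (top_of_set {0..1}) (realization X)) (realization X) hX"
    "\<And>p. hX (0::real, p) = g (realization_map Z f p)" "\<And>p. hX (1, p) = p"
    "continuous_map (prod_topology (top_of_set {0..1}) (realization Z)) (realization Z) hZ"
    "\<And>p. hZ (0::real, p) = realization_map Z f (g p)" "\<And>p. hZ (1, p) = p"
  using weq unfolding weak_equivalence_def homotopic_with_def o_def id_def by metis

lemma essentially_surjective:
  assumes "z \<in> simps Z 0"
  shows "\<exists>A\<in>Obj G. \<exists>m. m \<in> homs H (Fo A) (fst (L' 0 z) 0)"
  by (rule ex_homotopy_inverse) (rule essentially_surjective_aux[OF _ _ _ _ _ _ _ assms])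

lemma full:
  assumes "s \<in> simps X 0" "s' \<in> simps X 0"
    and "\<And>b. b \<in> homs H (fst (L' 0 (f 0 s)) 0) (fst (L' 0 (f 0 s')) 0) \<Longrightarrow>
      \<exists>a\<in>simps Z 1. edge_vertex Z 0 a = f 0 s \<and> edge_vertex Z 1 a = f 0 s' \<and> snd (L' 1 a) (0, 1) = b"
    and "b \<in> homs H (fst (L' 0 (f 0 s)) 0) (fst (L' 0 (f 0 s')) 0)"
  shows "\<exists>m \<in> homs G (fst (L 0 s) 0) (fst (L 0 s') 0). Fm m = b"
  by (rule ex_homotopy_inverse) (rule full_aux[OF _ _ _ _ _ _ _ assms])

end

section \<open>Double categories with shared isomorphisms\<close>

lemma isos_homs: "f \<in> isos C A B \<Longrightarrow> f \<in> homs C A B"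
  by (simp add: isos_def)

lemma isosI: "f \<in> homs C A B \<Longrightarrow> inverse_mors C f g \<Longrightarrow> f \<in> isos C A B"
  by (auto simp: isos_def)

lemma isosE:
  assumes "f \<in> isos C A B"
  obtains g where "g \<in> isos C B A" "inverse_mors C f g" "Cmp C g f = Idn C A" "Cmp C f g = Idn C B"
proof -
  obtain g where g: "inverse_mors C f g"
    using assms by (auto simp: isos_def)
  show ?thesis
    by (rule that[OF isosI g])
      (use inverse_mors_homs[OF g isos_homs[OF assms]] inverse_mors_sym[OF g] in auto)
qed

lemma id_iso:
  assumes "is_category C" "A \<in> Obj C"
  shows "Idn C A \<in> isos C A A"
  using id_in_homs[OF assms] comp_id[OF assms(1) id_in_homs[OF assms]]
  by (intro isosI inverse_morsI) auto

lemma comp_iso: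
  assumes C: "is_category C" and f: "f \<in> isos C A B" and g: "g \<in> isos C B E"
  shows "Cmp C g f \<in> isos C A E"
proof -
  obtain f' where f': "f' \<in> isos C B A" "Cmp C f' f = Idn C A" "Cmp C f f' = Idn C B"
    using f by (rule isosE)
  obtain g' where g': "g' \<in> isos C E B" "Cmp C g' g = Idn C B" "Cmp C g g' = Idn C E"
    using g by (rule isosE)
  note h = isos_homs[OF f] isos_homs[OF g] isos_homs[OF f'(1)] isos_homs[OF g'(1)]
  note gf = comp_in_homs[OF C h(1,2)] and fg = comp_in_homs[OF C h(4,3)]
  have 1: "Cmp C (Cmp C f' g') (Cmp C g f) = Idn C A"
    using comp_assoc[OF C gf h(4,3)] comp_assoc[OF C h(1,2,4)] comp_id[OF C h(1)] f' g' by simp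
  have 2: "Cmp C (Cmp C g f) (Cmp C f' g') = Idn C E"
    using comp_assoc[OF C fg h(1,2)] comp_assoc[OF C h(4,3,1)] comp_id[OF C h(4)] f' g' by simp
  show ?thesis
    by (rule isosI[OF gf inverse_morsI[OF gf fg 1 2]])
qed

lemma iso_cancel_right:
  assumes C: "is_category C" and f: "f \<in> isos C A B" and g: "g \<in> homs C B E" "h \<in> homs C B E"
  shows "Cmp C g f = Cmp C h f \<longleftrightarrow> g = h"
proof
  assume eq: "Cmp C g f = Cmp C h f"
  obtain f' where f': "f' \<in> isos C B A" "Cmp C f f' = Idn C B"
    using f by (rule isosE)
  have "Cmp C (Cmp C x f) f' = x" if "x \<in> homs C B E" for x
    using comp_assoc[OF C isos_homs[OF f'(1)] isos_homs[OF f] that] comp_id[OF C that] f' by simp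
  then show "g = h"
    using g eq by metis
qed simp

subsection \<open>Squares\<close>

lemma double_category_cats:
  assumes "double_category D"
  shows "is_category (hcat D)" "is_category (vcat D)" "is_category (sqh D)" "is_category (sqv D)"
    "Obj (vcat D) = obs D" "Obj (sqh D) = vers D" "Obj (sqv D) = hors D" "Mor (sqv D) = sqs D"
  using assms by (simp_all add: double_category_def)

lemma double_category_functors:
  assumes "double_category D"
  shows "is_functor (sqh D) (hcat D) (Dom (vcat D)) (sq_top D)"
    "is_functor (sqh D) (hcat D) (Cod (vcat D)) (sq_bot D)"
    "is_functor (sqv D) (vcat D) (Dom (hcat D)) (sq_left D)"
    "is_functor (sqv D) (vcat D) (Cod (hcat D)) (sq_right D)"
  using assms by (simp_all add: double_category_def)

lemma double_category_ids:
  assumes "double_category D"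
  shows "A \<in> obs D \<Longrightarrow> Idn (sqh D) (Idn (vcat D) A) = Idn (sqv D) (Idn (hcat D) A)"
    and "f \<in> homs (hcat D) A B \<Longrightarrow> g \<in> homs (hcat D) B E \<Longrightarrow>
       Idn (sqv D) (Cmp (hcat D) g f) = Cmp (sqh D) (Idn (sqv D) g) (Idn (sqv D) f)"
    and "u \<in> homs (vcat D) A B \<Longrightarrow> w \<in> homs (vcat D) B E \<Longrightarrow>
       Idn (sqh D) (Cmp (vcat D) w u) = Cmp (sqv D) (Idn (sqh D) w) (Idn (sqh D) u)"
  using assms by (auto simp: double_category_def homs_def)

lemma square_homs:
  assumes "double_category D" "is_square D f h k g s"
  shows "s \<in> homs (sqh D) h k" "s \<in> homs (sqv D) f g"
  using assms double_category_cats(8)[OF assms(1)] by (auto simp: is_square_def homs_def)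

lemma square_boundary:
  assumes D: "double_category D" and s: "is_square D f h k g s"
  shows "f \<in> hors D" "g \<in> hors D" "h \<in> vers D" "k \<in> vers D"
    "Dom (hcat D) f = Dom (vcat D) h" "Cod (hcat D) f = Dom (vcat D) k"
    "Dom (hcat D) g = Cod (vcat D) h" "Cod (hcat D) g = Cod (vcat D) k"
  using functor_homs[OF double_category_functors(1)[OF D] square_homs(1)[OF D s]]
    functor_homs[OF double_category_functors(2)[OF D] square_homs(1)[OF D s]]
    functor_homs[OF double_category_functors(3)[OF D] square_homs(2)[OF D s]]
    functor_homs[OF double_category_functors(4)[OF D] square_homs(2)[OF D s]] s
  by (auto simp: is_square_def homs_def)

lemma square_edges:
  assumes "double_category D" "s \<in> sqs D"
  shows "is_square D (sq_top D s) (sq_left D s) (sq_right D s) (sq_bot D s) s"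
  using assms by (simp add: is_square_def)

lemma square_hcomp:
  assumes D: "double_category D" and a: "is_square D f h k g a" and b: "is_square D f' k l g' b"
  shows "is_square D (Cmp (hcat D) f' f) h l (Cmp (hcat D) g' g) (Cmp (sqh D) b a)"
  using comp_in_homs[OF double_category_cats(3)[OF D] square_homs(1)[OF D a] square_homs(1)[OF D b]]
    functor_comp[OF double_category_functors(1)[OF D] square_homs(1)[OF D a] square_homs(1)[OF D b]]
    functor_comp[OF double_category_functors(2)[OF D] square_homs(1)[OF D a] square_homs(1)[OF D b]] a b
  by (auto simp: is_square_def homs_def)

lemma square_vcomp:
  assumes D: "double_category D" and a: "is_square D f h k g a" and b: "is_square D g h' k' g' b"
  shows "is_square D f (Cmp (vcat D) h' h) (Cmp (vcat D) k' k) g' (Cmp (sqv D) b a)"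
  using comp_in_homs[OF double_category_cats(4)[OF D] square_homs(2)[OF D a] square_homs(2)[OF D b]]
    functor_comp[OF double_category_functors(3)[OF D] square_homs(2)[OF D a] square_homs(2)[OF D b]]
    functor_comp[OF double_category_functors(4)[OF D] square_homs(2)[OF D a] square_homs(2)[OF D b]] a b
    double_category_cats(8)[OF D]
  by (auto simp: is_square_def homs_def)

lemma square_vid:
  assumes D: "double_category D" and f: "f \<in> homs (hcat D) A B"
  shows "is_square D f (Idn (vcat D) A) (Idn (vcat D) B) f (Idn (sqv D) f)"
proof -
  have fo: "f \<in> Obj (sqv D)"
    using f double_category_cats(7)[OF D] by (simp add: homs_def)
  show ?thesis
    using id_in_homs[OF double_category_cats(4)[OF D] fo] f double_category_cats(8)[OF D]
      functor_id[OF double_category_functors(3)[OF D] fo] functor_id[OF double_category_functors(4)[OF D] fo]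
    by (auto simp: is_square_def homs_def)
qed

lemma square_hid:
  assumes D: "double_category D" and u: "u \<in> homs (vcat D) A B"
  shows "is_square D (Idn (hcat D) A) u u (Idn (hcat D) B) (Idn (sqh D) u)"
proof -
  have uo: "u \<in> Obj (sqh D)"
    using u double_category_cats(6)[OF D] by (simp add: homs_def)
  show ?thesis
    using id_in_homs[OF double_category_cats(3)[OF D] uo] u
      functor_id[OF double_category_functors(1)[OF D] uo] functor_id[OF double_category_functors(2)[OF D] uo]
    by (auto simp: is_square_def homs_def)
qed

lemma interchange:
  assumes D: "double_category D"
    and "is_square D f h k g a" "is_square D f' k l g' b" "is_square D g h' k' g'' c" "is_square D g' k' l' g''' d"
  shows "Cmp (sqv D) (Cmp (sqh D) d c) (Cmp (sqh D) b a) = Cmp (sqh D) (Cmp (sqv D) d b) (Cmp (sqv D) c a)"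
proof -
  have "\<forall>a\<in>sqs D. \<forall>b\<in>sqs D. \<forall>c\<in>sqs D. \<forall>d\<in>sqs D.
       sq_right D a = sq_left D b \<longrightarrow> sq_right D c = sq_left D d \<longrightarrow>
       sq_bot D a = sq_top D c \<longrightarrow> sq_bot D b = sq_top D d \<longrightarrow>
       Cmp (sqv D) (Cmp (sqh D) d c) (Cmp (sqh D) b a) =
       Cmp (sqh D) (Cmp (sqv D) d b) (Cmp (sqv D) c a)"
    using D unfolding double_category_def by (elim conjE)
  then show ?thesis
    using assms(2-) unfolding is_square_def by metis
qed

subsection \<open>A functorial choice of shared isomorphisms\<close>

locale shared_isos =
  fixes D :: "('o, 'h, 'v, 's) dblcat" and \<phi> :: "'h \<Rightarrow> 'v"
  assumes dbl: "double_category D"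
    and bij: "\<And>A B. A \<in> obs D \<Longrightarrow> B \<in> obs D \<Longrightarrow> bij_betw \<phi> (isos (hcat D) A B) (isos (vcat D) A B)"
    and hsquare: "\<And>A A' B B' f g h k. f \<in> homs (hcat D) A A' \<Longrightarrow> g \<in> homs (hcat D) B B' \<Longrightarrow>
        h \<in> isos (hcat D) A B \<Longrightarrow> k \<in> isos (hcat D) A' B' \<Longrightarrow>
        (Cmp (hcat D) k f = Cmp (hcat D) g h \<longleftrightarrow> (\<exists>s. is_square D f (\<phi> h) (\<phi> k) g s)) \<and>
        unique_square D f (\<phi> h) (\<phi> k) g"
    and vsquare: "\<And>A A' B B' u u' h k. u \<in> homs (vcat D) A B \<Longrightarrow> u' \<in> homs (vcat D) A' B' \<Longrightarrow>
        h \<in> isos (hcat D) A A' \<Longrightarrow> k \<in> isos (hcat D) B B' \<Longrightarrow>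
        (Cmp (vcat D) u' (\<phi> h) = Cmp (vcat D) (\<phi> k) u \<longleftrightarrow> (\<exists>s. is_square D h u u' k s)) \<and>
        unique_square D h u u' k"
    and \<phi>_id: "\<And>A. A \<in> obs D \<Longrightarrow> \<phi> (Idn (hcat D) A) = Idn (vcat D) A"
    and \<phi>_comp: "\<And>A B E h k. h \<in> isos (hcat D) A B \<Longrightarrow> k \<in> isos (hcat D) B E \<Longrightarrow>
        \<phi> (Cmp (hcat D) k h) = Cmp (vcat D) (\<phi> k) (\<phi> h)"

text \<open>
  A bijection \<open>\<psi>\<close> witnessing shared isomorphisms need not be functorial: it may be twisted by a
  natural automorphism of the identity. Precomposing with the isomorphisms that \<open>\<psi>\<close> maps to
  identities removes the twist.
\<close>

lemma ex_shared_isos: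
  fixes D :: "('o, 'h, 'v, 's) dblcat"
  assumes D: "double_category D" and S: "has_shared_isos D"
  shows "\<exists>\<phi>. shared_isos D \<phi>"
proof -
  let ?H = "hcat D" and ?V = "vcat D"
  note cats = double_category_cats[OF D]
  note H = cats(1) and V = cats(2)
  obtain \<psi> where bij: "\<forall>A\<in>obs D. \<forall>B\<in>obs D. bij_betw \<psi> (isos ?H A B) (isos ?V A B)"
    and hs: "\<forall>A\<in>obs D. \<forall>A'\<in>obs D. \<forall>B\<in>obs D. \<forall>B'\<in>obs D.
      \<forall>f\<in>homs ?H A A'. \<forall>g\<in>homs ?H B B'. \<forall>h\<in>isos ?H A B. \<forall>k\<in>isos ?H A' B'.
        (Cmp ?H k f = Cmp ?H g h \<longleftrightarrow> (\<exists>s. is_square D f (\<psi> h) (\<psi> k) g s)) \<and>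
        unique_square D f (\<psi> h) (\<psi> k) g"
    and vs: "\<forall>A\<in>obs D. \<forall>A'\<in>obs D. \<forall>B\<in>obs D. \<forall>B'\<in>obs D.
      \<forall>u\<in>homs ?V A B. \<forall>u'\<in>homs ?V A' B'. \<forall>h\<in>isos ?H A A'. \<forall>k\<in>isos ?H B B'.
        (Cmp ?V u' (\<psi> h) = Cmp ?V (\<psi> k) u \<longleftrightarrow> (\<exists>s. is_square D h u u' k s)) \<and>
        unique_square D h u u' k"
    using S unfolding has_shared_isos_def by (elim exE conjE)
  have hsq: "(Cmp ?H k f = Cmp ?H g h \<longleftrightarrow> (\<exists>s. is_square D f (\<psi> h) (\<psi> k) g s)) \<and>
        unique_square D f (\<psi> h) (\<psi> k) g"
    if "f \<in> homs ?H A A'" "g \<in> homs ?H B B'" "h \<in> isos ?H A B" "k \<in> isos ?H A' B'" for f g h k A A' B B'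
    using hs that homs_obj[OF H that(1)] homs_obj[OF H that(2)] by simp
  have vsq: "(Cmp ?V u' (\<psi> h) = Cmp ?V (\<psi> k) u \<longleftrightarrow> (\<exists>s. is_square D h u u' k s)) \<and>
        unique_square D h u u' k"
    if "u \<in> homs ?V A B" "u' \<in> homs ?V A' B'" "h \<in> isos ?H A A'" "k \<in> isos ?H B B'" for u u' h k A A' B B'
    using vs that homs_obj[OF V that(1)] homs_obj[OF V that(2)] cats(5) by simp
  have \<psi>iso: "\<psi> h \<in> isos ?V A B" if "h \<in> isos ?H A B" for h A B
    using bij homs_obj[OF H isos_homs[OF that]] that by (auto simp: bij_betw_def)
  define j where "j A = inv_into (isos ?H A A) \<psi> (Idn ?V A)" for A
  have j: "j A \<in> isos ?H A A" "\<psi> (j A) = Idn ?V A" if A: "A \<in> obs D" for A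
  proof -
    have "Idn ?V A \<in> \<psi> ` isos ?H A A"
      using bij A id_iso[OF V, of A] cats(5) by (auto simp: bij_betw_def)
    then show "j A \<in> isos ?H A A" "\<psi> (j A) = Idn ?V A"
      unfolding j_def by (auto simp: inv_into_into f_inv_into_f)
  qed
  define z where "z A = \<psi> (Idn ?H A)" for A
  have z: "z A \<in> isos ?V A A" if "A \<in> obs D" for A
    unfolding z_def by (intro \<psi>iso id_iso[OF H that])
  \<comment> \<open>The vertical sides of the identity square of \<open>f\<close> are identities,
    that is, values of \<open>\<psi>\<close> at \<open>j\<close>; \<open>hsq\<close> reads this
    square as naturality of \<open>j\<close>.\<close>
  have j_natural: "Cmp ?H (j A') f = Cmp ?H f (j A)" if f: "f \<in> homs ?H A A'" for f A A'
  proof -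
    note ob = homs_obj[OF H f]
    have "is_square D f (\<psi> (j A)) (\<psi> (j A')) f (Idn (sqv D) f)"
      using square_vid[OF D f] j ob by simp
    then show ?thesis
      using hsq[OF f f j(1)[OF ob(1)] j(1)[OF ob(2)]] by blast
  qed
  \<comment> \<open>Dually, the horizontal identity square of \<open>u\<close> is read through
    \<open>vsq\<close>.\<close>
  have z_natural: "Cmp ?V u (z A) = Cmp ?V (z B) u" if u: "u \<in> homs ?V A B" for u A B
  proof -
    have ob: "A \<in> obs D" "B \<in> obs D"
      using homs_obj[OF V u] cats(5) by simp_all
    show ?thesis
      unfolding z_def using vsq[OF u u id_iso[OF H ob(1)] id_iso[OF H ob(2)]] square_hid[OF D u] by blast
  qed
  define \<phi> where "\<phi> h = \<psi> (Cmp ?H h (j (Dom ?H h)))" for h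
  have \<phi>: "\<phi> h = \<psi> (Cmp ?H h (j A))" if "h \<in> isos ?H A B" for h A B
    using that by (simp add: \<phi>_def isos_def homs_def)
  have hj: "Cmp ?H h (j A) \<in> isos ?H A B" if "h \<in> isos ?H A B" for h A B
    using comp_iso[OF H j(1) that] homs_obj[OF H isos_homs[OF that]] by simp
  \<comment> \<open>One square read through both conditions: \<open>hsq\<close> provides it, and
    \<open>vsq\<close> turns it into an equation. This exchanges the twist \<open>j\<close> on the
    horizontal side for the twist \<open>z\<close> on the vertical side; being natural, each cancels
    from its condition.\<close>
  have \<psi>_\<phi>: "\<psi> h = Cmp ?V (\<phi> h) (z A)" if h: "h \<in> isos ?H A B" for h A B
  proof -
    note ob = homs_obj[OF H isos_homs[OF h]]
    note idA = id_iso[OF H ob(1)]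
    have "Cmp ?H (Cmp ?H h (j A)) (Idn ?H A) = Cmp ?H h (j A)"
      by (rule comp_id(1)[OF H isos_homs[OF hj[OF h]]])
    then obtain s where "is_square D (Idn ?H A) (\<psi> (j A)) (\<psi> (Cmp ?H h (j A))) h s"
      using hsq[OF isos_homs[OF idA] isos_homs[OF h] j(1)[OF ob(1)] hj[OF h]] by blast
    then have "Cmp ?V (\<psi> (Cmp ?H h (j A))) (\<psi> (Idn ?H A)) = Cmp ?V (\<psi> h) (\<psi> (j A))"
      using vsq[OF isos_homs[OF \<psi>iso[OF j(1)[OF ob(1)]]] isos_homs[OF \<psi>iso[OF hj[OF h]]] idA h] by blast
    then show ?thesis
      using comp_id(1)[OF V isos_homs[OF \<psi>iso[OF h]]] j(2)[OF ob(1)] \<phi>[OF h] by (simp add: z_def)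
  qed
  have \<phi>iso: "\<phi> h \<in> isos ?V A B" if "h \<in> isos ?H A B" for h A B
    using \<phi>[OF that] \<psi>iso[OF hj[OF that]] by simp
  have hsquare: "(Cmp ?H k f = Cmp ?H g h \<longleftrightarrow> (\<exists>s. is_square D f (\<phi> h) (\<phi> k) g s)) \<and>
        unique_square D f (\<phi> h) (\<phi> k) g"
    if f: "f \<in> homs ?H A A'" and g: "g \<in> homs ?H B B'" and h: "h \<in> isos ?H A B" and k: "k \<in> isos ?H A' B'"
    for f g h k A A' B B'
  proof -
    note jA = j(1)[OF homs_obj(1)[OF H f]] and jA' = j(1)[OF homs_obj(2)[OF H f]]
    note hh = isos_homs[OF h] and kh = isos_homs[OF k]
    have "Cmp ?H (Cmp ?H k (j A')) f = Cmp ?H (Cmp ?H k f) (j A)"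
      using comp_assoc[OF H f isos_homs[OF jA'] kh] comp_assoc[OF H isos_homs[OF jA] f kh] j_natural[OF f]
      by simp
    moreover have "Cmp ?H g (Cmp ?H h (j A)) = Cmp ?H (Cmp ?H g h) (j A)"
      by (rule comp_assoc[OF H isos_homs[OF jA] hh g])
    ultimately have "Cmp ?H (Cmp ?H k (j A')) f = Cmp ?H g (Cmp ?H h (j A)) \<longleftrightarrow> Cmp ?H k f = Cmp ?H g h"
      using iso_cancel_right[OF H jA comp_in_homs[OF H f kh] comp_in_homs[OF H hh g]] by simp
    then show ?thesis
      using hsq[OF f g hj[OF h] hj[OF k]] \<phi>[OF h] \<phi>[OF k] by simp
  qed
  have vsquare: "(Cmp ?V u' (\<phi> h) = Cmp ?V (\<phi> k) u \<longleftrightarrow> (\<exists>s. is_square D h u u' k s)) \<and>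
        unique_square D h u u' k"
    if u: "u \<in> homs ?V A B" and u': "u' \<in> homs ?V A' B'" and h: "h \<in> isos ?H A A'" and k: "k \<in> isos ?H B B'"
    for u u' h k A A' B B'
  proof -
    have ob: "A \<in> obs D" "B \<in> obs D"
      using homs_obj[OF V u] cats(5) by simp_all
    note zA = z[OF ob(1)] and zB = z[OF ob(2)] and ph = isos_homs[OF \<phi>iso[OF h]] and pk = isos_homs[OF \<phi>iso[OF k]]
    have "Cmp ?V u' (\<psi> h) = Cmp ?V (Cmp ?V u' (\<phi> h)) (z A)"
      unfolding \<psi>_\<phi>[OF h] by (rule comp_assoc[OF V isos_homs[OF zA] ph u'])
    moreover have "Cmp ?V (\<psi> k) u = Cmp ?V (Cmp ?V (\<phi> k) u) (z A)"
      unfolding \<psi>_\<phi>[OF k]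
      using comp_assoc[OF V u isos_homs[OF zB] pk] comp_assoc[OF V isos_homs[OF zA] u pk] z_natural[OF u]
      by simp
    ultimately have "Cmp ?V u' (\<psi> h) = Cmp ?V (\<psi> k) u \<longleftrightarrow> Cmp ?V u' (\<phi> h) = Cmp ?V (\<phi> k) u"
      using iso_cancel_right[OF V zA comp_in_homs[OF V ph u'] comp_in_homs[OF V u pk]] by simp
    then show ?thesis
      using vsq[OF u u' h k] by simp
  qed
  have \<phi>_id: "\<phi> (Idn ?H A) = Idn ?V A" if A: "A \<in> obs D" for A
    using \<phi>[OF id_iso[OF H A]] comp_id(2)[OF H isos_homs[OF j(1)[OF A]]] j(2)[OF A] by simp
  \<comment> \<open>The same device: the trivial equation \<open>k h = (k h) id\<close> yields a
    square by \<open>hsquare\<close>, and \<open>vsquare\<close> reads it as the composition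
    law.\<close>
  have \<phi>_comp: "\<phi> (Cmp ?H k h) = Cmp ?V (\<phi> k) (\<phi> h)" if h: "h \<in> isos ?H A B" and k: "k \<in> isos ?H B E" for h k A B E
  proof -
    note ob = homs_obj(1)[OF H isos_homs[OF h]]
    note idA = id_iso[OF H ob] and kh = comp_iso[OF H h k]
    have "Cmp ?H k h = Cmp ?H (Cmp ?H k h) (Idn ?H A)"
      using comp_id(1)[OF H isos_homs[OF kh]] by simp
    then obtain s where "is_square D h (\<phi> (Idn ?H A)) (\<phi> k) (Cmp ?H k h) s"
      using hsquare[OF isos_homs[OF h] isos_homs[OF kh] idA k] by blast
    then have "Cmp ?V (\<phi> k) (\<phi> h) = Cmp ?V (\<phi> (Cmp ?H k h)) (\<phi> (Idn ?H A))"
      using vsquare[OF isos_homs[OF \<phi>iso[OF idA]] isos_homs[OF \<phi>iso[OF k]] h kh] by blast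
    then show ?thesis
      using comp_id(1)[OF V isos_homs[OF \<phi>iso[OF kh]]] \<phi>_id[OF ob] by simp
  qed
  have bij': "bij_betw \<phi> (isos ?H A B) (isos ?V A B)" if A: "A \<in> obs D" and B: "B \<in> obs D" for A B
  proof -
    note jA = j(1)[OF A]
    obtain j' where j': "j' \<in> isos ?H A A" "Cmp ?H j' (j A) = Idn ?H A"
      using jA by (rule isosE)
    have inj: "inj_on \<phi> (isos ?H A B)"
    proof
      fix h h' assume h: "h \<in> isos ?H A B" "h' \<in> isos ?H A B" and eq: "\<phi> h = \<phi> h'"
      then have "Cmp ?H h (j A) = Cmp ?H h' (j A)"
        using bij A B hj \<phi> by (simp add: bij_betw_def inj_on_def)
      then show "h = h'"
        using iso_cancel_right[OF H jA] isos_homs h by metis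
    qed
    have "w \<in> \<phi> ` isos ?H A B" if w: "w \<in> isos ?V A B" for w
    proof -
      obtain h where h: "h \<in> isos ?H A B" "w = \<psi> h"
        using bij_betw_imp_surj_on[OF bspec[OF bspec[OF bij A] B]] w by blast
      have hj': "Cmp ?H h j' \<in> isos ?H A B"
        by (rule comp_iso[OF H j'(1) h(1)])
      have "Cmp ?H (Cmp ?H h j') (j A) = h"
        using comp_assoc[OF H isos_homs[OF jA] isos_homs[OF j'(1)] isos_homs[OF h(1)]]
          comp_id(1)[OF H isos_homs[OF h(1)]] j'(2) by simp
      then have "w = \<phi> (Cmp ?H h j')"
        using \<phi>[OF hj'] h by simp
      then show ?thesis
        using hj' by blast
    qed
    then show ?thesis
      using inj \<phi>iso by (auto simp: bij_betw_def)
  qed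
  have "shared_isos D \<phi>"
    by unfold_locales (fact D bij' hsquare vsquare \<phi>_id \<phi>_comp)+
  then show ?thesis
    by blast
qed

context shared_isos
begin

abbreviation "H \<equiv> hcat D"
abbreviation "V \<equiv> vcat D"

lemmas cats = double_category_cats[OF dbl]
lemmas hcat = cats(1) and vcat = cats(2)

lemma \<phi>_iso: "h \<in> isos H A B \<Longrightarrow> \<phi> h \<in> isos V A B"
  using bij[of A B] homs_obj[OF hcat isos_homs[of h H A B]] by (auto simp: bij_betw_def)

lemma \<phi>_homs: "h \<in> isos H A B \<Longrightarrow> \<phi> h \<in> homs V A B"
  by (rule isos_homs[OF \<phi>_iso])

lemma \<phi>_inverse:
  assumes h: "h \<in> isos H A B" and g: "inverse_mors H h g"
  shows "g \<in> isos H B A" "inverse_mors V (\<phi> h) (\<phi> g)"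
proof -
  note g' = inverse_mors_homs[OF g isos_homs[OF h]]
  show gi: "g \<in> isos H B A"
    by (rule isosI[OF g'(1) inverse_mors_sym[OF g]])
  note ob = homs_obj[OF hcat isos_homs[OF h]]
  show "inverse_mors V (\<phi> h) (\<phi> g)"
    using \<phi>_comp[OF h gi] \<phi>_comp[OF gi h] g' \<phi>_id[OF ob(1)] \<phi>_id[OF ob(2)]
    by (intro inverse_morsI[OF \<phi>_homs[OF h] \<phi>_homs[OF gi]]) simp_all
qed

text \<open>The first of the four squares has identities on the right and at the bottom, so
  \<open>hsquare\<close> forces the horizontal part to be the preimage of the vertical part under
  \<open>\<phi>\<close>. Conversely, all four boundaries satisfy the equation in
  \<open>hsquare\<close>.\<close>

lemma shared_iso_iff: "shared_iso D A B p \<longleftrightarrow> fst p \<in> isos H A B \<and> snd p = \<phi> (fst p)"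
proof (cases p)
  case (Pair f f')
  show ?thesis
  proof
    assume "shared_iso D A B p"
    then obtain s where f: "f \<in> isos H A B" and f': "f' \<in> isos V A B"
      and s: "is_square D f f' (Idn V B) (Idn H B) s"
      by (auto simp: shared_iso_def Pair)
    note ob = homs_obj[OF hcat isos_homs[OF f]]
    note idB = id_iso[OF hcat ob(2)]
    obtain p' where p': "p' \<in> isos H A B" "f' = \<phi> p'"
      using bij[OF ob] f' by (auto simp: bij_betw_def)
    have "is_square D f (\<phi> p') (\<phi> (Idn H B)) (Idn H B) s"
      using s p' \<phi>_id[OF ob(2)] by simp
    then have "Cmp H (Idn H B) f = Cmp H (Idn H B) p'"
      using hsquare[OF isos_homs[OF f] isos_homs[OF idB] p'(1) idB] by blast
    then have "f = p'"
      using comp_id(2)[OF hcat isos_homs[OF f]] comp_id(2)[OF hcat isos_homs[OF p'(1)]] by simp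
    then show "fst p \<in> isos H A B \<and> snd p = \<phi> (fst p)"
      using f p' by (simp add: Pair)
  next
    assume "fst p \<in> isos H A B \<and> snd p = \<phi> (fst p)"
    then have f: "f \<in> isos H A B" and f': "f' = \<phi> f"
      by (simp_all add: Pair)
    note ob = homs_obj[OF hcat isos_homs[OF f]]
    note idA = id_iso[OF hcat ob(1)] and idB = id_iso[OF hcat ob(2)]
    obtain g where g: "g \<in> isos H B A" "inverse_mors H f g" "Cmp H g f = Idn H A" "Cmp H f g = Idn H B"
      using f by (rule isosE)
    note c = comp_id[OF hcat isos_homs[OF f]] comp_id[OF hcat isos_homs[OF g(1)]]
      comp_id[OF hcat isos_homs[OF idA]] comp_id[OF hcat isos_homs[OF idB]]
    have "\<exists>s. is_square D f (\<phi> f) (\<phi> (Idn H B)) (Idn H B) s"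
      using hsquare[OF isos_homs[OF f] isos_homs[OF idB] f idB] c by simp
    moreover have "\<exists>s. is_square D (Idn H A) (\<phi> (Idn H A)) (\<phi> f) f s"
      using hsquare[OF isos_homs[OF idA] isos_homs[OF f] idA f] c by simp
    moreover have "\<exists>s. is_square D f (\<phi> (Idn H A)) (\<phi> g) (Idn H A) s"
      using hsquare[OF isos_homs[OF f] isos_homs[OF idA] idA g(1)] c g by simp
    moreover have "\<exists>s. is_square D (Idn H A) (\<phi> f) (\<phi> (Idn H A)) g s"
      using hsquare[OF isos_homs[OF idA] isos_homs[OF g(1)] f idA] c g by simp
    ultimately show "shared_iso D A B p"
      using f f' \<phi>_iso[OF f] g(2) \<phi>_inverse(2)[OF f g(2)] \<phi>_id[OF ob(1)] \<phi>_id[OF ob(2)]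
      by (auto simp: shared_iso_def Pair)
  qed
qed

end

subsection \<open>Transposition\<close>

text \<open>Serves to obtain the statements on natural vertical transformations from their
  horizontal counterparts.\<close>

definition transpose_dbl :: "('o, 'h, 'v, 's) dblcat \<Rightarrow> ('o, 'v, 'h, 's) dblcat" where
  "transpose_dbl D = \<lparr>hcat = vcat D, vcat = hcat D, sqh = sqv D, sqv = sqh D\<rparr>"

definition transpose_dfun ::
    "('o1, 'h1, 'v1, 's1, 'o2, 'h2, 'v2, 's2) dfun \<Rightarrow> ('o1, 'v1, 'h1, 's1, 'o2, 'v2, 'h2, 's2) dfun" where
  "transpose_dfun F = \<lparr>onob = onob F, onhor = onver F, onver = onhor F, onsq = onsq F\<rparr>"

lemma transpose_dbl_sel [simp]:
  "hcat (transpose_dbl D) = vcat D" "vcat (transpose_dbl D) = hcat D"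
  "sqh (transpose_dbl D) = sqv D" "sqv (transpose_dbl D) = sqh D"
  by (simp_all add: transpose_dbl_def)

lemma transpose_dfun_sel [simp]:
  "onob (transpose_dfun F) = onob F" "onhor (transpose_dfun F) = onver F"
  "onver (transpose_dfun F) = onhor F" "onsq (transpose_dfun F) = onsq F"
  by (simp_all add: transpose_dfun_def)

lemma is_square_transpose:
  "double_category D \<Longrightarrow> is_square (transpose_dbl D) f h k g s \<longleftrightarrow> is_square D h f g k s"
  by (auto simp: is_square_def double_category_cats)

lemma double_category_transpose:
  assumes D: "double_category D"
  shows "double_category (transpose_dbl D)"
proof -
  note cats = double_category_cats[OF D]
  have "Cmp (sqh D) (Cmp (sqv D) d c) (Cmp (sqv D) b a) = Cmp (sqv D) (Cmp (sqh D) d b) (Cmp (sqh D) c a)"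
    if "a \<in> sqs D" "b \<in> sqs D" "c \<in> sqs D" "d \<in> sqs D" "sq_bot D a = sq_top D b" "sq_bot D c = sq_top D d"
      "sq_right D a = sq_left D c" "sq_right D b = sq_left D d" for a b c d
    by (rule interchange[OF D square_edges[OF D], symmetric]) (use that in \<open>auto simp: is_square_def\<close>)
  then show ?thesis
    using cats double_category_functors[OF D] double_category_ids[OF D]
    unfolding double_category_def transpose_dbl_sel
    by (simp add: homs_def)
qed

lemma double_functor_transpose:
  "double_category C \<Longrightarrow> double_functor (transpose_dbl C) (transpose_dbl D) (transpose_dfun F) \<longleftrightarrow> double_functor C D F"
  by (auto simp: double_functor_def double_category_cats)

lemma vertical_natural_transpose:
  assumes "double_category C" "double_category D"
  shows "vertical_natural C D F G \<theta> \<longleftrightarrow>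
    horizontal_natural (transpose_dbl C) (transpose_dbl D) (transpose_dfun F) (transpose_dfun G) \<theta>"
  unfolding vertical_natural_def horizontal_natural_def
  by (simp add: double_category_cats[OF assms(1)] is_square_transpose[OF assms(2)])

subsection \<open>Double functors and natural transformations\<close>

lemma double_functorD:
  assumes "double_functor C D F"
  shows "is_functor (hcat C) (hcat D) (onob F) (onhor F)" "is_functor (vcat C) (vcat D) (onob F) (onver F)"
    "is_functor (sqh C) (sqh D) (onver F) (onsq F)" "is_functor (sqv C) (sqv D) (onhor F) (onsq F)"
    "onob F \<in> extensional (obs C)" "onhor F \<in> extensional (hors C)" "onver F \<in> extensional (vers C)"
    "onsq F \<in> extensional (sqs C)"
  using assms by (simp_all add: double_functor_def)

lemma dfun_square:
  assumes C: "double_category C" and D: "double_category D" and F: "double_functor C D F"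
    and s: "is_square C f h k g s"
  shows "is_square D (onhor F f) (onver F h) (onver F k) (onhor F g) (onsq F s)"
  using functor_homs[OF double_functorD(3)[OF F] square_homs(1)[OF C s]]
    functor_homs[OF double_functorD(4)[OF F] square_homs(2)[OF C s]]
  by (auto simp: is_square_def homs_def)

lemma dfun_ob:
  assumes "double_functor C D F" "A \<in> obs C"
  shows "onob F A \<in> obs D"
  using double_functorD(1)[OF assms(1)] assms(2) by (auto simp: is_functor_def)

lemma horizontal_naturalE:
  assumes "horizontal_natural C D F G \<theta>"
  obtains \<tau> where
    "\<And>A. A \<in> obs C \<Longrightarrow> \<theta> A \<in> homs (hcat D) (onob F A) (onob G A)"
    "\<And>A B f. f \<in> homs (hcat C) A B \<Longrightarrow> Cmp (hcat D) (onhor G f) (\<theta> A) = Cmp (hcat D) (\<theta> B) (onhor F f)"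
    "\<And>A B u. u \<in> homs (vcat C) A B \<Longrightarrow> is_square D (\<theta> A) (onver F u) (onver G u) (\<theta> B) (\<tau> u)"
    "\<And>A. A \<in> obs C \<Longrightarrow> \<tau> (Idn (vcat C) A) = Idn (sqv D) (\<theta> A)"
    "\<And>u w A B E. u \<in> homs (vcat C) A B \<Longrightarrow> w \<in> homs (vcat C) B E \<Longrightarrow>
         \<tau> (Cmp (vcat C) w u) = Cmp (sqv D) (\<tau> w) (\<tau> u)"
    "\<And>f h k g s. is_square C f h k g s \<Longrightarrow> Cmp (sqh D) (\<tau> k) (onsq F s) = Cmp (sqh D) (onsq G s) (\<tau> h)"
proof -
  have 1: "\<forall>A\<in>obs C. \<theta> A \<in> homs (hcat D) (onob F A) (onob G A)"
    and 2: "\<forall>f\<in>hors C. Cmp (hcat D) (onhor G f) (\<theta> (Dom (hcat C) f)) =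
                 Cmp (hcat D) (\<theta> (Cod (hcat C) f)) (onhor F f)"
    and 3: "\<exists>\<tau>.
      (\<forall>u\<in>vers C. is_square D (\<theta> (Dom (vcat C) u)) (onver F u) (onver G u)
                    (\<theta> (Cod (vcat C) u)) (\<tau> u)) \<and>
      (\<forall>A\<in>obs C. \<tau> (Idn (vcat C) A) = Idn (sqv D) (\<theta> A)) \<and>
      (\<forall>u\<in>vers C. \<forall>w\<in>vers C. Cod (vcat C) u = Dom (vcat C) w \<longrightarrow>
         \<tau> (Cmp (vcat C) w u) = Cmp (sqv D) (\<tau> w) (\<tau> u)) \<and>
      (\<forall>s\<in>sqs C. Cmp (sqh D) (\<tau> (sq_right C s)) (onsq F s) =
                  Cmp (sqh D) (onsq G s) (\<tau> (sq_left C s)))"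
    using assms unfolding horizontal_natural_def by simp_all
  from 3 obtain \<tau> where \<tau>: "\<forall>u\<in>vers C. is_square D (\<theta> (Dom (vcat C) u)) (onver F u) (onver G u)
                    (\<theta> (Cod (vcat C) u)) (\<tau> u)"
    "\<forall>A\<in>obs C. \<tau> (Idn (vcat C) A) = Idn (sqv D) (\<theta> A)"
    "\<forall>u\<in>vers C. \<forall>w\<in>vers C. Cod (vcat C) u = Dom (vcat C) w \<longrightarrow>
         \<tau> (Cmp (vcat C) w u) = Cmp (sqv D) (\<tau> w) (\<tau> u)"
    "\<forall>s\<in>sqs C. Cmp (sqh D) (\<tau> (sq_right C s)) (onsq F s) =
                  Cmp (sqh D) (onsq G s) (\<tau> (sq_left C s))"
    by (elim exE conjE)
  show thesis
    by (rule that[of \<tau>]) (use 1 2 \<tau> in \<open>auto simp: homs_def is_square_def\<close>)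
qed

lemma horizontal_naturalI:
  assumes
    "\<And>A. A \<in> obs C \<Longrightarrow> \<theta> A \<in> homs (hcat D) (onob F A) (onob G A)"
    "\<And>A B f. f \<in> homs (hcat C) A B \<Longrightarrow> Cmp (hcat D) (onhor G f) (\<theta> A) = Cmp (hcat D) (\<theta> B) (onhor F f)"
    "\<And>A B u. u \<in> homs (vcat C) A B \<Longrightarrow> is_square D (\<theta> A) (onver F u) (onver G u) (\<theta> B) (\<tau> u)"
    "\<And>A. A \<in> obs C \<Longrightarrow> \<tau> (Idn (vcat C) A) = Idn (sqv D) (\<theta> A)"
    "\<And>u w A B E. u \<in> homs (vcat C) A B \<Longrightarrow> w \<in> homs (vcat C) B E \<Longrightarrow>
         \<tau> (Cmp (vcat C) w u) = Cmp (sqv D) (\<tau> w) (\<tau> u)"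
    "\<And>f h k g s. is_square C f h k g s \<Longrightarrow> Cmp (sqh D) (\<tau> k) (onsq F s) = Cmp (sqh D) (onsq G s) (\<tau> h)"
  shows "horizontal_natural C D F G \<theta>"
  unfolding horizontal_natural_def
proof (intro conjI exI[of _ \<tau>] ballI impI)
  show "\<tau> (Cmp (vcat C) w u) = Cmp (sqv D) (\<tau> w) (\<tau> u)"
    if "u \<in> vers C" "w \<in> vers C" "Cod (vcat C) u = Dom (vcat C) w" for u w
    by (rule assms(5)[of u "Dom (vcat C) u" "Cod (vcat C) u"]) (use that in \<open>auto simp: homs_def\<close>)
  show "Cmp (sqh D) (\<tau> (sq_right C s)) (onsq F s) = Cmp (sqh D) (onsq G s) (\<tau> (sq_left C s))"
    if "s \<in> sqs C" for s
    by (rule assms(6)[of "sq_top C s" _ _ "sq_bot C s"]) (use that in \<open>auto simp: is_square_def\<close>)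
qed (use assms(1,4) assms(2)[OF mor_in_homs] assms(3)[OF mor_in_homs] in \<open>simp_all\<close>)

lemma horizontal_natural_hor:
  assumes "horizontal_natural C D F G \<theta>" "f \<in> homs (hcat C) A B"
  shows "Cmp (hcat D) (onhor G f) (\<theta> A) = Cmp (hcat D) (\<theta> B) (onhor F f)"
  using assms by (auto simp: horizontal_natural_def homs_def)

lemma horizontal_natural_square:
  assumes "horizontal_natural C D F G \<theta>" "u \<in> homs (vcat C) A B"
  shows "\<exists>s. is_square D (\<theta> A) (onver F u) (onver G u) (\<theta> B) s"
  by (rule horizontal_naturalE[OF assms(1)]) (use assms(2) in blast)

lemma vertical_natural_ver:
  assumes "vertical_natural C D F G \<theta>" "u \<in> homs (vcat C) A B"
  shows "Cmp (vcat D) (onver G u) (\<theta> A) = Cmp (vcat D) (\<theta> B) (onver F u)"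
  using assms by (auto simp: vertical_natural_def homs_def)

text \<open>Components of a natural isomorphism are restricted to the objects, while naturality is
  proved for unrestricted expressions; this passes from one to the other.\<close>

lemma horizontal_natural_cong:
  assumes C: "double_category C" and eq: "\<And>A. A \<in> obs C \<Longrightarrow> \<theta> A = \<theta>' A"
    and n: "horizontal_natural C D F G \<theta>"
  shows "horizontal_natural C D F G \<theta>'"
proof -
  note h = homs_obj[OF double_category_cats(1)[OF C]] homs_obj[OF double_category_cats(2)[OF C]]
  show ?thesis
    by (rule horizontal_naturalE[OF n], rule horizontal_naturalI)
      (use eq h double_category_cats(5)[OF C] in simp_all)
qed

lemma horizontal_natural_id:
  assumes C: "double_category C" and D: "double_category D" and F: "double_functor C D F"
  shows "horizontal_natural C D F F (\<lambda>A. Idn (hcat D) (onob F A))"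
proof (rule horizontal_naturalI[where \<tau> = "\<lambda>u. Idn (sqh D) (onver F u)"])
  note cD = double_category_cats[OF D] and cC = double_category_cats[OF C]
  note FD = double_functorD[OF F]
  show "Idn (hcat D) (onob F A) \<in> homs (hcat D) (onob F A) (onob F A)" if "A \<in> obs C" for A
    by (rule id_in_homs[OF cD(1) dfun_ob[OF F that]])
  show "Cmp (hcat D) (onhor F f) (Idn (hcat D) (onob F A)) = Cmp (hcat D) (Idn (hcat D) (onob F B)) (onhor F f)"
    if "f \<in> homs (hcat C) A B" for A B f
    using comp_id[OF cD(1) functor_homs[OF FD(1) that]] by simp
  show "is_square D (Idn (hcat D) (onob F A)) (onver F u) (onver F u) (Idn (hcat D) (onob F B)) (Idn (sqh D) (onver F u))"
    if "u \<in> homs (vcat C) A B" for A B u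
    by (rule square_hid[OF D functor_homs[OF FD(2) that]])
  show "Idn (sqh D) (onver F (Idn (vcat C) A)) = Idn (sqv D) (Idn (hcat D) (onob F A))" if "A \<in> obs C" for A
    using functor_id[OF FD(2)] double_category_ids(1)[OF D dfun_ob[OF F that]] that cC(5) by simp
  show "Idn (sqh D) (onver F (Cmp (vcat C) w u)) = Cmp (sqv D) (Idn (sqh D) (onver F w)) (Idn (sqh D) (onver F u))"
    if "u \<in> homs (vcat C) A B" "w \<in> homs (vcat C) B E" for u w A B E
    using functor_comp[OF FD(2) that] double_category_ids(3)[OF D functor_homs[OF FD(2) that(1)] functor_homs[OF FD(2) that(2)]]
    by simp
  show "Cmp (sqh D) (Idn (sqh D) (onver F k)) (onsq F s) = Cmp (sqh D) (onsq F s) (Idn (sqh D) (onver F h))"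
    if "is_square C f h k g s" for f h k g s
    using comp_id[OF cD(3) square_homs(1)[OF D dfun_square[OF C D F that]]] by simp
qed

lemma horizontal_natural_comp:
  assumes C: "double_category C" and D: "double_category D"
    and F: "double_functor C D F" "double_functor C D G" "double_functor C D K"
    and \<theta>: "horizontal_natural C D F G \<theta>" and \<eta>: "horizontal_natural C D G K \<eta>"
  shows "horizontal_natural C D F K (\<lambda>A. Cmp (hcat D) (\<eta> A) (\<theta> A))"
proof (rule horizontal_naturalE[OF \<theta>], rule horizontal_naturalE[OF \<eta>])
  fix \<tau> \<sigma>
  note cD = double_category_cats[OF D] and cC = double_category_cats[OF C]
  note hobj = homs_obj[OF cC(1)]
  assume th: "\<And>A. A \<in> obs C \<Longrightarrow> \<theta> A \<in> homs (hcat D) (onob F A) (onob G A)"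
    and tn: "\<And>A B f. f \<in> homs (hcat C) A B \<Longrightarrow> Cmp (hcat D) (onhor G f) (\<theta> A) = Cmp (hcat D) (\<theta> B) (onhor F f)"
    and ts: "\<And>A B u. u \<in> homs (vcat C) A B \<Longrightarrow> is_square D (\<theta> A) (onver F u) (onver G u) (\<theta> B) (\<tau> u)"
    and ti: "\<And>A. A \<in> obs C \<Longrightarrow> \<tau> (Idn (vcat C) A) = Idn (sqv D) (\<theta> A)"
    and tc: "\<And>u w A B E. u \<in> homs (vcat C) A B \<Longrightarrow> w \<in> homs (vcat C) B E \<Longrightarrow>
         \<tau> (Cmp (vcat C) w u) = Cmp (sqv D) (\<tau> w) (\<tau> u)"
    and tq: "\<And>f h k g s. is_square C f h k g s \<Longrightarrow> Cmp (sqh D) (\<tau> k) (onsq F s) = Cmp (sqh D) (onsq G s) (\<tau> h)"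
    and eh: "\<And>A. A \<in> obs C \<Longrightarrow> \<eta> A \<in> homs (hcat D) (onob G A) (onob K A)"
    and en: "\<And>A B f. f \<in> homs (hcat C) A B \<Longrightarrow> Cmp (hcat D) (onhor K f) (\<eta> A) = Cmp (hcat D) (\<eta> B) (onhor G f)"
    and es: "\<And>A B u. u \<in> homs (vcat C) A B \<Longrightarrow> is_square D (\<eta> A) (onver G u) (onver K u) (\<eta> B) (\<sigma> u)"
    and ei: "\<And>A. A \<in> obs C \<Longrightarrow> \<sigma> (Idn (vcat C) A) = Idn (sqv D) (\<eta> A)"
    and ec: "\<And>u w A B E. u \<in> homs (vcat C) A B \<Longrightarrow> w \<in> homs (vcat C) B E \<Longrightarrow>
         \<sigma> (Cmp (vcat C) w u) = Cmp (sqv D) (\<sigma> w) (\<sigma> u)"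
    and eq: "\<And>f h k g s. is_square C f h k g s \<Longrightarrow> Cmp (sqh D) (\<sigma> k) (onsq G s) = Cmp (sqh D) (onsq K s) (\<sigma> h)"
  show ?thesis
  proof (rule horizontal_naturalI[where \<tau> = "\<lambda>u. Cmp (sqh D) (\<sigma> u) (\<tau> u)"])
    show "Cmp (hcat D) (\<eta> A) (\<theta> A) \<in> homs (hcat D) (onob F A) (onob K A)" if "A \<in> obs C" for A
      by (rule comp_in_homs[OF cD(1) th[OF that] eh[OF that]])
    show "Cmp (hcat D) (onhor K f) (Cmp (hcat D) (\<eta> A) (\<theta> A)) = Cmp (hcat D) (Cmp (hcat D) (\<eta> B) (\<theta> B)) (onhor F f)"
      if f: "f \<in> homs (hcat C) A B" for A B f
    proof -
      note A = hobj(1)[OF f] and B = hobj(2)[OF f]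
      note Ff = functor_homs[OF double_functorD(1)[OF F(1)] f] functor_homs[OF double_functorD(1)[OF F(2)] f]
        functor_homs[OF double_functorD(1)[OF F(3)] f]
      show ?thesis
        using comp_assoc[OF cD(1) th[OF A] eh[OF A] Ff(3)] comp_assoc[OF cD(1) th[OF A] Ff(2) eh[OF B]]
          comp_assoc[OF cD(1) Ff(1) th[OF B] eh[OF B]] tn[OF f] en[OF f] by simp
    qed
    show "is_square D (Cmp (hcat D) (\<eta> A) (\<theta> A)) (onver F u) (onver K u) (Cmp (hcat D) (\<eta> B) (\<theta> B)) (Cmp (sqh D) (\<sigma> u) (\<tau> u))"
      if "u \<in> homs (vcat C) A B" for A B u
      by (rule square_hcomp[OF D ts[OF that] es[OF that]])
    show "Cmp (sqh D) (\<sigma> (Idn (vcat C) A)) (\<tau> (Idn (vcat C) A)) = Idn (sqv D) (Cmp (hcat D) (\<eta> A) (\<theta> A))"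
      if "A \<in> obs C" for A
      using double_category_ids(2)[OF D th[OF that] eh[OF that]] ti[OF that] ei[OF that] by simp
    show "Cmp (sqh D) (\<sigma> (Cmp (vcat C) w u)) (\<tau> (Cmp (vcat C) w u)) =
        Cmp (sqv D) (Cmp (sqh D) (\<sigma> w) (\<tau> w)) (Cmp (sqh D) (\<sigma> u) (\<tau> u))"
      if u: "u \<in> homs (vcat C) A B" and w: "w \<in> homs (vcat C) B E" for u w A B E
      using interchange[OF D ts[OF u] es[OF u] ts[OF w] es[OF w]] tc[OF u w] ec[OF u w] by simp
    show "Cmp (sqh D) (Cmp (sqh D) (\<sigma> k) (\<tau> k)) (onsq F s) = Cmp (sqh D) (onsq K s) (Cmp (sqh D) (\<sigma> h) (\<tau> h))"
      if s: "is_square C f h k g s" for f h k g s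
    proof -
      note b = square_boundary[OF C s]
      have h: "h \<in> homs (vcat C) (Dom (vcat C) h) (Cod (vcat C) h)"
        and k: "k \<in> homs (vcat C) (Dom (vcat C) k) (Cod (vcat C) k)"
        using b by (auto intro: mor_in_homs)
      note sh = square_homs(1)[OF D]
      note Fs = sh[OF dfun_square[OF C D F(1) s]] sh[OF dfun_square[OF C D F(2) s]] sh[OF dfun_square[OF C D F(3) s]]
      show ?thesis
        using comp_assoc[OF cD(3) Fs(1) sh[OF ts[OF k]] sh[OF es[OF k]]]
          comp_assoc[OF cD(3) sh[OF ts[OF h]] Fs(2) sh[OF es[OF k]]]
          comp_assoc[OF cD(3) sh[OF ts[OF h]] sh[OF es[OF h]] Fs(3)] tq[OF s] eq[OF s] by simp
    qed
  qed
qed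

text \<open>The inverse squares are chosen by \<open>ex\<close>; uniqueness relative to the boundary
  makes them inverse to \<open>\<tau>\<close> and compatible with identities and composition. The
  hypotheses do not mention \<open>\<phi>\<close>, so that the lemma also applies after
  transposition, where existence and uniqueness come from the other condition on shared
  isomorphisms.\<close>

lemma horizontal_natural_inverse:
  assumes C: "double_category C" and D: "double_category D"
    and F: "double_functor C D F" "double_functor C D G"
    and \<theta>: "horizontal_natural C D F G \<theta>" and \<kappa>: "\<And>A. A \<in> obs C \<Longrightarrow> inverse_mors (hcat D) (\<theta> A) (\<kappa> A)"
    and ex: "\<And>u A B. u \<in> homs (vcat C) A B \<Longrightarrow> \<exists>s. is_square D (\<kappa> A) (onver G u) (onver F u) (\<kappa> B) s"
    and un: "\<And>u A B. u \<in> homs (vcat C) A B \<Longrightarrow> unique_square D (\<kappa> A) (onver G u) (onver F u) (\<kappa> B)"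
    and un_id: "\<And>u A B. u \<in> homs (vcat D) A B \<Longrightarrow> unique_square D (Idn (hcat D) A) u u (Idn (hcat D) B)"
  shows "horizontal_natural C D G F \<kappa>"
proof (rule horizontal_naturalE[OF \<theta>])
  fix \<tau>
  note cD = double_category_cats[OF D] and cC = double_category_cats[OF C]
  note hobj = homs_obj[OF cC(1)] and vobj = homs_obj[OF cC(2), unfolded cC(5)]
  assume th: "\<And>A. A \<in> obs C \<Longrightarrow> \<theta> A \<in> homs (hcat D) (onob F A) (onob G A)"
    and tn: "\<And>A B f. f \<in> homs (hcat C) A B \<Longrightarrow> Cmp (hcat D) (onhor G f) (\<theta> A) = Cmp (hcat D) (\<theta> B) (onhor F f)"
    and ts: "\<And>A B u. u \<in> homs (vcat C) A B \<Longrightarrow> is_square D (\<theta> A) (onver F u) (onver G u) (\<theta> B) (\<tau> u)"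
    and tq: "\<And>f h k g s. is_square C f h k g s \<Longrightarrow> Cmp (sqh D) (\<tau> k) (onsq F s) = Cmp (sqh D) (onsq G s) (\<tau> h)"
  have kh: "\<kappa> A \<in> homs (hcat D) (onob G A) (onob F A)" "Cmp (hcat D) (\<kappa> A) (\<theta> A) = Idn (hcat D) (onob F A)"
    "Cmp (hcat D) (\<theta> A) (\<kappa> A) = Idn (hcat D) (onob G A)" if "A \<in> obs C" for A
    using inverse_mors_homs[OF \<kappa>[OF that] th[OF that]] by auto
  define \<sigma> where "\<sigma> u = (SOME s. is_square D (\<kappa> (Dom (vcat C) u)) (onver G u) (onver F u) (\<kappa> (Cod (vcat C) u)) s)" for u
  have ss: "is_square D (\<kappa> A) (onver G u) (onver F u) (\<kappa> B) (\<sigma> u)" if u: "u \<in> homs (vcat C) A B" for u A B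
    using someI_ex[OF ex[OF u]] u by (simp add: \<sigma>_def homs_def)
  have FG: "onver F u \<in> homs (vcat D) (onob F A) (onob F B)" "onver G u \<in> homs (vcat D) (onob G A) (onob G B)"
    if "u \<in> homs (vcat C) A B" for u A B
    using functor_homs[OF double_functorD(2)[OF F(1)] that] functor_homs[OF double_functorD(2)[OF F(2)] that] by auto
  have st: "Cmp (sqh D) (\<sigma> u) (\<tau> u) = Idn (sqh D) (onver F u)" "Cmp (sqh D) (\<tau> u) (\<sigma> u) = Idn (sqh D) (onver G u)"
    if u: "u \<in> homs (vcat C) A B" for u A B
  proof -
    note ob = vobj[OF u]
    show "Cmp (sqh D) (\<sigma> u) (\<tau> u) = Idn (sqh D) (onver F u)"
      using square_hcomp[OF D ts[OF u] ss[OF u]] square_hid[OF D FG(1)[OF u]] un_id[OF FG(1)[OF u]]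
      unfolding unique_square_def kh(2)[OF ob(1)] kh(2)[OF ob(2)] by blast
    show "Cmp (sqh D) (\<tau> u) (\<sigma> u) = Idn (sqh D) (onver G u)"
      using square_hcomp[OF D ss[OF u] ts[OF u]] square_hid[OF D FG(2)[OF u]] un_id[OF FG(2)[OF u]]
      unfolding unique_square_def kh(3)[OF ob(1)] kh(3)[OF ob(2)] by blast
  qed
  show ?thesis
  proof (rule horizontal_naturalI[where \<tau> = \<sigma>])
    show "\<kappa> A \<in> homs (hcat D) (onob G A) (onob F A)" if "A \<in> obs C" for A
      by (rule kh(1)[OF that])
    show "is_square D (\<kappa> A) (onver G u) (onver F u) (\<kappa> B) (\<sigma> u)" if "u \<in> homs (vcat C) A B" for A B u
      by (rule ss[OF that])
    show "Cmp (hcat D) (onhor F f) (\<kappa> A) = Cmp (hcat D) (\<kappa> B) (onhor G f)"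
      if f: "f \<in> homs (hcat C) A B" for A B f
    proof -
      note A = hobj(1)[OF f] and B = hobj(2)[OF f]
      note Ff = functor_homs[OF double_functorD(1)[OF F(1)] f] functor_homs[OF double_functorD(1)[OF F(2)] f]
      have "Cmp (hcat D) (onhor F f) (\<kappa> A) = Cmp (hcat D) (Cmp (hcat D) (\<kappa> B) (\<theta> B)) (Cmp (hcat D) (onhor F f) (\<kappa> A))"
        using kh(2)[OF B] comp_id(2)[OF cD(1) comp_in_homs[OF cD(1) kh(1)[OF A] Ff(1)]] by simp
      also have "\<dots> = Cmp (hcat D) (\<kappa> B) (Cmp (hcat D) (Cmp (hcat D) (\<theta> B) (onhor F f)) (\<kappa> A))"
        using comp_assoc[OF cD(1) comp_in_homs[OF cD(1) kh(1)[OF A] Ff(1)] th[OF B] kh(1)[OF B]]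
          comp_assoc[OF cD(1) kh(1)[OF A] Ff(1) th[OF B]] by simp
      also have "\<dots> = Cmp (hcat D) (\<kappa> B) (Cmp (hcat D) (onhor G f) (Cmp (hcat D) (\<theta> A) (\<kappa> A)))"
        using tn[OF f] comp_assoc[OF cD(1) kh(1)[OF A] th[OF A] Ff(2)] by simp
      also have "\<dots> = Cmp (hcat D) (\<kappa> B) (onhor G f)"
        using kh(3)[OF A] comp_id(1)[OF cD(1) Ff(2)] by simp
      finally show ?thesis .
    qed
    show "\<sigma> (Idn (vcat C) A) = Idn (sqv D) (\<kappa> A)" if A: "A \<in> obs C" for A
    proof -
      have idA: "Idn (vcat C) A \<in> homs (vcat C) A A"
        using id_in_homs[OF cC(2)] A cC(5) by simp
      have "onver F (Idn (vcat C) A) = Idn (vcat D) (onob F A)" "onver G (Idn (vcat C) A) = Idn (vcat D) (onob G A)"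
        using functor_id[OF double_functorD(2)[OF F(1)]] functor_id[OF double_functorD(2)[OF F(2)]] A cC(5) by auto
      then show ?thesis
        using ss[OF idA] un[OF idA] square_vid[OF D kh(1)[OF A]] unfolding unique_square_def by simp
    qed
    show "\<sigma> (Cmp (vcat C) w u) = Cmp (sqv D) (\<sigma> w) (\<sigma> u)"
      if u: "u \<in> homs (vcat C) A B" and w: "w \<in> homs (vcat C) B E" for u w A B E
    proof -
      note wu = comp_in_homs[OF cC(2) u w]
      have "is_square D (\<kappa> A) (onver G (Cmp (vcat C) w u)) (onver F (Cmp (vcat C) w u)) (\<kappa> E) (Cmp (sqv D) (\<sigma> w) (\<sigma> u))"
        using square_vcomp[OF D ss[OF u] ss[OF w]] functor_comp[OF double_functorD(2)[OF F(1)] u w]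
          functor_comp[OF double_functorD(2)[OF F(2)] u w] by simp
      then show ?thesis
        using ss[OF wu] un[OF wu] unfolding unique_square_def by blast
    qed
    show "Cmp (sqh D) (\<sigma> k) (onsq G s) = Cmp (sqh D) (onsq F s) (\<sigma> h)"
      if s: "is_square C f h k g s" for f h k g s
    proof -
      note b = square_boundary[OF C s]
      have h: "h \<in> homs (vcat C) (Dom (vcat C) h) (Cod (vcat C) h)"
        and k: "k \<in> homs (vcat C) (Dom (vcat C) k) (Cod (vcat C) k)"
        using b by (auto intro: mor_in_homs)
      note sh = square_homs(1)[OF D]
      note Fs = sh[OF dfun_square[OF C D F(1) s]] sh[OF dfun_square[OF C D F(2) s]]
      note t = sh[OF ts[OF h]] sh[OF ts[OF k]] sh[OF ss[OF h]] sh[OF ss[OF k]]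
      note Fsh = comp_in_homs[OF cD(3) t(3) Fs(1)]
      have "Cmp (sqh D) (onsq F s) (\<sigma> h) = Cmp (sqh D) (Cmp (sqh D) (\<sigma> k) (\<tau> k)) (Cmp (sqh D) (onsq F s) (\<sigma> h))"
        using st(1)[OF k] comp_id(2)[OF cD(3) Fsh] by simp
      also have "\<dots> = Cmp (sqh D) (\<sigma> k) (Cmp (sqh D) (Cmp (sqh D) (\<tau> k) (onsq F s)) (\<sigma> h))"
        using comp_assoc[OF cD(3) Fsh t(2) t(4)] comp_assoc[OF cD(3) t(3) Fs(1) t(2)] by simp
      also have "\<dots> = Cmp (sqh D) (\<sigma> k) (Cmp (sqh D) (onsq G s) (Cmp (sqh D) (\<tau> h) (\<sigma> h)))"
        using tq[OF s] comp_assoc[OF cD(3) t(3) t(1) Fs(2)] by simp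
      also have "\<dots> = Cmp (sqh D) (\<sigma> k) (onsq G s)"
        using st(2)[OF h] comp_id(1)[OF cD(3) Fs(2)] by simp
      finally show ?thesis
        by simp
    qed
  qed
qed

lemma horizontal_natural_whisker:
  assumes B: "double_category B" and C: "double_category C" and P: "double_functor B C P"
    and \<theta>: "horizontal_natural C D F G \<theta>"
  shows "horizontal_natural B D (dfun_comp B F P) (dfun_comp B G P) (\<lambda>A. \<theta> (onob P A))"
proof (rule horizontal_naturalE[OF \<theta>])
  fix \<tau>
  note cB = double_category_cats[OF B] and PD = double_functorD[OF P]
  note vobj = homs_obj[OF cB(2), unfolded cB(5)]
  assume t: "\<And>A. A \<in> obs C \<Longrightarrow> \<theta> A \<in> homs (hcat D) (onob F A) (onob G A)"
    "\<And>A B f. f \<in> homs (hcat C) A B \<Longrightarrow> Cmp (hcat D) (onhor G f) (\<theta> A) = Cmp (hcat D) (\<theta> B) (onhor F f)"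
    "\<And>A B u. u \<in> homs (vcat C) A B \<Longrightarrow> is_square D (\<theta> A) (onver F u) (onver G u) (\<theta> B) (\<tau> u)"
    "\<And>A. A \<in> obs C \<Longrightarrow> \<tau> (Idn (vcat C) A) = Idn (sqv D) (\<theta> A)"
    "\<And>u w A B E. u \<in> homs (vcat C) A B \<Longrightarrow> w \<in> homs (vcat C) B E \<Longrightarrow>
         \<tau> (Cmp (vcat C) w u) = Cmp (sqv D) (\<tau> w) (\<tau> u)"
    "\<And>f h k g s. is_square C f h k g s \<Longrightarrow> Cmp (sqh D) (\<tau> k) (onsq F s) = Cmp (sqh D) (onsq G s) (\<tau> h)"
  show ?thesis
  proof (rule horizontal_naturalI[where \<tau> = "\<lambda>u. \<tau> (onver P u)"])
    show "\<theta> (onob P A) \<in> homs (hcat D) (onob (dfun_comp B F P) A) (onob (dfun_comp B G P) A)" if "A \<in> obs B" for A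
      using t(1)[OF dfun_ob[OF P that]] that by (simp add: dfun_comp_def)
    show "Cmp (hcat D) (onhor (dfun_comp B G P) f) (\<theta> (onob P A)) = Cmp (hcat D) (\<theta> (onob P A')) (onhor (dfun_comp B F P) f)"
      if "f \<in> homs (hcat B) A A'" for f A A'
      using t(2)[OF functor_homs[OF PD(1) that]] that by (simp add: dfun_comp_def homs_def)
    show "is_square D (\<theta> (onob P A)) (onver (dfun_comp B F P) u) (onver (dfun_comp B G P) u) (\<theta> (onob P A')) (\<tau> (onver P u))"
      if "u \<in> homs (vcat B) A A'" for u A A'
      using t(3)[OF functor_homs[OF PD(2) that]] that by (simp add: dfun_comp_def homs_def)
    show "\<tau> (onver P (Idn (vcat B) A)) = Idn (sqv D) (\<theta> (onob P A))" if "A \<in> obs B" for A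
      using functor_id[OF PD(2), of A] t(4)[OF dfun_ob[OF P that]] that cB(5) by simp
    show "\<tau> (onver P (Cmp (vcat B) w u)) = Cmp (sqv D) (\<tau> (onver P w)) (\<tau> (onver P u))"
      if "u \<in> homs (vcat B) A A'" "w \<in> homs (vcat B) A' E" for u w A A' E
      using functor_comp[OF PD(2) that] t(5)[OF functor_homs[OF PD(2) that(1)] functor_homs[OF PD(2) that(2)]] by simp
    show "Cmp (sqh D) (\<tau> (onver P k)) (onsq (dfun_comp B F P) s) = Cmp (sqh D) (onsq (dfun_comp B G P) s) (\<tau> (onver P h))"
      if "is_square B f h k g s" for f h k g s
      using t(6)[OF dfun_square[OF B C P that]] that by (simp add: dfun_comp_def is_square_def)
  qed
qed

lemma dfun_comp_functor:
  assumes B: "double_category B" and P: "double_functor B C P" and F: "double_functor C D F"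
  shows "double_functor B D (dfun_comp B F P)"
proof -
  note cB = double_category_cats[OF B] and PD = double_functorD[OF P] and FD = double_functorD[OF F]
  have comp: "is_functor X Z (restrict (\<lambda>A. Go (Fo A)) (Obj X)) (restrict (\<lambda>f. Gm (Fm f)) (Mor X))"
    if X: "is_category X" and F: "is_functor X Y Fo Fm" and G: "is_functor Y Z Go Gm" for X Y Z Fo Fm Go Gm
  proof -
    have "Cmp X g f \<in> Mor X" if "f \<in> Mor X" "g \<in> Mor X" "Cod X f = Dom X g" for f g
      using X that by (auto simp: is_category_def)
    moreover have "Dom X f \<in> Obj X" "Cod X f \<in> Obj X" if "f \<in> Mor X" for f
      using X that by (auto simp: is_category_def)
    moreover have "Idn X A \<in> Mor X" if "A \<in> Obj X" for A
      using X that by (auto simp: is_category_def)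
    ultimately show ?thesis
      using F G by (auto simp: is_functor_def Pi_iff)
  qed
  show ?thesis
    using comp[OF cB(1) PD(1) FD(1)] comp[OF cB(2) PD(2) FD(2)] comp[OF cB(3) PD(3) FD(3)]
      comp[OF cB(4) PD(4) FD(4)] cB
    by (simp add: double_functor_def dfun_comp_def)
qed

lemma transpose_dfun_comp:
  "double_category B \<Longrightarrow> transpose_dfun (dfun_comp B F P) =
    dfun_comp (transpose_dbl B) (transpose_dfun F) (transpose_dfun P)"
  by (simp add: transpose_dfun_def dfun_comp_def double_category_cats)

lemma vertical_natural_cong:
  assumes C: "double_category C" and D: "double_category D" and eq: "\<And>A. A \<in> obs C \<Longrightarrow> \<theta> A = \<theta>' A"
    and n: "vertical_natural C D F G \<theta>"
  shows "vertical_natural C D F G \<theta>'"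
  using n unfolding vertical_natural_transpose[OF C D]
  by (rule horizontal_natural_cong[OF double_category_transpose[OF C], rotated])
    (simp add: eq double_category_cats[OF C])

lemma vertical_natural_id:
  assumes C: "double_category C" and D: "double_category D" and F: "double_functor C D F"
  shows "vertical_natural C D F F (\<lambda>A. Idn (vcat D) (onob F A))"
  using horizontal_natural_id[OF double_category_transpose[OF C] double_category_transpose[OF D],
      of "transpose_dfun F"] F
  by (simp add: vertical_natural_transpose[OF C D] double_functor_transpose[OF C])

lemma vertical_natural_comp:
  assumes C: "double_category C" and D: "double_category D"
    and F: "double_functor C D F" "double_functor C D G" "double_functor C D K"
    and \<theta>: "vertical_natural C D F G \<theta>" and \<eta>: "vertical_natural C D G K \<eta>"
  shows "vertical_natural C D F K (\<lambda>A. Cmp (vcat D) (\<eta> A) (\<theta> A))"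
  using horizontal_natural_comp[OF double_category_transpose[OF C] double_category_transpose[OF D],
      of "transpose_dfun F" "transpose_dfun G" "transpose_dfun K" \<theta> \<eta>] F \<theta> \<eta>
  by (simp add: vertical_natural_transpose[OF C D] double_functor_transpose[OF C])

lemma vertical_natural_whisker:
  assumes B: "double_category B" and C: "double_category C" and D: "double_category D"
    and P: "double_functor B C P" and \<theta>: "vertical_natural C D F G \<theta>"
  shows "vertical_natural B D (dfun_comp B F P) (dfun_comp B G P) (\<lambda>A. \<theta> (onob P A))"
  using horizontal_natural_whisker[OF double_category_transpose[OF B] double_category_transpose[OF C],
      of "transpose_dfun P" "transpose_dbl D" "transpose_dfun F" "transpose_dfun G" \<theta>] P \<theta>
  by (simp add: vertical_natural_transpose[OF B D] vertical_natural_transpose[OF C D]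
      double_functor_transpose[OF B] transpose_dfun_comp[OF B])

lemma natural_iso_whisker:
  assumes B: "double_category B" and C: "double_category C" and D: "double_category D"
    and P: "double_functor B C P" and \<theta>: "natural_iso C D F G \<theta>"
  shows "natural_iso B D (dfun_comp B F P) (dfun_comp B G P) (\<lambda>A\<in>obs B. \<theta> (onob P A))"
  unfolding natural_iso_def
proof (intro conjI ballI)
  show "shared_iso D (onob (dfun_comp B F P) A) (onob (dfun_comp B G P) A) ((\<lambda>A\<in>obs B. \<theta> (onob P A)) A)"
    if "A \<in> obs B" for A
    using \<theta> dfun_ob[OF P that] that by (simp add: natural_iso_def dfun_comp_def)
  show "horizontal_natural B D (dfun_comp B F P) (dfun_comp B G P) (\<lambda>A. fst ((\<lambda>A\<in>obs B. \<theta> (onob P A)) A))"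
    by (rule horizontal_natural_cong[OF B _ horizontal_natural_whisker[OF B C P, of D F G "\<lambda>A. fst (\<theta> A)"]])
      (use \<theta> in \<open>auto simp: natural_iso_def\<close>)
  show "vertical_natural B D (dfun_comp B F P) (dfun_comp B G P) (\<lambda>A. snd ((\<lambda>A\<in>obs B. \<theta> (onob P A)) A))"
    by (rule vertical_natural_cong[OF B D _ vertical_natural_whisker[OF B C D P, of F G "\<lambda>A. snd (\<theta> A)"]])
      (use \<theta> in \<open>auto simp: natural_iso_def\<close>)
qed simp

lemma dfun_groupoid_sel [simp]:
  "Obj (dfun_groupoid C D) = {F. double_functor C D F}"
  "Dom (dfun_groupoid C D) (F, \<theta>, G) = F" "Cod (dfun_groupoid C D) (F, \<theta>, G) = G"
  "Idn (dfun_groupoid C D) F = (F, (\<lambda>A\<in>obs C. shared_id D (onob F A)), F)"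
  "Cmp (dfun_groupoid C D) (G', \<eta>, K) (F, \<theta>, G) = (F, (\<lambda>A\<in>obs C. shared_comp D (\<eta> A) (\<theta> A)), K)"
  "(F, \<theta>, G) \<in> Mor (dfun_groupoid C D) \<longleftrightarrow> double_functor C D F \<and> double_functor C D G \<and> natural_iso C D F G \<theta>"
  by (simp_all add: dfun_groupoid_def)

text \<open>Makes the structure maps of the classifying diagram nerves of functors, so that weak
  equivalences between its spaces can be studied through functors of groupoids.\<close>

lemma whisker_functor:
  assumes B: "double_category B" and C: "double_category C" and D: "double_category D"
    and P: "double_functor B C P"
  shows "is_functor (dfun_groupoid C D) (dfun_groupoid B D) (\<lambda>F. dfun_comp B F P) (whisker B P)"
  unfolding is_functor_def
proof (intro conjI ballI impI)
  show "(\<lambda>F. dfun_comp B F P) \<in> Obj (dfun_groupoid C D) \<rightarrow> Obj (dfun_groupoid B D)"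
    using dfun_comp_functor[OF B P] by auto
  show "whisker B P \<in> Mor (dfun_groupoid C D) \<rightarrow> Mor (dfun_groupoid B D)"
    using dfun_comp_functor[OF B P] natural_iso_whisker[OF B C D P] by (auto simp: whisker_def)
  show "whisker B P (Idn (dfun_groupoid C D) F) = Idn (dfun_groupoid B D) (dfun_comp B F P)"
    if "F \<in> Obj (dfun_groupoid C D)" for F
    using dfun_ob[OF P] by (auto simp: whisker_def dfun_comp_def fun_eq_iff)
  fix x assume x: "x \<in> Mor (dfun_groupoid C D)"
  then show "Dom (dfun_groupoid B D) (whisker B P x) = dfun_comp B (Dom (dfun_groupoid C D) x) P"
    "Cod (dfun_groupoid B D) (whisker B P x) = dfun_comp B (Cod (dfun_groupoid C D) x) P"
    by (cases x; simp add: whisker_def)+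
  fix y
  show "whisker B P (Cmp (dfun_groupoid C D) y x) = Cmp (dfun_groupoid B D) (whisker B P y) (whisker B P x)"
    using dfun_ob[OF P] by (cases x; cases y) (auto simp: whisker_def fun_eq_iff)
qed

context shared_isos
begin

lemma natural_iso_id:
  assumes C: "double_category C" and F: "double_functor C D F"
  shows "natural_iso C D F F (\<lambda>A\<in>obs C. shared_id D (onob F A))"
  unfolding natural_iso_def
proof (intro conjI ballI)
  show "shared_iso D (onob F A) (onob F A) ((\<lambda>A\<in>obs C. shared_id D (onob F A)) A)" if "A \<in> obs C" for A
    using id_iso[OF hcat dfun_ob[OF F that]] \<phi>_id[OF dfun_ob[OF F that]] that
    by (simp add: shared_iso_iff shared_id_def)
  show "horizontal_natural C D F F (\<lambda>A. fst ((\<lambda>A\<in>obs C. shared_id D (onob F A)) A))"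
    by (rule horizontal_natural_cong[OF C _ horizontal_natural_id[OF C dbl F]]) (simp add: shared_id_def)
  show "vertical_natural C D F F (\<lambda>A. snd ((\<lambda>A\<in>obs C. shared_id D (onob F A)) A))"
    by (rule vertical_natural_cong[OF C dbl _ vertical_natural_id[OF C dbl F]]) (simp add: shared_id_def)
qed simp

text \<open>Functoriality of \<open>\<phi>\<close> is what makes the componentwise composite a
  shared isomorphism again.\<close>

lemma natural_iso_comp:
  assumes C: "double_category C"
    and F: "double_functor C D F" "double_functor C D G" "double_functor C D K"
    and \<theta>: "natural_iso C D F G \<theta>" and \<eta>: "natural_iso C D G K \<eta>"
  shows "natural_iso C D F K (\<lambda>A\<in>obs C. shared_comp D (\<eta> A) (\<theta> A))"
  unfolding natural_iso_def
proof (intro conjI ballI)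
  show "shared_iso D (onob F A) (onob K A) ((\<lambda>A\<in>obs C. shared_comp D (\<eta> A) (\<theta> A)) A)" if "A \<in> obs C" for A
  proof -
    have t: "fst (\<theta> A) \<in> isos H (onob F A) (onob G A)" "snd (\<theta> A) = \<phi> (fst (\<theta> A))"
      and e: "fst (\<eta> A) \<in> isos H (onob G A) (onob K A)" "snd (\<eta> A) = \<phi> (fst (\<eta> A))"
      using \<theta> \<eta> that by (simp_all add: natural_iso_def shared_iso_iff)
    show ?thesis
      using comp_iso[OF hcat t(1) e(1)] \<phi>_comp[OF t(1) e(1)] t(2) e(2) that
      by (simp add: shared_iso_iff shared_comp_def)
  qed
  show "horizontal_natural C D F K (\<lambda>A. fst ((\<lambda>A\<in>obs C. shared_comp D (\<eta> A) (\<theta> A)) A))"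
    by (rule horizontal_natural_cong[OF C _ horizontal_natural_comp[OF C dbl F, of "\<lambda>A. fst (\<theta> A)" "\<lambda>A. fst (\<eta> A)"]])
      (use \<theta> \<eta> in \<open>auto simp: shared_comp_def natural_iso_def\<close>)
  show "vertical_natural C D F K (\<lambda>A. snd ((\<lambda>A\<in>obs C. shared_comp D (\<eta> A) (\<theta> A)) A))"
    by (rule vertical_natural_cong[OF C dbl _ vertical_natural_comp[OF C dbl F, of "\<lambda>A. snd (\<theta> A)" "\<lambda>A. snd (\<eta> A)"]])
      (use \<theta> \<eta> in \<open>auto simp: shared_comp_def natural_iso_def\<close>)
qed simp

text \<open>Squares for the horizontal inverse come from commutation in the vertical category, by
  \<open>vsquare\<close>; squares for the vertical inverse come from the horizontal naturality thus
  obtained, by \<open>hsquare\<close>.\<close>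

lemma natural_iso_inverse:
  assumes C: "double_category C" and F: "double_functor C D F" "double_functor C D G"
    and \<theta>: "natural_iso C D F G \<theta>"
  shows "\<exists>\<kappa>. natural_iso C D G F \<kappa> \<and>
    (\<forall>A\<in>obs C. shared_comp D (\<kappa> A) (\<theta> A) = shared_id D (onob F A) \<and>
                shared_comp D (\<theta> A) (\<kappa> A) = shared_id D (onob G A))"
proof -
  note cC = double_category_cats[OF C]
  define g where "g A = (SOME k. inverse_mors H (fst (\<theta> A)) k)" for A
  have t: "fst (\<theta> A) \<in> isos H (onob F A) (onob G A)" "snd (\<theta> A) = \<phi> (fst (\<theta> A))" if "A \<in> obs C" for A
    using \<theta> that by (simp_all add: natural_iso_def shared_iso_iff)
  have g: "inverse_mors H (fst (\<theta> A)) (g A)" if "A \<in> obs C" for A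
    using t(1)[OF that] someI_ex[of "inverse_mors H (fst (\<theta> A))"] by (auto simp: isos_def g_def)
  have gi: "g A \<in> isos H (onob G A) (onob F A)" "inverse_mors V (\<phi> (fst (\<theta> A))) (\<phi> (g A))" if "A \<in> obs C" for A
    using \<phi>_inverse[OF t(1)[OF that] g[OF that]] by simp_all
  have hn: "horizontal_natural C D F G (\<lambda>A. fst (\<theta> A))" and vn: "vertical_natural C D F G (\<lambda>A. snd (\<theta> A))"
    using \<theta> by (simp_all add: natural_iso_def)
  note FD = double_functorD[OF F(1)] and GD = double_functorD[OF F(2)]
  note vobj = homs_obj[OF cC(2), unfolded cC(5)] and hobj = homs_obj[OF cC(1)]
  have gh: "horizontal_natural C D G F g"
  proof (rule horizontal_natural_inverse[OF C dbl F hn g])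
    fix u A B assume u: "u \<in> homs (Defs.vcat C) A B"
    note ob = vobj[OF u]
    note Fu = functor_homs[OF FD(2) u] and Gu = functor_homs[OF GD(2) u]
    obtain s where "is_square D (fst (\<theta> A)) (onver F u) (onver G u) (fst (\<theta> B)) s"
      using horizontal_natural_square[OF hn u] by blast
    then have c: "Cmp V (onver G u) (\<phi> (fst (\<theta> A))) = Cmp V (\<phi> (fst (\<theta> B))) (onver F u)"
      using vsquare[OF Fu Gu t(1)[OF ob(1)] t(1)[OF ob(2)]] by blast
    note i = inverse_mors_homs[OF gi(2)[OF ob(1)] \<phi>_homs[OF t(1)[OF ob(1)]]]
      inverse_mors_homs[OF gi(2)[OF ob(2)] \<phi>_homs[OF t(1)[OF ob(2)]]]
    note ph = \<phi>_homs[OF t(1)[OF ob(1)]] \<phi>_homs[OF t(1)[OF ob(2)]]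
    note Fi = comp_in_homs[OF vcat i(1) Fu]
    have "Cmp V (onver F u) (\<phi> (g A)) = Cmp V (Cmp V (\<phi> (g B)) (\<phi> (fst (\<theta> B)))) (Cmp V (onver F u) (\<phi> (g A)))"
      using i(5) comp_id(2)[OF vcat Fi] by simp
    also have "\<dots> = Cmp V (\<phi> (g B)) (Cmp V (Cmp V (\<phi> (fst (\<theta> B))) (onver F u)) (\<phi> (g A)))"
      using comp_assoc[OF vcat Fi ph(2) i(4)] comp_assoc[OF vcat i(1) Fu ph(2)] by simp
    also have "\<dots> = Cmp V (\<phi> (g B)) (Cmp V (onver G u) (Cmp V (\<phi> (fst (\<theta> A))) (\<phi> (g A))))"
      unfolding c[symmetric] using comp_assoc[OF vcat i(1) ph(1) Gu] by simp
    also have "\<dots> = Cmp V (\<phi> (g B)) (onver G u)"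
      using i(3) comp_id(1)[OF vcat Gu] by simp
    finally show "\<exists>s. is_square D (g A) (onver G u) (onver F u) (g B) s"
      using vsquare[OF Gu Fu gi(1)[OF ob(1)] gi(1)[OF ob(2)]] by blast
    show "unique_square D (g A) (onver G u) (onver F u) (g B)"
      using vsquare[OF Gu Fu gi(1)[OF ob(1)] gi(1)[OF ob(2)]] by blast
  next
    fix u A B assume u: "u \<in> homs V A B"
    then show "unique_square D (Idn H A) u u (Idn H B)"
      using vsquare[OF u u id_iso[OF hcat] id_iso[OF hcat]] homs_obj[OF vcat u] cats(5) by simp
  qed
  have gv: "vertical_natural C D G F (\<lambda>A. \<phi> (g A))"
    unfolding vertical_natural_transpose[OF C dbl]
  proof (rule horizontal_natural_inverse[OF double_category_transpose[OF C] double_category_transpose[OF dbl]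
        _ _ vn[unfolded vertical_natural_transpose[OF C dbl]]], unfold transpose_dbl_sel transpose_dfun_sel)
    show "double_functor (transpose_dbl C) (transpose_dbl D) (transpose_dfun F)"
      "double_functor (transpose_dbl C) (transpose_dbl D) (transpose_dfun G)"
      using F double_functor_transpose[OF C] by auto
    show "inverse_mors V (snd (\<theta> A)) (\<phi> (g A))" if "A \<in> Obj (Defs.vcat C)" for A
      using gi(2)[of A] t(2)[of A] that cC(5) by simp
  next
    fix f A B assume f: "f \<in> homs (Defs.hcat C) A B"
    note ob = hobj[OF f]
    note Ff = functor_homs[OF FD(1) f] and Gf = functor_homs[OF GD(1) f]
    have "Cmp H (g B) (onhor G f) = Cmp H (onhor F f) (g A)"
      using horizontal_natural_hor[OF gh f] by simp
    then show "\<exists>s. is_square (transpose_dbl D) (\<phi> (g A)) (onhor G f) (onhor F f) (\<phi> (g B)) s"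
      "unique_square (transpose_dbl D) (\<phi> (g A)) (onhor G f) (onhor F f) (\<phi> (g B))"
      using hsquare[OF Gf Ff gi(1)[OF ob(1)] gi(1)[OF ob(2)]]
      by (auto simp: is_square_transpose[OF dbl] unique_square_def)
  next
    fix f A B assume f: "f \<in> homs H A B"
    note ob = homs_obj[OF hcat f]
    show "unique_square (transpose_dbl D) (Idn V A) f f (Idn V B)"
      using hsquare[OF f f id_iso[OF hcat ob(1)] id_iso[OF hcat ob(2)]] \<phi>_id[OF ob(1)] \<phi>_id[OF ob(2)]
      by (simp add: is_square_transpose[OF dbl] unique_square_def)
  qed
  define \<kappa> where "\<kappa> = (\<lambda>A\<in>obs C. (g A, \<phi> (g A)))"
  have "natural_iso C D G F \<kappa>"
    unfolding natural_iso_def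
  proof (intro conjI ballI)
    show "horizontal_natural C D G F (\<lambda>A. fst (\<kappa> A))"
      by (rule horizontal_natural_cong[OF C _ gh]) (simp add: \<kappa>_def)
    show "vertical_natural C D G F (\<lambda>A. snd (\<kappa> A))"
      by (rule vertical_natural_cong[OF C dbl _ gv]) (simp add: \<kappa>_def)
    show "shared_iso D (onob G A) (onob F A) (\<kappa> A)" if "A \<in> obs C" for A
      using gi(1)[OF that] that by (simp add: \<kappa>_def shared_iso_iff)
  qed (simp add: \<kappa>_def)
  moreover have "shared_comp D (\<kappa> A) (\<theta> A) = shared_id D (onob F A) \<and>
                shared_comp D (\<theta> A) (\<kappa> A) = shared_id D (onob G A)" if A: "A \<in> obs C" for A
    using inverse_mors_homs[OF g[OF A] isos_homs[OF t(1)[OF A]]]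
      inverse_mors_homs[OF gi(2)[OF A] \<phi>_homs[OF t(1)[OF A]]] t(2)[OF A] A
    by (simp add: \<kappa>_def shared_comp_def shared_id_def)
  ultimately show ?thesis
    by blast
qed

lemma groupoid_dfun_groupoid:
  assumes C: "double_category C"
  shows "groupoid (dfun_groupoid C D)"
  unfolding groupoid_def
proof
  let ?G = "dfun_groupoid C D"
  have ext: "\<theta> \<in> extensional (obs C)" if "natural_iso C D F G \<theta>" for F G \<theta>
    using that by (simp add: natural_iso_def)
  have th: "fst (\<theta> A) \<in> homs H (onob F A) (onob G A)" "snd (\<theta> A) \<in> homs V (onob F A) (onob G A)"
    if "natural_iso C D F G \<theta>" "A \<in> obs C" for F G \<theta> A
  proof -
    have "fst (\<theta> A) \<in> isos H (onob F A) (onob G A)" "snd (\<theta> A) = \<phi> (fst (\<theta> A))"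
      using that by (simp_all add: natural_iso_def shared_iso_iff)
    then show "fst (\<theta> A) \<in> homs H (onob F A) (onob G A)" "snd (\<theta> A) \<in> homs V (onob F A) (onob G A)"
      using \<phi>_homs isos_homs by metis+
  qed
  show "is_category ?G"
    unfolding is_category_def
  proof (intro conjI ballI impI)
    show "Dom ?G \<in> Mor ?G \<rightarrow> Obj ?G" "Cod ?G \<in> Mor ?G \<rightarrow> Obj ?G"
      by (auto simp: dfun_groupoid_def)
    show "Idn ?G \<in> Obj ?G \<rightarrow> Mor ?G"
      using natural_iso_id[OF C] by simp
    show "Dom ?G (Idn ?G F) = F" "Cod ?G (Idn ?G F) = F" for F
      by simp_all
    fix x assume x: "x \<in> Mor ?G"
    obtain F \<theta> G where x_eq: "x = (F, \<theta>, G)"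
      by (cases x)
    have \<theta>: "double_functor C D F" "double_functor C D G" "natural_iso C D F G \<theta>"
      using x by (simp_all add: x_eq)
    have "(\<lambda>A\<in>obs C. shared_comp D (\<theta> A) ((\<lambda>A\<in>obs C. shared_id D (onob F A)) A)) = \<theta>"
      by (rule extensionalityI[OF _ ext[OF \<theta>(3)]])
        (use comp_id(1)[OF hcat th(1)[OF \<theta>(3)]] comp_id(1)[OF vcat th(2)[OF \<theta>(3)]] in
          \<open>auto simp: shared_comp_def shared_id_def\<close>)
    then show "Cmp ?G x (Idn ?G (Dom ?G x)) = x"
      by (simp add: x_eq)
    have "(\<lambda>A\<in>obs C. shared_comp D ((\<lambda>A\<in>obs C. shared_id D (onob G A)) A) (\<theta> A)) = \<theta>"
      by (rule extensionalityI[OF _ ext[OF \<theta>(3)]])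
        (use comp_id(2)[OF hcat th(1)[OF \<theta>(3)]] comp_id(2)[OF vcat th(2)[OF \<theta>(3)]] in
          \<open>auto simp: shared_comp_def shared_id_def\<close>)
    then show "Cmp ?G (Idn ?G (Cod ?G x)) x = x"
      by (simp add: x_eq)
    fix y assume y: "y \<in> Mor ?G" and xy: "Cod ?G x = Dom ?G y"
    obtain \<eta> K where y_eq: "y = (G, \<eta>, K)"
      using xy by (cases y) (simp add: x_eq)
    have \<eta>: "double_functor C D K" "natural_iso C D G K \<eta>"
      using y by (simp_all add: y_eq)
    show "Cmp ?G y x \<in> Mor ?G" "Dom ?G (Cmp ?G y x) = Dom ?G x" "Cod ?G (Cmp ?G y x) = Cod ?G y"
      using natural_iso_comp[OF C \<theta>(1,2) \<eta>(1) \<theta>(3) \<eta>(2)] \<theta> \<eta> by (simp_all add: x_eq y_eq)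
    fix w assume w: "w \<in> Mor ?G" and yw: "Cod ?G y = Dom ?G w"
    obtain \<zeta> L where w_eq: "w = (K, \<zeta>, L)"
      using yw by (cases w) (simp add: y_eq)
    have \<zeta>: "natural_iso C D K L \<zeta>"
      using w by (simp add: w_eq)
    show "Cmp ?G w (Cmp ?G y x) = Cmp ?G (Cmp ?G w y) x"
      using comp_assoc[OF hcat th(1)[OF \<theta>(3)] th(1)[OF \<eta>(2)] th(1)[OF \<zeta>]]
        comp_assoc[OF vcat th(2)[OF \<theta>(3)] th(2)[OF \<eta>(2)] th(2)[OF \<zeta>]]
      by (auto simp: x_eq y_eq w_eq shared_comp_def fun_eq_iff)
  qed
  show "\<forall>x\<in>Mor ?G. \<exists>y. inverse_mors ?G x y"
  proof
    fix x assume x: "x \<in> Mor ?G"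
    obtain F \<theta> G where x_eq: "x = (F, \<theta>, G)"
      by (cases x)
    have \<theta>: "double_functor C D F" "double_functor C D G" "natural_iso C D F G \<theta>"
      using x by (simp_all add: x_eq)
    obtain \<kappa> where \<kappa>: "natural_iso C D G F \<kappa>"
      "\<And>A. A \<in> obs C \<Longrightarrow> shared_comp D (\<kappa> A) (\<theta> A) = shared_id D (onob F A) \<and>
                shared_comp D (\<theta> A) (\<kappa> A) = shared_id D (onob G A)"
      using natural_iso_inverse[OF C \<theta>] by blast
    have "inverse_mors ?G x (G, \<kappa>, F)"
      using \<theta> \<kappa> by (auto simp: inverse_mors_def x_eq fun_eq_iff)
    then show "\<exists>y. inverse_mors ?G x y" ..
  qed
qed

end

subsection \<open>Grids and the double functor of a square\<close>

lemma grid_sel [simp]: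
  "Obj (hcat (grid m n)) = {..m} \<times> {..n}" "Obj (vcat (grid m n)) = {..m} \<times> {..n}"
  "Mor (hcat (grid m n)) = {(i, j). i \<le> j \<and> j \<le> m} \<times> {..n}"
  "Mor (vcat (grid m n)) = {..m} \<times> {(i, j). i \<le> j \<and> j \<le> n}"
  "Obj (sqh (grid m n)) = {..m} \<times> {(i, j). i \<le> j \<and> j \<le> n}"
  "Obj (sqv (grid m n)) = {(i, j). i \<le> j \<and> j \<le> m} \<times> {..n}"
  "Mor (sqh (grid m n)) = {(i, j). i \<le> j \<and> j \<le> m} \<times> {(i, j). i \<le> j \<and> j \<le> n}"
  "Mor (sqv (grid m n)) = {(i, j). i \<le> j \<and> j \<le> m} \<times> {(i, j). i \<le> j \<and> j \<le> n}"
  "Dom (hcat (grid m n)) (p, y) = (fst p, y)" "Cod (hcat (grid m n)) (p, y) = (snd p, y)"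
  "Dom (vcat (grid m n)) (x, q) = (x, fst q)" "Cod (vcat (grid m n)) (x, q) = (x, snd q)"
  "Dom (sqh (grid m n)) (p, q) = (fst p, q)" "Cod (sqh (grid m n)) (p, q) = (snd p, q)"
  "Dom (sqv (grid m n)) (p, q) = (p, fst q)" "Cod (sqv (grid m n)) (p, q) = (p, snd q)"
  "Idn (hcat (grid m n)) (x, y) = ((x, x), y)" "Idn (vcat (grid m n)) (x, y) = (x, (y, y))"
  "Idn (sqh (grid m n)) (x, q) = ((x, x), q)" "Idn (sqv (grid m n)) (p, y) = (p, (y, y))"
  "Cmp (hcat (grid m n)) (p', y') (p, y) = ((fst p, snd p'), y)"
  "Cmp (vcat (grid m n)) (x', q') (x, q) = (x, (fst q, snd q'))"
  "Cmp (sqh (grid m n)) (p', q') (p, q) = ((fst p, snd p'), q)"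
  "Cmp (sqv (grid m n)) (p', q') (p, q) = (p, (fst q, snd q'))"
  by (simp_all add: grid_def ordcat_def)

lemma double_category_grid: "double_category (grid m n)"
proof -
  have "is_category (hcat (grid m n))" "is_category (vcat (grid m n))"
    "is_category (sqh (grid m n))" "is_category (sqv (grid m n))"
    by (auto simp: is_category_def)
  moreover have "is_functor (sqh (grid m n)) (hcat (grid m n)) (Dom (vcat (grid m n))) (sq_top (grid m n))"
    "is_functor (sqh (grid m n)) (hcat (grid m n)) (Cod (vcat (grid m n))) (sq_bot (grid m n))"
    "is_functor (sqv (grid m n)) (vcat (grid m n)) (Dom (hcat (grid m n))) (sq_left (grid m n))"
    "is_functor (sqv (grid m n)) (vcat (grid m n)) (Cod (hcat (grid m n))) (sq_right (grid m n))"
    by (auto simp: is_functor_def)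
  ultimately show ?thesis
    unfolding double_category_def by auto
qed

lemma grid_map_sel:
  "i \<le> m \<Longrightarrow> j \<le> n \<Longrightarrow> onob (grid_map m n \<alpha> \<beta>) (i, j) = (\<alpha> i, \<beta> j)"
  "i \<le> i' \<Longrightarrow> i' \<le> m \<Longrightarrow> j \<le> n \<Longrightarrow> onhor (grid_map m n \<alpha> \<beta>) ((i, i'), j) = ((\<alpha> i, \<alpha> i'), \<beta> j)"
  "i \<le> m \<Longrightarrow> j \<le> j' \<Longrightarrow> j' \<le> n \<Longrightarrow> onver (grid_map m n \<alpha> \<beta>) (i, (j, j')) = (\<alpha> i, (\<beta> j, \<beta> j'))"
  "i \<le> i' \<Longrightarrow> i' \<le> m \<Longrightarrow> j \<le> j' \<Longrightarrow> j' \<le> n \<Longrightarrow>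
    onsq (grid_map m n \<alpha> \<beta>) ((i, i'), (j, j')) = ((\<alpha> i, \<alpha> i'), (\<beta> j, \<beta> j'))"
  by (simp_all add: grid_map_def)

lemma double_functor_grid_map:
  assumes "\<alpha> \<in> \<Delta> m m'" "\<beta> \<in> \<Delta> n n'"
  shows "double_functor (grid m n) (grid m' n') (grid_map m n \<alpha> \<beta>)"
proof -
  have a: "\<alpha> i \<le> m'" "\<alpha> i \<le> \<alpha> i'" if "i \<le> i'" "i' \<le> m" for i i'
    using assms(1) that by (auto simp: Delta_def mono_on_def)
  have a': "\<alpha> i \<le> m'" if "i \<le> m" for i
    using a(1)[of i i] that by simp
  have b: "\<beta> j \<le> n'" "\<beta> j \<le> \<beta> j'" if "j \<le> j'" "j' \<le> n" for j j'
    using assms(2) that by (auto simp: Delta_def mono_on_def)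
  have b': "\<beta> j \<le> n'" if "j \<le> n" for j
    using b(1)[of j j] that by simp
  show ?thesis
    unfolding double_functor_def is_functor_def
    using a b a' b' by (auto simp: grid_map_def)
qed

abbreviation restr ::
    "nat \<Rightarrow> nat \<Rightarrow> (nat \<Rightarrow> nat) \<Rightarrow> (nat \<Rightarrow> nat) \<Rightarrow> ('o, 'h, 'v, 's) grid_dfun \<Rightarrow> ('o, 'h, 'v, 's) grid_dfun" where
  "restr m n \<alpha> \<beta> F \<equiv> dfun_comp (grid m n) F (grid_map m n \<alpha> \<beta>)"

lemma restr_sel:
  "i \<le> m \<Longrightarrow> j \<le> n \<Longrightarrow> onob (restr m n \<alpha> \<beta> F) (i, j) = onob F (\<alpha> i, \<beta> j)"
  "i \<le> i' \<Longrightarrow> i' \<le> m \<Longrightarrow> j \<le> n \<Longrightarrow> onhor (restr m n \<alpha> \<beta> F) ((i, i'), j) = onhor F ((\<alpha> i, \<alpha> i'), \<beta> j)"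
  "i \<le> m \<Longrightarrow> j \<le> j' \<Longrightarrow> j' \<le> n \<Longrightarrow> onver (restr m n \<alpha> \<beta> F) (i, (j, j')) = onver F (\<alpha> i, (\<beta> j, \<beta> j'))"
  by (simp_all add: dfun_comp_def grid_map_sel)

lemma grid_dfun_unit:
  assumes F: "double_functor (grid m n) D F"
  shows "i \<le> m \<Longrightarrow> j \<le> n \<Longrightarrow> onhor F ((i, i), j) = Idn (hcat D) (onob F (i, j))"
    and "i \<le> m \<Longrightarrow> j \<le> n \<Longrightarrow> onver F (i, (j, j)) = Idn (vcat D) (onob F (i, j))"
    and "i \<le> m \<Longrightarrow> j \<le> j' \<Longrightarrow> j' \<le> n \<Longrightarrow> onsq F ((i, i), (j, j')) = Idn (sqh D) (onver F (i, (j, j')))"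
    and "i \<le> i' \<Longrightarrow> i' \<le> m \<Longrightarrow> j \<le> n \<Longrightarrow> onsq F ((i, i'), (j, j)) = Idn (sqv D) (onhor F ((i, i'), j))"
  using functor_id[OF double_functorD(1)[OF F], of "(i, j)"] functor_id[OF double_functorD(2)[OF F], of "(i, j)"]
    functor_id[OF double_functorD(3)[OF F], of "(i, (j, j'))"] functor_id[OF double_functorD(4)[OF F], of "((i, i'), j)"]
  by simp_all

lemma grid_dfun_homs:
  assumes F: "double_functor (grid m n) D F"
  shows "i \<le> i' \<Longrightarrow> i' \<le> m \<Longrightarrow> j \<le> n \<Longrightarrow> onhor F ((i, i'), j) \<in> homs (hcat D) (onob F (i, j)) (onob F (i', j))"
    and "i \<le> m \<Longrightarrow> j \<le> j' \<Longrightarrow> j' \<le> n \<Longrightarrow> onver F (i, (j, j')) \<in> homs (vcat D) (onob F (i, j)) (onob F (i, j'))"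
  using functor_homs[OF double_functorD(1)[OF F], of "((i, i'), j)" "(i, j)" "(i', j)"]
    functor_homs[OF double_functorD(2)[OF F], of "(i, (j, j'))" "(i, j)" "(i, j')"]
  by (simp_all add: homs_def)

lemma grid_dfun_eqI:
  fixes F G :: "('o, 'h, 'v, 's) grid_dfun"
  assumes F: "double_functor (grid m n) D F" and G: "double_functor (grid m n) D G"
    and ob: "\<And>i j. i \<le> m \<Longrightarrow> j \<le> n \<Longrightarrow> onob F (i, j) = onob G (i, j)"
    and hor: "\<And>i i' j. i \<le> i' \<Longrightarrow> i' \<le> m \<Longrightarrow> j \<le> n \<Longrightarrow> onhor F ((i, i'), j) = onhor G ((i, i'), j)"
    and ver: "\<And>i j j'. i \<le> m \<Longrightarrow> j \<le> j' \<Longrightarrow> j' \<le> n \<Longrightarrow> onver F (i, (j, j')) = onver G (i, (j, j'))"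
    and sq: "\<And>i i' j j'. i \<le> i' \<Longrightarrow> i' \<le> m \<Longrightarrow> j \<le> j' \<Longrightarrow> j' \<le> n \<Longrightarrow>
      onsq F ((i, i'), (j, j')) = onsq G ((i, i'), (j, j'))"
  shows "F = G"
proof -
  note FD = double_functorD[OF F] and GD = double_functorD[OF G]
  have "onob F = onob G"
    by (rule extensionalityI[OF FD(5) GD(5)]) (auto simp: ob)
  moreover have "onhor F = onhor G"
    by (rule extensionalityI[OF FD(6) GD(6)]) (auto simp: hor)
  moreover have "onver F = onver G"
    by (rule extensionalityI[OF FD(7) GD(7)]) (auto simp: ver)
  moreover have "onsq F = onsq G"
    by (rule extensionalityI[OF FD(8) GD(8)]) (auto simp: sq)
  ultimately show ?thesis
    by simp
qed

lemma grid_00_eqI: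
  assumes F: "double_functor (grid 0 0) D F" and G: "double_functor (grid 0 0) D G"
    and ob: "onob F (0, 0) = onob G (0, 0)"
  shows "F = G"
  by (rule grid_dfun_eqI[OF F G]) (use ob grid_dfun_unit[OF F] grid_dfun_unit[OF G] in simp_all)

text \<open>Used to see that two squares with a common edge have equal, and not only isomorphic,
  restrictions to that edge.\<close>

lemma grid_01_eqI:
  assumes F: "double_functor (grid 0 1) D F" and G: "double_functor (grid 0 1) D G"
    and ver: "onver F (0, (0, 1)) = onver G (0, (0, 1))"
  shows "F = G"
proof -
  have h: "onver F (0, (0, 1)) \<in> homs (vcat D) (onob F (0, 0)) (onob F (0, 1))"
    "onver G (0, (0, 1)) \<in> homs (vcat D) (onob G (0, 0)) (onob G (0, 1))"
    by (simp_all add: grid_dfun_homs(2)[OF F] grid_dfun_homs(2)[OF G])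
  have j: "j = 0 \<or> j = 1" if "j \<le> 1" for j :: nat
    using that by auto
  have ob: "onob F (0, j) = onob G (0, j)" if "j \<le> 1" for j
    using h ver j[OF that] by (auto simp: homs_def)
  have ver': "onver F (0, (j, j')) = onver G (0, (j, j'))" if "j \<le> j'" "j' \<le> 1" for j j'
    using ver ob[of j] grid_dfun_unit(2)[OF F, of 0 j] grid_dfun_unit(2)[OF G, of 0 j] j[of j] j[of j'] that
    by auto
  show ?thesis
    by (rule grid_dfun_eqI[OF F G])
      (use ob ver' grid_dfun_unit(1,3)[OF F] grid_dfun_unit(1,3)[OF G] in simp_all)
qed

lemma grid_10_eqI:
  assumes F: "double_functor (grid 1 0) D F" and G: "double_functor (grid 1 0) D G"
    and hor: "onhor F ((0, 1), 0) = onhor G ((0, 1), 0)"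
  shows "F = G"
proof -
  have h: "onhor F ((0, 1), 0) \<in> homs (hcat D) (onob F (0, 0)) (onob F (1, 0))"
    "onhor G ((0, 1), 0) \<in> homs (hcat D) (onob G (0, 0)) (onob G (1, 0))"
    by (simp_all add: grid_dfun_homs(1)[OF F] grid_dfun_homs(1)[OF G])
  have j: "j = 0 \<or> j = 1" if "j \<le> 1" for j :: nat
    using that by auto
  have ob: "onob F (j, 0) = onob G (j, 0)" if "j \<le> 1" for j
    using h hor j[OF that] by (auto simp: homs_def)
  have hor': "onhor F ((j, j'), 0) = onhor G ((j, j'), 0)" if "j \<le> j'" "j' \<le> 1" for j j'
    using hor ob[of j] grid_dfun_unit(1)[OF F, of j 0] grid_dfun_unit(1)[OF G, of j 0] j[of j] j[of j'] that
    by auto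
  show ?thesis
    by (rule grid_dfun_eqI[OF F G])
      (use ob hor' grid_dfun_unit(2,4)[OF F] grid_dfun_unit(2,4)[OF G] in simp_all)
qed

lemma square_dfun_sel:
  "onob (square_dfun D s) (0, 0) = Dom (hcat D) (sq_top D s)"
    "onob (square_dfun D s) (1, 0) = Cod (hcat D) (sq_top D s)"
    "onob (square_dfun D s) (0, 1) = Dom (hcat D) (sq_bot D s)"
    "onob (square_dfun D s) (1, 1) = Cod (hcat D) (sq_bot D s)"
    "onhor (square_dfun D s) ((0, 1), 0) = sq_top D s"
    "onhor (square_dfun D s) ((0, 1), 1) = sq_bot D s"
    "onver (square_dfun D s) (0, (0, 1)) = sq_left D s"
    "onver (square_dfun D s) (1, (0, 1)) = sq_right D s"
    "onsq (square_dfun D s) ((0, 1), (0, 1)) = s"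
  by (simp_all add: square_dfun_def Let_def)

lemma double_functor_square_dfun:
  assumes D: "double_category D" and s: "s \<in> sqs D"
  shows "double_functor (grid 1 1) D (square_dfun D s)"
proof -
  note cD = double_category_cats[OF D]
  note sq = square_edges[OF D s]
  note b = square_boundary[OF D sq]
  \<comment> \<open>The components as functions of the indices; functoriality becomes a list of
    equations for \<open>A\<close>, \<open>f\<close>, \<open>u\<close> and \<open>q\<close>.\<close>
  define A where "A = (\<lambda>i j. if i = (0::nat) then Dom (hcat D) (if j = (0::nat) then sq_top D s else sq_bot D s)
    else Cod (hcat D) (if j = 0 then sq_top D s else sq_bot D s))"
  define f where "f = (\<lambda>i i' j. if i = (i'::nat) then Idn (hcat D) (A i j) else if j = (0::nat) then sq_top D s else sq_bot D s)"
  define u where "u = (\<lambda>i j j'. if j = (j'::nat) then Idn (vcat D) (A i j) else if i = (0::nat) then sq_left D s else sq_right D s)"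
  define q where "q = (\<lambda>i i' j j'. if i = (i'::nat) \<and> j = (j'::nat) then Idn (sqv D) (Idn (hcat D) (A i j))
        else if i = i' then Idn (sqh D) (u i j j') else if j = j' then Idn (sqv D) (f i i' j) else s)"
  have two: "i = 0 \<or> i = 1" if "i \<le> 1" for i :: nat
    using that by auto
  have A: "A i j \<in> obs D" for i j
    using homs_obj[OF cD(1) mor_in_homs[OF b(1)]] homs_obj[OF cD(1) mor_in_homs[OF b(2)]] by (simp add: A_def)
  have f: "f i i' j \<in> homs (hcat D) (A i j) (A i' j)" if "i \<le> i'" "i' \<le> 1" "j \<le> 1" for i i' j
    using two[of i] two[of i'] two[of j] that id_in_homs[OF cD(1) A] mor_in_homs[OF b(1)] mor_in_homs[OF b(2)]
    by (auto simp: f_def) (auto simp: A_def)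
  have u: "u i j j' \<in> homs (vcat D) (A i j) (A i j')" if "i \<le> 1" "j \<le> j'" "j' \<le> 1" for i j j'
    using two[of i] two[of j] two[of j'] that id_in_homs[OF cD(2), unfolded cD(5), OF A]
      mor_in_homs[OF b(3)] mor_in_homs[OF b(4)] b(5-8)
    by (auto simp: u_def) (auto simp: A_def)
  have q_h: "q i i j j' = Idn (sqh D) (u i j j')" for i j j'
    using double_category_ids(1)[OF D A] by (simp add: q_def u_def)
  have q_v: "q i i' j j = Idn (sqv D) (f i i' j)" for i i' j
    by (simp add: q_def f_def)
  have q: "is_square D (f i i' j) (u i j j') (u i' j j') (f i i' j') (q i i' j j')"
    if "i \<le> i'" "i' \<le> 1" "j \<le> j'" "j' \<le> 1" for i i' j j'
  proof -
    have "i = i' \<or> j = j' \<or> i = 0 \<and> i' = 1 \<and> j = 0 \<and> j' = 1"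
      using that by linarith
    then consider "i = i'" | "j = j'" | "i = 0" "i' = 1" "j = 0" "j' = 1"
      by blast
    then show ?thesis
    proof cases
      case 1
      then show ?thesis
        using square_hid[OF D u[of i j j']] that q_h[of i j j'] by (simp add: f_def)
    next
      case 2
      then show ?thesis
        using square_vid[OF D f[of i i' j]] that q_v[of i i' j] by (simp add: u_def)
    next
      case 3
      then show ?thesis
        using sq by (simp add: f_def u_def q_def)
    qed
  qed
  have fc: "Cmp (hcat D) (f i' i'' j) (f i i' j) = f i i'' j" if "i \<le> i'" "i' \<le> i''" "i'' \<le> 1" "j \<le> 1" for i i' i'' j
  proof -
    \<comment> \<open>Of two composable arrows of \<open>[1]\<close> one is an identity, so each of
      the four composition laws is a unit law.\<close>
    have "i = i' \<or> i' = i''"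
      using two[of i] two[of i'] two[of i''] that by linarith
    then show ?thesis
      using comp_id[OF cD(1) f[of i i'' j]] that by (auto simp: f_def)
  qed
  have uc: "Cmp (vcat D) (u i j' j'') (u i j j') = u i j j''" if "i \<le> 1" "j \<le> j'" "j' \<le> j''" "j'' \<le> 1" for i j j' j''
  proof -
    have "j = j' \<or> j' = j''"
      using two[of j] two[of j'] two[of j''] that by linarith
    then show ?thesis
      using comp_id[OF cD(2) u[of i j j'']] that by (auto simp: u_def)
  qed
  have qh: "Cmp (sqh D) (q i' i'' j j') (q i i' j j') = q i i'' j j'"
    if "i \<le> i'" "i' \<le> i''" "i'' \<le> 1" "j \<le> j'" "j' \<le> 1" for i i' i'' j j'
  proof -
    have "i = i' \<or> i' = i''"
      using two[of i] two[of i'] two[of i''] that by linarith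
    then show ?thesis
      using comp_id[OF cD(3) square_homs(1)[OF D q[of i i'' j j']]] that q_h by auto
  qed
  have qv: "Cmp (sqv D) (q i i' j' j'') (q i i' j j') = q i i' j j''"
    if "i \<le> i'" "i' \<le> 1" "j \<le> j'" "j' \<le> j''" "j'' \<le> 1" for i i' j j' j''
  proof -
    have "j = j' \<or> j' = j''"
      using two[of j] two[of j'] two[of j''] that by linarith
    then show ?thesis
      using comp_id[OF cD(4) square_homs(2)[OF D q[of i i' j j'']]] that q_v by auto
  qed
  have fid: "f i i j = Idn (hcat D) (A i j)" and uid: "u i j j = Idn (vcat D) (A i j)" for i j
    by (simp_all add: f_def u_def)
  have sel: "onob (square_dfun D s) (i, j) = A i j" if "i \<le> 1" "j \<le> 1" for i j
    using that by (simp add: square_dfun_def Let_def A_def)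
  have sel1: "onhor (square_dfun D s) ((i, i'), j) = f i i' j" if "i \<le> i'" "i' \<le> 1" "j \<le> 1" for i i' j
    using that by (simp add: square_dfun_def Let_def A_def f_def)
  have sel2: "onver (square_dfun D s) (i, (j, j')) = u i j j'" if "i \<le> 1" "j \<le> j'" "j' \<le> 1" for i j j'
    using that by (simp add: square_dfun_def Let_def A_def u_def)
  have sel3: "onsq (square_dfun D s) ((i, i'), (j, j')) = q i i' j j'" if "i \<le> i'" "i' \<le> 1" "j \<le> j'" "j' \<le> 1" for i i' j j'
    using that by (simp add: square_dfun_def Let_def A_def u_def f_def q_def)
  have ext: "onob (square_dfun D s) \<in> extensional (obs (grid 1 1))" "onhor (square_dfun D s) \<in> extensional (hors (grid 1 1))"
    "onver (square_dfun D s) \<in> extensional (vers (grid 1 1))" "onsq (square_dfun D s) \<in> extensional (sqs (grid 1 1))"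
    unfolding square_dfun_def Let_def by simp_all
  have h: "is_functor (hcat (grid 1 1)) (hcat D) (onob (square_dfun D s)) (onhor (square_dfun D s))"
    unfolding is_functor_def using A f fc fid by (auto simp: sel sel1 homs_def)
  have v: "is_functor (vcat (grid 1 1)) (vcat D) (onob (square_dfun D s)) (onver (square_dfun D s))"
    unfolding is_functor_def using A u uc uid cD(5) by (auto simp: sel sel2 homs_def)
  have "is_functor (sqh (grid 1 1)) (sqh D) (onver (square_dfun D s)) (onsq (square_dfun D s))"
    unfolding is_functor_def using u q qh q_h cD(6) by (auto simp: sel2 sel3 homs_def is_square_def)
  moreover have "is_functor (sqv (grid 1 1)) (sqv D) (onhor (square_dfun D s)) (onsq (square_dfun D s))"
    unfolding is_functor_def using f q qv q_v cD(7,8) by (auto simp: sel1 sel3 homs_def is_square_def)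
  ultimately show ?thesis
    using ext h v by (simp add: double_functor_def)
qed

section \<open>Lifting along a corner of a square\<close>

text \<open>A strict pullback, with equalities of objects and of morphisms, because the fiber
  products of simplicial sets in the stability condition are strict as well.\<close>

definition pullback_cat ::
    "('a, 'f) cat \<Rightarrow> ('a \<Rightarrow> 'e) \<Rightarrow> ('f \<Rightarrow> 'k) \<Rightarrow> ('b, 'g) cat \<Rightarrow> ('b \<Rightarrow> 'e) \<Rightarrow> ('g \<Rightarrow> 'k) \<Rightarrow> ('a \<times> 'b, 'f \<times> 'g) cat" where
  "pullback_cat A Uo Um B Vo Vm = \<lparr>
    Obj = {(x, y). x \<in> Obj A \<and> y \<in> Obj B \<and> Uo x = Vo y},
    Mor = {(f, g). f \<in> Mor A \<and> g \<in> Mor B \<and> Um f = Vm g},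
    Dom = (\<lambda>(f, g). (Dom A f, Dom B g)), Cod = (\<lambda>(f, g). (Cod A f, Cod B g)),
    Idn = (\<lambda>(x, y). (Idn A x, Idn B y)),
    Cmp = (\<lambda>(f', g') (f, g). (Cmp A f' f, Cmp B g' g))\<rparr>"

lemma pullback_cat_sel [simp]:
  "(x, y) \<in> Obj (pullback_cat A Uo Um B Vo Vm) \<longleftrightarrow> x \<in> Obj A \<and> y \<in> Obj B \<and> Uo x = Vo y"
  "(f, g) \<in> Mor (pullback_cat A Uo Um B Vo Vm) \<longleftrightarrow> f \<in> Mor A \<and> g \<in> Mor B \<and> Um f = Vm g"
  "Dom (pullback_cat A Uo Um B Vo Vm) (f, g) = (Dom A f, Dom B g)"
  "Cod (pullback_cat A Uo Um B Vo Vm) (f, g) = (Cod A f, Cod B g)"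
  "Idn (pullback_cat A Uo Um B Vo Vm) (x, y) = (Idn A x, Idn B y)"
  "Cmp (pullback_cat A Uo Um B Vo Vm) (f', g') (f, g) = (Cmp A f' f, Cmp B g' g)"
  by (simp_all add: pullback_cat_def)

lemma functor_inverse_mors:
  assumes C: "is_category C" and F: "is_functor C E Fo Fm" and f: "inverse_mors C f g"
  shows "inverse_mors E (Fm f) (Fm g)"
proof -
  have fh: "f \<in> homs C (Dom C f) (Cod C f)"
    using f by (simp add: inverse_mors_def homs_def)
  note g = inverse_mors_homs[OF f fh]
  show ?thesis
    using functor_comp[OF F fh g(1)] functor_comp[OF F g(1) fh] functor_id[OF F homs_obj(1)[OF C fh]]
      functor_id[OF F homs_obj(2)[OF C fh]] g
    by (intro inverse_morsI[OF functor_homs[OF F fh] functor_homs[OF F g(1)]]) simp_all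
qed

lemma groupoid_pullback_cat:
  assumes A: "groupoid A" and B: "groupoid B" and E: "is_category E"
    and U: "is_functor A E Uo Um" and V: "is_functor B E Vo Vm"
  shows "groupoid (pullback_cat A Uo Um B Vo Vm)" (is "groupoid ?P")
  unfolding groupoid_def
proof
  note cA = groupoid_is_category[OF A] and cB = groupoid_is_category[OF B]
  have "is_category (pullback_cat A Uo Um B Vo Vm)"
    using cA cB U V unfolding is_category_def is_functor_def
    by (auto simp: pullback_cat_def Pi_iff)
  then show "is_category ?P" .
  show "\<forall>m\<in>Mor ?P. \<exists>n. inverse_mors ?P m n"
  proof
    fix m assume m: "m \<in> Mor ?P"
    obtain f g where m_eq: "m = (f, g)" and f: "f \<in> Mor A" and g: "g \<in> Mor B" and fg: "Um f = Vm g"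
      using m by (cases m) simp
    obtain f' where f': "inverse_mors A f f'"
      using A f unfolding groupoid_def by blast
    obtain g' where g': "inverse_mors B g g'"
      using B g unfolding groupoid_def by blast
    \<comment> \<open>Functors preserve inverses, and inverses are unique, so compatibility passes
      to the inverses.\<close>
    have "Um f' = Vm g'"
      by (rule inverse_mors_unique[OF E functor_inverse_mors[OF cA U f']])
        (use functor_inverse_mors[OF cB V g'] fg in simp)
    then have "inverse_mors ?P m (f', g')"
      using f' g' fg by (auto simp: m_eq inverse_mors_def)
    then show "\<exists>n. inverse_mors ?P m n" ..
  qed
qed

lemma pullback_homs:
  "(f, g) \<in> homs (pullback_cat A Uo Um B Vo Vm) (x, y) (x', y') \<longleftrightarrow>
    f \<in> homs A x x' \<and> g \<in> homs B y y' \<and> Um f = Vm g"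
  by (auto simp: homs_def)

section \<open>Fiber products, nerves and their simplices\<close>

lemma simplicial_set_fiber_product:
  assumes "simplicial_set X" "simplicial_set Y" "simplicial_map X W f" "simplicial_map Y W g"
  shows "simplicial_set (fiber_product X f Y g)"
proof -
  have "fiber_product X f Y g = \<lparr>simps = (\<lambda>k. {(x, y). x \<in> simps X k \<and> y \<in> simps Y k \<and> f k x = g k y}),
    sact = (\<lambda>k l \<alpha>. map_prod (sact X k l \<alpha>) (sact Y k l \<alpha>))\<rparr>"
    by (simp add: fiber_product_def)
  then show ?thesis
    using assms unfolding simplicial_set_def simplicial_map_def by (auto simp: Pi_iff)
qed

lemma nerve_simpsD:
  assumes "\<sigma> \<in> simps (nerve C) k"
  shows "is_functor (ordcat k) C (fst \<sigma>) (snd \<sigma>)"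
    "fst \<sigma> \<in> extensional {..k}" "snd \<sigma> \<in> extensional {(i, j). i \<le> j \<and> j \<le> k}"
  using assms by (auto simp: nerve_def ordcat_def)

lemma nerve_eqI:
  assumes \<sigma>: "\<sigma> \<in> simps (nerve C) k" and \<tau>: "\<tau> \<in> simps (nerve C) k"
    and o: "\<And>i. i \<le> k \<Longrightarrow> fst \<sigma> i = fst \<tau> i"
    and m: "\<And>i j. i \<le> j \<Longrightarrow> j \<le> k \<Longrightarrow> snd \<sigma> (i, j) = snd \<tau> (i, j)"
  shows "\<sigma> = \<tau>"
proof (rule prod_eqI)
  show "fst \<sigma> = fst \<tau>"
    by (rule extensionalityI[OF nerve_simpsD(2)[OF \<sigma>] nerve_simpsD(2)[OF \<tau>]]) (simp add: o)
  show "snd \<sigma> = snd \<tau>"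
    by (rule extensionalityI[OF nerve_simpsD(3)[OF \<sigma>] nerve_simpsD(3)[OF \<tau>]]) (auto simp: m)
qed

lemma nerve_vertex_eqI:
  assumes \<sigma>: "\<sigma> \<in> simps (nerve C) 0" and \<tau>: "\<tau> \<in> simps (nerve C) 0" and eq: "fst \<sigma> 0 = fst \<tau> 0"
  shows "\<sigma> = \<tau>"
proof (rule nerve_eqI[OF \<sigma> \<tau>])
  fix i j :: nat assume "i \<le> j" "j \<le> 0"
  then show "snd \<sigma> (i, j) = snd \<tau> (i, j)"
    using functor_id[OF nerve_simpsD(1)[OF \<sigma>], of 0] functor_id[OF nerve_simpsD(1)[OF \<tau>], of 0] eq
    by (simp add: ordcat_def)
qed (use eq in simp)

definition vertex_simplex :: "('o, 'm) cat \<Rightarrow> 'o \<Rightarrow> (nat \<Rightarrow> 'o) \<times> (nat \<times> nat \<Rightarrow> 'm)" where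
  "vertex_simplex C A = (\<lambda>i\<in>{..0}. A, \<lambda>u\<in>{(i, j). i \<le> j \<and> j \<le> 0}. Idn C A)"

lemma vertex_simplex_in:
  assumes C: "is_category C" and A: "A \<in> Obj C"
  shows "vertex_simplex C A \<in> simps (nerve C) 0"
  using id_in_homs[OF C A] comp_id[OF C id_in_homs[OF C A]] A
  by (auto simp: vertex_simplex_def nerve_def is_functor_def ordcat_def homs_def)

definition edge_simplex :: "('o, 'm) cat \<Rightarrow> 'm \<Rightarrow> (nat \<Rightarrow> 'o) \<times> (nat \<times> nat \<Rightarrow> 'm)" where
  "edge_simplex C f = (\<lambda>i\<in>{..1}. if i = 0 then Dom C f else Cod C f,
    \<lambda>(i, j)\<in>{(i, j). i \<le> j \<and> j \<le> 1}. if j = 0 then Idn C (Dom C f) else if i = 0 then f else Idn C (Cod C f))"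

lemma edge_simplex_in:
  assumes C: "is_category C" and f: "f \<in> Mor C"
  shows "edge_simplex C f \<in> simps (nerve C) 1"
proof -
  note h = mor_in_homs[OF f]
  note ob = homs_obj[OF C h]
  note i = id_in_homs[OF C ob(1)] id_in_homs[OF C ob(2)]
  show ?thesis
    using ob i comp_id[OF C h] comp_id[OF C i(1)] comp_id[OF C i(2)] f
    unfolding edge_simplex_def nerve_def is_functor_def ordcat_def homs_def
    by (auto simp: le_Suc_eq)
qed

lemma edge_simplex_sel:
  "fst (edge_simplex C f) 0 = Dom C f" "fst (edge_simplex C f) 1 = Cod C f" "snd (edge_simplex C f) (0, 1) = f"
  by (simp_all add: edge_simplex_def)

lemma nerve_map_edge_simplex:
  assumes C: "is_category C" and F: "is_functor C E Fo Fm" and f: "f \<in> Mor C"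
  shows "nerve_map Fo Fm 1 (edge_simplex C f) = edge_simplex E (Fm f)"
  using functor_homs[OF F mor_in_homs[OF f]] functor_id[OF F homs_obj(1)[OF C mor_in_homs[OF f]]]
    functor_id[OF F homs_obj(2)[OF C mor_in_homs[OF f]]]
  by (auto simp: nerve_map_def edge_simplex_def ordcat_def homs_def fun_eq_iff)

lemma nerve_map_sel:
  "i \<le> k \<Longrightarrow> fst (nerve_map Fo Fm k \<sigma>) i = Fo (fst \<sigma> i)"
  "i \<le> j \<Longrightarrow> j \<le> k \<Longrightarrow> snd (nerve_map Fo Fm k \<sigma>) (i, j) = Fm (snd \<sigma> (i, j))"
  by (simp_all add: nerve_map_def ordcat_def split_beta)

lemma nerve_act_sel:
  "i \<le> k \<Longrightarrow> fst (sact (nerve C) k l \<alpha> \<sigma>) i = fst \<sigma> (\<alpha> i)"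
  "i \<le> j \<Longrightarrow> j \<le> k \<Longrightarrow> snd (sact (nerve C) k l \<alpha> \<sigma>) (i, j) = snd \<sigma> (\<alpha> i, \<alpha> j)"
  by (simp_all add: nerve_def ordcat_def split_beta)

text \<open>The comparison from the fiber product of two nerves to the nerve of the pullback; it
  provides the labels on the target of a stability map.\<close>

definition pair_simplex where
  "pair_simplex k \<sigma> \<tau> = (\<lambda>i\<in>{..k}. (fst \<sigma> i, fst \<tau> i),
    \<lambda>u\<in>{(i, j). i \<le> j \<and> j \<le> k}. (snd \<sigma> u, snd \<tau> u))"

lemma pair_simplex_sel:
  "i \<le> k \<Longrightarrow> fst (pair_simplex k \<sigma> \<tau>) i = (fst \<sigma> i, fst \<tau> i)"
  "i \<le> j \<Longrightarrow> j \<le> k \<Longrightarrow> snd (pair_simplex k \<sigma> \<tau>) (i, j) = (snd \<sigma> (i, j), snd \<tau> (i, j))"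
  by (simp_all add: pair_simplex_def)

lemma pair_simplex_in:
  assumes \<sigma>: "\<sigma> \<in> simps (nerve A) k" and \<tau>: "\<tau> \<in> simps (nerve B) k"
    and eq: "nerve_map Uo Um k \<sigma> = nerve_map Vo Vm k \<tau>"
  shows "pair_simplex k \<sigma> \<tau> \<in> simps (nerve (pullback_cat A Uo Um B Vo Vm)) k"
proof -
  have o: "Uo (fst \<sigma> i) = Vo (fst \<tau> i)" if "i \<le> k" for i
    using nerve_map_sel(1)[OF that, of Uo Um \<sigma>] nerve_map_sel(1)[OF that, of Vo Vm \<tau>] eq by simp
  have m: "Um (snd \<sigma> (i, j)) = Vm (snd \<tau> (i, j))" if "i \<le> j" "j \<le> k" for i j
    using nerve_map_sel(2)[OF that, of Uo Um \<sigma>] nerve_map_sel(2)[OF that, of Vo Vm \<tau>] eq by simp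
  note S = nerve_simpsD(1)[OF \<sigma>] and T = nerve_simpsD(1)[OF \<tau>]
  have ob: "fst \<sigma> i \<in> Obj A" "fst \<tau> i \<in> Obj B" if "i \<le> k" for i
    using S T that unfolding is_functor_def by (auto simp: ordcat_def)
  have mor: "snd \<sigma> (i, j) \<in> homs A (fst \<sigma> i) (fst \<sigma> j)" "snd \<tau> (i, j) \<in> homs B (fst \<tau> i) (fst \<tau> j)"
    if "i \<le> j" "j \<le> k" for i j
    using functor_homs[OF S, of "(i, j)" i j] functor_homs[OF T, of "(i, j)" i j] that
    by (auto simp: ordcat_def homs_def)
  have idn: "snd \<sigma> (i, i) = Idn A (fst \<sigma> i)" "snd \<tau> (i, i) = Idn B (fst \<tau> i)" if "i \<le> k" for i
    using functor_id[OF S, of i] functor_id[OF T, of i] that by (auto simp: ordcat_def)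
  have cmp: "snd \<sigma> (h, j) = Cmp A (snd \<sigma> (i, j)) (snd \<sigma> (h, i))"
    "snd \<tau> (h, j) = Cmp B (snd \<tau> (i, j)) (snd \<tau> (h, i))" if "h \<le> i" "i \<le> j" "j \<le> k" for h i j
    using functor_comp[OF S, of "(h, i)" h i "(i, j)" j] functor_comp[OF T, of "(h, i)" h i "(i, j)" j] that
    by (auto simp: ordcat_def homs_def)
  have "is_functor (ordcat k) (pullback_cat A Uo Um B Vo Vm) (fst (pair_simplex k \<sigma> \<tau>)) (snd (pair_simplex k \<sigma> \<tau>))"
    unfolding is_functor_def
  proof (intro conjI ballI impI)
    show "fst (pair_simplex k \<sigma> \<tau>) \<in> Obj (ordcat k) \<rightarrow> Obj (pullback_cat A Uo Um B Vo Vm)"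
      using ob o by (auto simp: ordcat_def pair_simplex_sel)
    show "snd (pair_simplex k \<sigma> \<tau>) \<in> Mor (ordcat k) \<rightarrow> Mor (pullback_cat A Uo Um B Vo Vm)"
      using mor m by (auto simp: ordcat_def pair_simplex_sel homs_def)
    show "snd (pair_simplex k \<sigma> \<tau>) (Idn (ordcat k) i) =
        Idn (pullback_cat A Uo Um B Vo Vm) (fst (pair_simplex k \<sigma> \<tau>) i)" if "i \<in> Obj (ordcat k)" for i
      using idn that by (simp add: ordcat_def pair_simplex_sel)
    fix u assume "u \<in> Mor (ordcat k)"
    then obtain h i where u: "u = (h, i)" "h \<le> i" "i \<le> k"
      by (auto simp: ordcat_def)
    show "Dom (pullback_cat A Uo Um B Vo Vm) (snd (pair_simplex k \<sigma> \<tau>) u) = fst (pair_simplex k \<sigma> \<tau>) (Dom (ordcat k) u)"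
      "Cod (pullback_cat A Uo Um B Vo Vm) (snd (pair_simplex k \<sigma> \<tau>) u) = fst (pair_simplex k \<sigma> \<tau>) (Cod (ordcat k) u)"
      using mor[OF u(2,3)] u by (simp_all add: ordcat_def pair_simplex_sel homs_def)
    fix w assume "w \<in> Mor (ordcat k)" "Cod (ordcat k) u = Dom (ordcat k) w"
    then obtain j where w: "w = (i, j)" "i \<le> j" "j \<le> k"
      by (auto simp: ordcat_def u)
    show "snd (pair_simplex k \<sigma> \<tau>) (Cmp (ordcat k) w u) = Cmp (pullback_cat A Uo Um B Vo Vm)
        (snd (pair_simplex k \<sigma> \<tau>) w) (snd (pair_simplex k \<sigma> \<tau>) u)"
      using cmp[OF u(2) w(2,3)] u w by (simp add: ordcat_def pair_simplex_sel)
  qed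
  then show ?thesis
    by (simp add: nerve_def pair_simplex_def ordcat_def)
qed

lemma pair_simplex_act:
  assumes a: "a \<in> \<Delta> k l"
  shows "pair_simplex k (sact (nerve A) k l a \<sigma>) (sact (nerve B) k l a \<tau>) =
    sact (nerve C) k l a (pair_simplex l \<sigma> \<tau>)"
proof -
  have a': "a i \<le> a j" "a j \<le> l" if "i \<le> j" "j \<le> k" for i j
    using a that by (auto simp: Delta_def mono_on_def)
  have "fst (sact (nerve C) k l a (pair_simplex l \<sigma> \<tau>)) = (\<lambda>i\<in>{..k}. (fst \<sigma> (a i), fst \<tau> (a i)))"
    using a' by (auto simp: nerve_def ordcat_def pair_simplex_def fun_eq_iff)
  moreover have "snd (sact (nerve C) k l a (pair_simplex l \<sigma> \<tau>)) =
      (\<lambda>(i, j)\<in>{(i, j). i \<le> j \<and> j \<le> k}. (snd \<sigma> (a i, a j), snd \<tau> (a i, a j)))"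
    using a' by (auto simp: nerve_def ordcat_def pair_simplex_def fun_eq_iff)
  moreover have "fst (pair_simplex k (sact (nerve A) k l a \<sigma>) (sact (nerve B) k l a \<tau>)) =
      (\<lambda>i\<in>{..k}. (fst \<sigma> (a i), fst \<tau> (a i)))"
    by (simp add: pair_simplex_def nerve_act_sel cong: restrict_cong)
  moreover have "snd (pair_simplex k (sact (nerve A) k l a \<sigma>) (sact (nerve B) k l a \<tau>)) =
      (\<lambda>(i, j)\<in>{(i, j). i \<le> j \<and> j \<le> k}. (snd \<sigma> (a i, a j), snd \<tau> (a i, a j)))"
    by (auto simp: pair_simplex_def nerve_act_sel fun_eq_iff)
  ultimately show ?thesis
    by (simp add: prod_eq_iff)
qed

text \<open>Treats both stability maps at once. The grids \<open>(p, q)\<close> and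
  \<open>(p', q')\<close> are two edges of the square, embedded by \<open>\<alpha>\<close>,
  \<open>\<beta>\<close> and \<open>\<alpha>'\<close>, \<open>\<beta>'\<close>; their common vertex
  is located by \<open>\<gamma>\<close>, \<open>\<delta>\<close> in the first and by
  \<open>\<gamma>'\<close>, \<open>\<delta>'\<close> in the second. \<open>\<Phi>\<close> is the
  given isomorphism to the classifying diagram.\<close>

locale stable_corner = shared_isos D \<phi>
  for D :: "('o, 'h, 'v, 's) dblcat" and \<phi> +
  fixes Y :: "('a, 'z) bispace_scheme"
    and \<Phi> :: "nat \<Rightarrow> nat \<Rightarrow> nat \<Rightarrow> 'a \<Rightarrow> ('o, 'h, 'v, 's) grid_simplex"
    and p q p' q' :: nat and \<alpha> \<beta> \<alpha>' \<beta>' \<gamma> \<delta> \<gamma>' \<delta>' :: "nat \<Rightarrow> nat"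
  assumes bis: "bisimplicial_space Y"
    and \<Phi>_map: "\<And>m n. simplicial_map (spc Y m n) (nerve (dfun_groupoid (grid m n) D)) (\<Phi> m n)"
    and \<Phi>_bij: "\<And>m n k. bij_betw (\<Phi> m n k) (simps (spc Y m n) k) (simps (nerve (dfun_groupoid (grid m n) D)) k)"
    and \<Phi>_act: "\<And>m n m' n' a b k y. a \<in> \<Delta> m m' \<Longrightarrow> b \<in> \<Delta> n n' \<Longrightarrow> y \<in> simps (spc Y m' n') k \<Longrightarrow>
      \<Phi> m n k (bact Y m n m' n' a b k y) =
      nerve_map (restr m n a b) (whisker (grid m n) (grid_map m n a b)) k (\<Phi> m' n' k y)"
    and \<Delta>s: "\<alpha> \<in> \<Delta> p 1" "\<beta> \<in> \<Delta> q 1" "\<alpha>' \<in> \<Delta> p' 1" "\<beta>' \<in> \<Delta> q' 1"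
      "\<gamma> \<in> \<Delta> 0 p" "\<delta> \<in> \<Delta> 0 q" "\<gamma>' \<in> \<Delta> 0 p'" "\<delta>' \<in> \<Delta> 0 q'"
    and corner: "\<alpha> (\<gamma> 0) = \<alpha>' (\<gamma>' 0)" "\<beta> (\<delta> 0) = \<beta>' (\<delta>' 0)"
    and weq: "weak_equivalence (spc Y 1 1)
      (fiber_product (spc Y p q) (bact Y 0 0 p q \<gamma> \<delta>) (spc Y p' q') (bact Y 0 0 p' q' \<gamma>' \<delta>'))
      (\<lambda>k y. (bact Y p q 1 1 \<alpha> \<beta> k y, bact Y p' q' 1 1 \<alpha>' \<beta>' k y))"
begin

abbreviation "G \<equiv> dfun_groupoid (grid 1 1) D"
abbreviation "G1 \<equiv> dfun_groupoid (grid p q) D"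
abbreviation "G2 \<equiv> dfun_groupoid (grid p' q') D"
abbreviation "G0 \<equiv> dfun_groupoid (grid 0 0) D"
abbreviation "W1 \<equiv> whisker (grid p q) (grid_map p q \<alpha> \<beta>)"
abbreviation "W2 \<equiv> whisker (grid p' q') (grid_map p' q' \<alpha>' \<beta>')"
abbreviation "U \<equiv> whisker (grid 0 0) (grid_map 0 0 \<gamma> \<delta>)"
abbreviation "U' \<equiv> whisker (grid 0 0) (grid_map 0 0 \<gamma>' \<delta>')"
abbreviation "PB \<equiv> pullback_cat G1 (restr 0 0 \<gamma> \<delta>) U G2 (restr 0 0 \<gamma>' \<delta>') U'"
abbreviation "Z \<equiv> fiber_product (spc Y p q) (bact Y 0 0 p q \<gamma> \<delta>) (spc Y p' q') (bact Y 0 0 p' q' \<gamma>' \<delta>')"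
abbreviation "f \<equiv> (\<lambda>k y. (bact Y p q 1 1 \<alpha> \<beta> k y, bact Y p' q' 1 1 \<alpha>' \<beta>' k y))"
abbreviation "LZ \<equiv> (\<lambda>k (y, y'). pair_simplex k (\<Phi> p q k y) (\<Phi> p' q' k y'))"

lemma grp: "groupoid (dfun_groupoid (grid m n) D)"
  by (rule groupoid_dfun_groupoid[OF double_category_grid])

lemma restr_functor:
  "a \<in> \<Delta> m m' \<Longrightarrow> b \<in> \<Delta> n n' \<Longrightarrow>
    is_functor (dfun_groupoid (grid m' n') D) (dfun_groupoid (grid m n) D) (restr m n a b)
      (whisker (grid m n) (grid_map m n a b))"
  by (intro whisker_functor double_category_grid dbl double_functor_grid_map)

lemma \<Phi>_in: "y \<in> simps (spc Y m n) k \<Longrightarrow> \<Phi> m n k y \<in> simps (nerve (dfun_groupoid (grid m n) D)) k"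
  using \<Phi>_bij[of m n k] by (auto simp: bij_betw_def)

lemma \<Phi>_inj:
  "y \<in> simps (spc Y m n) k \<Longrightarrow> y' \<in> simps (spc Y m n) k \<Longrightarrow> \<Phi> m n k y = \<Phi> m n k y' \<Longrightarrow> y = y'"
  using \<Phi>_bij[of m n k] by (auto simp: bij_betw_def inj_on_def)

lemma \<Phi>_surj:
  assumes "\<sigma> \<in> simps (nerve (dfun_groupoid (grid m n) D)) k"
  shows "\<exists>y\<in>simps (spc Y m n) k. \<Phi> m n k y = \<sigma>"
proof -
  have "\<sigma> \<in> \<Phi> m n k ` simps (spc Y m n) k"
    unfolding bij_betw_imp_surj_on[OF \<Phi>_bij] by (rule assms)
  then show ?thesis
    by (elim imageE) auto
qed

lemma bact_in:
  "a \<in> \<Delta> m m' \<Longrightarrow> b \<in> \<Delta> n n' \<Longrightarrow> y \<in> simps (spc Y m' n') k \<Longrightarrow>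
    bact Y m n m' n' a b k y \<in> simps (spc Y m n) k"
  using bis by (auto simp: bisimplicial_space_def simplicial_map_def Pi_iff)

lemma corner_restr_eq:
  assumes P: "double_functor (grid 1 1) D P"
  shows "restr 0 0 \<gamma> \<delta> (restr p q \<alpha> \<beta> P) = restr 0 0 \<gamma>' \<delta>' (restr p' q' \<alpha>' \<beta>' P)"
proof (rule grid_00_eqI)
  note c = dfun_comp_functor[OF double_category_grid double_functor_grid_map]
  show "double_functor (grid 0 0) D (restr 0 0 \<gamma> \<delta> (restr p q \<alpha> \<beta> P))"
    by (rule c[OF \<Delta>s(5,6) c[OF \<Delta>s(1,2) P]])
  show "double_functor (grid 0 0) D (restr 0 0 \<gamma>' \<delta>' (restr p' q' \<alpha>' \<beta>' P))"
    by (rule c[OF \<Delta>s(7,8) c[OF \<Delta>s(3,4) P]])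
  have "\<gamma> 0 \<le> p" "\<delta> 0 \<le> q" "\<gamma>' 0 \<le> p'" "\<delta>' 0 \<le> q'"
    using \<Delta>s by (auto simp: Delta_def)
  then show "onob (restr 0 0 \<gamma> \<delta> (restr p q \<alpha> \<beta> P)) (0, 0) = onob (restr 0 0 \<gamma>' \<delta>' (restr p' q' \<alpha>' \<beta>' P)) (0, 0)"
    using corner by (simp add: restr_sel)
qed

lemma corner_whisker_eq:
  assumes m: "m \<in> Mor G"
  shows "U (W1 m) = U' (W2 m)"
proof -
  obtain F \<theta> F' where m_eq: "m = (F, \<theta>, F')"
    by (cases m)
  have "\<gamma> 0 \<le> p" "\<delta> 0 \<le> q" "\<gamma>' 0 \<le> p'" "\<delta>' 0 \<le> q'"
    using \<Delta>s by (auto simp: Delta_def)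
  then show ?thesis
    using m corner_restr_eq[of F] corner_restr_eq[of F'] corner
    by (auto simp: m_eq whisker_def fun_eq_iff grid_map_sel)
qed

lemma corner_functor: "is_functor G PB (\<lambda>P. (restr p q \<alpha> \<beta> P, restr p' q' \<alpha>' \<beta>' P)) (\<lambda>m. (W1 m, W2 m))"
proof -
  note 1 = restr_functor[OF \<Delta>s(1,2)] and 2 = restr_functor[OF \<Delta>s(3,4)]
  show ?thesis
    using 1 2 corner_restr_eq corner_whisker_eq unfolding is_functor_def by (auto simp: Pi_iff)
qed

lemma Z_sset: "simplicial_set Z"
proof (rule simplicial_set_fiber_product)
  show "simplicial_set (spc Y p q)" "simplicial_set (spc Y p' q')"
    using bis by (simp_all add: bisimplicial_space_def)
  show "simplicial_map (spc Y p q) (spc Y 0 0) (bact Y 0 0 p q \<gamma> \<delta>)"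
    "simplicial_map (spc Y p' q') (spc Y 0 0) (bact Y 0 0 p' q' \<gamma>' \<delta>')"
    using bis \<Delta>s by (simp_all add: bisimplicial_space_def)
qed

lemma Z_simps:
  "(y, y') \<in> simps Z k \<longleftrightarrow> y \<in> simps (spc Y p q) k \<and> y' \<in> simps (spc Y p' q') k \<and>
    bact Y 0 0 p q \<gamma> \<delta> k y = bact Y 0 0 p' q' \<gamma>' \<delta>' k y'"
  "sact Z k l a (y, y') = (sact (spc Y p q) k l a y, sact (spc Y p' q') k l a y')"
  by (simp_all add: fiber_product_def)

text \<open>Injectivity of \<open>\<Phi>\<close> lets the strict matching condition in
  \<open>Y\<close> be tested in the nerves.\<close>

lemma Z_iff:
  assumes "y \<in> simps (spc Y p q) k" "y' \<in> simps (spc Y p' q') k"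
  shows "bact Y 0 0 p q \<gamma> \<delta> k y = bact Y 0 0 p' q' \<gamma>' \<delta>' k y' \<longleftrightarrow>
    nerve_map (restr 0 0 \<gamma> \<delta>) U k (\<Phi> p q k y) = nerve_map (restr 0 0 \<gamma>' \<delta>') U' k (\<Phi> p' q' k y')"
  using \<Phi>_act[OF \<Delta>s(5,6) assms(1)] \<Phi>_act[OF \<Delta>s(7,8) assms(2)]
    \<Phi>_inj[OF bact_in[OF \<Delta>s(5,6) assms(1)] bact_in[OF \<Delta>s(7,8) assms(2)]] by auto

lemma act_in: "y \<in> simps (spc Y m n) l \<Longrightarrow> a \<in> \<Delta> k l \<Longrightarrow> sact (spc Y m n) k l a y \<in> simps (spc Y m n) k"
  using bis by (auto simp: bisimplicial_space_def simplicial_set_def Pi_iff)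

lemma \<Phi>_sact:
  "y \<in> simps (spc Y m n) l \<Longrightarrow> a \<in> \<Delta> k l \<Longrightarrow>
    \<Phi> m n k (sact (spc Y m n) k l a y) = sact (nerve (dfun_groupoid (grid m n) D)) k l a (\<Phi> m n l y)"
  using \<Phi>_map[of m n] by (simp add: simplicial_map_def)

lemma LZ_map: "simplicial_map Z (nerve PB) LZ"
  unfolding simplicial_map_def
proof (intro conjI allI ballI)
  show "LZ k \<in> simps Z k \<rightarrow> simps (nerve PB) k" for k
    using pair_simplex_in[OF \<Phi>_in \<Phi>_in] Z_iff by (auto simp: Z_simps)
  fix k l a z assume a: "a \<in> \<Delta> k l" and z: "z \<in> simps Z l"
  obtain y y' where zy: "z = (y, y')" and y: "y \<in> simps (spc Y p q) l" "y' \<in> simps (spc Y p' q') l"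
    using z by (cases z) (simp add: Z_simps)
  show "LZ k (sact Z k l a z) = sact (nerve PB) k l a (LZ l z)"
    using \<Phi>_sact[OF y(1) a] \<Phi>_sact[OF y(2) a] by (simp add: zy Z_simps pair_simplex_act[OF a])
qed

lemma labelled_equivalence:
  "labelled_weak_equivalence (spc Y 1 1) G (\<Phi> 1 1) Z PB LZ f
    (\<lambda>P. (restr p q \<alpha> \<beta> P, restr p' q' \<alpha>' \<beta>' P)) (\<lambda>m. (W1 m, W2 m))"
proof unfold_locales
  show "simplicial_set (spc Y 1 1)"
    using bis by (simp add: bisimplicial_space_def)
  show "groupoid PB"
    by (rule groupoid_pullback_cat[OF grp grp groupoid_is_category[OF grp[of 0 0]]
          restr_functor[OF \<Delta>s(5,6)] restr_functor[OF \<Delta>s(7,8)]])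
  fix k i :: nat and y assume y: "y \<in> simps (spc Y 1 1) k"
  show "fst (LZ k (f k y)) i = (restr p q \<alpha> \<beta> (fst (\<Phi> 1 1 k y) i), restr p' q' \<alpha>' \<beta>' (fst (\<Phi> 1 1 k y) i))"
    if "i \<le> k"
    using \<Phi>_act[OF \<Delta>s(1,2) y] \<Phi>_act[OF \<Delta>s(3,4) y] that by (simp add: pair_simplex_sel nerve_map_sel)
  show "snd (LZ k (f k y)) (i, j) = (W1 (snd (\<Phi> 1 1 k y) (i, j)), W2 (snd (\<Phi> 1 1 k y) (i, j)))"
    if "i \<le> j" "j \<le> k" for j
    using \<Phi>_act[OF \<Delta>s(1,2) y] \<Phi>_act[OF \<Delta>s(3,4) y] that by (simp add: pair_simplex_sel nerve_map_sel)
qed (fact grp \<Phi>_map Z_sset LZ_map weq corner_functor)+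

text \<open>Prepares the hypothesis of \<open>full\<close> that every morphism labels an edge
  between prescribed vertices. Surjectivity of \<open>\<Phi>\<close> gives an edge; its ends are the
  right ones because vertices of a nerve are determined by their objects and \<open>\<Phi>\<close>
  is injective.\<close>

lemma ex_edge:
  assumes y: "y \<in> simps (spc Y m n) 0" "y' \<in> simps (spc Y m n) 0"
    and b: "b \<in> homs (dfun_groupoid (grid m n) D) (fst (\<Phi> m n 0 y) 0) (fst (\<Phi> m n 0 y') 0)"
  obtains a where "a \<in> simps (spc Y m n) 1" "\<Phi> m n 1 a = edge_simplex (dfun_groupoid (grid m n) D) b"
    "sact (spc Y m n) 0 1 (Delta_vertex 0) a = y" "sact (spc Y m n) 0 1 (Delta_vertex 1) a = y'"
proof -
  let ?C = "dfun_groupoid (grid m n) D"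
  have bM: "b \<in> Mor ?C"
    using b by (simp add: homs_def)
  obtain a where a: "a \<in> simps (spc Y m n) 1" "\<Phi> m n 1 a = edge_simplex ?C b"
    using \<Phi>_surj[OF edge_simplex_in[OF groupoid_is_category[OF grp] bM]] by blast
  have v: "Delta_vertex i \<in> \<Delta> 0 1" if "i \<le> 1" for i
    by (rule Delta_vertex_in[OF that])
  have e: "sact (spc Y m n) 0 1 (Delta_vertex i) a = w"
    if i: "i \<le> 1" and w: "w \<in> simps (spc Y m n) 0" and eq: "fst (\<Phi> m n 0 w) 0 = fst (edge_simplex ?C b) i" for i w
  proof (rule \<Phi>_inj[OF act_in[OF a(1) v[OF i]] w], rule nerve_vertex_eqI[OF \<Phi>_in[OF act_in[OF a(1) v[OF i]]] \<Phi>_in[OF w]])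
    show "fst (\<Phi> m n 0 (sact (spc Y m n) 0 1 (Delta_vertex i) a)) 0 = fst (\<Phi> m n 0 w) 0"
      using \<Phi>_sact[OF a(1) v[OF i]] a(2) eq by (simp add: nerve_act_sel Delta_vertex_def)
  qed
  show thesis
    by (rule that[OF a]) (use e y b edge_simplex_sel[of ?C b] in \<open>auto simp: homs_def\<close>)
qed

text \<open>What \<open>full\<close> needs are edges of the fiber product. The two components of a
  morphism of the pullback are realized by edges separately, and these match over the common vertex
  because their labels do.\<close>

lemma corner_full:
  assumes P: "double_functor (grid 1 1) D P" "double_functor (grid 1 1) D P'"
    and m1: "m1 \<in> homs G1 (restr p q \<alpha> \<beta> P) (restr p q \<alpha> \<beta> P')"
    and m2: "m2 \<in> homs G2 (restr p' q' \<alpha>' \<beta>' P) (restr p' q' \<alpha>' \<beta>' P')"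
    and eq: "U m1 = U' m2"
  shows "\<exists>m\<in>homs G P P'. W1 m = m1 \<and> W2 m = m2"
proof -
  interpret E: labelled_weak_equivalence "spc Y 1 1" G "\<Phi> 1 1" Z PB LZ f
    "\<lambda>P. (restr p q \<alpha> \<beta> P, restr p' q' \<alpha>' \<beta>' P)" "\<lambda>m. (W1 m, W2 m)"
    by (rule labelled_equivalence)
  have "\<exists>s\<in>simps (spc Y 1 1) 0. fst (\<Phi> 1 1 0 s) 0 = P" if "double_functor (grid 1 1) D P" for P
    using \<Phi>_surj[OF vertex_simplex_in[OF groupoid_is_category[OF grp], of P 1 1]] that
    by (force simp: vertex_simplex_def)
  then obtain s s' where s: "s \<in> simps (spc Y 1 1) 0" "fst (\<Phi> 1 1 0 s) 0 = P"
    and s': "s' \<in> simps (spc Y 1 1) 0" "fst (\<Phi> 1 1 0 s') 0 = P'"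
    using P by metis
  have ob: "fst (LZ 0 (f 0 s)) 0 = (restr p q \<alpha> \<beta> P, restr p' q' \<alpha>' \<beta>' P)"
    "fst (LZ 0 (f 0 s')) 0 = (restr p q \<alpha> \<beta> P', restr p' q' \<alpha>' \<beta>' P')"
    using E.label_ob[OF s(1), of 0] E.label_ob[OF s'(1), of 0] s s' by auto
  have b: "(m1, m2) \<in> homs PB (fst (LZ 0 (f 0 s)) 0) (fst (LZ 0 (f 0 s')) 0)"
    unfolding ob pullback_homs using m1 m2 eq by simp
  have "\<exists>a\<in>simps Z 1. edge_vertex Z 0 a = f 0 s \<and> edge_vertex Z 1 a = f 0 s' \<and> snd (LZ 1 a) (0, 1) = b"
    if b: "b \<in> homs PB (fst (LZ 0 (f 0 s)) 0) (fst (LZ 0 (f 0 s')) 0)" for b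
  proof -
    obtain b1 b2 where b_eq: "b = (b1, b2)"
      by (cases b)
    have fs: "bact Y p q 1 1 \<alpha> \<beta> 0 s \<in> simps (spc Y p q) 0" "bact Y p' q' 1 1 \<alpha>' \<beta>' 0 s \<in> simps (spc Y p' q') 0"
      "bact Y p q 1 1 \<alpha> \<beta> 0 s' \<in> simps (spc Y p q) 0" "bact Y p' q' 1 1 \<alpha>' \<beta>' 0 s' \<in> simps (spc Y p' q') 0"
      using bact_in \<Delta>s s s' by simp_all
    have b1: "b1 \<in> homs G1 (fst (\<Phi> p q 0 (bact Y p q 1 1 \<alpha> \<beta> 0 s)) 0) (fst (\<Phi> p q 0 (bact Y p q 1 1 \<alpha> \<beta> 0 s')) 0)"
      and b2: "b2 \<in> homs G2 (fst (\<Phi> p' q' 0 (bact Y p' q' 1 1 \<alpha>' \<beta>' 0 s)) 0) (fst (\<Phi> p' q' 0 (bact Y p' q' 1 1 \<alpha>' \<beta>' 0 s')) 0)"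
      and b12: "U b1 = U' b2"
      using b unfolding b_eq by (simp_all add: pair_simplex_sel pullback_homs)
    obtain a1 where a1: "a1 \<in> simps (spc Y p q) 1" "\<Phi> p q 1 a1 = edge_simplex G1 b1"
      "sact (spc Y p q) 0 1 (Delta_vertex 0) a1 = bact Y p q 1 1 \<alpha> \<beta> 0 s"
      "sact (spc Y p q) 0 1 (Delta_vertex 1) a1 = bact Y p q 1 1 \<alpha> \<beta> 0 s'"
      using ex_edge[OF fs(1,3) b1] .
    obtain a2 where a2: "a2 \<in> simps (spc Y p' q') 1" "\<Phi> p' q' 1 a2 = edge_simplex G2 b2"
      "sact (spc Y p' q') 0 1 (Delta_vertex 0) a2 = bact Y p' q' 1 1 \<alpha>' \<beta>' 0 s"
      "sact (spc Y p' q') 0 1 (Delta_vertex 1) a2 = bact Y p' q' 1 1 \<alpha>' \<beta>' 0 s'"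
      using ex_edge[OF fs(2,4) b2] .
    have "nerve_map (restr 0 0 \<gamma> \<delta>) U 1 (\<Phi> p q 1 a1) = nerve_map (restr 0 0 \<gamma>' \<delta>') U' 1 (\<Phi> p' q' 1 a2)"
      unfolding a1(2) a2(2)
      using nerve_map_edge_simplex[OF groupoid_is_category[OF grp] restr_functor[OF \<Delta>s(5,6)], of b1]
        nerve_map_edge_simplex[OF groupoid_is_category[OF grp] restr_functor[OF \<Delta>s(7,8)], of b2]
        b1 b2 b12 by (simp add: homs_def)
    then have "(a1, a2) \<in> simps Z 1"
      using a1(1) a2(1) Z_iff by (simp add: Z_simps)
    moreover have "edge_vertex Z 0 (a1, a2) = f 0 s" "edge_vertex Z 1 (a1, a2) = f 0 s'"
      using a1(3,4) a2(3,4) by (simp_all add: edge_vertex_def Z_simps)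
    moreover have "snd (LZ 1 (a1, a2)) (0, 1) = b"
      using a1(2) a2(2) by (simp add: pair_simplex_sel b_eq edge_simplex_sel(3)[unfolded One_nat_def])
    ultimately show ?thesis
      by blast
  qed
  from E.full[OF s(1) s'(1) this b] show ?thesis
    unfolding s(2) s'(2) by auto
qed

text \<open>Two edges of the grid with a common vertex form a vertex of the fiber product, to which
  \<open>essentially_surjective\<close> applies. A morphism of the pullback is a pair of
  isomorphisms that agree at the common vertex.\<close>

lemma corner_essentially_surjective:
  assumes Q: "double_functor (grid p q) D Q" "double_functor (grid p' q') D Q'"
    and eq: "restr 0 0 \<gamma> \<delta> Q = restr 0 0 \<gamma>' \<delta>' Q'"
  shows "\<exists>P. double_functor (grid 1 1) D P \<and> (\<exists>m1\<in>homs G1 (restr p q \<alpha> \<beta> P) Q.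
    \<exists>m2\<in>homs G2 (restr p' q' \<alpha>' \<beta>' P) Q'. U m1 = U' m2)"
proof -
  interpret E: labelled_weak_equivalence "spc Y 1 1" G "\<Phi> 1 1" Z PB LZ f
    "\<lambda>P. (restr p q \<alpha> \<beta> P, restr p' q' \<alpha>' \<beta>' P)" "\<lambda>m. (W1 m, W2 m)"
    by (rule labelled_equivalence)
  note c = groupoid_is_category[OF grp]
  obtain y where y: "y \<in> simps (spc Y p q) 0" "\<Phi> p q 0 y = vertex_simplex G1 Q"
    using \<Phi>_surj[OF vertex_simplex_in[OF c, of Q p q]] Q by auto
  obtain y' where y': "y' \<in> simps (spc Y p' q') 0" "\<Phi> p' q' 0 y' = vertex_simplex G2 Q'"
    using \<Phi>_surj[OF vertex_simplex_in[OF c, of Q' p' q']] Q by auto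
  have "bact Y 0 0 p q \<gamma> \<delta> 0 y = bact Y 0 0 p' q' \<gamma>' \<delta>' 0 y'"
  proof (rule \<Phi>_inj[OF bact_in[OF \<Delta>s(5,6) y(1)] bact_in[OF \<Delta>s(7,8) y'(1)]],
      rule nerve_vertex_eqI[OF \<Phi>_in[OF bact_in[OF \<Delta>s(5,6) y(1)]] \<Phi>_in[OF bact_in[OF \<Delta>s(7,8) y'(1)]]])
    show "fst (\<Phi> 0 0 0 (bact Y 0 0 p q \<gamma> \<delta> 0 y)) 0 = fst (\<Phi> 0 0 0 (bact Y 0 0 p' q' \<gamma>' \<delta>' 0 y')) 0"
      unfolding \<Phi>_act[OF \<Delta>s(5,6) y(1)] \<Phi>_act[OF \<Delta>s(7,8) y'(1)] y(2) y'(2)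
      using eq by (simp add: nerve_map_sel vertex_simplex_def)
  qed
  then have "(y, y') \<in> simps Z 0"
    using y(1) y'(1) by (simp add: Z_simps)
  from E.essentially_surjective[OF this]
  obtain P m where P: "double_functor (grid 1 1) D P"
    and m: "m \<in> homs PB (restr p q \<alpha> \<beta> P, restr p' q' \<alpha>' \<beta>' P) (Q, Q')"
    using y(2) y'(2) by (auto simp: pair_simplex_sel vertex_simplex_def)
  then show ?thesis
    by (cases m) (auto simp: pullback_homs)
qed

end

section \<open>Extensions of spans and cospans to squares\<close>

lemma Delta_id_in: "Delta_id k \<in> \<Delta> k k"
  by (auto simp: Delta_def Delta_id_def mono_on_def)

context shared_isos
begin

text \<open>Only the two prescribed edges of \<open>s\<close> are corrected: a square with
  isomorphisms as top and bottom is pasted on the left and turns the left edge into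
  \<open>h\<close>, then one with isomorphisms as vertical sides is pasted on top and turns the top
  edge into \<open>f\<close>. The right and bottom edges are free to change.\<close>

lemma transport_span:
  assumes s: "is_square D t l r b s"
    and a: "a \<in> isos H (Dom H t) A" and c: "c \<in> isos H (Dom H b) C" and d: "d \<in> isos H (Cod H t) B"
    and f: "f \<in> homs H A B" and h: "h \<in> homs V A C"
    and hor: "Cmp H f a = Cmp H d t" and ver: "Cmp V h (\<phi> a) = Cmp V (\<phi> c) l"
  shows "\<exists>s\<in>sqs D. sq_left D s = h \<and> sq_top D s = f"
proof -
  note bd = square_boundary[OF dbl s]
  have t: "t \<in> homs H (Dom H t) (Cod H t)" and l: "l \<in> homs V (Dom H t) (Dom H b)"
    using bd by (auto simp: homs_def)
  obtain a' where a': "a' \<in> isos H A (Dom H t)" "Cmp H a a' = Idn H A" "Cmp V (\<phi> a) (\<phi> a') = Idn V A"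
    using isosE[OF a] \<phi>_inverse(2)[OF a] inverse_mors_homs(3)[OF _ \<phi>_homs[OF a]] by metis
  obtain c' where c': "c' \<in> isos H C (Dom H b)" "Cmp V (\<phi> c') (\<phi> c) = Idn V (Dom H b)"
    using isosE[OF c] \<phi>_inverse(2)[OF c] inverse_mors_homs(2)[OF _ \<phi>_homs[OF c]] by metis
  obtain d' where d': "d' \<in> isos H B (Cod H t)" "Cmp H d' d = Idn H (Cod H t)"
    using isosE[OF d] by metis
  note ah = isos_homs[OF a] and ah' = isos_homs[OF a'(1)] and dh = isos_homs[OF d] and dh' = isos_homs[OF d'(1)]
  note pa = \<phi>_homs[OF a] \<phi>_homs[OF a'(1)] and pc = \<phi>_homs[OF c] \<phi>_homs[OF c'(1)]
  have "Cmp V (\<phi> c') h = Cmp V (\<phi> c') (Cmp V h (Cmp V (\<phi> a) (\<phi> a')))"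
    using comp_id(1)[OF vcat h] a'(3) by simp
  also have "\<dots> = Cmp V (\<phi> c') (Cmp V (Cmp V (\<phi> c) l) (\<phi> a'))"
    using comp_assoc[OF vcat pa(2,1) h] ver by simp
  also have "\<dots> = Cmp V (Cmp V (\<phi> c') (\<phi> c)) (Cmp V l (\<phi> a'))"
    using comp_assoc[OF vcat pa(2) l pc(1)] comp_assoc[OF vcat comp_in_homs[OF vcat pa(2) l] pc] by simp
  also have "\<dots> = Cmp V l (\<phi> a')"
    using c'(2) comp_id(2)[OF vcat comp_in_homs[OF vcat pa(2) l]] by simp
  finally obtain s1 where s1: "is_square D a' h l c' s1"
    using vsquare[OF h l a'(1) c'(1)] by auto
  note s01 = square_hcomp[OF dbl s1 s]
  note ta = comp_in_homs[OF hcat ah' t]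
  have "Cmp H d' f = Cmp H d' (Cmp H f (Cmp H a a'))"
    using comp_id(1)[OF hcat f] a'(2) by simp
  also have "\<dots> = Cmp H d' (Cmp H (Cmp H d t) a')"
    using comp_assoc[OF hcat ah' ah f] hor by simp
  also have "\<dots> = Cmp H (Cmp H d' d) (Cmp H t a')"
    using comp_assoc[OF hcat ah' t dh] comp_assoc[OF hcat ta dh dh'] by simp
  also have "\<dots> = Cmp H (Cmp H t a') (Idn H A)"
    using d'(2) comp_id[OF hcat ta] by simp
  \<comment> \<open>Its left edge is an identity, so that pasting it on top leaves the left edge
    \<open>h\<close> untouched.\<close>
  finally obtain s2 where s2: "is_square D f (\<phi> (Idn H A)) (\<phi> d') (Cmp H t a') s2"
    using hsquare[OF f ta id_iso[OF hcat homs_obj(1)[OF hcat f]] d'(1)] by auto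
  have "Cmp V h (\<phi> (Idn H A)) = h"
    using comp_id(1)[OF vcat h] \<phi>_id[OF homs_obj(1)[OF hcat f]] by simp
  then show ?thesis
    using square_vcomp[OF dbl s2 s01] by (auto simp: is_square_def)
qed

text \<open>The correcting squares are now pasted on the right and below. The given isomorphisms
  already point in the direction needed, so no inverses occur.\<close>

lemma transport_cospan:
  assumes s: "is_square D t l r b s"
    and c: "c \<in> isos H (Dom H b) C" and e: "e \<in> isos H (Cod H b) E" and d: "d \<in> isos H (Cod H t) B"
    and g: "g \<in> homs H C E" and k: "k \<in> homs V B E"
    and hor: "Cmp H g c = Cmp H e b" and ver: "Cmp V k (\<phi> d) = Cmp V (\<phi> e) r"
  shows "\<exists>s\<in>sqs D. sq_bot D s = g \<and> sq_right D s = k"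
proof -
  note bd = square_boundary[OF dbl s]
  have b: "b \<in> homs H (Dom H b) (Cod H b)" and r: "r \<in> homs V (Cod H t) (Cod H b)"
    using bd by (auto simp: homs_def)
  obtain s1 where s1: "is_square D d r k e s1"
    using vsquare[OF r k d e] ver by auto
  note s01 = square_hcomp[OF dbl s s1]
  note eb = comp_in_homs[OF hcat b isos_homs[OF e]]
  note E = homs_obj(2)[OF hcat g]
  have "Cmp H (Idn H E) (Cmp H e b) = Cmp H g c"
    using comp_id(2)[OF hcat eb] hor by simp
  then obtain s2 where s2: "is_square D (Cmp H e b) (\<phi> c) (\<phi> (Idn H E)) g s2"
    using hsquare[OF eb g c id_iso[OF hcat E]] by auto
  have "Cmp V (\<phi> (Idn H E)) k = k"
    using comp_id(2)[OF vcat k] \<phi>_id[OF E] by simp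
  then show ?thesis
    using square_vcomp[OF dbl s01 s2] by (auto simp: is_square_def)
qed

text \<open>Restricting the double functor of an identity square avoids a separate construction on
  this grid.\<close>

lemma ex_vertical_dfun:
  assumes h: "h \<in> vers D"
  shows "\<exists>Q. double_functor (grid 0 1) D Q \<and> onver Q (0, (0, 1)) = h"
proof -
  note s = square_hid[OF dbl mor_in_homs[OF h]]
  let ?s = "Idn (sqh D) h"
  have "?s \<in> sqs D" "sq_left D ?s = h"
    using s by (auto simp: is_square_def)
  moreover from this have "double_functor (grid 0 1) D (restr 0 1 (Delta_vertex 0) (Delta_id 1) (square_dfun D ?s))"
    by (intro dfun_comp_functor[OF double_category_grid double_functor_grid_map[OF Delta_vertex_in[of 0 1, OF le0] Delta_id_in]]
        double_functor_square_dfun[OF dbl])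
  ultimately show ?thesis
    by (intro exI[of _ "restr 0 1 (Delta_vertex 0) (Delta_id 1) (square_dfun D ?s)"] conjI)
      (simp_all add: restr_sel Delta_vertex_def Delta_id_def square_dfun_sel[unfolded One_nat_def])
qed

lemma ex_horizontal_dfun:
  assumes f: "f \<in> hors D"
  shows "\<exists>Q. double_functor (grid 1 0) D Q \<and> onhor Q ((0, 1), 0) = f"
proof -
  note s = square_vid[OF dbl mor_in_homs[OF f]]
  let ?s = "Idn (sqv D) f"
  have "?s \<in> sqs D" "sq_top D ?s = f"
    using s by (auto simp: is_square_def)
  moreover from this have "double_functor (grid 1 0) D (restr 1 0 (Delta_id 1) (Delta_vertex 0) (square_dfun D ?s))"
    by (intro dfun_comp_functor[OF double_category_grid double_functor_grid_map[OF Delta_id_in Delta_vertex_in[of 0 1, OF le0]]]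
        double_functor_square_dfun[OF dbl])
  ultimately show ?thesis
    by (intro exI[of _ "restr 1 0 (Delta_id 1) (Delta_vertex 0) (square_dfun D ?s)"] conjI)
      (simp_all add: restr_sel Delta_vertex_def Delta_id_def square_dfun_sel[unfolded One_nat_def])
qed

lemma natural_iso_isos:
  assumes "natural_iso C D F G \<theta>" "A \<in> obs C"
  shows "fst (\<theta> A) \<in> isos H (onob F A) (onob G A)" "snd (\<theta> A) = \<phi> (fst (\<theta> A))"
  using assms by (simp_all add: natural_iso_def shared_iso_iff)

lemma natural_iso_01:
  assumes "natural_iso (grid 0 1) D F Q \<theta>"
  shows "Cmp V (onver Q (0, (0, 1))) (\<phi> (fst (\<theta> (0, 0)))) = Cmp V (\<phi> (fst (\<theta> (0, 1)))) (onver F (0, (0, 1)))"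
proof -
  have "vertical_natural (grid 0 1) D F Q (\<lambda>A. snd (\<theta> A))"
    using assms by (simp add: natural_iso_def)
  from vertical_natural_ver[OF this, of "(0, (0, 1))" "(0, 0)" "(0, 1)"] show ?thesis
    using natural_iso_isos(2)[OF assms] by (simp add: homs_def)
qed

lemma natural_iso_10:
  assumes "natural_iso (grid 1 0) D F Q \<theta>"
  shows "Cmp H (onhor Q ((0, 1), 0)) (fst (\<theta> (0, 0))) = Cmp H (fst (\<theta> (1, 0))) (onhor F ((0, 1), 0))"
proof -
  have "horizontal_natural (grid 1 0) D F Q (\<lambda>A. fst (\<theta> A))"
    using assms by (simp add: natural_iso_def)
  from horizontal_natural_hor[OF this, of "((0, 1), 0)" "(0, 0)" "(1, 0)"] show ?thesis
    by (simp add: homs_def)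
qed

lemma natural_iso_11_eqI:
  assumes \<theta>: "natural_iso (grid 1 1) D F G \<theta>" and \<eta>: "natural_iso (grid 1 1) D F G \<eta>"
    and eq: "fst (\<theta> (0, 0)) = fst (\<eta> (0, 0))" "fst (\<theta> (1, 0)) = fst (\<eta> (1, 0))"
      "fst (\<theta> (0, 1)) = fst (\<eta> (0, 1))" "fst (\<theta> (1, 1)) = fst (\<eta> (1, 1))"
  shows "\<theta> = \<eta>"
proof (rule extensionalityI)
  show "\<theta> \<in> extensional (obs (grid 1 1))" "\<eta> \<in> extensional (obs (grid 1 1))"
    using \<theta> \<eta> by (simp_all add: natural_iso_def)
  fix A assume A: "A \<in> obs (grid 1 1)"
  then have "A = (0, 0) \<or> A = (1, 0) \<or> A = (0, 1) \<or> A = (1, 1)"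
    by auto
  then have "fst (\<theta> A) = fst (\<eta> A)"
    using eq by auto
  then show "\<theta> A = \<eta> A"
    using natural_iso_isos(2)[OF \<theta> A] natural_iso_isos(2)[OF \<eta> A] by (simp add: prod_eq_iff)
qed

text \<open>The component at the free corner \<open>(1, 1)\<close> is determined by vertical
  naturality along the right edge of the source \<open>F\<close>, which is epic; injectivity of
  \<open>\<phi>\<close> carries this over to the horizontal part.\<close>

lemma natural_iso_span_unique:
  assumes epi: "is_epic V (onver F (1, (0, 1)))"
    and F: "double_functor (grid 1 1) D F"
    and \<theta>: "natural_iso (grid 1 1) D F G \<theta>" and \<eta>: "natural_iso (grid 1 1) D F G \<eta>"
    and eq: "\<theta> (0, 0) = \<eta> (0, 0)" "\<theta> (1, 0) = \<eta> (1, 0)" "\<theta> (0, 1) = \<eta> (0, 1)"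
  shows "\<theta> = \<eta>"
proof (rule natural_iso_11_eqI[OF \<theta> \<eta>])
  let ?u = "(1, (0, 1)) :: nat \<times> nat \<times> nat"
  have u: "?u \<in> homs (Defs.vcat (grid 1 1)) (1, 0) (1, 1)"
    by (simp add: homs_def)
  have "vertical_natural (grid 1 1) D F G (\<lambda>A. snd (\<theta> A))" "vertical_natural (grid 1 1) D F G (\<lambda>A. snd (\<eta> A))"
    using \<theta> \<eta> by (simp_all add: natural_iso_def)
  note n = vertical_natural_ver[OF this(1) u] vertical_natural_ver[OF this(2) u]
  have A: "(1, 1) \<in> obs (grid 1 1)"
    by simp
  note ti = natural_iso_isos[OF \<theta> A] and ei = natural_iso_isos[OF \<eta> A]
  have h: "\<phi> (fst (\<theta> (1, 1))) \<in> homs V (onob F (1, 1)) (onob G (1, 1))"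
    "\<phi> (fst (\<eta> (1, 1))) \<in> homs V (onob F (1, 1)) (onob G (1, 1))"
    "onver F ?u \<in> homs V (onob F (1, 0)) (onob F (1, 1))"
    using \<phi>_homs[OF ti(1)] \<phi>_homs[OF ei(1)] grid_dfun_homs(2)[OF F, of 1 0 1] by simp_all
  have "\<phi> (fst (\<theta> (1, 1))) = \<phi> (fst (\<eta> (1, 1)))"
    using epi n h eq(2) ti(2) ei(2) unfolding is_epic_def homs_def by simp
  then show "fst (\<theta> (1, 1)) = fst (\<eta> (1, 1))"
    using bij[OF homs_obj[OF hcat isos_homs[OF ti(1)]]] ti(1) ei(1) by (auto simp: bij_betw_def inj_on_def)
qed (use eq in simp_all)

text \<open>The free corner is now \<open>(0, 0)\<close>. Naturality puts the top edge of the target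
  \<open>G\<close> after its component, so it is this edge that has to be monic.\<close>

lemma natural_iso_cospan_unique:
  assumes mono: "is_monic H (onhor G ((0, 1), 0))"
    and G: "double_functor (grid 1 1) D G"
    and \<theta>: "natural_iso (grid 1 1) D F G \<theta>" and \<eta>: "natural_iso (grid 1 1) D F G \<eta>"
    and eq: "\<theta> (0, 1) = \<eta> (0, 1)" "\<theta> (1, 1) = \<eta> (1, 1)" "\<theta> (1, 0) = \<eta> (1, 0)"
  shows "\<theta> = \<eta>"
proof (rule natural_iso_11_eqI[OF \<theta> \<eta>])
  let ?f = "((0, 1), 0) :: (nat \<times> nat) \<times> nat"
  have f: "?f \<in> homs (Defs.hcat (grid 1 1)) (0, 0) (1, 0)"
    by (simp add: homs_def)
  have "horizontal_natural (grid 1 1) D F G (\<lambda>A. fst (\<theta> A))" "horizontal_natural (grid 1 1) D F G (\<lambda>A. fst (\<eta> A))"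
    using \<theta> \<eta> by (simp_all add: natural_iso_def)
  note n = horizontal_natural_hor[OF this(1) f] horizontal_natural_hor[OF this(2) f]
  have A: "(0, 0) \<in> obs (grid 1 1)"
    by simp
  note ti = natural_iso_isos(1)[OF \<theta> A] and ei = natural_iso_isos(1)[OF \<eta> A]
  have h: "fst (\<theta> (0, 0)) \<in> homs H (onob F (0, 0)) (onob G (0, 0))"
    "fst (\<eta> (0, 0)) \<in> homs H (onob F (0, 0)) (onob G (0, 0))"
    "onhor G ?f \<in> homs H (onob G (0, 0)) (onob G (1, 0))"
    using isos_homs[OF ti] isos_homs[OF ei] grid_dfun_homs(1)[OF G, of 0 1 0] by simp_all
  show "fst (\<theta> (0, 0)) = fst (\<eta> (0, 0))"
    using mono n h eq(3) unfolding is_monic_def homs_def by simp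
qed (use eq in simp_all)

end

context stable_corner
begin

text \<open>The restrictions to the corner are equal on the nose, so their identities form a
  morphism of the pullback. A preimage of it under the full restriction functor is an isomorphism of
  squares that is the identity on the given corners.\<close>

lemma corner_extension:
  assumes P: "double_functor (grid 1 1) D P" "double_functor (grid 1 1) D P'"
    and eq: "restr p q \<alpha> \<beta> P = restr p q \<alpha> \<beta> P'" "restr p' q' \<alpha>' \<beta>' P = restr p' q' \<alpha>' \<beta>' P'"
  shows "\<exists>\<theta>. natural_iso (grid 1 1) D P P' \<theta> \<and>
    (\<forall>i\<le>p. \<forall>j\<le>q. \<theta> (\<alpha> i, \<beta> j) = shared_id D (onob P (\<alpha> i, \<beta> j))) \<and>
    (\<forall>i\<le>p'. \<forall>j\<le>q'. \<theta> (\<alpha>' i, \<beta>' j) = shared_id D (onob P (\<alpha>' i, \<beta>' j)))"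
proof -
  note c = groupoid_is_category[OF grp]
  let ?Q = "restr p q \<alpha> \<beta> P" and ?Q' = "restr p' q' \<alpha>' \<beta>' P"
  have Q: "?Q \<in> Obj G1" "?Q' \<in> Obj G2"
    using restr_functor[OF \<Delta>s(1,2)] restr_functor[OF \<Delta>s(3,4)] P by (auto simp: is_functor_def)
  have 1: "Idn G1 ?Q \<in> homs G1 ?Q (restr p q \<alpha> \<beta> P')"
    unfolding eq(1)[symmetric] by (rule id_in_homs[OF c Q(1)])
  have 2: "Idn G2 ?Q' \<in> homs G2 ?Q' (restr p' q' \<alpha>' \<beta>' P')"
    unfolding eq(2)[symmetric] by (rule id_in_homs[OF c Q(2)])
  have 3: "U (Idn G1 ?Q) = U' (Idn G2 ?Q')"
    unfolding functor_id[OF restr_functor[OF \<Delta>s(5,6)] Q(1)] functor_id[OF restr_functor[OF \<Delta>s(7,8)] Q(2)]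
      corner_restr_eq[OF P(1)] ..
  obtain m where m: "m \<in> homs G P P'" "W1 m = Idn G1 ?Q" "W2 m = Idn G2 ?Q'"
    using corner_full[OF P 1 2 3] by blast
  obtain \<theta> where m_eq: "m = (P, \<theta>, P')" and \<theta>: "natural_iso (grid 1 1) D P P' \<theta>"
    using m(1) by (cases m) (auto simp: homs_def)
  have "\<theta> (\<alpha> i, \<beta> j) = shared_id D (onob P (\<alpha> i, \<beta> j))" if "i \<le> p" "j \<le> q" for i j
    using m(2) that by (auto simp: m_eq whisker_def grid_map_sel restr_sel dest!: fun_cong[of _ _ "(i, j)"])
  moreover have "\<theta> (\<alpha>' i, \<beta>' j) = shared_id D (onob P (\<alpha>' i, \<beta>' j))" if "i \<le> p'" "j \<le> q'" for i j
    using m(3) that by (auto simp: m_eq whisker_def grid_map_sel restr_sel dest!: fun_cong[of _ _ "(i, j)"])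
  ultimately show ?thesis
    using \<theta> by blast
qed

text \<open>Essential surjectivity unpacked into components. The last equation is what allows the
  two isomorphisms to be used together in transporting the square onto the given corner.\<close>

lemma corner_approximation:
  assumes Q: "double_functor (grid p q) D Q" "double_functor (grid p' q') D Q'"
    and eq: "onob Q (\<gamma> 0, \<delta> 0) = onob Q' (\<gamma>' 0, \<delta>' 0)"
  shows "\<exists>P \<theta>1 \<theta>2. double_functor (grid 1 1) D P \<and> natural_iso (grid p q) D (restr p q \<alpha> \<beta> P) Q \<theta>1 \<and>
    natural_iso (grid p' q') D (restr p' q' \<alpha>' \<beta>' P) Q' \<theta>2 \<and> \<theta>1 (\<gamma> 0, \<delta> 0) = \<theta>2 (\<gamma>' 0, \<delta>' 0)"
proof -
  note c = dfun_comp_functor[OF double_category_grid double_functor_grid_map]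
  have "restr 0 0 \<gamma> \<delta> Q = restr 0 0 \<gamma>' \<delta>' Q'"
    by (rule grid_00_eqI[OF c[OF \<Delta>s(5,6) Q(1)] c[OF \<Delta>s(7,8) Q(2)]]) (simp add: restr_sel eq)
  from corner_essentially_surjective[OF Q this]
  obtain P m1 m2 where P: "double_functor (grid 1 1) D P"
    and m1: "m1 \<in> homs G1 (restr p q \<alpha> \<beta> P) Q" and m2: "m2 \<in> homs G2 (restr p' q' \<alpha>' \<beta>' P) Q'"
    and u: "U m1 = U' m2"
    by blast
  obtain \<theta>1 where \<theta>1: "m1 = (restr p q \<alpha> \<beta> P, \<theta>1, Q)" "natural_iso (grid p q) D (restr p q \<alpha> \<beta> P) Q \<theta>1"
    using m1 by (cases m1) (auto simp: homs_def)
  obtain \<theta>2 where \<theta>2: "m2 = (restr p' q' \<alpha>' \<beta>' P, \<theta>2, Q')" "natural_iso (grid p' q') D (restr p' q' \<alpha>' \<beta>' P) Q' \<theta>2"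
    using m2 by (cases m2) (auto simp: homs_def)
  have "\<theta>1 (\<gamma> 0, \<delta> 0) = \<theta>2 (\<gamma>' 0, \<delta>' 0)"
    using u by (auto simp: \<theta>1(1) \<theta>2(1) whisker_def grid_map_sel dest!: fun_cong[of _ _ "(0, 0)"])
  then show ?thesis
    using P \<theta>1(2) \<theta>2(2) by blast
qed

end

lemma unique_extensions_of_stable:
  fixes D :: "('o, 'h, 'v, 's) dblcat" and Y :: "('a, 'b) preaug_bispace"
  assumes D: "double_category D" and S: "has_shared_isos D" and M: "all_monic_epic D"
    and Y: "pointed_stable_double_Segal_space Y" and iso: "Y \<cong>\<^sub>p classifying_diagram D"
  shows "unique_extensions D"
proof -
  obtain \<phi> where "shared_isos D \<phi>"
    using ex_shared_isos[OF D S] by blast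
  then interpret shared_isos D \<phi> .
  have bis: "bisimplicial_space Y" and st: "stable Y"
    using Y by (auto simp: pointed_stable_double_Segal_space_def double_Segal_space_def)
  obtain \<Phi>0 where \<Phi>0: "\<forall>m n. simplicial_map (spc Y m n) (nerve (dfun_groupoid (grid m n) D)) (\<Phi>0 m n)"
    "\<forall>m n k. bij_betw (\<Phi>0 m n k) (simps (spc Y m n) k) (simps (nerve (dfun_groupoid (grid m n) D)) k)"
    "\<forall>m n m' n'. \<forall>a\<in>\<Delta> m m'. \<forall>b\<in>\<Delta> n n'. \<forall>k. \<forall>y\<in>simps (spc Y m' n') k.
      \<Phi>0 m n k (bact Y m n m' n' a b k y) =
      nerve_map (restr m n a b) (whisker (grid m n) (grid_map m n a b)) k (\<Phi>0 m' n' k y)"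
    using iso unfolding isomorphic_preaug_def classifying_diagram_def
    by (simp only: bispace.simps preaug_bispace.simps) (elim exE conjE, assumption)
  obtain \<Phi> where \<Phi>: "\<And>m n. simplicial_map (spc Y m n) (nerve (dfun_groupoid (grid m n) D)) (\<Phi> m n)"
    "\<And>m n k. bij_betw (\<Phi> m n k) (simps (spc Y m n) k) (simps (nerve (dfun_groupoid (grid m n) D)) k)"
    "\<And>m n m' n' a b k y. a \<in> \<Delta> m m' \<Longrightarrow> b \<in> \<Delta> n n' \<Longrightarrow> y \<in> simps (spc Y m' n') k \<Longrightarrow>
      \<Phi> m n k (bact Y m n m' n' a b k y) =
      nerve_map (restr m n a b) (whisker (grid m n) (grid_map m n a b)) k (\<Phi> m' n' k y)"
    by (rule that[of \<Phi>0]) (use \<Phi>0 in blast)+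
  have sq: "double_functor (grid 1 1) D (square_dfun D s)" if "s \<in> sqs D" for s
    by (rule double_functor_square_dfun[OF D that])
  note \<Delta>0 = Delta_vertex_in[of 0 1] Delta_vertex_in[of 1 1] Delta_id_in
  note dels = Delta_vertex_def Delta_id_def
  \<comment> \<open>The left edge is column 0 and the top edge is row 0; their common vertex is the
    start of both.\<close>
  interpret span: stable_corner D \<phi> Y \<Phi> 0 1 1 0 "Delta_vertex 0" "Delta_id 1" "Delta_id 1" "Delta_vertex 0"
    "Delta_id 0" "Delta_vertex 0" "Delta_vertex 0" "Delta_id 0"
    by unfold_locales
      (use bis \<Phi> \<Delta>0 Delta_id_in[of 0] Delta_id_in[of 1] st in \<open>simp_all add: dels stable_def hsource_def vsource_def\<close>)
  \<comment> \<open>The bottom edge is row 1 and the right edge is column 1; their common vertex is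
    the end of both.\<close>
  interpret cospan: stable_corner D \<phi> Y \<Phi> 1 0 0 1 "Delta_id 1" "Delta_vertex 1" "Delta_vertex 1" "Delta_id 1"
    "Delta_vertex 1" "Delta_id 0" "Delta_id 0" "Delta_vertex 1"
    by unfold_locales
      (use bis \<Phi> \<Delta>0 Delta_id_in[of 0] Delta_id_in[of 1] st in \<open>simp_all add: dels stable_def htarget_def vtarget_def\<close>)
  note res = dfun_comp_functor[OF double_category_grid double_functor_grid_map]
  show ?thesis
    unfolding unique_extensions_def
  proof (intro conjI ballI impI)
    fix h f assume h: "h \<in> vers D" and f: "f \<in> hors D" and hf: "Dom V h = Dom H f"
    obtain Q where Q: "double_functor (grid 0 1) D Q" "onver Q (0, (0, 1)) = h"
      using ex_vertical_dfun[OF h] by blast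
    obtain Q' where Q': "double_functor (grid 1 0) D Q'" "onhor Q' ((0, 1), 0) = f"
      using ex_horizontal_dfun[OF f] by blast
    have obQ: "onob Q (0, 0) = Dom V h" "onob Q (0, 1) = Cod V h"
      "onob Q' (0, 0) = Dom H f" "onob Q' (1, 0) = Cod H f"
      using grid_dfun_homs(2)[OF Q(1), of 0 0 1] grid_dfun_homs(1)[OF Q'(1), of 0 1 0] Q(2) Q'(2)
      by (simp_all add: homs_def)
    obtain P \<theta>1 \<theta>2 where P: "double_functor (grid 1 1) D P"
      and \<theta>1: "natural_iso (grid 0 1) D (restr 0 1 (Delta_vertex 0) (Delta_id 1) P) Q \<theta>1"
      and \<theta>2: "natural_iso (grid 1 0) D (restr 1 0 (Delta_id 1) (Delta_vertex 0) P) Q' \<theta>2"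
      and \<theta>: "\<theta>1 (0, 0) = \<theta>2 (0, 0)"
      using span.corner_approximation[OF Q(1) Q'(1)] hf obQ by (auto simp: dels)
    have s: "is_square D (onhor P ((0, 1), 0)) (onver P (0, (0, 1))) (onver P (1, (0, 1)))
        (onhor P ((0, 1), 1)) (onsq P ((0, 1), (0, 1)))"
      by (rule dfun_square[OF double_category_grid D P]) (simp add: is_square_def)
    have obP: "Dom H (onhor P ((0, 1), 0)) = onob P (0, 0)" "Cod H (onhor P ((0, 1), 0)) = onob P (1, 0)"
      "Dom H (onhor P ((0, 1), 1)) = onob P (0, 1)"
      using grid_dfun_homs(1)[OF P, of 0 1 0] grid_dfun_homs(1)[OF P, of 0 1 1] by (simp_all add: homs_def)
    have i: "fst (\<theta>1 (0, 0)) \<in> isos H (onob P (0, 0)) (Dom H f)" "fst (\<theta>1 (0, 1)) \<in> isos H (onob P (0, 1)) (Cod V h)"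
      "fst (\<theta>2 (1, 0)) \<in> isos H (onob P (1, 0)) (Cod H f)"
      using natural_iso_isos(1)[OF \<theta>1, of "(0, 0)"] natural_iso_isos(1)[OF \<theta>1, of "(0, 1)"]
        natural_iso_isos(1)[OF \<theta>2, of "(1, 0)"] obQ hf by (simp_all add: restr_sel dels)
    show "\<exists>s\<in>sqs D. sq_left D s = h \<and> sq_top D s = f"
    \<comment> \<open>The corner of \<open>P\<close> is only isomorphic to the given one; the
      components at its three vertices move it onto \<open>h\<close> and \<open>f\<close>.\<close>
    proof (rule transport_span[OF s, unfolded obP, OF i])
      show "f \<in> homs H (Dom H f) (Cod H f)" "h \<in> homs V (Dom H f) (Cod V h)"
        using h f hf by (simp_all add: homs_def)
      show "Cmp H f (fst (\<theta>1 (0, 0))) = Cmp H (fst (\<theta>2 (1, 0))) (onhor P ((0, 1), 0))"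
        using natural_iso_10[OF \<theta>2] \<theta> Q'(2) by (simp add: restr_sel dels)
      show "Cmp V h (\<phi> (fst (\<theta>1 (0, 0)))) = Cmp V (\<phi> (fst (\<theta>1 (0, 1)))) (onver P (0, (0, 1)))"
        using natural_iso_01[OF \<theta>1] Q(2) by (simp add: restr_sel dels)
    qed
    fix s s' assume s: "s \<in> sqs D" and s': "s' \<in> sqs D"
      and e: "sq_left D s = h \<and> sq_top D s = f \<and> sq_left D s' = h \<and> sq_top D s' = f"
    let ?P = "square_dfun D s" and ?P' = "square_dfun D s'"
    have obs: "onob ?P (0, 0) = Dom H f" "onob ?P (1, 0) = Cod H f" "onob ?P (0, 1) = Cod V h"
      using square_boundary(7)[OF D square_edges[OF D s]] e
      by (simp_all add: square_dfun_sel[unfolded One_nat_def])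
    have "restr 0 1 (Delta_vertex 0) (Delta_id 1) ?P = restr 0 1 (Delta_vertex 0) (Delta_id 1) ?P'"
      by (rule grid_01_eqI[OF res[OF \<Delta>0(1,3) sq[OF s]] res[OF \<Delta>0(1,3) sq[OF s']]])
        (use e in \<open>simp_all add: restr_sel dels square_dfun_sel[unfolded One_nat_def]\<close>)
    moreover have "restr 1 0 (Delta_id 1) (Delta_vertex 0) ?P = restr 1 0 (Delta_id 1) (Delta_vertex 0) ?P'"
      by (rule grid_10_eqI[OF res[OF \<Delta>0(3,1) sq[OF s]] res[OF \<Delta>0(3,1) sq[OF s']]])
        (use e in \<open>simp_all add: restr_sel dels square_dfun_sel[unfolded One_nat_def]\<close>)
    ultimately obtain \<theta> where \<theta>: "natural_iso (grid 1 1) D ?P ?P' \<theta>"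
      and v: "\<theta> (0, 0) = shared_id D (Dom H f)" "\<theta> (1, 0) = shared_id D (Cod H f)" "\<theta> (0, 1) = shared_id D (Cod V h)"
      using span.corner_extension[OF sq[OF s] sq[OF s']] obs by (force simp: dels)
    have epi: "is_epic V (onver ?P (1, (0, 1)))"
      using M square_boundary(4)[OF D square_edges[OF D s]]
      by (simp add: all_monic_epic_def square_dfun_sel[unfolded One_nat_def])
    show "\<exists>!\<theta>. square_iso D s s' \<theta> \<and> \<theta> (0, 0) = shared_id D (Dom H f) \<and>
        \<theta> (1, 0) = shared_id D (Cod H f) \<and> \<theta> (0, 1) = shared_id D (Cod V h)"
      unfolding square_iso_def
    proof (rule ex1I[of _ \<theta>])
      fix \<eta> assume \<eta>: "natural_iso (grid 1 1) D ?P ?P' \<eta> \<and> \<eta> (0, 0) = shared_id D (Dom H f) \<and>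
        \<eta> (1, 0) = shared_id D (Cod H f) \<and> \<eta> (0, 1) = shared_id D (Cod V h)"
      show "\<eta> = \<theta>"
        by (rule natural_iso_span_unique[OF epi sq[OF s] _ \<theta>]) (use \<eta> v in simp_all)
    qed (use \<theta> v in simp)
  next
    fix g k assume g: "g \<in> hors D" and k: "k \<in> vers D" and gk: "Cod H g = Cod V k"
    obtain Q where Q: "double_functor (grid 1 0) D Q" "onhor Q ((0, 1), 0) = g"
      using ex_horizontal_dfun[OF g] by blast
    obtain Q' where Q': "double_functor (grid 0 1) D Q'" "onver Q' (0, (0, 1)) = k"
      using ex_vertical_dfun[OF k] by blast
    have obQ: "onob Q' (0, 0) = Dom V k" "onob Q' (0, 1) = Cod V k"
      "onob Q (0, 0) = Dom H g" "onob Q (1, 0) = Cod H g"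
      using grid_dfun_homs(2)[OF Q'(1), of 0 0 1] grid_dfun_homs(1)[OF Q(1), of 0 1 0] Q(2) Q'(2)
      by (simp_all add: homs_def)
    obtain P \<theta>1 \<theta>2 where P: "double_functor (grid 1 1) D P"
      and \<theta>1: "natural_iso (grid 1 0) D (restr 1 0 (Delta_id 1) (Delta_vertex 1) P) Q \<theta>1"
      and \<theta>2: "natural_iso (grid 0 1) D (restr 0 1 (Delta_vertex 1) (Delta_id 1) P) Q' \<theta>2"
      and \<theta>: "\<theta>1 (1, 0) = \<theta>2 (0, 1)"
      using cospan.corner_approximation[OF Q(1) Q'(1)] gk obQ by (auto simp: dels)
    have s: "is_square D (onhor P ((0, 1), 0)) (onver P (0, (0, 1))) (onver P (1, (0, 1)))
        (onhor P ((0, 1), 1)) (onsq P ((0, 1), (0, 1)))"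
      by (rule dfun_square[OF double_category_grid D P]) (simp add: is_square_def)
    have obP: "Cod H (onhor P ((0, 1), 0)) = onob P (1, 0)"
      "Dom H (onhor P ((0, 1), 1)) = onob P (0, 1)" "Cod H (onhor P ((0, 1), 1)) = onob P (1, 1)"
      using grid_dfun_homs(1)[OF P, of 0 1 0] grid_dfun_homs(1)[OF P, of 0 1 1] by (simp_all add: homs_def)
    have i: "fst (\<theta>1 (0, 0)) \<in> isos H (onob P (0, 1)) (Dom H g)" "fst (\<theta>1 (1, 0)) \<in> isos H (onob P (1, 1)) (Cod H g)"
      "fst (\<theta>2 (0, 0)) \<in> isos H (onob P (1, 0)) (Dom V k)"
      using natural_iso_isos(1)[OF \<theta>1, of "(0, 0)"] natural_iso_isos(1)[OF \<theta>1, of "(1, 0)"]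
        natural_iso_isos(1)[OF \<theta>2, of "(0, 0)"] obQ by (simp_all add: restr_sel dels)
    show "\<exists>s\<in>sqs D. sq_bot D s = g \<and> sq_right D s = k"
    \<comment> \<open>Both isomorphisms have the same component at the vertex \<open>(1, 1)\<close>,
      so the one of \<open>\<theta>1\<close> may also be used in the vertical equation.\<close>
    proof (rule transport_cospan[OF s, unfolded obP, OF i])
      show "g \<in> homs H (Dom H g) (Cod H g)" "k \<in> homs V (Dom V k) (Cod H g)"
        using g k gk by (simp_all add: homs_def)
      show "Cmp H g (fst (\<theta>1 (0, 0))) = Cmp H (fst (\<theta>1 (1, 0))) (onhor P ((0, 1), 1))"
        using natural_iso_10[OF \<theta>1] Q(2) by (simp add: restr_sel dels)
      show "Cmp V k (\<phi> (fst (\<theta>2 (0, 0)))) = Cmp V (\<phi> (fst (\<theta>1 (1, 0)))) (onver P (1, (0, 1)))"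
        using natural_iso_01[OF \<theta>2] \<theta> Q'(2) by (simp add: restr_sel dels)
    qed
    fix s s' assume s: "s \<in> sqs D" and s': "s' \<in> sqs D"
      and e: "sq_bot D s = g \<and> sq_right D s = k \<and> sq_bot D s' = g \<and> sq_right D s' = k"
    let ?P = "square_dfun D s" and ?P' = "square_dfun D s'"
    have obs: "onob ?P (0, 1) = Dom H g" "onob ?P (1, 1) = Cod H g" "onob ?P (1, 0) = Dom V k"
      using square_boundary(6)[OF D square_edges[OF D s]] e
      by (simp_all add: square_dfun_sel[unfolded One_nat_def])
    have "restr 1 0 (Delta_id 1) (Delta_vertex 1) ?P = restr 1 0 (Delta_id 1) (Delta_vertex 1) ?P'"
      by (rule grid_10_eqI[OF res[OF \<Delta>0(3,2) sq[OF s]] res[OF \<Delta>0(3,2) sq[OF s']]])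
        (use e in \<open>simp_all add: restr_sel dels square_dfun_sel[unfolded One_nat_def]\<close>)
    moreover have "restr 0 1 (Delta_vertex 1) (Delta_id 1) ?P = restr 0 1 (Delta_vertex 1) (Delta_id 1) ?P'"
      by (rule grid_01_eqI[OF res[OF \<Delta>0(2,3) sq[OF s]] res[OF \<Delta>0(2,3) sq[OF s']]])
        (use e in \<open>simp_all add: restr_sel dels square_dfun_sel[unfolded One_nat_def]\<close>)
    ultimately obtain \<theta> where \<theta>: "natural_iso (grid 1 1) D ?P ?P' \<theta>"
      and v: "\<theta> (0, 1) = shared_id D (Dom H g)" "\<theta> (1, 1) = shared_id D (Cod H g)" "\<theta> (1, 0) = shared_id D (Dom V k)"
      using cospan.corner_extension[OF sq[OF s] sq[OF s']] obs by (force simp: dels)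
    have mono: "is_monic H (onhor ?P' ((0, 1), 0))"
      using M square_boundary(1)[OF D square_edges[OF D s']]
      by (simp add: all_monic_epic_def square_dfun_sel[unfolded One_nat_def])
    show "\<exists>!\<theta>. square_iso D s s' \<theta> \<and> \<theta> (0, 1) = shared_id D (Dom H g) \<and>
        \<theta> (1, 1) = shared_id D (Cod H g) \<and> \<theta> (1, 0) = shared_id D (Dom V k)"
      unfolding square_iso_def
    proof (rule ex1I[of _ \<theta>])
      fix \<eta> assume \<eta>: "natural_iso (grid 1 1) D ?P ?P' \<eta> \<and> \<eta> (0, 1) = shared_id D (Dom H g) \<and>
        \<eta> (1, 1) = shared_id D (Cod H g) \<and> \<eta> (1, 0) = shared_id D (Dom V k)"
      show "\<eta> = \<theta>"
        by (rule natural_iso_cospan_unique[OF mono sq[OF s'] _ \<theta>]) (use \<eta> v in simp_all)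
    qed (use \<theta> v in simp)
  qed
qed

text \<open>Contractibility as defined includes a point of the realization, hence a cell of the
  augmentation; vertex 0 of the corresponding simplex of the nerve lies over a zero object.\<close>

lemma zero_object_of_pointed:
  assumes Y: "pointed Y" and iso: "Y \<cong>\<^sub>p classifying_diagram D"
  shows "\<exists>Z. zero_object D Z"
proof -
  let ?C = "full_subcat (dfun_groupoid (grid 0 0) D) {F. zero_object D (onob F (0, 0))}"
  have "topspace (realization (aug Y)) \<noteq> {}"
    using Y by (simp add: pointed_def contractible_sset_def)
  then obtain c where "c \<in> topspace (cells (aug Y))"
    unfolding topspace_realization quotient_def by auto
  then obtain k x where x: "x \<in> simps (aug Y) k"
    by (auto simp: topspace_cells)
  obtain \<Psi> where "\<forall>k. bij_betw (\<Psi> k) (simps (aug Y) k) (simps (nerve ?C) k)"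
    using iso unfolding isomorphic_preaug_def classifying_diagram_def
    by (simp only: bispace.simps preaug_bispace.simps) (elim exE conjE, assumption)
  then have "bij_betw (\<Psi> k) (simps (aug Y) k) (simps (nerve ?C) k)" ..
  then have "\<Psi> k x \<in> simps (nerve ?C) k"
    using x by (auto simp: bij_betw_def)
  from nerve_simpsD(1)[OF this] have "fst (\<Psi> k x) 0 \<in> Obj ?C"
    by (auto simp: is_functor_def ordcat_def)
  then show ?thesis
    by (auto simp: full_subcat_def)
qed

theorem theorem7p29:
  fixes Y :: "('a, 'b) preaug_bispace"
  assumes "pointed_stable_double_Segal_space Y"
  shows "(\<exists>D :: ('o, 'h, 'v, 's) dblcat.
            reverse_CGW_category D \<and> Y \<cong>\<^sub>p classifying_diagram D) \<longleftrightarrow>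
         (\<exists>D :: ('o, 'h, 'v, 's) dblcat.
            double_category D \<and> has_shared_isos D \<and> all_monic_epic D \<and>
            Y \<cong>\<^sub>p classifying_diagram D)"
proof
  assume "\<exists>D :: ('o, 'h, 'v, 's) dblcat. reverse_CGW_category D \<and> Y \<cong>\<^sub>p classifying_diagram D"
  then show "\<exists>D :: ('o, 'h, 'v, 's) dblcat. double_category D \<and> has_shared_isos D \<and> all_monic_epic D \<and>
      Y \<cong>\<^sub>p classifying_diagram D"
    by (auto simp: reverse_CGW_category_def)
next
  assume "\<exists>D :: ('o, 'h, 'v, 's) dblcat. double_category D \<and> has_shared_isos D \<and> all_monic_epic D \<and>
      Y \<cong>\<^sub>p classifying_diagram D"
  then obtain D :: "('o, 'h, 'v, 's) dblcat" where D: "double_category D" "has_shared_isos D" "all_monic_epic D"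
    and iso: "Y \<cong>\<^sub>p classifying_diagram D"
    by blast
  have "\<exists>Z. zero_object D Z"
    using zero_object_of_pointed[OF _ iso] assms by (simp add: pointed_stable_double_Segal_space_def)
  then have "reverse_CGW_category D"
    using D unique_extensions_of_stable[OF D assms iso] by (simp add: reverse_CGW_category_def)
  then show "\<exists>D :: ('o, 'h, 'v, 's) dblcat. reverse_CGW_category D \<and> Y \<cong>\<^sub>p classifying_diagram D"
    using iso by blast
qed

end
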